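(* Fix any $p>0$. Let $A$ be an $n\times n$ random real matrix with i.i.d. entries. Suppose that the entries of $A$ have bounded concentration function with parameters $a>0$ and $b\in(0,1)$, i.e. $\sup_{z\in\mathbb{R}}P(|a_{ij}-z|<a)<b$, and that there is a constant $K>0$ such that $$\left(\mathbb{E}|Ae_1|^p\right)^{\frac1p}\le K\sqrt n .$$ Then for every $\epsilon>0$, $$P\left(\sigma_n(A)<\frac{\epsilon}{\sqrt n}\right)\le C\epsilon+e^{-c\min(1,p)n},$$ where $C,c>0$ are constants which depend (polynomially) only on $K$, $a$ and $b$, and $C$ additionally depends on $p$.
   Context: $|\cdot|$ is the Euclidean norm and $Ae_1$ is the first column of $A$. $\sigma_n(A)=\min_{x\in\mathbb{S}^{n-1}}|Ax|$ is the smallest singular value. The constants do not depend on $n$.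
   Formalization: The polynomial dependence of c is claimed only in K and 1/a for each fixed b, since polynomial dependence of c on b fails as b tends to 1 (sparse Bernoulli entries with n about 1/(1-b)); C stays polynomial in K, 1/a and 1/(1-b). *)

theory Defs
  imports "HOL-Probability.Probability" "Jordan_Normal_Form.Matrix"
begin

definition eucl_norm :: "real vec \<Rightarrow> real" where
  "eucl_norm v = sqrt (\<Sum>i<dim_vec v. (vec_index v i)\<^sup>2)"

text \<open>The infimum is attained (the sphere is compact) whenever the matrix has at least one column;
  for matrices without columns the sphere is empty and the value is meaningless.\<close>

definition smallest_singular_value :: "real mat \<Rightarrow> real" where
  "smallest_singular_value A =
     (INF x\<in>{x \<in> carrier_vec (dim_col A). eucl_norm x = 1}. eucl_norm (A *\<^sub>v x))"

context prob_space
begin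

definition concentration_function :: "('a \<Rightarrow> real) \<Rightarrow> real \<Rightarrow> real" where
  "concentration_function X a = (SUP z. prob {\<omega> \<in> space M. \<bar>X \<omega> - z\<bar> < a})"

text \<open>Measurability of the entries is part of \<^const>\<open>indep_vars\<close>.\<close>

definition iid_matrix :: "nat \<Rightarrow> ('a \<Rightarrow> real mat) \<Rightarrow> bool" where
  "iid_matrix n A \<longleftrightarrow>
     (\<forall>\<omega>\<in>space M. A \<omega> \<in> carrier_mat n n) \<and>
     indep_vars (\<lambda>_. borel) (\<lambda>(i, j) \<omega>. A \<omega> $$ (i, j)) ({..<n} \<times> {..<n}) \<and>
     (\<forall>i<n. \<forall>j<n. \<forall>k<n. \<forall>l<n.
        distr M borel (\<lambda>\<omega>. A \<omega> $$ (i, j)) = distr M borel (\<lambda>\<omega>. A \<omega> $$ (k, l)))"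

end

text \<open>Polynomial dependence is understood as a bound by a polynomial in \<open>K\<close>, \<open>1/a\<close> and
  \<open>1/(1 - b)\<close>. For the rate in the exponent the polynomial in \<open>K\<close> and \<open>1/a\<close> may vary with \<open>b\<close>:
  no bound \<open>c \<ge> 1 / poly (1 / (1 - b))\<close> can hold. Indeed, let the entries be Bernoulli of mean \<open>d\<close>
  with \<open>d\<close> small, \<open>a = 1/2\<close>, \<open>b = 1 - d/2\<close>, \<open>K = 1\<close>, \<open>p = 2\<close>, and let \<open>n\<close> be about \<open>1/d\<close>. The matrix
  has a zero column with probability \<open>1 - (1 - (1 - d)^n)^n\<close>, about \<open>1 - (1 - exp (-1))^n\<close>, so that
  \<open>c\<close> must be exponentially small in \<open>1/d\<close>.\<close>

definition rate_depends_polynomially :: "(real \<Rightarrow> real \<Rightarrow> real \<Rightarrow> real) \<Rightarrow> bool" where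
  "rate_depends_polynomially c \<longleftrightarrow>
     (\<forall>b\<in>{0<..<1}. \<exists>(D::real) (m::nat). \<forall>K>0. \<forall>a>0.
        1 / c K a b \<le> D * (1 + K + 1 / a) ^ m)"

definition factor_depends_polynomially :: "(real \<Rightarrow> real \<Rightarrow> real \<Rightarrow> real) \<Rightarrow> bool" where
  "factor_depends_polynomially C \<longleftrightarrow>
     (\<exists>(D::real) (m::nat). \<forall>K>0. \<forall>a>0. \<forall>b\<in>{0<..<1}.
        C K a b \<le> D * (1 + K + 1 / a + 1 / (1 - b)) ^ m)"

end

theory Submission
  imports Defs "Jordan_Normal_Form.Determinant" "HOL-Real_Asymp.Real_Asymp"
begin

text \<open>
Put \<open>X = 2 + K + 1/a + 1/(1 - b)\<close>. All constants will be powers of \<open>X\<close>, and by Young's inequality one may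
assume \<open>p \<le> 1\<close>. Suppose that \<open>|A x| < \<epsilon>/sqrt n\<close> for a unit vector \<open>x\<close>. If only few coordinates of \<open>x\<close> have
the order of magnitude \<open>1/sqrt n\<close>, then \<open>x\<close> lies in a set with a small net, and \<open>spread_vectors\<close> excludes it up to an
exponentially small probability. Otherwise \<open>|A x| \<ge> |x k| dist (A k, span of the other columns)\<close> shows that a
positive fraction of the columns is at distance \<open>O(\<epsilon>)\<close> from the span of the others. A column is independent
of a unit normal \<open>v\<close> of the others, and its inner product with \<open>v\<close> is at most \<open>s\<close> with probability
\<open>O(s)\<close>, unless the characteristic function of that inner product has a large value at a moderate argument; this is the
Cauchy kernel bound \<open>cauchy_kernel_bound\<close>. That normals with such a value do not occur is
\<open>normal_vectors_unstructured\<close>: they are sorted by the first argument \<open>\<theta>\<close> at which the characteristic function is not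
exponentially small, each class is rounded to a lattice whose mesh is proportional to \<open>1/\<theta>\<close>, and the lattice points
that arise are so few that a union bound works. The theorem \<open>invertibility\<close> combines the two alternatives.

A moment of small order \<open>p\<close> gives no bound on the operator norm, so that the usual net arguments are not
available. Two things replace it. The rounding \<open>greedy_rounding\<close> chooses the roundings up and down such that
a weighted sum of the squares of the errors \<open>(A i, z - x)\<close> is no larger than for random signs; with weights that decrease
with the norm of the row, no norm bound enters. And the rows matter only through the product of their
truncated norms \<open>max 1 (|A i|/(X sqrt n))\<close>. The \<open>p\<close>-th moment of a truncated norm exceeds \<open>1\<close> by \<open>O(p ln X)\<close> only, so that
the product of \<open>n\<close> of them exceeds \<open>X^(7 n)\<close> with probability at most \<open>exp (- p n)\<close>, where the base \<open>X^7\<close> does not depend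
on \<open>p\<close> (\<open>trunc_norm_product_tail\<close>). This is the origin of the term \<open>exp (- c p n)\<close>.

All this requires \<open>n \<ge> X^4000 (1 + ln (1/p))\<close>. For smaller \<open>n\<close> the number \<open>exp (- c p n)\<close> is close to \<open>1\<close>, of order
\<open>1 - c p n\<close>, and it is enough to bound the smallest singular value below by a negative power of \<open>n\<close> with
probability at least \<open>cb/n\<close>, where \<open>cb\<close> depends on \<open>b\<close> only (\<open>small_dimension_estimate\<close>). By Odlyzko's argument
(\<open>near_subspace_prob\<close>) a column is at distance at least \<open>a/sqrt n\<close> from a fixed subspace of codimension \<open>m\<close> with
probability at least \<open>1 - b^m\<close>. This handles all columns but the last \<open>O(ln ln n)\<close>. Each of those is picked from
many independent copies, so as to maximise the determinant; by Cramer's rule the chosen columns are then well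
separated. A fixed choice has the law of the matrix, so that the price is the inverse of the number of choices, which is
less than \<open>n\<close> up to a factor.
\<close>

section \<open>Entry laws and damped characteristic functions\<close>

definition ip :: "nat \<Rightarrow> (nat \<Rightarrow> real) \<Rightarrow> (nat \<Rightarrow> real) \<Rightarrow> real" where
  "ip n x y = (\<Sum>j<n. x j * y j)"

definition nsq :: "nat \<Rightarrow> (nat \<Rightarrow> real) \<Rightarrow> real" where
  "nsq n x = (\<Sum>j<n. (x j)\<^sup>2)"

lemma nsq_nonneg [simp]: "0 \<le> nsq n x"
  unfolding nsq_def by (intro sum_nonneg) auto

lemma one_minus_cos_le: "1 - cos u \<le> u\<^sup>2 / 2" for u :: real
proof -
  have "1 - cos u = 2 * (sin (u/2))\<^sup>2"
    using cos_double_sin[of "u/2"] by simp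
  moreover have "(sin (u/2))\<^sup>2 \<le> (u/2)\<^sup>2"
    using abs_sin_x_le_abs_x[of "u/2"] by (metis abs_le_square_iff)
  ultimately show ?thesis by (simp add: power2_eq_square)
qed

lemma one_minus_cos_ge:
  fixes u :: real assumes "\<bar>u\<bar> \<le> 1" shows "u\<^sup>2 / 4 \<le> 1 - cos u"
proof -
  define v where "v = u/2"
  have v: "\<bar>v\<bar> \<le> 1/2" using assms by (simp add: v_def)
  have "\<bar>sin v - v\<bar> \<le> \<bar>v\<bar> ^ 3 / 6"
    using Maclaurin_sin_bound[of v 3] by (simp add: eval_nat_numeral sin_coeff_def fact_numeral divide_simps)
  moreover have "\<bar>v\<bar> ^ 3 \<le> \<bar>v\<bar> * (1/4)"
  proof -
    have "\<bar>v\<bar> * \<bar>v\<bar> \<le> (1/2) * (1/2)" by (intro mult_mono v) auto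
    then have "\<bar>v\<bar> * (\<bar>v\<bar> * \<bar>v\<bar>) \<le> \<bar>v\<bar> * (1/4)" by (intro mult_left_mono) auto
    then show ?thesis by (simp add: power3_eq_cube mult.assoc)
  qed
  ultimately have "\<bar>sin v\<bar> \<ge> \<bar>v\<bar> * (23/24)" by linarith
  then have "(\<bar>v\<bar> * (23/24))\<^sup>2 \<le> \<bar>sin v\<bar>\<^sup>2" by (intro power_mono) auto
  then have a: "v\<^sup>2 * (529/576) \<le> (sin v)\<^sup>2" by (simp add: power_mult_distrib power2_eq_square)
  have "1 - cos u = 2 * (sin v)\<^sup>2"
    using cos_double_sin[of v] by (simp add: v_def)
  moreover have "u\<^sup>2 = 4 * v\<^sup>2" by (simp add: v_def power2_eq_square)
  ultimately show ?thesis using a zero_le_power2[of v] by linarith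
qed

lemma one_minus_cos_add_le:
  fixes x y :: real shows "1 - cos (x + y) \<le> 2 * (1 - cos x) + 2 * (1 - cos y)"
proof -
  have h: "1 - cos u = 2 * (sin (u/2))\<^sup>2" for u :: real
    using cos_double_sin[of "u/2"] by simp
  have "\<bar>sin ((x + y)/2)\<bar> \<le> \<bar>sin (x/2)\<bar> + \<bar>sin (y/2)\<bar>"
  proof -
    have "sin ((x + y)/2) = sin (x/2) * cos (y/2) + cos (x/2) * sin (y/2)"
      by (simp add: add_divide_distrib sin_add)
    moreover have "\<bar>sin (x/2) * cos (y/2)\<bar> \<le> \<bar>sin (x/2)\<bar>" "\<bar>cos (x/2) * sin (y/2)\<bar> \<le> \<bar>sin (y/2)\<bar>"
      by (auto simp: abs_mult intro: mult_left_le mult_left_le_one_le)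
    ultimately show ?thesis by linarith
  qed
  then have "(\<bar>sin ((x + y)/2)\<bar>)\<^sup>2 \<le> (\<bar>sin (x/2)\<bar> + \<bar>sin (y/2)\<bar>)\<^sup>2" by (intro power_mono) auto
  also have "\<dots> \<le> 2 * (\<bar>sin (x/2)\<bar>)\<^sup>2 + 2 * (\<bar>sin (y/2)\<bar>)\<^sup>2"
    using zero_le_power2[of "\<bar>sin (x/2)\<bar> - \<bar>sin (y/2)\<bar>"] by (simp add: power2_eq_square algebra_simps)
  finally show ?thesis unfolding h by simp
qed

text \<open>The law of one entry. Rows and columns of the matrix both have the product law \<open>gam n\<close>.\<close>

locale entry_law = prob_space \<mu> for \<mu> :: "real measure" +
  assumes sets_mu [measurable_cong, simp]: "sets \<mu> = sets borel"
begin

lemma space_mu [simp]: "space \<mu> = UNIV"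
  using sets_eq_imp_space_eq[OF sets_mu] by simp

lemma prob_UNIV [simp]: "prob UNIV = 1"
  using prob_space by simp

definition gam :: "nat \<Rightarrow> (nat \<Rightarrow> real) measure" where
  "gam n = PiM {..<n} (\<lambda>_. \<mu>)"

sublocale pp: pair_prob_space \<mu> \<mu> ..

definition wmass :: "real \<Rightarrow> real" where
  "wmass l = (\<integral>x. exp (- l * x\<^sup>2) \<partial>\<mu>)"

text \<open>The damping \<open>exp (- l * x\<^sup>2)\<close> multiplies up over the coordinates to \<open>exp (- l * |g|\<^sup>2)\<close>, a weight that suppresses
rows of large norm.\<close>

definition wchar :: "real \<Rightarrow> real \<Rightarrow> complex" where
  "wchar l s = (\<integral>x. complex_of_real (exp (- l * x\<^sup>2)) * cis (s * x) \<partial>\<mu>)"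

text \<open>One minus the squared absolute value of the characteristic function of the law with density proportional to
\<open>exp (- l * x\<^sup>2)\<close>. For \<open>l = 0\<close> this is the expectation of \<open>1 - cos (s * (x - y))\<close> for independent \<open>x\<close>, \<open>y\<close>, which is
subadditive in \<open>s\<close> up to a factor of \<open>2\<close>.\<close>

definition defect :: "real \<Rightarrow> real \<Rightarrow> real" where
  "defect l s = 1 - (cmod (wchar l s) / wmass l)\<^sup>2"

lemma integrable_bdd:
  fixes f :: "real \<Rightarrow> 'b::{banach, second_countable_topology}"
  assumes "f \<in> borel_measurable \<mu>" "\<And>x. norm (f x) \<le> B"
  shows "integrable \<mu> f"
  by (rule integrable_const_bound[of _ B]) (use assms in auto)

lemma wmass_pos: assumes "0 \<le> l" shows "0 < wmass l"
proof -
  have i: "integrable \<mu> (\<lambda>x. exp (- l * x\<^sup>2))"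
    by (rule integrable_bdd[of _ 1]) (use assms in auto)
  have "wmass l \<noteq> 0"
  proof
    assume "wmass l = 0"
    then have "AE x in \<mu>. exp (- l * x\<^sup>2) = 0"
      using integral_nonneg_eq_0_iff_AE[OF i] by (simp add: wmass_def)
    then show False by (simp add: AE_False)
  qed
  moreover have "0 \<le> wmass l" unfolding wmass_def by (intro integral_nonneg_AE) auto
  ultimately show ?thesis by simp
qed

lemma wmass_le1: assumes "0 \<le> l" shows "wmass l \<le> 1"
proof -
  have i: "integrable \<mu> (\<lambda>x. exp (- l * x\<^sup>2))"
    by (rule integrable_bdd[of _ 1]) (use assms in auto)
  have "wmass l \<le> (\<integral>x. 1 \<partial>\<mu>)" unfolding wmass_def
    by (intro integral_mono i) (use assms in auto)
  then show ?thesis by (simp add: prob_space)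
qed

lemma wmass_0 [simp]: "wmass 0 = 1" by (simp add: wmass_def prob_space)

abbreviation mu2 where "mu2 \<equiv> \<mu> \<Otimes>\<^sub>M \<mu>"

lemma integrable2:
  fixes f :: "real \<times> real \<Rightarrow> real"
  assumes "f \<in> borel_measurable (\<mu> \<Otimes>\<^sub>M \<mu>)" "\<And>z. \<bar>f z\<bar> \<le> B"
  shows "integrable mu2 f"
  by (rule pp.P.integrable_const_bound[of _ B]) (use assms in auto)

lemma wchar_sq:
  assumes l: "0 \<le> l"
  shows "(cmod (wchar l s))\<^sup>2 = (\<integral>z. exp (- l * ((fst z)\<^sup>2 + (snd z)\<^sup>2)) * cos (s * (fst z - snd z)) \<partial>mu2)"
proof -
  define w where "w = (\<lambda>x::real. exp (- l * x\<^sup>2))"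
  have w: "0 \<le> w x" "w x \<le> 1" for x using l by (auto simp: w_def)
  have wm [measurable]: "w \<in> borel_measurable \<mu>" unfolding w_def by simp
  have wb: "\<bar>w x * cos y\<bar> \<le> 1" "\<bar>w x * sin y\<bar> \<le> 1" for x y
    using w[of x] by (auto simp: abs_mult intro: mult_le_one)
  have ic: "integrable \<mu> (\<lambda>x. w x * cos (s * x))" and isn: "integrable \<mu> (\<lambda>x. w x * sin (s * x))"
    by (rule integrable_bdd[of _ 1]; use wb in auto)+
  define C S where "C = (\<integral>x. w x * cos (s * x) \<partial>\<mu>)" and "S = (\<integral>x. w x * sin (s * x) \<partial>\<mu>)"
  have ich: "integrable \<mu> (\<lambda>x. complex_of_real (w x) * cis (s * x))"
    by (rule integrable_bdd[of _ 1]) (use w in \<open>auto simp: norm_mult cis_conv_exp\<close>)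
  have "wchar l s = Complex C S"
  proof (rule complex_eqI)
    show "Re (wchar l s) = Re (Complex C S)"
      using integral_Re[OF ich] by (simp add: wchar_def C_def w_def)
    show "Im (wchar l s) = Im (Complex C S)"
      using integral_Im[OF ich] by (simp add: wchar_def S_def w_def)
  qed
  then have 1: "(cmod (wchar l s))\<^sup>2 = C * C + S * S" by (simp add: cmod_def power2_eq_square)
  have i2: "integrable mu2 (\<lambda>z. w (fst z) * w (snd z) * cos (s * (fst z - snd z)))"
  proof (rule integrable2[of _ 1])
    fix z
    have "w (fst z) * w (snd z) \<le> 1" using w[of "fst z"] w[of "snd z"] by (intro mult_le_one) auto
    moreover have "0 \<le> w (fst z) * w (snd z)" using w[of "fst z"] w[of "snd z"] by auto
    ultimately have "(w (fst z) * w (snd z)) * \<bar>cos (s * (fst z - snd z))\<bar> \<le> 1"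
      using abs_cos_le_one by (intro mult_le_one[of "w (fst z) * w (snd z)"]) auto
    then show "\<bar>w (fst z) * w (snd z) * cos (s * (fst z - snd z))\<bar> \<le> 1"
      using w by (simp add: abs_mult)
  qed measurable
  have "(\<integral>z. w (fst z) * w (snd z) * cos (s * (fst z - snd z)) \<partial>mu2)
      = (\<integral>x. (\<integral>y. w x * w y * cos (s * (x - y)) \<partial>\<mu>) \<partial>\<mu>)"
    using pp.integral_fst'[OF i2] by simp
  also have "\<dots> = (\<integral>x. (w x * cos (s * x)) * C + (w x * sin (s * x)) * S \<partial>\<mu>)"
  proof (rule Bochner_Integration.integral_cong[OF refl])
    fix x
    have "(\<integral>y. w x * w y * cos (s * (x - y)) \<partial>\<mu>)
        = (\<integral>y. (w x * cos (s * x)) * (w y * cos (s * y)) + (w x * sin (s * x)) * (w y * sin (s * y)) \<partial>\<mu>)"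
      by (rule Bochner_Integration.integral_cong[OF refl]) (simp add: right_diff_distrib cos_diff algebra_simps)
    also have "\<dots> = (w x * cos (s * x)) * C + (w x * sin (s * x)) * S"
      using ic isn by (subst Bochner_Integration.integral_add) (auto simp: C_def S_def)
    finally show "(\<integral>y. w x * w y * cos (s * (x - y)) \<partial>\<mu>) = \<dots>" .
  qed
  also have "\<dots> = C * C + S * S"
    using ic isn by (subst Bochner_Integration.integral_add) (auto simp: C_def S_def)
  finally have "(\<integral>z. w (fst z) * w (snd z) * cos (s * (fst z - snd z)) \<partial>mu2) = C * C + S * S" .
  moreover have "exp (- l * ((fst z)\<^sup>2 + (snd z)\<^sup>2)) = w (fst z) * w (snd z)" for z :: "real \<times> real"
    unfolding w_def by (simp add: mult_exp_exp algebra_simps)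
  ultimately show ?thesis using 1 by simp
qed

lemma wmass_sq:
  assumes l: "0 \<le> l"
  shows "(wmass l)\<^sup>2 = (\<integral>z. exp (- l * ((fst z)\<^sup>2 + (snd z)\<^sup>2)) \<partial>mu2)"
proof -
  have "wchar l 0 = complex_of_real (wmass l)"
    by (simp add: wchar_def wmass_def)
  then show ?thesis using wchar_sq[OF l, of 0] by simp
qed

lemma defect_eq:
  assumes l: "0 \<le> l"
  shows "defect l s = (\<integral>z. exp (- l * ((fst z)\<^sup>2 + (snd z)\<^sup>2)) * (1 - cos (s * (fst z - snd z))) \<partial>mu2) / (wmass l)\<^sup>2"
proof -
  have e: "exp (- l * ((fst z)\<^sup>2 + (snd z)\<^sup>2)) \<le> 1" for z :: "real \<times> real" using l by simp
  have i1: "integrable mu2 (\<lambda>z. exp (- l * ((fst z)\<^sup>2 + (snd z)\<^sup>2)))"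
    by (rule integrable2[of _ 1]) (use e in auto)
  have i2: "integrable mu2 (\<lambda>z. exp (- l * ((fst z)\<^sup>2 + (snd z)\<^sup>2)) * cos (s * (fst z - snd z)))"
    by (rule integrable2[of _ 1]) (use e in \<open>auto simp: abs_mult intro!: mult_le_one\<close>)
  have "(\<integral>z. exp (- l * ((fst z)\<^sup>2 + (snd z)\<^sup>2)) * (1 - cos (s * (fst z - snd z))) \<partial>mu2)
     = (wmass l)\<^sup>2 - (cmod (wchar l s))\<^sup>2"
    unfolding wmass_sq[OF l] wchar_sq[OF l] using i1 i2
    by (subst Bochner_Integration.integral_diff[symmetric]) (auto simp: algebra_simps)
  then show ?thesis using wmass_pos[OF l] by (simp add: defect_def power_divide field_simps)
qed

lemma defect_nonneg: assumes "0 \<le> l" shows "0 \<le> defect l s"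
  unfolding defect_eq[OF assms]
  by (intro divide_nonneg_nonneg integral_nonneg_AE) (auto simp: cos_le_one)

lemma defect_0 [simp]: "0 \<le> l \<Longrightarrow> defect l 0 = 0" by (simp add: defect_eq)

lemma defect_minus: "0 \<le> l \<Longrightarrow> defect l (- s) = defect l s"
  by (simp add: defect_eq)

lemma integrable_cos2: "integrable mu2 (\<lambda>z. 1 - cos (s * (fst z - snd z)))"
proof (rule integrable2[of _ 2])
  fix z :: "real \<times> real"
  show "\<bar>1 - cos (s * (fst z - snd z))\<bar> \<le> 2"
    using cos_ge_minus_one[of "s * (fst z - snd z)"] cos_le_one[of "s * (fst z - snd z)"] by linarith
qed measurable

lemma defect0_eq: "defect 0 s = (\<integral>z. 1 - cos (s * (fst z - snd z)) \<partial>mu2)"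
  using defect_eq[of 0 s] by simp

lemma defect_add: "defect 0 (s + t) \<le> 2 * defect 0 s + 2 * defect 0 t"
proof -
  have "defect 0 (s + t) \<le> (\<integral>z. 2 * (1 - cos (s * (fst z - snd z))) + 2 * (1 - cos (t * (fst z - snd z))) \<partial>mu2)"
    unfolding defect0_eq
  proof (intro integral_mono integrable_cos2 Bochner_Integration.integrable_add integrable_mult_right)
    fix z :: "real \<times> real"
    show "1 - cos ((s + t) * (fst z - snd z)) \<le> 2 * (1 - cos (s * (fst z - snd z))) + 2 * (1 - cos (t * (fst z - snd z)))"
      using one_minus_cos_add_le[of "s * (fst z - snd z)" "t * (fst z - snd z)"] by (simp add: distrib_right)
  qed
  also have "\<dots> = 2 * defect 0 s + 2 * defect 0 t"
    unfolding defect0_eq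
    by (subst Bochner_Integration.integral_add; (intro integrable_mult_right integrable_cos2)?)
       (simp only: integral_mult_right_zero)
  finally show ?thesis .
qed

text \<open>By symmetrisation the defect is the expectation of \<open>1 - cos (s * (x - y))\<close> under the damped law of a pair; on the event in the
hypothesis the argument is at most \<open>1\<close>, where \<open>1 - cos u\<close> is at least \<open>u\<^sup>2/4\<close>.\<close>

lemma defect_lower:
  assumes l: "0 \<le> l" and L: "2 * L * \<bar>s\<bar> \<le> 1" "0 \<le> d"
    and h: "h \<le> measure mu2 {z. d \<le> \<bar>fst z - snd z\<bar> \<and> \<bar>fst z\<bar> \<le> L \<and> \<bar>snd z\<bar> \<le> L}"
  shows "h * exp (- 2 * l * L\<^sup>2) * d\<^sup>2 / 4 * s\<^sup>2 \<le> defect l s"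
proof -
  let ?E = "{z :: real \<times> real. d \<le> \<bar>fst z - snd z\<bar> \<and> \<bar>fst z\<bar> \<le> L \<and> \<bar>snd z\<bar> \<le> L}"
  have Em [measurable]: "?E \<in> sets mu2"
  proof -
    have "?E = {z \<in> space mu2. d \<le> \<bar>fst z - snd z\<bar> \<and> \<bar>fst z\<bar> \<le> L \<and> \<bar>snd z\<bar> \<le> L}"
      by (auto simp: space_pair_measure)
    also have "\<dots> \<in> sets mu2" by measurable
    finally show ?thesis .
  qed
  let ?c = "exp (- 2 * l * L\<^sup>2) * d\<^sup>2 / 4 * s\<^sup>2"
  let ?f = "\<lambda>z::real\<times>real. exp (- l * ((fst z)\<^sup>2 + (snd z)\<^sup>2)) * (1 - cos (s * (fst z - snd z)))"
  have fb: "\<bar>?f z\<bar> \<le> 2" and fn: "0 \<le> ?f z" for z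
  proof -
    have "exp (- l * ((fst z)\<^sup>2 + (snd z)\<^sup>2)) \<le> 1" using l by simp
    moreover have "0 \<le> 1 - cos (s * (fst z - snd z))" "1 - cos (s * (fst z - snd z)) \<le> 2"
      using cos_ge_minus_one[of "s * (fst z - snd z)"] by (auto simp: cos_le_one)
    ultimately have "exp (- l * ((fst z)\<^sup>2 + (snd z)\<^sup>2)) * (1 - cos (s * (fst z - snd z))) \<le> 1 * 2"
      by (intro mult_mono) auto
    then show "\<bar>?f z\<bar> \<le> 2" "0 \<le> ?f z" by (auto simp: cos_le_one)
  qed
  have fi: "integrable mu2 ?f" by (rule integrable2[of _ 2]) (use fb in auto)
  have "?c * h \<le> ?c * measure mu2 ?E" by (intro mult_left_mono h) auto
  also have "\<dots> = (\<integral>z. ?c * indicator ?E z \<partial>mu2)"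
  proof -
    have "?E \<inter> space mu2 = ?E" by (simp add: space_pair_measure)
    then show ?thesis by simp
  qed
  also have "\<dots> \<le> (\<integral>z. ?f z \<partial>mu2)"
  proof (intro integral_mono fi)
    show "integrable mu2 (\<lambda>z. ?c * indicator ?E z)" by (intro integrable_mult_right pp.P.integrable_const_bound[of _ 1]) auto
    fix z :: "real \<times> real"
    show "?c * indicator ?E z \<le> ?f z"
    proof (cases "z \<in> ?E")
      case True
      then have z: "d \<le> \<bar>fst z - snd z\<bar>" "\<bar>fst z\<bar> \<le> L" "\<bar>snd z\<bar> \<le> L" by auto
      have "(fst z)\<^sup>2 \<le> L\<^sup>2" "(snd z)\<^sup>2 \<le> L\<^sup>2" using z by (auto simp: abs_le_square_iff[symmetric])
      then have "l * ((fst z)\<^sup>2 + (snd z)\<^sup>2) \<le> l * (2 * L\<^sup>2)" using l by (intro mult_left_mono) auto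
      then have e: "exp (- 2 * l * L\<^sup>2) \<le> exp (- l * ((fst z)\<^sup>2 + (snd z)\<^sup>2))" by simp
      have "\<bar>s * (fst z - snd z)\<bar> \<le> \<bar>s\<bar> * (2 * L)" unfolding abs_mult using z by (intro mult_left_mono) auto
      then have "\<bar>s * (fst z - snd z)\<bar> \<le> 1" using L by (simp add: mult_ac)
      from one_minus_cos_ge[OF this] have "s\<^sup>2 * (fst z - snd z)\<^sup>2 / 4 \<le> 1 - cos (s * (fst z - snd z))"
        by (simp add: power_mult_distrib)
      moreover have "d\<^sup>2 \<le> (fst z - snd z)\<^sup>2" using z(1) L(2) by (metis abs_of_nonneg abs_le_square_iff)
      then have "s\<^sup>2 * d\<^sup>2 \<le> s\<^sup>2 * (fst z - snd z)\<^sup>2" by (intro mult_left_mono) auto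
      ultimately have "s\<^sup>2 * d\<^sup>2 / 4 \<le> 1 - cos (s * (fst z - snd z))" by linarith
      then have "exp (- 2 * l * L\<^sup>2) * (s\<^sup>2 * d\<^sup>2 / 4) \<le> ?f z" using e by (intro mult_mono) auto
      then show ?thesis using True by (simp add: mult_ac)
    next
      case False then show ?thesis using fn[of z] by simp
    qed
  qed
  finally have "?c * h \<le> (\<integral>z. ?f z \<partial>mu2)" .
  moreover have "(\<integral>z. ?f z \<partial>mu2) \<le> (\<integral>z. ?f z \<partial>mu2) / (wmass l)\<^sup>2"
  proof -
    have "0 \<le> (\<integral>z. ?f z \<partial>mu2)" by (intro integral_nonneg_AE) (use fn in auto)
    moreover have "(wmass l)\<^sup>2 \<le> 1" "0 < (wmass l)\<^sup>2" using wmass_pos[OF l] wmass_le1[OF l] by (auto simp: power_le_one)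
    ultimately show ?thesis by (simp add: pos_le_divide_eq mult_left_le)
  qed
  ultimately show ?thesis unfolding defect_eq[OF l] by (simp add: mult_ac)
qed

lemma defect_upper:
  assumes "0 \<le> L"
  shows "defect 0 s \<le> 4 * measure \<mu> {x. L < \<bar>x\<bar>} + 2 * s\<^sup>2 * L\<^sup>2"
proof -
  have m [measurable]: "{x. L < \<bar>x\<bar>} \<in> sets \<mu>" by simp
  let ?i = "indicator {x. L < \<bar>x\<bar>} :: real \<Rightarrow> real"
  have i1: "integrable mu2 (\<lambda>z. ?i (fst z))" and i2: "integrable mu2 (\<lambda>z. ?i (snd z))"
    by (rule integrable2[of _ 1]; auto simp: indicator_def)+
  have v1: "(\<integral>z. ?i (fst z) \<partial>mu2) = measure \<mu> {x. L < \<bar>x\<bar>}"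
    using pp.integral_fst'[OF i1] by (simp add: prob_space)
  have v2: "(\<integral>z. ?i (snd z) \<partial>mu2) = measure \<mu> {x. L < \<bar>x\<bar>}"
    using pp.integral_fst'[OF i2] by (simp add: prob_space)
  have "defect 0 s \<le> (\<integral>z. 2 * ?i (fst z) + 2 * ?i (snd z) + 2 * s\<^sup>2 * L\<^sup>2 \<partial>mu2)"
    unfolding defect0_eq
  proof (intro integral_mono integrable_cos2 Bochner_Integration.integrable_add integrable_mult_right i1 i2)
    fix z :: "real \<times> real"
    show "1 - cos (s * (fst z - snd z)) \<le> 2 * ?i (fst z) + 2 * ?i (snd z) + 2 * s\<^sup>2 * L\<^sup>2"
    proof (cases "L < \<bar>fst z\<bar> \<or> L < \<bar>snd z\<bar>")
      case True
      then have "2 \<le> 2 * ?i (fst z) + 2 * ?i (snd z)" by (auto simp: indicator_def)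
      moreover have "1 - cos (s * (fst z - snd z)) \<le> 2" using cos_ge_minus_one[of "s * (fst z - snd z)"] by linarith
      moreover have "0 \<le> 2 * s\<^sup>2 * L\<^sup>2" by simp
      ultimately show ?thesis by linarith
    next
      case False
      then have "\<bar>fst z - snd z\<bar> \<le> 2 * L" by linarith
      then have "(fst z - snd z)\<^sup>2 \<le> (2 * L)\<^sup>2" using assms by (metis abs_le_square_iff abs_of_nonneg mult_nonneg_nonneg zero_le_numeral)
      then have "s\<^sup>2 * (fst z - snd z)\<^sup>2 \<le> s\<^sup>2 * (4 * L\<^sup>2)" by (intro mult_left_mono) (auto simp: power_mult_distrib)
      then show ?thesis using one_minus_cos_le[of "s * (fst z - snd z)"] False
        by (auto simp: power_mult_distrib)
    qed
  qed auto
  also have "\<dots> = 4 * measure \<mu> {x. L < \<bar>x\<bar>} + 2 * s\<^sup>2 * L\<^sup>2"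
  proof -
    have "(\<integral>z. 2 * ?i (fst z) + 2 * ?i (snd z) + 2 * s\<^sup>2 * L\<^sup>2 \<partial>mu2)
       = (\<integral>z. 2 * ?i (fst z) \<partial>mu2) + (\<integral>z. 2 * ?i (snd z) \<partial>mu2) + 2 * s\<^sup>2 * L\<^sup>2"
      using i1 i2 by (simp add: pp.P.prob_space Bochner_Integration.integral_add)
    then show ?thesis using v1 v2 by simp
  qed
  finally show ?thesis .
qed

lemma cmod_wchar_le:
  assumes l: "0 \<le> l"
  shows "cmod (wchar l s) \<le> wmass l * exp (- defect l s / 2)"
proof -
  have "(cmod (wchar l s) / wmass l)\<^sup>2 = 1 - defect l s" by (simp add: defect_def)
  also have "\<dots> \<le> exp (- defect l s)" using exp_ge_add_one_self[of "- defect l s"] by simp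
  also have "\<dots> = (exp (- defect l s / 2))\<^sup>2" by (simp add: exp_double[symmetric])
  finally have "cmod (wchar l s) / wmass l \<le> exp (- defect l s / 2)"
    using power2_le_imp_le[of "cmod (wchar l s) / wmass l" "exp (- defect l s / 2)"] by simp
  then show ?thesis using wmass_pos[OF l] by (simp add: field_simps)
qed

lemma prob_gam: "prob_space (gam n)"
  unfolding gam_def by (rule prob_space_PiM) (rule prob_space_axioms)

lemma meas_coord: "j < n \<Longrightarrow> (\<lambda>x. x j) \<in> borel_measurable (gam n)"
  unfolding gam_def using measurable_component_singleton[of j "{..<n}" "\<lambda>_. \<mu>"] by simp

lemma meas_ip [measurable]: "(\<lambda>x. ip n v x) \<in> borel_measurable (gam n)"
  unfolding ip_def by (intro borel_measurable_sum borel_measurable_times meas_coord) auto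

lemma meas_nsq [measurable]: "(\<lambda>x. nsq n x) \<in> borel_measurable (gam n)"
  unfolding nsq_def by (intro borel_measurable_sum borel_measurable_power meas_coord) auto

lemma wchar_product:
  assumes l: "0 \<le> l"
  shows "(\<integral>x. complex_of_real (exp (- l * nsq n x)) * cis (th * ip n v x) \<partial>gam n) = (\<Prod>j<n. wchar l (th * v j))"
proof -
  interpret ps: product_sigma_finite "\<lambda>_::nat. \<mu>" ..
  have "(\<integral>x. complex_of_real (exp (- l * nsq n x)) * cis (th * ip n v x) \<partial>gam n)
     = (\<integral>x. (\<Prod>j<n. complex_of_real (exp (- l * (x j)\<^sup>2)) * cis (th * v j * x j)) \<partial>PiM {..<n} (\<lambda>_. \<mu>))"
    unfolding gam_def
  proof (rule Bochner_Integration.integral_cong[OF refl])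
    fix x :: "nat \<Rightarrow> real"
    have 1: "exp (- l * nsq n x) = (\<Prod>j<n. exp (- l * (x j)\<^sup>2))"
      unfolding nsq_def by (simp add: sum_distrib_left exp_sum[symmetric])
    have 2: "cis (th * ip n v x) = (\<Prod>j<n. cis (th * v j * x j))"
      unfolding ip_def cis_conv_exp by (simp add: sum_distrib_left exp_sum[symmetric] mult.assoc)
    show "complex_of_real (exp (- l * nsq n x)) * cis (th * ip n v x) = (\<Prod>j<n. complex_of_real (exp (- l * (x j)\<^sup>2)) * cis (th * v j * x j))"
      unfolding 1 2 by (simp add: prod.distrib)
  qed
  also have "\<dots> = (\<Prod>j<n. wchar l (th * v j))"
    unfolding wchar_def
  proof (rule ps.product_integral_prod)
    fix j
    have "(\<lambda>x. complex_of_real (exp (- l * x\<^sup>2)) * cis (th * v j * x)) \<in> borel_measurable borel"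
      by (intro borel_measurable_continuous_onI continuous_intros)
    then have m: "(\<lambda>x. complex_of_real (exp (- l * x\<^sup>2)) * cis (th * v j * x)) \<in> borel_measurable \<mu>"
      by (simp cong: measurable_cong_sets)
    show "integrable \<mu> (\<lambda>x. complex_of_real (exp (- l * x\<^sup>2)) * cis (th * v j * x))"
      by (rule integrable_bdd[of _ 1, OF m]) (simp add: norm_mult l)
  qed simp
  finally show ?thesis .
qed

lemma wchar_product_bound:
  assumes l: "0 \<le> l"
  shows "cmod (\<integral>x. complex_of_real (exp (- l * nsq n x)) * cis (th * ip n v x) \<partial>gam n)
      \<le> wmass l ^ n * exp (- (\<Sum>j<n. defect l (th * v j)) / 2)"
proof -
  have "cmod (\<integral>x. complex_of_real (exp (- l * nsq n x)) * cis (th * ip n v x) \<partial>gam n)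
     = (\<Prod>j<n. cmod (wchar l (th * v j)))"
    unfolding wchar_product[OF l] by (simp add: prod_norm)
  also have "\<dots> \<le> (\<Prod>j<n. wmass l * exp (- defect l (th * v j) / 2))"
    by (intro prod_mono conjI norm_ge_zero cmod_wchar_le l)
  also have "\<dots> = wmass l ^ n * exp (- (\<Sum>j<n. defect l (th * v j)) / 2)"
    by (simp add: prod.distrib exp_sum[symmetric] sum_divide_distrib sum_negf)
  finally show ?thesis .
qed

lemma wmass_product:
  assumes l: "0 \<le> l"
  shows "(\<integral>x. exp (- l * nsq n x) \<partial>gam n) = wmass l ^ n"
proof -
  interpret g: prob_space "gam n" by (rule prob_gam)
  have "complex_of_real (\<integral>x. exp (- l * nsq n x) \<partial>gam n) = (\<Prod>j<n. wchar l 0)"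
    using wchar_product[OF l, of n 0 "\<lambda>_. 0"] by simp
  also have "wchar l 0 = complex_of_real (wmass l)" by (simp add: wchar_def wmass_def)
  finally show ?thesis by (simp flip: of_real_power)
qed

end

section \<open>The Cauchy kernel and rounding to a lattice\<close>

lemma measurable_cis [measurable]: "cis \<in> borel_measurable borel"
  by (intro borel_measurable_continuous_onI continuous_intros)

text \<open>Equal to \<open>(1 - cos x)/x\<^sup>2\<close>: a nonnegative function whose Fourier transform has compact support.\<close>

definition fejer :: "real \<Rightarrow> real" where
  "fejer x = (\<integral>l. ((1 - l) * cos (l * x)) * indicator {0..1} l \<partial>lborel)"

lemma fejer_0: "fejer 0 = 1/2"
proof -
  have "fejer 0 = (\<integral>l. (1 - l) * indicator {0..1} l \<partial>lborel)" by (simp add: fejer_def)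
  also have "\<dots> = (1 - 1\<^sup>2/2) - (0 - 0\<^sup>2/2)"
    by (rule integral_FTC_Icc_real) (auto intro!: derivative_eq_intros continuous_intros)
  finally show ?thesis by simp
qed

lemma fejer_eq: assumes "x \<noteq> 0" shows "fejer x = (1 - cos x) / x\<^sup>2"
proof -
  have "fejer x = ((1 - 1) * sin (1 * x) / x - cos (1 * x) / x\<^sup>2) - ((1 - 0) * sin (0 * x) / x - cos (0 * x) / x\<^sup>2)"
    unfolding fejer_def
    by (rule integral_FTC_Icc_real)
       (use assms in \<open>auto intro!: derivative_eq_intros continuous_intros simp: power2_eq_square field_simps\<close>)
  then show ?thesis by (simp add: diff_divide_distrib)
qed

lemma fejer_nonneg: "0 \<le> fejer x"
  by (cases "x = 0") (auto simp: fejer_0 fejer_eq cos_le_one)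

text \<open>The zeros of \<open>fejer\<close> are avoided by adding the translate by \<open>pi\<close>.\<close>

lemma cauchy_le_fejer: "1 / (1 + x\<^sup>2) \<le> 10 * (fejer x + fejer (x + pi))"
proof (cases "x = 0 \<or> x = - pi")
  case True
  then have "1/2 \<le> fejer x + fejer (x + pi)"
    using fejer_nonneg[of x] fejer_nonneg[of "x + pi"] by (auto simp: fejer_0)
  then have "10 * (1/2) \<le> 10 * (fejer x + fejer (x + pi))" by (intro mult_left_mono) auto
  moreover have "1 / (1 + x\<^sup>2) \<le> 10 * (1/2)" by (simp add: add_pos_nonneg pos_divide_le_eq add_increasing2)
  ultimately show ?thesis by (rule order_trans[rotated])
next
  case False
  define M where "M = (\<bar>x\<bar> + pi)\<^sup>2"
  have c1: "0 \<le> 1 + cos x" using cos_ge_minus_one[of x] by linarith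
  have "0 < \<bar>x\<bar> + pi" using pi_gt_zero by linarith
  then have Mp: "0 < M" unfolding M_def by simp
  have a: "x\<^sup>2 \<le> M" "(x + pi)\<^sup>2 \<le> M"
    unfolding M_def by (rule abs_le_square_iff[THEN iffD1], use pi_gt_zero in linarith)+
  have "M \<le> 2 * x\<^sup>2 + 2 * pi\<^sup>2"
    using zero_le_power2[of "\<bar>x\<bar> - pi"] unfolding M_def by (simp add: power2_eq_square algebra_simps)
  moreover have "pi\<^sup>2 \<le> 10"
  proof -
    have "pi \<le> 3.16" using pi_approx by simp
    then have "pi\<^sup>2 \<le> 3.16\<^sup>2" by (intro power_mono) auto
    then show ?thesis by (simp add: power2_eq_square)
  qed
  ultimately have "M \<le> 20 + 20 * x\<^sup>2" using zero_le_power2[of x] by linarith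
  then have "M \<le> 20 * (1 + x\<^sup>2)" by simp
  then have "1 / (1 + x\<^sup>2) \<le> 20 / M" using Mp by (simp add: field_simps add_pos_nonneg)
  also have "\<dots> = 10 * ((1 - cos x) / M + (1 - cos (x + pi)) / M)"
    by (simp add: add_divide_distrib[symmetric])
  also have "\<dots> \<le> 10 * ((1 - cos x) / x\<^sup>2 + (1 - cos (x + pi)) / (x + pi)\<^sup>2)"
    using False a by (intro mult_left_mono add_mono divide_left_mono) (auto simp: cos_le_one Mp mult_pos_pos add_eq_0_iff c1)
  finally show ?thesis using False by (simp add: fejer_eq add_eq_0_iff)
qed

abbreviation unif01 :: "real measure" where "unif01 \<equiv> restrict_space lborel {0..1}"

lemma prob_unif01: "prob_space unif01"
  by (rule prob_spaceI) (simp add: space_restrict_space emeasure_restrict_space)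

lemma unif01_integral: "(\<integral>l. f l \<partial>unif01) = (\<integral>l. f l * indicator {0..1} l \<partial>lborel)" for f :: "real \<Rightarrow> real"
  by (subst integral_restrict_space) (auto simp: mult.commute)

lemma (in prob_space) expectation_fejer:
  assumes [measurable]: "S \<in> borel_measurable M"
  shows "integrable M (\<lambda>\<omega>. fejer (S \<omega>))"
    "expectation (\<lambda>\<omega>. fejer (S \<omega>)) = (\<integral>l. (1 - l) * expectation (\<lambda>\<omega>. cos (l * S \<omega>)) \<partial>unif01)"
    "(\<lambda>l. expectation (\<lambda>\<omega>. cos (l * S \<omega>))) \<in> borel_measurable unif01"
proof -
  interpret U: prob_space unif01 by (rule prob_unif01)
  interpret pp: pair_prob_space M unif01 ..
  let ?f = "\<lambda>\<omega> l. (1 - l) * cos (l * S \<omega>) :: real"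
  have [measurable]: "(\<lambda>l. l) \<in> borel_measurable unif01"
    by (simp add: measurable_restrict_space1)
  have sp: "l \<in> {0..1}" if "l \<in> space unif01" for l using that by (simp add: space_restrict_space)
  have im: "integrable (M \<Otimes>\<^sub>M unif01) (case_prod ?f)"
  proof (rule pp.P.integrable_const_bound[of _ 1])
    show "AE x in M \<Otimes>\<^sub>M unif01. norm (case_prod ?f x) \<le> 1"
      by (rule AE_I2) (auto simp: space_pair_measure abs_mult dest!: sp intro!: mult_le_one)
  qed measurable
  show "integrable M (\<lambda>\<omega>. fejer (S \<omega>))"
    using pp.integrable_fst'[OF im] by (simp add: fejer_def unif01_integral)
  have "expectation (\<lambda>\<omega>. fejer (S \<omega>)) = (\<integral>\<omega>. (\<integral>l. ?f \<omega> l \<partial>unif01) \<partial>M)"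
    by (simp add: fejer_def unif01_integral)
  also have "\<dots> = (\<integral>l. (\<integral>\<omega>. ?f \<omega> l \<partial>M) \<partial>unif01)"
    using pp.Fubini_integral[OF im] by simp
  finally show "expectation (\<lambda>\<omega>. fejer (S \<omega>)) = (\<integral>l. (1 - l) * expectation (\<lambda>\<omega>. cos (l * S \<omega>)) \<partial>unif01)"
    by simp
  show "(\<lambda>l. expectation (\<lambda>\<omega>. cos (l * S \<omega>))) \<in> borel_measurable unif01"
    by measurable
qed

lemma (in prob_space) expectation_cos_shift_le:
  assumes [measurable]: "S \<in> borel_measurable M"
  shows "\<bar>expectation (\<lambda>\<omega>. cos (a * S \<omega> + b))\<bar> \<le> cmod (expectation (\<lambda>\<omega>. cis (a * S \<omega>)))"
proof -
  have i: "integrable M (\<lambda>\<omega>. cis b * cis (a * S \<omega>))"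
    by (rule integrable_const_bound[of _ 1]) (auto simp: norm_mult)
  have "expectation (\<lambda>\<omega>. cos (a * S \<omega> + b)) = Re (expectation (\<lambda>\<omega>. cis b * cis (a * S \<omega>)))"
    using integral_Re[OF i] by (simp add: cis_mult add.commute)
  also have "expectation (\<lambda>\<omega>. cis b * cis (a * S \<omega>)) = cis b * expectation (\<lambda>\<omega>. cis (a * S \<omega>))" by simp
  finally have "\<bar>expectation (\<lambda>\<omega>. cos (a * S \<omega> + b))\<bar> \<le> cmod (cis b * expectation (\<lambda>\<omega>. cis (a * S \<omega>)))"
    using abs_Re_le_cmod by metis
  then show ?thesis by (simp add: norm_mult)
qed

text \<open>A form of Esseen's inequality. The Cauchy kernel is dominated by two translates of \<open>fejer\<close>, whose expectations are averages of
the characteristic function over an interval of length \<open>1/s\<close>. In contrast with the indicator of a small ball, the Cauchy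
kernel compares well with truncated norms, see \<open>weighted_rows_prob\<close>.\<close>

lemma (in prob_space) cauchy_kernel_bound:
  assumes S [measurable]: "S \<in> borel_measurable M" and s: "0 < s" and c: "0 < c" and e: "0 \<le> e"
    and h: "\<And>th. 0 \<le> th \<Longrightarrow> th \<le> 1 / s \<Longrightarrow>
      cmod (expectation (\<lambda>\<omega>. cis (th * S \<omega>))) \<le> 1 / (1 + (c * th)\<^sup>2) + e"
  shows "expectation (\<lambda>\<omega>. 1 / (1 + (S \<omega> / s)\<^sup>2)) \<le> 20 * (2 * s / c + e)"
proof -
  interpret U: prob_space unif01 by (rule prob_unif01)
  have sp: "l \<in> {0..1}" if "l \<in> space unif01" for l using that by (simp add: space_restrict_space)
  have [measurable]: "(\<lambda>l. l) \<in> borel_measurable unif01"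
    by (simp add: measurable_restrict_space1)
  define k where "k = c / s"
  have k: "0 < k" using s c by (simp add: k_def)
  let ?h = "\<lambda>l. 1 / (1 + (k * l)\<^sup>2) + e"
  have hi: "integrable unif01 ?h"
  proof (rule U.integrable_const_bound[of _ "1 + e"])
    have "1 / (1 + (k * l)\<^sup>2) \<le> 1" for l by (simp add: add_pos_nonneg)
    then show "AE x in unif01. norm (1 / (1 + (k * x)\<^sup>2) + e) \<le> 1 + e"
      using e by (intro AE_I2) (simp add: add_nonneg_nonneg abs_of_nonneg)
  qed measurable
  have hval: "(\<integral>l. ?h l \<partial>unif01) \<le> 2 / k + e"
  proof -
    have "(\<integral>l. ?h l \<partial>unif01) = (\<integral>l. ?h l * indicator {0..1} l \<partial>lborel)" by (rule unif01_integral)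
    also have "\<dots> = (arctan (k * 1) / k + e * 1) - (arctan (k * 0) / k + e * 0)"
      by (rule integral_FTC_Icc_real)
         (use k in \<open>auto intro!: derivative_eq_intros continuous_intros simp: add_nonneg_eq_0_iff inverse_eq_divide\<close>)
    also have "\<dots> \<le> 2 / k + e"
      using k arctan_ubound[of k] pi_less_4 by (auto intro!: divide_right_mono)
    finally show ?thesis .
  qed
  have b: "expectation (\<lambda>\<omega>. fejer (S \<omega> / s + d)) \<le> 2 / k + e" for d
  proof -
    have [measurable]: "(\<lambda>\<omega>. S \<omega> / s + d) \<in> borel_measurable M" by measurable
    have "expectation (\<lambda>\<omega>. fejer (S \<omega> / s + d)) = (\<integral>l. (1 - l) * expectation (\<lambda>\<omega>. cos (l * (S \<omega> / s + d))) \<partial>unif01)"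
      by (rule expectation_fejer(2)) measurable
    also have "\<dots> \<le> (\<integral>l. ?h l \<partial>unif01)"
    proof (rule integral_mono_AE)
      have bd: "(1 - l) * expectation (\<lambda>\<omega>. cos (l * (S \<omega> / s + d))) \<le> ?h l"
        "\<bar>(1 - l) * expectation (\<lambda>\<omega>. cos (l * (S \<omega> / s + d)))\<bar> \<le> 1 + e"
        if l: "l \<in> space unif01" for l
      proof -
        have l01: "0 \<le> l" "l \<le> 1" using sp[OF l] by auto
        have "\<bar>expectation (\<lambda>\<omega>. cos ((l / s) * S \<omega> + l * d))\<bar> \<le> cmod (expectation (\<lambda>\<omega>. cis ((l / s) * S \<omega>)))"
          by (rule expectation_cos_shift_le) measurable
        also have "\<dots> \<le> 1 / (1 + (c * (l / s))\<^sup>2) + e"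
          using l01 s by (intro h) (auto simp: divide_right_mono)
        finally have 1: "\<bar>expectation (\<lambda>\<omega>. cos (l * (S \<omega> / s + d)))\<bar> \<le> ?h l"
          by (simp add: k_def distrib_left)
        have "\<bar>(1 - l) * expectation (\<lambda>\<omega>. cos (l * (S \<omega> / s + d)))\<bar> \<le> 1 * \<bar>expectation (\<lambda>\<omega>. cos (l * (S \<omega> / s + d)))\<bar>"
          unfolding abs_mult using l01 by (intro mult_right_mono) auto
        then have 2: "\<bar>(1 - l) * expectation (\<lambda>\<omega>. cos (l * (S \<omega> / s + d)))\<bar> \<le> ?h l" using 1 by linarith
        then show "(1 - l) * expectation (\<lambda>\<omega>. cos (l * (S \<omega> / s + d))) \<le> ?h l" by linarith
        have "1 / (1 + (k * l)\<^sup>2) \<le> 1" by (simp add: add_pos_nonneg)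
        then show "\<bar>(1 - l) * expectation (\<lambda>\<omega>. cos (l * (S \<omega> / s + d)))\<bar> \<le> 1 + e" using 2 by linarith
      qed
      show "AE l in unif01. (1 - l) * expectation (\<lambda>\<omega>. cos (l * (S \<omega> / s + d))) \<le> ?h l"
        using bd by auto
      have [measurable]: "(\<lambda>l. expectation (\<lambda>\<omega>. cos (l * (S \<omega> / s + d)))) \<in> borel_measurable unif01"
        by (rule expectation_fejer(3)) measurable
      show "integrable unif01 (\<lambda>l. (1 - l) * expectation (\<lambda>\<omega>. cos (l * (S \<omega> / s + d))))"
        by (rule U.integrable_const_bound[of _ "1 + e"]) (use bd in auto)
    qed (rule hi)
    finally show ?thesis using hval by linarith
  qed
  have fi: "integrable M (\<lambda>\<omega>. fejer (S \<omega> / s + d))" for d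
    by (rule expectation_fejer(1)) measurable
  have "expectation (\<lambda>\<omega>. 1 / (1 + (S \<omega> / s)\<^sup>2)) \<le> expectation (\<lambda>\<omega>. 10 * (fejer (S \<omega> / s + 0) + fejer (S \<omega> / s + pi)))"
  proof (intro integral_mono integrable_mult_right Bochner_Integration.integrable_add fi)
    show "integrable M (\<lambda>\<omega>. 1 / (1 + (S \<omega> / s)\<^sup>2))"
      by (rule integrable_const_bound[of _ 1]) (auto simp: add_pos_nonneg abs_of_nonneg add_nonneg_nonneg)
  qed (use cauchy_le_fejer in auto)
  also have "\<dots> = 10 * (expectation (\<lambda>\<omega>. fejer (S \<omega> / s + 0)) + expectation (\<lambda>\<omega>. fejer (S \<omega> / s + pi)))"
    by (subst integral_mult_right_zero, subst Bochner_Integration.integral_add) (use fi[of 0] fi[of pi] in auto)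
  also have "\<dots> \<le> 10 * ((2 / k + e) + (2 / k + e))"
    by (intro mult_left_mono add_mono b) auto
  finally show ?thesis by (simp add: k_def)
qed

text \<open>The method of conditional expectations: round the coordinates one after the other. If \<open>x j/u\<close> is
rounded up or down with mean \<open>x j/u\<close>, then the linear term does not change in the mean and the \<open>i\<close>-th quadratic term grows by
at most \<open>u\<^sup>2\<close> times the square of the \<open>j\<close>-th entry of \<open>g i\<close>; one of the two choices is as good as the mean.\<close>

lemma greedy_rounding:
  fixes x :: "nat \<Rightarrow> real" and g :: "'i \<Rightarrow> nat \<Rightarrow> real" and c :: "'i \<Rightarrow> real" and l :: "nat \<Rightarrow> real"
  assumes I: "finite I" and c: "\<And>i. i \<in> I \<Longrightarrow> 0 \<le> c i" and u: "0 < u"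
  shows "\<exists>z :: nat \<Rightarrow> int. (\<forall>j<n. z j = \<lfloor>x j / u\<rfloor> \<or> z j = \<lceil>x j / u\<rceil>) \<and>
    (\<Sum>i\<in>I. c i * (ip n (g i) (\<lambda>j. u * z j - x j))\<^sup>2) + (\<Sum>j<n. l j * (u * z j - x j))
      \<le> u\<^sup>2 * (\<Sum>i\<in>I. c i * nsq n (g i))"
proof (induction n)
  case 0
  then show ?case by (auto simp: ip_def nsq_def)
next
  case (Suc n)
  then obtain z :: "nat \<Rightarrow> int" where z: "\<And>j. j < n \<Longrightarrow> z j = \<lfloor>x j / u\<rfloor> \<or> z j = \<lceil>x j / u\<rceil>"
    and le: "(\<Sum>i\<in>I. c i * (ip n (g i) (\<lambda>j. u * z j - x j))\<^sup>2) + (\<Sum>j<n. l j * (u * z j - x j))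
      \<le> u\<^sup>2 * (\<Sum>i\<in>I. c i * nsq n (g i))" by blast
  define p where "p i = ip n (g i) (\<lambda>j. u * z j - x j)" for i
  define q where "q = 2 * (\<Sum>i\<in>I. c i * p i * g i n) + l n"
  define k where "k = (if q \<ge> 0 then \<lfloor>x n / u\<rfloor> else \<lceil>x n / u\<rceil>)"
  define w where "w = u * k - x n"
  have wq: "w * q \<le> 0"
  proof (cases "q \<ge> 0")
    case True
    have "u * \<lfloor>x n / u\<rfloor> \<le> u * (x n / u)" using u by (intro mult_left_mono) auto
    then have "w \<le> 0" using u True by (simp add: w_def k_def)
    then show ?thesis using True by (simp add: mult_nonpos_nonneg)
  next
    case False
    have "u * (x n / u) \<le> u * \<lceil>x n / u\<rceil>" using u by (intro mult_left_mono) auto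
    then have "0 \<le> w" using u False by (simp add: w_def k_def)
    then show ?thesis using False by (simp add: mult_nonneg_nonpos)
  qed
  have wu: "\<bar>w\<bar> \<le> u"
  proof -
    have "\<bar>real_of_int k - x n / u\<bar> \<le> 1" unfolding k_def by (simp split: if_splits; linarith)
    then have "\<bar>real_of_int k - x n / u\<bar> * u \<le> 1 * u" using u by (intro mult_right_mono) auto
    moreover have "\<bar>real_of_int k - x n / u\<bar> * u = \<bar>w\<bar>"
      using u by (simp add: w_def abs_if field_simps split: if_splits)
    ultimately show ?thesis by simp
  qed
  have w2: "w\<^sup>2 \<le> u\<^sup>2" using wu u by (metis abs_le_square_iff abs_of_pos)
  let ?z = "z(n := k)"
  have ipn: "ip (Suc n) (g i) (\<lambda>j. u * ?z j - x j) = p i + g i n * w" for i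
    unfolding ip_def p_def w_def by (simp add: sum.lessThan_Suc)
  have "(\<Sum>i\<in>I. c i * (ip (Suc n) (g i) (\<lambda>j. u * ?z j - x j))\<^sup>2) + (\<Sum>j<Suc n. l j * (u * ?z j - x j))
     = ((\<Sum>i\<in>I. c i * (p i)\<^sup>2) + (\<Sum>j<n. l j * (u * z j - x j))) + w * q + w\<^sup>2 * (\<Sum>i\<in>I. c i * (g i n)\<^sup>2)"
  proof -
    have 1: "(\<Sum>j<Suc n. l j * (u * ?z j - x j)) = (\<Sum>j<n. l j * (u * z j - x j)) + l n * w"
      by (simp add: w_def)
    have 2: "(\<Sum>i\<in>I. c i * (p i + g i n * w)\<^sup>2)
       = (\<Sum>i\<in>I. c i * (p i)\<^sup>2) + w * (2 * (\<Sum>i\<in>I. c i * p i * g i n)) + w\<^sup>2 * (\<Sum>i\<in>I. c i * (g i n)\<^sup>2)"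
      unfolding sum_distrib_left sum.distrib[symmetric]
      by (intro sum.cong refl) (simp add: power2_eq_square algebra_simps)
    show ?thesis unfolding ipn 1 2 q_def by (simp add: algebra_simps)
  qed
  also have "\<dots> \<le> u\<^sup>2 * (\<Sum>i\<in>I. c i * nsq n (g i)) + 0 + u\<^sup>2 * (\<Sum>i\<in>I. c i * (g i n)\<^sup>2)"
    using le wq w2 c unfolding p_def[symmetric]
    by (intro add_mono mult_right_mono sum_nonneg mult_nonneg_nonneg) auto
  also have "\<dots> = u\<^sup>2 * (\<Sum>i\<in>I. c i * nsq (Suc n) (g i))"
    by (simp add: nsq_def distrib_left sum.distrib)
  finally have "(\<Sum>i\<in>I. c i * (ip (Suc n) (g i) (\<lambda>j. u * ?z j - x j))\<^sup>2) + (\<Sum>j<Suc n. l j * (u * ?z j - x j))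
      \<le> u\<^sup>2 * (\<Sum>i\<in>I. c i * nsq (Suc n) (g i))" .
  moreover have "\<forall>j<Suc n. ?z j = \<lfloor>x j / u\<rfloor> \<or> ?z j = \<lceil>x j / u\<rceil>"
    using z by (auto simp: k_def less_Suc_eq)
  ultimately show ?case by blast
qed

text \<open>Every point of \<open>Z\<close> contributes at least \<open>1\<close> to the sum of \<open>exp (W - (\<Sum>j<n. w (z j)))\<close> over the whole box, and
this sum factorises.\<close>

lemma weighted_count:
  fixes w :: "int \<Rightarrow> real" and Z :: "(nat \<Rightarrow> int) set"
  assumes B: "finite B" and Z: "Z \<subseteq> PiE {..<n} (\<lambda>_. B)"
    and W: "\<And>z. z \<in> Z \<Longrightarrow> (\<Sum>j<n. w (z j)) \<le> W"
  shows "finite Z" "real (card Z) \<le> exp W * (\<Sum>k\<in>B. exp (- w k)) ^ n"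
proof -
  have fP: "finite (PiE {..<n} (\<lambda>_. B))" using B by (intro finite_PiE) auto
  show fZ: "finite Z" using Z fP by (rule finite_subset)
  have "real (card Z) = (\<Sum>z\<in>Z. 1)" by simp
  also have "\<dots> \<le> (\<Sum>z\<in>Z. exp (W - (\<Sum>j<n. w (z j))))"
    using W by (intro sum_mono) simp
  also have "\<dots> \<le> (\<Sum>z\<in>PiE {..<n} (\<lambda>_. B). exp (W - (\<Sum>j<n. w (z j))))"
    by (intro sum_mono2 fP Z) auto
  also have "\<dots> = exp W * (\<Sum>z\<in>PiE {..<n} (\<lambda>_. B). \<Prod>j<n. exp (- w (z j)))"
    unfolding sum_distrib_left
    by (intro sum.cong refl) (simp add: exp_diff exp_sum exp_minus prod_inversef[symmetric] divide_inverse)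
  also have "(\<Sum>z\<in>PiE {..<n} (\<lambda>_. B). \<Prod>j<n. exp (- w (z j))) = (\<Prod>j<n. \<Sum>k\<in>B. exp (- w k))"
    using B by (subst prod_sum_PiE) auto
  finally show "real (card Z) \<le> exp W * (\<Sum>k\<in>B. exp (- w k)) ^ n" by simp
qed

section \<open>Tails of the norms of rows and columns\<close>

context entry_law
begin

text \<open>Bounded below by \<open>1\<close>, so that a product of these numbers controls every subproduct.\<close>

definition trunc_norm :: "real \<Rightarrow> nat \<Rightarrow> (nat \<Rightarrow> real) \<Rightarrow> real" where
  "trunc_norm K n g = max 1 (sqrt (nsq n g) / (K * sqrt (real n)))"

lemma trunc_norm_ge1: "1 \<le> trunc_norm K n g" by (simp add: trunc_norm_def)

lemma meas_trunc [measurable]: "(\<lambda>g. trunc_norm K n g) \<in> borel_measurable (gam n)"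
  unfolding trunc_norm_def by measurable

lemma integrable_expw: "0 \<le> l \<Longrightarrow> integrable \<mu> (\<lambda>x. exp (- l * x\<^sup>2))"
  by (rule integrable_bdd[of _ 1]) auto

lemma wmass_anticoncentrated:
  assumes X: "2 \<le> X" and c: "prob {x. \<bar>x\<bar> < 1 / X} \<le> 1 - 1 / X"
  shows "wmass (X\<^sup>2) \<le> 1 - 1 / (2 * X)"
proof -
  let ?E = "{x. 1 / X \<le> \<bar>x\<bar>}"
  have E: "?E \<in> sets \<mu>" by simp
  have "{x. \<bar>x\<bar> < 1 / X} = space \<mu> - ?E" by auto
  then have pE: "1 / X \<le> prob ?E" using c prob_compl[OF E] by simp
  have i: "integrable \<mu> (\<lambda>x. exp (- X\<^sup>2 * x\<^sup>2))" by (rule integrable_expw) simp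
  have "wmass (X\<^sup>2) \<le> (\<integral>x. 1 - (1/2) * indicator ?E x \<partial>\<mu>)"
    unfolding wmass_def
  proof (intro integral_mono i)
    show "integrable \<mu> (\<lambda>x. 1 - (1/2) * indicator ?E x :: real)"
      by (intro Bochner_Integration.integrable_diff integrable_mult_right integrable_bdd[of _ 1]) auto
    fix x :: real
    show "exp (- X\<^sup>2 * x\<^sup>2) \<le> 1 - (1/2) * indicator ?E x"
    proof (cases "x \<in> ?E")
      case True
      then have "1 \<le> X * \<bar>x\<bar>" using X by (simp add: field_simps)
      then have "1 \<le> (X * \<bar>x\<bar>)\<^sup>2" by (simp add: one_le_power)
      then have "1 \<le> X\<^sup>2 * x\<^sup>2" by (simp add: power_mult_distrib)
      then have "exp (- X\<^sup>2 * x\<^sup>2) \<le> exp (-1)" by simp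
      also have "\<dots> \<le> 1/2" using exp_ge_add_one_self[of 1] by (simp add: exp_minus field_simps)
      finally show ?thesis using True by simp
    next
      case False then show ?thesis by simp
    qed
  qed
  also have "\<dots> = 1 - prob ?E / 2"
  proof -
    have "integrable \<mu> (indicator ?E :: real \<Rightarrow> real)" by (rule integrable_bdd[of _ 1]) (auto simp: indicator_def)
    then show ?thesis by (subst Bochner_Integration.integral_diff) auto
  qed
  finally have "wmass (X\<^sup>2) \<le> 1 - prob ?E / 2" .
  moreover have "1 / (2 * X) = (1 / X) / 2" by simp
  ultimately show ?thesis using pE by linarith
qed

text \<open>Exponential Markov inequality: \<open>exp (- X\<^sup>2 * nsq n g)\<close> has expectation \<open>wmass (X\<^sup>2) ^ n\<close>.\<close>

lemma small_norm_prob: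
  assumes X: "2 \<le> X" and c: "prob {x. \<bar>x\<bar> < 1 / X} \<le> 1 - 1 / X"
  shows "measure (gam n) {g \<in> space (gam n). nsq n g \<le> n / (4 * X^3)} \<le> exp (- n / (4 * X))"
proof -
  interpret g: prob_space "gam n" by (rule prob_gam)
  have i: "integrable (gam n) (\<lambda>g. exp (- X\<^sup>2 * nsq n g))"
    by (rule g.integrable_const_bound[of _ 1]) auto
  let ?E = "{g \<in> space (gam n). nsq n g \<le> n / (4 * X^3)}"
  have "exp (- n / (4 * X)) * measure (gam n) ?E = (\<integral>g. exp (- n / (4 * X)) * indicator ?E g \<partial>gam n)" by simp
  also have "\<dots> \<le> (\<integral>g. exp (- X\<^sup>2 * nsq n g) \<partial>gam n)"
  proof (intro integral_mono i)
    show "integrable (gam n) (\<lambda>g. exp (- n / (4 * X)) * indicator ?E g)"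
      by (intro integrable_mult_right g.integrable_const_bound[of _ 1]) auto
    fix g
    show "exp (- n / (4 * X)) * indicator ?E g \<le> exp (- X\<^sup>2 * nsq n g)"
    proof (cases "g \<in> ?E")
      case True
      then have "X\<^sup>2 * nsq n g \<le> X\<^sup>2 * (n / (4 * X^3))" by (intro mult_left_mono) auto
      also have "\<dots> = n / (4 * X)" using X by (simp add: power2_eq_square power3_eq_cube)
      finally show ?thesis using True by simp
    qed auto
  qed
  also have "\<dots> = wmass (X\<^sup>2) ^ n" by (rule wmass_product) simp
  also have "\<dots> \<le> (exp (- 1 / (2 * X))) ^ n"
  proof (rule power_mono)
    show "wmass (X\<^sup>2) \<le> exp (- 1 / (2 * X))"
      using wmass_anticoncentrated[OF assms] exp_ge_add_one_self[of "- 1 / (2 * X)"] by simp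
    show "0 \<le> wmass (X\<^sup>2)" using wmass_pos[of "X\<^sup>2"] by simp
  qed
  also have "\<dots> = exp (- n / (4 * X)) * exp (- n / (4 * X))"
    using X by (simp add: exp_of_nat_mult[symmetric] mult_exp_exp field_simps)
  finally show ?thesis by simp
qed

text \<open>With \<open>Y = (|g|/(X sqrt n))^p\<close> the maximum of \<open>1\<close> and \<open>Y\<close> is \<open>Y\<close> plus the positive part of \<open>1 - Y\<close>. Unless \<open>|g|\<close>
is less than a fixed power of \<open>1/X\<close> times \<open>sqrt n\<close>, the latter is at most \<open>4 p ln X\<close>; the exceptional event has probability
at most \<open>p\<close>.\<close>

lemma trunc_norm_moment:
  assumes X: "2 \<le> X" and c: "prob {x. \<bar>x\<bar> < 1 / X} \<le> 1 - 1 / X" and n: "1 \<le> n"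
    and p: "0 < p" "p \<le> 1" and q: "exp (- n / (4 * X)) \<le> p"
    and i: "integrable (gam n) (\<lambda>g. (sqrt (nsq n g) / (X * sqrt n)) powr p)"
    and m: "(\<integral>g. (sqrt (nsq n g) / (X * sqrt n)) powr p \<partial>gam n) \<le> 1"
  shows "integrable (gam n) (\<lambda>g. trunc_norm X n g powr p)"
    "(\<integral>g. trunc_norm X n g powr p \<partial>gam n) \<le> 1 + p * (4 * ln X + 1)"
proof -
  interpret g: prob_space "gam n" by (rule prob_gam)
  let ?E = "{g \<in> space (gam n). nsq n g \<le> n / (4 * X^3)}"
  let ?Y = "\<lambda>g. (sqrt (nsq n g) / (X * sqrt n)) powr p"
  have lnX: "0 \<le> ln X" using X by simp
  have pw: "trunc_norm X n g powr p \<le> ?Y g + (4 * p * ln X + indicator ?E g)" if g: "g \<in> space (gam n)" for g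
  proof (cases "sqrt (nsq n g) / (X * sqrt n) \<ge> 1")
    case True
    then have "trunc_norm X n g = sqrt (nsq n g) / (X * sqrt n)" by (simp add: trunc_norm_def max_def)
    then show ?thesis using p lnX by simp
  next
    case False
    then have t: "trunc_norm X n g = 1" by (simp add: trunc_norm_def)
    show ?thesis
    proof (cases "g \<in> ?E")
      case True then show ?thesis using t p lnX by simp
    next
      case F: False
      then have "n / (4 * X^3) \<le> nsq n g" using g by auto
      then have "sqrt (n / (4 * X^3)) \<le> sqrt (nsq n g)" by simp
      moreover have "X ^ 3 * 4 \<le> X ^ 6"
      proof -
        have "2 ^ 3 \<le> X ^ 3" using X by (intro power_mono) auto
        then have "X^3 * 4 \<le> X^3 * X^3" using X by (intro mult_left_mono) auto
        then show ?thesis by (simp add: power_add[symmetric])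
      qed
      then have "sqrt (n / X ^ 6) \<le> sqrt (n / (4 * X^3))"
        using X by (intro real_sqrt_le_mono divide_left_mono) auto
      moreover have "sqrt (n / X ^ 6) = sqrt n / X ^ 3"
        using X real_sqrt_abs[of "X^3"] by (simp add: real_sqrt_divide power_mult[symmetric])
      ultimately have "sqrt n / X^3 \<le> sqrt (nsq n g)" by linarith
      then have "(sqrt n / X^3) / (X * sqrt n) \<le> sqrt (nsq n g) / (X * sqrt n)"
        using X by (intro divide_right_mono) auto
      moreover have "(sqrt n / X^3) / (X * sqrt n) = X powr (-4)"
        using X n by (simp add: powr_minus powr_numeral field_simps power_Suc[symmetric] eval_nat_numeral)
      ultimately have "(X powr (-4)) powr p \<le> ?Y g" using p by (intro powr_mono2) auto
      moreover have "(X powr (-4)) powr p = exp (- (4 * p * ln X))"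
        using X by (simp add: powr_powr powr_def mult_ac)
      moreover have "1 - 4 * p * ln X \<le> exp (- (4 * p * ln X))"
        using exp_ge_add_one_self[of "- (4 * p * ln X)"] by simp
      ultimately have "1 \<le> ?Y g + 4 * p * ln X" by linarith
      then show ?thesis using t F by simp
    qed
  qed
  have i2: "integrable (gam n) (\<lambda>g. ?Y g + (4 * p * ln X + indicator ?E g))"
    by (intro Bochner_Integration.integrable_add i g.integrable_const_bound[of _ "4 * p * ln X + 1"])
       (use p lnX in \<open>auto simp: indicator_def\<close>)
  show 1: "integrable (gam n) (\<lambda>g. trunc_norm X n g powr p)"
  proof (rule Bochner_Integration.integrable_bound[OF i2])
    show "AE g in gam n. norm (trunc_norm X n g powr p) \<le> norm (?Y g + (4 * p * ln X + indicator ?E g))"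
      using pw p lnX by (intro AE_I2) force
  qed measurable
  have "(\<integral>g. trunc_norm X n g powr p \<partial>gam n) \<le> (\<integral>g. ?Y g + (4 * p * ln X + indicator ?E g) \<partial>gam n)"
    by (intro integral_mono_AE 1 i2) (use pw in auto)
  also have "\<dots> = (\<integral>g. ?Y g \<partial>gam n) + (\<integral>g. 4 * p * ln X + indicator ?E g \<partial>gam n)"
    by (intro Bochner_Integration.integral_add i g.integrable_const_bound[of _ "4 * p * ln X + 1"])
       (use p lnX in \<open>auto simp: indicator_def\<close>)
  also have "(\<integral>g. 4 * p * ln X + indicator ?E g \<partial>gam n) = 4 * p * ln X + measure (gam n) ?E"
    by (subst Bochner_Integration.integral_add)
       (auto simp: g.prob_space[unfolded] intro!: g.integrable_const_bound[of _ 1] simp: indicator_def)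
  also have "(\<integral>g. ?Y g \<partial>gam n) + (4 * p * ln X + measure (gam n) ?E) \<le> 1 + (4 * p * ln X + p)"
    using m small_norm_prob[OF X c, of n] q by (intro add_mono) auto
  finally show "(\<integral>g. trunc_norm X n g powr p \<partial>gam n) \<le> 1 + p * (4 * ln X + 1)" by (simp add: algebra_simps)
qed

lemma ln_ge_two_thirds: assumes "2 \<le> X" shows "2 \<le> 3 * ln (X::real)"
proof -
  have "exp 2 \<le> (8::real)"
  proof -
    have "exp 1 \<le> (2.8::real)" using e_less_272 by simp
    then have "exp 1 * exp 1 \<le> (2.8 * 2.8 :: real)" by (intro mult_mono) auto
    then show ?thesis by (simp add: mult_exp_exp)
  qed
  also have "8 \<le> X ^ 3" using power_mono[of 2 X 3] assms by simp
  finally have "ln (exp 2) \<le> ln (X ^ 3)" using assms by (subst ln_le_cancel_iff) auto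
  then show ?thesis using assms by (simp add: ln_realpow)
qed

abbreviation gams :: "'i set \<Rightarrow> nat \<Rightarrow> ('i \<Rightarrow> nat \<Rightarrow> real) measure" where
  "gams J n \<equiv> PiM J (\<lambda>_. gam n)"

lemma prob_gams: "prob_space (gams J n)" by (rule prob_space_PiM) (rule prob_gam)

lemma integral_gams_prod:
  fixes f :: "(nat \<Rightarrow> real) \<Rightarrow> real"
  assumes "finite J" "integrable (gam n) f"
  shows "(\<integral>A. (\<Prod>i\<in>J. f (A i)) \<partial>gams J n) = (\<integral>g. f g \<partial>gam n) ^ card J"
    "integrable (gams J n) (\<lambda>A. \<Prod>i\<in>J. f (A i))"
proof -
  interpret product_sigma_finite "\<lambda>_::'a. gam n"
    by (rule product_sigma_finite.intro) (rule prob_space_imp_sigma_finite[OF prob_gam])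
  show "(\<integral>A. (\<Prod>i\<in>J. f (A i)) \<partial>gams J n) = (\<integral>g. f g \<partial>gam n) ^ card J"
    using product_integral_prod[of J "\<lambda>_. f"] assms by simp
  show "integrable (gams J n) (\<lambda>A. \<Prod>i\<in>J. f (A i))"
    using product_integrable_prod[of J "\<lambda>_. f"] assms by simp
qed

lemma meas_gams_coord: "i \<in> J \<Longrightarrow> (\<lambda>A. A i) \<in> gams J n \<rightarrow>\<^sub>M gam n"
  by (rule measurable_component_singleton)

lemma markov_gams:
  fixes f :: "(nat \<Rightarrow> real) \<Rightarrow> real"
  assumes J: "finite J" and f: "integrable (gam n) f" and E: "E \<in> sets (gams J n)" and b: "0 < b"
    and ge: "\<And>A. A \<in> E \<Longrightarrow> b \<le> (\<Prod>i\<in>J. f (A i))" and f0: "\<And>g. 0 \<le> f g"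
  shows "measure (gams J n) E \<le> (\<integral>g. f g \<partial>gam n) ^ card J / b"
proof -
  interpret G: prob_space "gams J n" by (rule prob_gams)
  have "b * measure (gams J n) E = (\<integral>A. b * indicator E A \<partial>gams J n)"
    using E by simp
  also have "\<dots> \<le> (\<integral>A. (\<Prod>i\<in>J. f (A i)) \<partial>gams J n)"
  proof (intro integral_mono integral_gams_prod(2) J f)
    show "integrable (gams J n) (\<lambda>A. b * indicator E A)"
      by (intro integrable_mult_right G.integrable_const_bound[of _ 1]) (use E in auto)
    fix A show "b * indicator E A \<le> (\<Prod>i\<in>J. f (A i))"
      using ge[of A] f0 by (cases "A \<in> E") (auto intro: prod_nonneg)
  qed
  finally show ?thesis using b integral_gams_prod(1)[OF J f] by (simp add: field_simps)
qed

text \<open>Markov's inequality for the \<open>p\<close>-th power of the product. The exponent \<open>p (4 ln X + 1)\<close> from the moment and the exponent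
\<open>7 p ln X\<close> from the threshold are both proportional to \<open>p\<close>, which makes the threshold independent of \<open>p\<close>.\<close>

lemma trunc_norm_product_tail:
  assumes X: "2 \<le> X" and c: "prob {x. \<bar>x\<bar> < 1 / X} \<le> 1 - 1 / X" and n: "1 \<le> n"
    and p: "0 < p" "p \<le> 1" and q: "exp (- n / (4 * X)) \<le> p"
    and i: "integrable (gam n) (\<lambda>g. (sqrt (nsq n g) / (X * sqrt n)) powr p)"
    and m: "(\<integral>g. (sqrt (nsq n g) / (X * sqrt n)) powr p \<partial>gam n) \<le> 1"
    and J: "finite J" "card J \<le> n"
  shows "{A \<in> space (gams J n). (X ^ 7) ^ n < (\<Prod>i\<in>J. trunc_norm X n (A i))} \<in> sets (gams J n)" (is "?E \<in> _")
    "measure (gams J n) {A \<in> space (gams J n). (X ^ 7) ^ n < (\<Prod>i\<in>J. trunc_norm X n (A i))} \<le> exp (- p * n)"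
proof -
  have "(\<lambda>A. \<Prod>i\<in>J. trunc_norm X n (A i)) \<in> borel_measurable (gams J n)"
    by (intro borel_measurable_prod measurable_compose[OF meas_gams_coord meas_trunc]) auto
  then show E: "?E \<in> sets (gams J n)" by measurable
  note tm = trunc_norm_moment[OF X c n p q i m]
  let ?b = "((X ^ 7) ^ n) powr p"
  have "measure (gams J n) ?E \<le> (\<integral>g. trunc_norm X n g powr p \<partial>gam n) ^ card J / ?b"
  proof (rule markov_gams[OF J(1) tm(1) E])
    show "0 < ?b" using X by simp
    fix A assume "A \<in> ?E"
    then have "?b \<le> (\<Prod>i\<in>J. trunc_norm X n (A i)) powr p" using X p by (intro powr_mono2) auto
    also have "\<dots> = (\<Prod>i\<in>J. trunc_norm X n (A i) powr p)"
      by (rule prod_powr_distrib)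
    finally show "?b \<le> (\<Prod>i\<in>J. trunc_norm X n (A i) powr p)" .
  qed auto
  also have "(\<integral>g. trunc_norm X n g powr p \<partial>gam n) ^ card J \<le> exp (p * (4 * ln X + 1)) ^ card J"
  proof (rule power_mono)
    show "(\<integral>g. trunc_norm X n g powr p \<partial>gam n) \<le> exp (p * (4 * ln X + 1))"
      using tm(2) exp_ge_add_one_self[of "p * (4 * ln X + 1)"] by linarith
  qed (auto intro: integral_nonneg_AE)
  also have "\<dots> \<le> exp (p * (4 * ln X + 1)) ^ n"
    using J p X by (intro power_increasing) auto
  also have "exp (p * (4 * ln X + 1)) ^ n / ?b = exp (n * p * (4 * ln X + 1) - 7 * n * p * ln X)"
    using X by (simp add: exp_of_nat_mult[symmetric] powr_def exp_diff ln_realpow power_mult[symmetric] mult_ac)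
  also have "\<dots> \<le> exp (- p * n)"
  proof -
    have "n * p * 2 \<le> n * p * (3 * ln X)" using ln_ge_two_thirds[OF X] p by (intro mult_left_mono) auto
    then show ?thesis by (simp add: algebra_simps)
  qed
  finally show "measure (gams J n) ?E \<le> exp (- p * n)"
    using X by (simp add: divide_right_mono)
qed

text \<open>The inequality \<open>y powr p - 1 \<ge> p * ln y\<close> turns the moment of order \<open>p\<close> into a logarithmic moment that does not
depend on \<open>p\<close>. Therefore a quarter of the mass is reached at a scale \<open>X^23\<close> that does not degenerate as \<open>p\<close> tends to
zero.\<close>

lemma norm_tail:
  assumes X: "2 \<le> X" and c: "prob {x. \<bar>x\<bar> < 1 / X} \<le> 1 - 1 / X" and n: "1 \<le> n"
    and p: "0 < p" "p \<le> 1" and q: "exp (- n / (4 * X)) \<le> p"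
    and i: "integrable (gam n) (\<lambda>g. (sqrt (nsq n g) / (X * sqrt n)) powr p)"
    and m: "(\<integral>g. (sqrt (nsq n g) / (X * sqrt n)) powr p \<partial>gam n) \<le> 1"
  shows "measure (gam n) {g \<in> space (gam n). X ^ 23 * sqrt n < sqrt (nsq n g)} \<le> 1/4" (is "measure _ ?E \<le> _")
proof -
  interpret g: prob_space "gam n" by (rule prob_gam)
  note tm = trunc_norm_moment[OF X c n p q i m]
  define La where "La = 4 * ln X + 1"
  have La: "0 < La" using X by (simp add: La_def add_nonneg_pos)
  have "4 * p * La * measure (gam n) ?E = (\<integral>g. 4 * p * La * indicator ?E g \<partial>gam n)" by simp
  also have "\<dots> \<le> (\<integral>g. trunc_norm X n g powr p - 1 \<partial>gam n)"
  proof (intro integral_mono Bochner_Integration.integrable_diff tm)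
    show "integrable (gam n) (\<lambda>g. 4 * p * La * indicator ?E g)"
      by (intro integrable_mult_right g.integrable_const_bound[of _ 1]) auto
    fix g
    show "4 * p * La * indicator ?E g \<le> trunc_norm X n g powr p - 1"
    proof (cases "g \<in> ?E")
      case True
      then have "X ^ 23 * sqrt n \<le> sqrt (nsq n g)" by auto
      then have "X ^ 22 \<le> sqrt (nsq n g) / (X * sqrt n)"
        using X n by (simp add: field_simps eval_nat_numeral)
      then have 1: "X ^ 22 \<le> trunc_norm X n g" by (simp add: trunc_norm_def)
      have "exp (4 * La) \<le> exp (22 * ln X)"
        using ln_ge_two_thirds[OF X] by (simp add: La_def)
      also have "22 * ln X = ln (X ^ 22)" using X by (simp add: ln_realpow)
      also have "exp (ln (X ^ 22)) = X ^ 22" using X by simp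
      finally have "exp (4 * La) powr p \<le> trunc_norm X n g powr p" using 1 p by (intro powr_mono2) auto
      moreover have "1 + 4 * La * p \<le> exp (4 * La) powr p"
        using exp_ge_add_one_self[of "4 * La * p"] by (simp add: powr_def mult_ac)
      ultimately show ?thesis using True by (simp add: mult_ac)
    next
      case False
      have "1 powr p \<le> trunc_norm X n g powr p" using trunc_norm_ge1[of X n g] p by (intro powr_mono2) auto
      then show ?thesis using False by simp
    qed
  qed simp
  also have "\<dots> = (\<integral>g. trunc_norm X n g powr p \<partial>gam n) - 1"
    using tm(1) g.prob_space by (subst Bochner_Integration.integral_diff) auto
  also have "\<dots> \<le> p * La" using tm(2) by (simp add: La_def)
  finally show ?thesis using p La by simp
qed

lemma wmass_from_tail:
  assumes t: "0 < t" "1 \<le> n" and le: "measure (gam n) {g \<in> space (gam n). t * sqrt n < sqrt (nsq n g)} \<le> 1/4"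
  shows "1/4 \<le> wmass (1 / (t\<^sup>2 * n)) ^ n"
proof -
  interpret g: prob_space "gam n" by (rule prob_gam)
  let ?E = "{g \<in> space (gam n). t * sqrt n < sqrt (nsq n g)}"
  let ?F = "{g \<in> space (gam n). \<not> t * sqrt n < sqrt (nsq n g)}"
  have "measure (gam n) ?F = 1 - measure (gam n) ?E"
    by (subst g.prob_compl[symmetric]) (auto intro!: arg_cong[where f="measure (gam n)"])
  then have F: "3/4 \<le> measure (gam n) ?F" using le by simp
  have "exp (-1) * (3/4) \<le> exp (-1) * measure (gam n) ?F" using F by simp
  also have "\<dots> = (\<integral>g. exp (-1) * indicator ?F g \<partial>gam n)" by simp
  also have "\<dots> \<le> (\<integral>g. exp (- (1 / (t\<^sup>2 * n)) * nsq n g) \<partial>gam n)"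
  proof (intro integral_mono)
    show "integrable (gam n) (\<lambda>g. exp (-1) * indicator ?F g)"
      by (intro integrable_mult_right g.integrable_const_bound[of _ 1]) (auto simp: indicator_def)
    show "integrable (gam n) (\<lambda>g. exp (- (1 / (t\<^sup>2 * n)) * nsq n g))"
      by (rule g.integrable_const_bound[of _ 1]) auto
    fix g
    show "exp (-1) * indicator ?F g \<le> exp (- (1 / (t\<^sup>2 * n)) * nsq n g)"
    proof (cases "g \<in> ?F")
      case True
      then have "(sqrt (nsq n g))\<^sup>2 \<le> (t * sqrt n)\<^sup>2" by (intro power_mono) auto
      then have "nsq n g \<le> t\<^sup>2 * n" by (simp add: power_mult_distrib)
      then have "nsq n g / (t\<^sup>2 * n) \<le> 1" using t by (simp add: field_simps)
      then show ?thesis using True by simp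
    qed auto
  qed
  also have "\<dots> = wmass (1 / (t\<^sup>2 * n)) ^ n" by (rule wmass_product) simp
  finally have "exp (-1) * (3/4) \<le> wmass (1 / (t\<^sup>2 * n)) ^ n" .
  moreover have "1/4 \<le> exp (-1) * (3/4 :: real)"
    using e_less_272 by (simp add: exp_minus field_simps)
  ultimately show ?thesis by linarith
qed

lemma wmass_ge:
  assumes m: "1/4 \<le> wmass l ^ n" and l: "0 \<le> l" and n: "1 \<le> n"
  shows "1 - wmass l \<le> 2 / n"
proof -
  have w: "0 < wmass l" by (rule wmass_pos[OF l])
  have "ln (1/4) \<le> ln (wmass l ^ n)" using m w by (subst ln_le_cancel_iff) auto
  then have "- ln 4 \<le> n * ln (wmass l)" using w by (simp add: ln_realpow ln_div)
  moreover have "ln (wmass l) \<le> wmass l - 1" using w by (rule ln_le_minus_one)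
  then have "n * ln (wmass l) \<le> n * (wmass l - 1)" by (intro mult_left_mono) auto
  moreover have "ln 4 \<le> (2::real)"
  proof -
    have "ln 4 = 2 * ln (2::real)" using ln_realpow[of 2 2] by simp
    then show ?thesis using ln_le_minus_one[of "2::real"] by simp
  qed
  ultimately have "n * (1 - wmass l) \<le> 2" by (simp add: algebra_simps)
  then show ?thesis using n by (simp add: field_simps)
qed

text \<open>If the entries were often larger than \<open>L\<close>, then the norm would exceed \<open>t sqrt n\<close> too often and the damped mass
would be less than \<open>1/4\<close>.\<close>

lemma entry_tail:
  assumes m: "1/4 \<le> wmass (1 / (t\<^sup>2 * n)) ^ n" and t: "0 < t" and n: "1 \<le> n"
    and L: "0 < L" "L\<^sup>2 \<le> t\<^sup>2 * n"
  shows "prob {x. L < \<bar>x\<bar>} \<le> 4 * t\<^sup>2 / L\<^sup>2"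
proof -
  define l where "l = 1 / (t\<^sup>2 * n)"
  have l: "0 \<le> l" by (simp add: l_def)
  define y where "y = l * L\<^sup>2"
  have y: "0 < y" "y \<le> 1" using L t n by (auto simp: y_def l_def field_simps)
  let ?E = "{x. L < \<bar>x\<bar>}"
  have e: "y / 2 \<le> 1 - exp (- y)"
  proof -
    have "1 + y \<le> exp y" by (rule exp_ge_add_one_self)
    then have "exp (- y) \<le> 1 / (1 + y)" using y by (simp add: exp_minus field_simps)
    moreover have "1 / (1 + y) \<le> 1 - y / 2" using y by (simp add: field_simps)
    ultimately show ?thesis by linarith
  qed
  have "(y / 2) * prob ?E = (\<integral>x. (y / 2) * indicator ?E x \<partial>\<mu>)" by simp
  also have "\<dots> \<le> (\<integral>x. 1 - exp (- l * x\<^sup>2) \<partial>\<mu>)"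
  proof (intro integral_mono)
    show "integrable \<mu> (\<lambda>x. (y / 2) * indicator ?E x)"
      by (intro integrable_mult_right integrable_bdd[of _ 1]) auto
    show "integrable \<mu> (\<lambda>x. 1 - exp (- l * x\<^sup>2))"
      by (rule integrable_bdd[of _ 1]) (use l in auto)
    fix x :: real
    show "(y / 2) * indicator ?E x \<le> 1 - exp (- l * x\<^sup>2)"
    proof (cases "x \<in> ?E")
      case True
      then have "L\<^sup>2 \<le> x\<^sup>2" using L by (simp add: abs_le_square_iff[symmetric])
      then have "y \<le> l * x\<^sup>2" unfolding y_def using l by (intro mult_left_mono)
      then have "exp (- l * x\<^sup>2) \<le> exp (- y)" by simp
      then have "y / 2 \<le> 1 - exp (- l * x\<^sup>2)" using e by linarith
      then show ?thesis using True by simp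
    next
      case False then show ?thesis using l by simp
    qed
  qed
  also have "\<dots> = 1 - wmass l"
    unfolding wmass_def by (subst Bochner_Integration.integral_diff) (auto intro!: integrable_bdd[of _ 1] simp: l)
  also have "\<dots> \<le> 2 / n" using m l n by (intro wmass_ge) (auto simp: l_def)
  finally show ?thesis using y L t n unfolding y_def l_def by (simp add: field_simps)
qed

lemma defect_small:
  assumes m: "1/4 \<le> wmass (1 / (t\<^sup>2 * n)) ^ n" and t: "0 < t" and n: "1 \<le> n"
    and tau: "0 < tau" "32 / tau \<le> n" and s: "\<bar>s\<bar> \<le> tau / (16 * t)"
  shows "defect 0 s \<le> tau"
proof -
  define L where "L = t * sqrt (32 / tau)"
  have L: "0 < L" "L\<^sup>2 = t\<^sup>2 * (32 / tau)" using t tau by (auto simp: L_def power_mult_distrib)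
  have "prob {x. L < \<bar>x\<bar>} \<le> 4 * t\<^sup>2 / L\<^sup>2"
    using L mult_left_mono[OF tau(2), of "t\<^sup>2"] by (intro entry_tail[OF m t n]) auto
  also have "\<dots> = tau / 8" using t tau unfolding L(2) by simp
  finally have 1: "4 * prob {x. L < \<bar>x\<bar>} \<le> tau / 2" by simp
  have "s\<^sup>2 \<le> (tau / (16 * t))\<^sup>2" using s by (metis abs_ge_zero power2_abs power_mono)
  then have "2 * s\<^sup>2 * L\<^sup>2 \<le> 2 * (tau / (16 * t))\<^sup>2 * L\<^sup>2" by (intro mult_right_mono) auto
  also have "\<dots> = tau / 4" using t tau unfolding L(2) by (simp add: power2_eq_square field_simps)
  finally show ?thesis using 1 defect_upper[of L s] L tau by linarith
qed

text \<open>Two independent entries differ by at least \<open>1/X\<close> and are bounded by \<open>4 t X\<close> with a probability that is polynomial in \<open>1/X\<close>;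
apply \<open>defect_lower\<close>.\<close>

lemma defect_large:
  assumes m: "1/4 \<le> wmass (1 / (t\<^sup>2 * n)) ^ n" and t: "0 < t" and X: "2 \<le> X" and n: "64 * X\<^sup>2 \<le> n"
    and c: "\<And>z. prob {x. \<bar>x - z\<bar> < 1 / X} \<le> 1 - 1 / X"
    and l: "0 \<le> l" "l \<le> 1 / (t\<^sup>2 * n)" and s: "\<bar>s\<bar> \<le> 1 / (8 * t * X)"
  shows "s\<^sup>2 / X ^ 7 \<le> defect l s"
proof -
  define L where "L = 4 * t * X"
  have L: "0 < L" using t X by (simp add: L_def)
  have n1: "1 \<le> n"
  proof (cases n)
    case 0 then show ?thesis using n X by auto
  qed simp
  have L2: "L\<^sup>2 = 16 * X\<^sup>2 * t\<^sup>2" by (simp add: L_def power_mult_distrib)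
  have L2n: "L\<^sup>2 \<le> t\<^sup>2 * n"
  proof -
    have "16 * X\<^sup>2 \<le> n" using n zero_le_power2[of X] by linarith
    then show ?thesis unfolding L2 using mult_left_mono[of "16 * X\<^sup>2" n "t\<^sup>2"] by (simp add: mult_ac)
  qed
  have "prob {x. L < \<bar>x\<bar>} \<le> 4 * t\<^sup>2 / L\<^sup>2" using L L2n by (intro entry_tail[OF m t n1])
  also have "\<dots> = 1 / (4 * X\<^sup>2)" unfolding L2 using t X by simp
  also have "\<dots> \<le> 1 / (4 * X)" using X by (intro divide_left_mono) (auto simp: power2_eq_square)
  finally have tail: "prob {x. L < \<bar>x\<bar>} \<le> 1 / (4 * X)" .
  let ?G = "{z. 1 / X \<le> \<bar>fst z - snd z\<bar> \<and> \<bar>fst z\<bar> \<le> L \<and> \<bar>snd z\<bar> \<le> L} :: (real \<times> real) set"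
  let ?B1 = "{z \<in> space mu2. \<bar>fst z - snd z\<bar> < 1 / X}"
  let ?B2 = "{z \<in> space mu2. L < \<bar>fst z\<bar>}"
  let ?B3 = "{z \<in> space mu2. L < \<bar>snd z\<bar>}"
  have s1: "?B1 \<in> sets mu2" "?B2 \<in> sets mu2" "?B3 \<in> sets mu2" by measurable
  have b1: "pp.P.prob ?B1 \<le> 1 - 1 / X"
  proof -
    have "emeasure mu2 ?B1 = (\<integral>\<^sup>+y. emeasure \<mu> ((\<lambda>x. (x, y)) -` ?B1) \<partial>\<mu>)"
      by (rule pp.emeasure_pair_measure_alt2[OF s1(1)])
    also have "\<dots> \<le> (\<integral>\<^sup>+y. ennreal (1 - 1 / X) \<partial>\<mu>)"
    proof (rule nn_integral_mono)
      fix y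
      have "(\<lambda>x. (x, y)) -` ?B1 = {x. \<bar>x - y\<bar> < 1 / X}" by (auto simp: space_pair_measure)
      then have "emeasure \<mu> ((\<lambda>x. (x, y)) -` ?B1) = ennreal (prob {x. \<bar>x - y\<bar> < 1 / X})"
        by (simp only: emeasure_eq_measure)
      then show "emeasure \<mu> ((\<lambda>x. (x, y)) -` ?B1) \<le> ennreal (1 - 1 / X)"
        using ennreal_leI[OF c[of y]] by simp
    qed
    also have "\<dots> = ennreal (1 - 1 / X)" using emeasure_space_1 by simp
    finally show ?thesis using X by (simp add: pp.P.emeasure_eq_measure)
  qed
  have b2: "pp.P.prob ?B2 \<le> 1 / (4 * X)"
  proof -
    have "?B2 = {x. L < \<bar>x\<bar>} \<times> space \<mu>" by (auto simp: space_pair_measure)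
    then have "emeasure mu2 ?B2 = emeasure \<mu> {x. L < \<bar>x\<bar>} * 1"
      using emeasure_pair_measure_Times[of "{x. L < \<bar>x\<bar>}" \<mu> "space \<mu>"] emeasure_space_1 by simp
    then show ?thesis using tail by (simp add: measure_def)
  qed
  have b3: "pp.P.prob ?B3 \<le> 1 / (4 * X)"
  proof -
    have "?B3 = space \<mu> \<times> {x. L < \<bar>x\<bar>}" by (auto simp: space_pair_measure)
    then have "emeasure mu2 ?B3 = 1 * emeasure \<mu> {x. L < \<bar>x\<bar>}"
      using emeasure_pair_measure_Times[of "space \<mu>" \<mu> "{x. L < \<bar>x\<bar>}"] emeasure_space_1 by simp
    then show ?thesis using tail by (simp add: measure_def)
  qed
  have "?G = space mu2 - (?B1 \<union> ?B2 \<union> ?B3)" by (auto simp: space_pair_measure not_less)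
  then have "pp.P.prob ?G = 1 - pp.P.prob (?B1 \<union> ?B2 \<union> ?B3)"
    using pp.P.prob_compl[of "?B1 \<union> ?B2 \<union> ?B3"] s1 by simp
  moreover have "pp.P.prob (?B1 \<union> ?B2 \<union> ?B3) \<le> pp.P.prob ?B1 + pp.P.prob ?B2 + pp.P.prob ?B3"
    using measure_Un_le[of "?B1 \<union> ?B2" mu2 ?B3] measure_Un_le[of ?B1 mu2 ?B2] s1 by auto
  moreover have "1 / X - 2 * (1 / (4 * X)) = 1 / (2 * X)" using X by (simp add: field_simps)
  ultimately have G: "1 / (2 * X) \<le> pp.P.prob ?G" using b1 b2 b3 by linarith
  have "2 * L * \<bar>s\<bar> \<le> 2 * L * (1 / (8 * t * X))" using s L by (intro mult_left_mono) auto
  also have "\<dots> = 1" using t X by (simp add: L_def)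
  finally have "1 / (2 * X) * exp (- 2 * l * L\<^sup>2) * (1 / X)\<^sup>2 / 4 * s\<^sup>2 \<le> defect l s"
    using X by (intro defect_lower[OF l(1) _ _ G]) auto
  moreover have "s\<^sup>2 / X ^ 7 \<le> 1 / (2 * X) * exp (- 2 * l * L\<^sup>2) * (1 / X)\<^sup>2 / 4 * s\<^sup>2"
  proof -
    have "l * L\<^sup>2 \<le> 1 / (t\<^sup>2 * n) * (16 * X\<^sup>2 * t\<^sup>2)" unfolding L2 using l by (intro mult_right_mono) auto
    also have "\<dots> \<le> 1 / 4" using n t X n1 by (simp add: field_simps)
    finally have "exp (- (1/2)) \<le> exp (- 2 * l * L\<^sup>2)" by simp
    moreover have "1/2 \<le> exp (- (1/2) :: real)" using exp_ge_add_one_self[of "-(1/2)::real"] by simp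
    ultimately have e: "1/2 \<le> exp (- 2 * l * L\<^sup>2)" by linarith
    have "2 ^ 4 * X ^ 3 \<le> X ^ 4 * X ^ 3" using X by (intro mult_right_mono power_mono) auto
    then have "1 / X ^ 7 \<le> 1 / (16 * X ^ 3)" using X by (intro divide_left_mono) (auto simp: power_add[symmetric])
    also have "\<dots> = 1 / (2 * X) * (1/2) * (1 / X)\<^sup>2 / 4" using X by (simp add: power2_eq_square power3_eq_cube)
    also have "\<dots> \<le> 1 / (2 * X) * exp (- 2 * l * L\<^sup>2) * (1 / X)\<^sup>2 / 4"
      using e X by (intro divide_right_mono mult_right_mono mult_left_mono) auto
    finally have "1 / X ^ 7 * s\<^sup>2 \<le> 1 / (2 * X) * exp (- 2 * l * L\<^sup>2) * (1 / X)\<^sup>2 / 4 * s\<^sup>2"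
      by (intro mult_right_mono) auto
    then show ?thesis by simp
  qed
  ultimately show ?thesis by linarith
qed

end

section \<open>Vectors with few large coordinates\<close>

lemma ip_commute: "ip n x y = ip n y x"
  by (simp add: ip_def mult.commute)

lemma ip_add_right: "ip n x (\<lambda>j. y j + z j) = ip n x y + ip n x z"
  by (simp add: ip_def distrib_left sum.distrib)

lemma exp_sum_nat_le: assumes "0 < s" shows "(\<Sum>k=1..N. exp (- s * real k)) \<le> 1 / s"
proof -
  define r where "r = exp (- s)"
  have r: "0 < r" "r < 1" using assms by (auto simp: r_def)
  have "exp (- s * real k) = r ^ k" for k by (simp add: r_def exp_of_nat_mult[symmetric] mult.commute)
  then have "(\<Sum>k=1..N. exp (- s * real k)) = (\<Sum>k=1..N. r ^ k)" by simp
  also have "\<dots> = r * (\<Sum>k<N. r ^ k)"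
    unfolding sum_distrib_left power_Suc[symmetric]
    by (rule sum.reindex_bij_witness[of _ Suc "\<lambda>k. k - 1"]) auto
  also have "\<dots> = r * ((1 - r ^ N) / (1 - r))"
    using r by (subst geometric_sum) (auto simp: minus_divide_divide[of "1 - r ^ N" "1 - r", symmetric])
  also have "\<dots> \<le> r * (1 / (1 - r))"
    using r by (intro mult_left_mono divide_right_mono) auto
  also have "\<dots> = 1 / (exp s - 1)"
  proof -
    have "exp s * r = 1" by (simp add: r_def mult_exp_exp)
    moreover have "1 < exp s" using assms by simp
    ultimately show ?thesis using r by (simp add: field_simps)
  qed
  also have "\<dots> \<le> 1 / s"
  proof -
    have "s \<le> exp s - 1" using exp_ge_add_one_self[of s] by linarith
    then show ?thesis using assms by (intro divide_left_mono mult_pos_pos) linarith+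
  qed
  finally show ?thesis .
qed

lemma sum_int_even:
  fixes f :: "int \<Rightarrow> real"
  assumes "\<And>k. f (- k) = f k"
  shows "(\<Sum>k\<in>{- int N..int N}. f k) = f 0 + 2 * (\<Sum>k=1..N. f (int k))"
proof (induction N)
  case (Suc N)
  have "{- int (Suc N)..int (Suc N)} = insert (int (Suc N)) (insert (- int (Suc N)) {- int N..int N})"
    by auto
  then have "(\<Sum>k\<in>{- int (Suc N)..int (Suc N)}. f k) = f (int (Suc N)) + (f (- int (Suc N)) + (\<Sum>k\<in>{- int N..int N}. f k))"
    by (simp only:) (subst sum.insert; (subst sum.insert)?; auto)
  then show ?case using Suc assms[of "int (Suc N)"] by simp
qed simp

lemma exp_minus_le_chord: "0 \<le> y \<Longrightarrow> y \<le> 1 \<Longrightarrow> exp (- y) \<le> 1 - y / (2::real)"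
proof -
  assume y: "0 \<le> y" "y \<le> 1"
  have "1 + y \<le> exp y" by (rule exp_ge_add_one_self)
  then have "exp (- y) \<le> 1 / (1 + y)" using y by (simp add: exp_minus field_simps)
  moreover have "1 \<le> (1 - y / 2) * (1 + y)" using y mult_left_le[of y y] by (simp add: field_simps)
  then have "1 / (1 + y) \<le> 1 - y / 2" using y by (simp add: pos_divide_le_eq)
  ultimately show ?thesis by linarith
qed

text \<open>The defect is bounded below by a parabola near the origin, also after damping at the scale \<open>t\<close> of the normalised row
norm, and a quarter of the mass survives the damping.\<close>

locale flat_entry = entry_law \<mu> for \<mu> +
  fixes n :: nat and al ell t :: real
  assumes n1: "1 \<le> n" and al: "0 < al" "al \<le> 1" and ell: "0 < ell" "ell \<le> 1" and t: "1 \<le> t"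
    and low: "\<And>s. \<bar>s\<bar> \<le> ell \<Longrightarrow> al * s\<^sup>2 \<le> defect 0 s"
    and loww: "\<And>s. \<bar>s\<bar> \<le> ell \<Longrightarrow> al * s\<^sup>2 \<le> defect (1 / (t\<^sup>2 * n)) s"
    and mass: "1/4 \<le> wmass (1 / (t\<^sup>2 * n)) ^ n"
begin

definition wt :: "(nat \<Rightarrow> real) \<Rightarrow> real" where "wt g = exp (- (1 / (t\<^sup>2 * n)) * nsq n g)"

definition c1 where "c1 = al * ell\<^sup>2 / 256"
definition eta where "eta = al / (64 * t)"
definition beta where "beta = eta * (c1 / 512)\<^sup>2"
definition rho where "rho = beta * eta / 2"

lemma c1: "0 < c1" "c1 \<le> 1/256"
proof -
  show "0 < c1" using al ell by (simp add: c1_def)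
  have "al * ell\<^sup>2 \<le> 1 * 1\<^sup>2" using al ell by (intro mult_mono power_mono) auto
  then show "c1 \<le> 1/256" by (simp add: c1_def)
qed

lemma eta: "0 < eta" "eta \<le> 1/64"
proof -
  show "0 < eta" using al t by (simp add: eta_def)
  show "eta \<le> 1/64" using al t by (simp add: eta_def divide_simps)
qed

lemma beta: "0 < beta" "beta \<le> c1 / 384" "beta \<le> 1" "8 * beta / (eta * (c1/512)) = c1 / 64"
proof -
  show b: "0 < beta" using eta c1 by (simp add: beta_def)
  have "beta \<le> 1 * (c1 / 512)\<^sup>2" unfolding beta_def using eta by (intro mult_right_mono) auto
  also have "\<dots> = c1 * (c1 / (512 * 512))" by (simp add: power2_eq_square)
  also have "\<dots> \<le> c1 * (1 / 384)" using c1 by (intro mult_left_mono) auto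
  finally show "beta \<le> c1 / 384" by simp
  then show "beta \<le> 1" using c1 by simp
  show "8 * beta / (eta * (c1/512)) = c1 / 64" using eta c1 by (simp add: beta_def power2_eq_square)
qed

lemma rho: "0 < rho" "rho \<le> eta / 2"
proof -
  show "0 < rho" using beta eta by (simp add: rho_def)
  show "rho \<le> eta / 2" unfolding rho_def using beta eta by (simp add: mult_right_le_one_le mult_left_le_one_le)
qed

lemma la_pos: "0 \<le> 1 / (t\<^sup>2 * n)" by simp

lemma wt_bounds: "0 < wt g" "wt g \<le> 1"
  using t by (auto simp: wt_def divide_nonneg_nonneg)

lemma meas_wt [measurable]: "wt \<in> borel_measurable (gam n)"
  unfolding wt_def by measurable

lemma wt_nsq: "wt g * nsq n g \<le> t\<^sup>2 * n"
proof -
  define y where "y = nsq n g / (t\<^sup>2 * n)"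
  have "y \<le> exp y" using exp_ge_add_one_self[of y] by linarith
  then have "exp (- y) * y \<le> 1" by (simp add: exp_minus field_simps)
  moreover have "wt g = exp (- y)" by (simp add: wt_def y_def)
  moreover have "nsq n g = y * (t\<^sup>2 * n)" using t n1 by (simp add: y_def)
  ultimately show ?thesis using mult_right_mono[of "exp (- y) * y" 1 "t\<^sup>2 * n"] by (simp add: mult_ac)
qed

text \<open>The damped expectation of the cosine is a product of values of \<open>wchar\<close>, each of which falls short of \<open>wmass\<close> by a term quadratic
in the coordinate of \<open>x\<close>.\<close>

lemma weighted_anticoncentration:
  assumes x: "1/4 \<le> nsq n x" "nsq n x \<le> 4"
  shows "c1 \<le> (\<integral>g. wt g * (1 - cos (ell / 2 * ip n x g)) \<partial>gam n)"
proof -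
  interpret g: prob_space "gam n" by (rule prob_gam)
  let ?l = "1 / (t\<^sup>2 * n)"
  have xj: "\<bar>x j\<bar> \<le> 2" if "j < n" for j
  proof -
    have "(x j)\<^sup>2 \<le> nsq n x" unfolding nsq_def using that by (intro member_le_sum) auto
    then have "(x j)\<^sup>2 \<le> 2\<^sup>2" using x by simp
    then show ?thesis using abs_le_square_iff[of "x j" 2] by simp
  qed
  have i1: "integrable (gam n) (\<lambda>g. complex_of_real (wt g) * cis (ell / 2 * ip n x g))"
    by (rule g.integrable_const_bound[of _ 1]) (use wt_bounds in \<open>auto simp: norm_mult less_imp_le\<close>)
  have i2: "integrable (gam n) wt"
    by (rule g.integrable_const_bound[of _ 1]) (use wt_bounds in \<open>auto simp: less_imp_le\<close>)
  have i3: "integrable (gam n) (\<lambda>g. wt g * cos (ell / 2 * ip n x g))"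
    using integrable_Re[OF i1] by simp
  have "(\<integral>g. wt g * cos (ell / 2 * ip n x g) \<partial>gam n) = Re (\<integral>g. complex_of_real (wt g) * cis (ell / 2 * ip n x g) \<partial>gam n)"
    using integral_Re[OF i1] by simp
  also have "\<dots> \<le> cmod (\<integral>g. complex_of_real (wt g) * cis (ell / 2 * ip n x g) \<partial>gam n)"
    by (rule complex_Re_le_cmod)
  also have "\<dots> \<le> wmass ?l ^ n * exp (- (\<Sum>j<n. defect ?l (ell / 2 * x j)) / 2)"
    using wchar_product_bound[OF la_pos, of n "ell / 2" x] by (simp add: wt_def)
  also have "\<dots> \<le> wmass ?l ^ n * exp (- (al * ell\<^sup>2 / 32))"
  proof -
    have "al * ell\<^sup>2 / 16 \<le> al * (ell\<^sup>2 / 4) * nsq n x"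
      using x al ell by (simp add: mult_left_mono[of "1/4" "nsq n x" "al * (ell\<^sup>2 / 4)", simplified])
    also have "\<dots> = (\<Sum>j<n. al * (ell / 2 * x j)\<^sup>2)"
      unfolding nsq_def sum_distrib_left by (intro sum.cong refl) (simp add: power2_eq_square)
    also have "\<dots> \<le> (\<Sum>j<n. defect ?l (ell / 2 * x j))"
    proof (intro sum_mono loww)
      fix j assume "j \<in> {..<n}"
      then have "ell / 2 * \<bar>x j\<bar> \<le> ell / 2 * 2" using xj ell by (intro mult_left_mono) auto
      then show "\<bar>ell / 2 * x j\<bar> \<le> ell" using ell by (simp add: abs_mult)
    qed
    finally have "exp (- (\<Sum>j<n. defect ?l (ell / 2 * x j)) / 2) \<le> exp (- (al * ell\<^sup>2 / 32))" by simp
    then show ?thesis using wmass_pos[OF la_pos] by (intro mult_left_mono) auto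
  qed
  finally have c: "(\<integral>g. wt g * cos (ell / 2 * ip n x g) \<partial>gam n) \<le> wmass ?l ^ n * exp (- (al * ell\<^sup>2 / 32))" .
  have "(\<integral>g. wt g * (1 - cos (ell / 2 * ip n x g)) \<partial>gam n) = (\<integral>g. wt g - wt g * cos (ell / 2 * ip n x g) \<partial>gam n)"
    by (simp add: right_diff_distrib)
  also have "\<dots> = wmass ?l ^ n - (\<integral>g. wt g * cos (ell / 2 * ip n x g) \<partial>gam n)"
  proof -
    have "(\<integral>g. wt g \<partial>gam n) = wmass ?l ^ n"
      using wmass_product[OF la_pos, of n] unfolding wt_def .
    then show ?thesis using Bochner_Integration.integral_diff[OF i2 i3] by simp
  qed
  finally have e: "wmass ?l ^ n * (1 - exp (- (al * ell\<^sup>2 / 32))) \<le> (\<integral>g. wt g * (1 - cos (ell / 2 * ip n x g)) \<partial>gam n)"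
    using c by (simp add: right_diff_distrib)
  define y where "y = al * ell\<^sup>2 / 32"
  have y: "0 < y" "y \<le> 1" "y = 8 * c1" using c1 by (auto simp: y_def c1_def)
  have "y / 2 \<le> 1 - exp (- y)" using exp_minus_le_chord[of y] y by simp
  then have "1/4 * (y/2) \<le> wmass ?l ^ n * (1 - exp (- y))"
    using mass y by (intro mult_mono) auto
  then show ?thesis using e y unfolding y_def[symmetric] by linarith
qed

text \<open>Exponential Markov inequality over the independent rows, with \<open>1 - cos u \<le> u\<^sup>2/2\<close>.\<close>

lemma weighted_product_prob:
  assumes x: "1/4 \<le> nsq n x" "nsq n x \<le> 4" and J: "finite J" "n \<le> 2 * card J"
  shows "{A \<in> space (gams J n). (\<Sum>i\<in>J. wt (A i) * (ip n x (A i))\<^sup>2) \<le> al / 256 * n} \<in> sets (gams J n)" (is "?E \<in> _")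
    "measure (gams J n) {A \<in> space (gams J n). (\<Sum>i\<in>J. wt (A i) * (ip n x (A i))\<^sup>2) \<le> al / 256 * n} \<le> exp (- c1 * n / 16)"
proof -
  interpret g: prob_space "gam n" by (rule prob_gam)
  have "(\<lambda>A. \<Sum>i\<in>J. wt (A i) * (ip n x (A i))\<^sup>2) \<in> borel_measurable (gams J n)"
    by (intro borel_measurable_sum borel_measurable_times borel_measurable_power
        measurable_compose[OF meas_gams_coord meas_wt] measurable_compose[OF meas_gams_coord meas_ip])
  then show E: "?E \<in> sets (gams J n)" by measurable
  let ?d = "\<lambda>g. wt g * (1 - cos (ell / 2 * ip n x g))"
  let ?f = "\<lambda>g. exp (- (?d g / 2))"
  have d: "0 \<le> ?d g" "?d g \<le> 2" for g
  proof -
    have c: "0 \<le> 1 - cos (ell / 2 * ip n x g)" "1 - cos (ell / 2 * ip n x g) \<le> 2"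
      using cos_ge_minus_one[of "ell / 2 * ip n x g"] by auto
    then show "0 \<le> ?d g" using wt_bounds[of g] by auto
    have "?d g \<le> 1 * 2" using c wt_bounds[of g] by (intro mult_mono) auto
    then show "?d g \<le> 2" by simp
  qed
  have fi: "integrable (gam n) ?f"
    by (rule g.integrable_const_bound[of _ 1]) (use d in auto)
  have di: "integrable (gam n) ?d"
    by (rule g.integrable_const_bound[of _ 2]) (use d in auto)
  have "(\<integral>g. ?f g \<partial>gam n) \<le> (\<integral>g. 1 - ?d g / 4 \<partial>gam n)"
  proof (intro integral_mono fi)
    show "integrable (gam n) (\<lambda>g. 1 - ?d g / 4)" using di by auto
    show "?f g \<le> 1 - ?d g / 4" for g using exp_minus_le_chord[of "?d g / 2"] d[of g] by simp
  qed
  also have "\<dots> = 1 - (\<integral>g. ?d g \<partial>gam n) / 4"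
    using di g.prob_space by (subst Bochner_Integration.integral_diff) auto
  also have "\<dots> \<le> 1 - c1 / 4" using weighted_anticoncentration[OF x] by simp
  also have "\<dots> \<le> exp (- c1 / 4)" using exp_ge_add_one_self[of "- c1 / 4"] by simp
  finally have f: "(\<integral>g. ?f g \<partial>gam n) \<le> exp (- c1 / 4)" .
  have "measure (gams J n) ?E \<le> (\<integral>g. ?f g \<partial>gam n) ^ card J / exp (- c1 * n / 16)"
  proof (rule markov_gams[OF J(1) fi E])
    fix A assume "A \<in> ?E"
    then have le: "(\<Sum>i\<in>J. wt (A i) * (ip n x (A i))\<^sup>2) \<le> al / 256 * n" by auto
    have "(\<Sum>i\<in>J. ?d (A i) / 2) \<le> (\<Sum>i\<in>J. ell\<^sup>2 / 16 * (wt (A i) * (ip n x (A i))\<^sup>2))"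
    proof (intro sum_mono)
      fix i
      have "?d (A i) \<le> wt (A i) * ((ell / 2 * ip n x (A i))\<^sup>2 / 2)"
        using one_minus_cos_le wt_bounds[of "A i"] by (intro mult_left_mono) auto
      moreover have "wt (A i) * ((ell / 2 * ip n x (A i))\<^sup>2 / 2) = 2 * (ell\<^sup>2 / 16 * (wt (A i) * (ip n x (A i))\<^sup>2))"
        by (simp add: power_mult_distrib power_divide)
      ultimately show "?d (A i) / 2 \<le> ell\<^sup>2 / 16 * (wt (A i) * (ip n x (A i))\<^sup>2)"
        by linarith
    qed
    also have "\<dots> \<le> ell\<^sup>2 / 16 * (al / 256 * n)"
      unfolding sum_distrib_left[symmetric] using le by (intro mult_left_mono) auto
    also have "\<dots> = c1 * n / 16" by (simp add: c1_def)
    finally show "exp (- c1 * n / 16) \<le> (\<Prod>i\<in>J. ?f (A i))"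
      by (simp add: exp_sum[OF J(1), symmetric] sum_negf)
  qed auto
  also have "\<dots> \<le> exp (- c1 / 4) ^ card J / exp (- c1 * n / 16)"
    by (intro divide_right_mono power_mono f) (auto intro: integral_nonneg_AE)
  also have "\<dots> = exp (- c1 * card J / 4 + c1 * n / 16)"
    by (simp add: exp_of_nat_mult[symmetric] exp_diff[symmetric] mult_ac)
  also have "\<dots> \<le> exp (- c1 * n / 16)"
  proof -
    have "real n \<le> 2 * real (card J)" using J(2) by (simp flip: of_nat_mult)
    then have "c1 * n \<le> c1 * (2 * card J)" using c1 by (intro mult_left_mono) auto
    then show ?thesis by (simp add: mult_ac)
  qed
  finally show "measure (gams J n) ?E \<le> exp (- c1 * n / 16)" .
qed

text \<open>The lattice points that approximate vectors with few large coordinates, in units of \<open>eta/sqrt n\<close>.\<close>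

definition sparse_net :: "(nat \<Rightarrow> int) set" where
  "sparse_net = {z \<in> PiE {..<n} (\<lambda>_. {- int (nat \<lceil>4 * n / eta\<^sup>2\<rceil>)..int (nat \<lceil>4 * n / eta\<^sup>2\<rceil>)}).
     card {j \<in> {..<n}. z j \<noteq> 0} \<le> 2 * beta * n \<and> (\<Sum>j<n. (real_of_int (z j))\<^sup>2) \<le> 4 * n / eta\<^sup>2}"

lemma sparse_net_card: "finite sparse_net" "card sparse_net \<le> exp (c1 * n / 32)"
proof -
  define N where "N = nat \<lceil>4 * n / eta\<^sup>2\<rceil>"
  define s where "s = beta * eta\<^sup>2"
  define q where "q = (beta * eta)\<^sup>2"
  have s: "0 < s" using beta eta by (simp add: s_def)
  have q: "0 < q" using beta eta by (simp add: q_def)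
  define w where "w k = (if k = 0 then 0 else - ln q) + s * (real_of_int k)\<^sup>2" for k :: int
  define W where "W = 2 * beta * n * (- ln q) + 4 * beta * n"
  have lnq: "0 \<le> - ln q"
  proof -
    have "beta * eta \<le> 1 * 1" using beta eta by (intro mult_mono) auto
    then have "q \<le> 1" unfolding q_def using beta eta by (intro power_le_one) auto
    then show ?thesis using q by simp
  qed
  have ww: "(\<Sum>j<n. w (z j)) \<le> W" if z: "z \<in> sparse_net" for z
  proof -
    have "(\<Sum>j<n. w (z j)) = (\<Sum>j<n. if z j = 0 then 0 else - ln q) + s * (\<Sum>j<n. (real_of_int (z j))\<^sup>2)"
      by (simp add: w_def sum.distrib sum_distrib_left)
    also have "(\<Sum>j<n. if z j = 0 then 0 else - ln q) = (\<Sum>j\<in>{j \<in> {..<n}. z j \<noteq> 0}. - ln q)"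
      unfolding sum.inter_filter[OF finite_lessThan] by (intro sum.cong refl) auto
    also have "\<dots> = card {j \<in> {..<n}. z j \<noteq> 0} * (- ln q)" by (simp only: sum_constant)
    also have "\<dots> + s * (\<Sum>j<n. (real_of_int (z j))\<^sup>2) \<le> (2 * beta * n) * (- ln q) + s * (4 * n / eta\<^sup>2)"
      using z s lnq by (intro add_mono mult_right_mono mult_left_mono) (auto simp: sparse_net_def)
    also have "\<dots> = W" using eta by (simp add: W_def s_def)
    finally show ?thesis .
  qed
  have sub: "sparse_net \<subseteq> PiE {..<n} (\<lambda>_. {- int N..int N})"
    unfolding sparse_net_def N_def by (rule Collect_restrict)
  note wc = weighted_count[OF finite_atLeastAtMost_int sub ww]
  have fin: "finite sparse_net" and cd: "card sparse_net \<le> exp W * (\<Sum>k\<in>{- int N..int N}. exp (- w k)) ^ n"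
    using wc by auto
  show "finite sparse_net" by (rule fin)
  have "(\<Sum>k\<in>{- int N..int N}. exp (- w k)) = exp (- w 0) + 2 * (\<Sum>k=1..N. exp (- w (int k)))"
    by (rule sum_int_even) (simp add: w_def)
  also have "(\<Sum>k=1..N. exp (- w (int k))) \<le> (\<Sum>k=1..N. q * exp (- s * real k))"
  proof (intro sum_mono)
    fix k assume k: "k \<in> {1..N}"
    then have "real k * 1 \<le> real k * real k" by (intro mult_left_mono) auto
    then have "exp (- (s * (real k)\<^sup>2)) \<le> exp (- s * real k)" using s by (simp add: power2_eq_square)
    moreover have "exp (- w (int k)) = q * exp (- (s * (real k)\<^sup>2))"
      using k q by (simp add: w_def exp_add exp_diff exp_minus divide_inverse)
    ultimately show "exp (- w (int k)) \<le> q * exp (- s * real k)" using q by simp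
  qed
  also have "\<dots> \<le> q * (1 / s)"
    unfolding sum_distrib_left[symmetric] using q by (intro mult_left_mono exp_sum_nat_le s) auto
  also have "q * (1 / s) = beta" using beta eta by (simp add: q_def s_def power2_eq_square)
  finally have "(\<Sum>k\<in>{- int N..int N}. exp (- w k)) \<le> 1 + 2 * beta" by (simp add: w_def)
  also have "\<dots> \<le> exp (2 * beta)" by (rule exp_ge_add_one_self)
  finally have "(\<Sum>k\<in>{- int N..int N}. exp (- w k)) ^ n \<le> exp (2 * beta) ^ n"
    by (intro power_mono sum_nonneg) auto
  also have "exp (2 * beta) ^ n = exp (2 * beta * n)" by (simp add: exp_of_nat_mult[symmetric] mult_ac)
  finally have "real (card sparse_net) \<le> exp W * exp (2 * beta * n)"
    using cd by (meson mult_left_mono exp_ge_zero order_trans)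
  also have "\<dots> = exp (n * (2 * beta * (- ln q) + 6 * beta))" by (simp add: W_def mult_exp_exp algebra_simps)
  also have "\<dots> \<le> exp (c1 * n / 32)"
  proof -
    define b where "b = eta * (c1 / 512)"
    have b: "0 < b" using eta c1 by (simp add: b_def)
    have "beta * eta = b\<^sup>2" by (simp add: b_def beta_def power2_eq_square)
    then have "- ln q = 4 * ln (1 / b)" using b by (simp add: q_def ln_realpow ln_div power_mult[symmetric])
    also have "\<dots> \<le> 4 * (1 / b)" using b ln_le_minus_one[of "1 / b"] by simp
    finally have "2 * beta * (- ln q) \<le> 2 * beta * (4 * (1 / b))" using beta by (intro mult_left_mono) auto
    also have "\<dots> = c1 / 64" using beta(4) by (simp add: b_def)
    finally have "2 * beta * (- ln q) + 6 * beta \<le> c1 / 32" using beta by simp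
    then have "n * (2 * beta * (- ln q) + 6 * beta) \<le> n * (c1 / 32)" by (intro mult_left_mono) auto
    then show ?thesis by (simp add: mult.commute)
  qed
  finally show "card sparse_net \<le> exp (c1 * n / 32)" .
qed

lemma nsq_add_le: "nsq k (\<lambda>j. x j + y j) \<le> 2 * nsq k x + 2 * nsq k y"
  unfolding nsq_def sum_distrib_left sum.distrib[symmetric]
proof (intro sum_mono)
  fix j show "(x j + y j)\<^sup>2 \<le> 2 * (x j)\<^sup>2 + 2 * (y j)\<^sup>2"
    using zero_le_power2[of "x j - y j"] by (simp add: power2_eq_square algebra_simps)
qed

lemma floor_ceiling_close:
  fixes u x :: real
  assumes u: "0 < u" and z: "(z::int) = \<lfloor>x / u\<rfloor> \<or> z = \<lceil>x / u\<rceil>"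
  shows "\<bar>u * z - x\<bar> \<le> u" "sgn x * z = \<bar>real_of_int z\<bar>"
proof -
  have "\<bar>real_of_int z - x / u\<bar> \<le> 1" using z by (auto; linarith)
  then have "u * \<bar>real_of_int z - x / u\<bar> \<le> u * 1" using u by (intro mult_left_mono) auto
  moreover have "u * \<bar>real_of_int z - x / u\<bar> = \<bar>u * z - x\<bar>"
    using u abs_mult[of u "real_of_int z - x / u"] by (simp add: right_diff_distrib)
  ultimately show "\<bar>u * z - x\<bar> \<le> u" by simp
  consider "0 < x" | "x = 0" | "x < 0" by linarith
  then show "sgn x * z = \<bar>real_of_int z\<bar>"
  proof cases
    case 1
    then have "0 < x / u" using u by simp
    then have "0 \<le> z" using z by auto
    then show ?thesis using 1 by simp
  next
    case 2 then show ?thesis using z by auto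
  next
    case 3
    then have "x / u < 0" using u by (simp add: divide_neg_pos)
    then have "z \<le> 0" using z by (auto simp: ceiling_le_iff floor_le_iff)
    then show ?thesis using 3 by simp
  qed
qed

text \<open>The weights \<open>wt\<close> in \<open>greedy_rounding\<close> keep \<open>wt (A i) * nsq n (A i)\<close> below \<open>t\<^sup>2 n\<close> for every row, whatever its norm, so that
the rounding error is at most a multiple of \<open>eta\<^sup>2 t\<^sup>2 n\<close>. Coordinates below \<open>rho/sqrt n\<close> are smaller than the step
\<open>eta/sqrt n\<close>, and the linear term of \<open>greedy_rounding\<close> sees to it that most of them are rounded to zero.\<close>

lemma sparse_rounding:
  assumes x: "nsq n x = 1" and sp: "card {j \<in> {..<n}. rho / sqrt n \<le> \<bar>x j\<bar>} \<le> beta * n"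
    and J: "finite J" "card J \<le> n" and s: "(\<Sum>i\<in>J. (ip n x (A i))\<^sup>2) \<le> al / 1024 * n"
  shows "\<exists>z\<in>sparse_net. 1/4 \<le> nsq n (\<lambda>j. eta / sqrt n * z j) \<and> nsq n (\<lambda>j. eta / sqrt n * z j) \<le> 4 \<and>
    (\<Sum>i\<in>J. wt (A i) * (ip n (\<lambda>j. eta / sqrt n * z j) (A i))\<^sup>2) \<le> al / 256 * n"
proof -
  define u where "u = eta / sqrt n"
  have sn: "0 < sqrt n" using n1 by simp
  have u: "0 < u" using eta n1 by (simp add: u_def)
  have u2: "u\<^sup>2 * n = eta\<^sup>2" using n1 by (simp add: u_def power_divide)
  define S where "S = {j \<in> {..<n}. rho / sqrt n \<le> \<bar>x j\<bar>}"
  define K where "K = t\<^sup>2 * eta\<^sup>2 * n"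
  have K: "0 < K" using t eta n1 by (simp add: K_def)
  have R: "0 < rho * sqrt n" using rho sn by simp
  define l where "l j = (if j \<in> S then 0 else sgn (x j) / (rho * sqrt n))" for j
  have c0: "0 \<le> wt (A i) / K" for i using K wt_bounds(1)[of "A i"] by simp
  from greedy_rounding[where c = "\<lambda>i. wt (A i) / K" and n = n and x = x and g = A and l = l, OF J(1) c0 u]
  obtain z0 :: "nat \<Rightarrow> int" where z00: "(\<forall>j<n. z0 j = \<lfloor>x j / u\<rfloor> \<or> z0 j = \<lceil>x j / u\<rceil>) \<and>
    (\<Sum>i\<in>J. (wt (A i) / K) * (ip n (A i) (\<lambda>j. u * z0 j - x j))\<^sup>2)
       + (\<Sum>j<n. l j * (u * z0 j - x j)) \<le> u\<^sup>2 * (\<Sum>i\<in>J. (wt (A i) / K) * nsq n (A i))"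
    by (elim exE)
  note z0 = conjunct1[OF z00] and le = conjunct2[OF z00]
  define z where "z = restrict z0 {..<n}"
  have zz: "z j = \<lfloor>x j / u\<rfloor> \<or> z j = \<lceil>x j / u\<rceil>" if "j < n" for j using z0 that by (simp add: z_def)
  define w where "w j = u * z j - x j" for j
  have wj: "\<bar>w j\<bar> \<le> u" "sgn (x j) * z j = \<bar>real_of_int (z j)\<bar>" if "j < n" for j
    unfolding w_def using floor_ceiling_close[OF u zz[OF that]] by auto
  have ipw: "ip n (A i) (\<lambda>j. u * z0 j - x j) = ip n (A i) w" for i
    unfolding ip_def w_def z_def by (intro sum.cong) auto
  have "u\<^sup>2 * (\<Sum>i\<in>J. (wt (A i) / K) * nsq n (A i)) \<le> u\<^sup>2 * (\<Sum>i\<in>J. (t\<^sup>2 * n) / K)"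
  proof (intro mult_left_mono sum_mono)
    fix i
    show "(wt (A i) / K) * nsq n (A i) \<le> (t\<^sup>2 * n) / K"
      using divide_right_mono[OF wt_nsq[of "A i"], of K] K by simp
  qed simp
  also have "\<dots> = card J * (u\<^sup>2 / eta\<^sup>2)"
    using t n1 eta by (simp add: K_def)
  also have "\<dots> \<le> n * (u\<^sup>2 / eta\<^sup>2)" using J by (intro mult_right_mono) auto
  also have "\<dots> = 1" using u2 eta by (simp add: mult.commute)
  finally have rhs: "u\<^sup>2 * (\<Sum>i\<in>J. (wt (A i) / K) * nsq n (A i)) \<le> 1" .
  define T where "T = (\<Sum>j\<in>{..<n} - S. \<bar>real_of_int (z j)\<bar>)"
  have lin: "(\<Sum>j<n. l j * (u * z0 j - x j)) \<ge> (u * T - rho * sqrt n) / (rho * sqrt n)"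
  proof -
    have "(\<Sum>j<n. l j * (u * z0 j - x j))
       = (\<Sum>j\<in>{..<n} - S. sgn (x j) / (rho * sqrt n) * (u * z j - x j))"
      by (rule sum.mono_neutral_cong_right) (auto simp: z_def l_def)
    also have "\<dots> = (\<Sum>j\<in>{..<n} - S. (u * \<bar>real_of_int (z j)\<bar> - \<bar>x j\<bar>)) / (rho * sqrt n)"
      unfolding sum_divide_distrib
    proof (intro sum.cong refl)
      fix j assume "j \<in> {..<n} - S"
      then have "sgn (x j) * (u * z j - x j) = u * \<bar>real_of_int (z j)\<bar> - \<bar>x j\<bar>"
        using wj(2)[of j] by (simp add: right_diff_distrib abs_sgn mult.commute mult.left_commute)
      then show "sgn (x j) / (rho * sqrt n) * (u * z j - x j) = (u * \<bar>real_of_int (z j)\<bar> - \<bar>x j\<bar>) / (rho * sqrt n)" by simp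
    qed
    also have "(\<Sum>j\<in>{..<n} - S. (u * \<bar>real_of_int (z j)\<bar> - \<bar>x j\<bar>)) = u * T - (\<Sum>j\<in>{..<n} - S. \<bar>x j\<bar>)"
      by (simp add: T_def sum_subtractf sum_distrib_left)
    finally have e: "(\<Sum>j<n. l j * (u * z0 j - x j))
      = (u * T - (\<Sum>j\<in>{..<n} - S. \<bar>x j\<bar>)) / (rho * sqrt n)" .
    have "(\<Sum>j\<in>{..<n} - S. \<bar>x j\<bar>) \<le> (\<Sum>j\<in>{..<n} - S. rho / sqrt n)"
      by (intro sum_mono) (auto simp: S_def)
    also have "\<dots> = card ({..<n} - S) * (rho / sqrt n)" by (simp only: sum_constant)
    also have "\<dots> \<le> n * (rho / sqrt n)"
    proof (intro mult_right_mono)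
      show "real (card ({..<n} - S)) \<le> real n" using card_mono[of "{..<n}" "{..<n} - S"] by simp
    qed (use rho sn in auto)
    also have "\<dots> = rho * sqrt n" using n1 by (simp add: real_div_sqrt mult.commute field_simps)
    finally have "u * T - rho * sqrt n \<le> u * T - (\<Sum>j\<in>{..<n} - S. \<bar>x j\<bar>)" by simp
    then show ?thesis unfolding e by (rule divide_right_mono) (use R in linarith)
  qed
  have q0: "0 \<le> (\<Sum>i\<in>J. (wt (A i) / K) * (ip n (A i) w)\<^sup>2)"
    using K wt_bounds by (intro sum_nonneg mult_nonneg_nonneg divide_nonneg_nonneg) (auto simp: less_imp_le)
  have T0: "0 \<le> T" unfolding T_def by (intro sum_nonneg) auto
  have tot: "(\<Sum>i\<in>J. (wt (A i) / K) * (ip n (A i) w)\<^sup>2) + (u * T - rho * sqrt n) / (rho * sqrt n) \<le> 1"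
    using le rhs lin unfolding ipw by linarith
  have dv: "(u * T - rho * sqrt n) / (rho * sqrt n) = u * T / (rho * sqrt n) - 1"
  proof -
    have "(a - r) / r = a / r - 1" if "0 < r" for a r :: real using that by (simp add: diff_divide_distrib)
    from this[OF R] show ?thesis .
  qed
  have "0 \<le> u * T / (rho * sqrt n)" using T0 u R by simp
  then have Q: "(\<Sum>i\<in>J. (wt (A i) / K) * (ip n (A i) w)\<^sup>2) \<le> 2" using tot dv by linarith
  have Q': "(\<Sum>i\<in>J. wt (A i) * (ip n (A i) w)\<^sup>2) \<le> 2 * K"
  proof -
    have "(\<Sum>i\<in>J. (wt (A i) / K) * (ip n (A i) w)\<^sup>2) = (\<Sum>i\<in>J. wt (A i) * (ip n (A i) w)\<^sup>2) / K"
      by (simp add: sum_divide_distrib)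
    then have "(\<Sum>i\<in>J. wt (A i) * (ip n (A i) w)\<^sup>2) / K \<le> 2" using Q by linarith
    then show ?thesis using K by (simp only: pos_divide_le_eq)
  qed
  have "u * T / (rho * sqrt n) \<le> 2" using tot dv q0 by linarith
  then have "u * T \<le> 2 * (rho * sqrt n)" using R by (simp add: field_simps)
  then have "sqrt n * (u * T) \<le> sqrt n * (2 * (rho * sqrt n))" using sn by (intro mult_left_mono) auto
  moreover have "sqrt n * (u * T) = eta * T" using sn by (simp add: u_def)
  moreover have "sqrt n * (2 * (rho * sqrt n)) = 2 * rho * (sqrt n * sqrt n)" by (simp only: mult_ac)
  ultimately have uT: "eta * T \<le> 2 * rho * n" by simp
  have "2 * rho * n = eta * (beta * n)" by (simp add: rho_def)
  then have "eta * T \<le> eta * (beta * n)" using uT by linarith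
  then have Tb: "T \<le> beta * n" using eta(1) by (simp only: mult_le_cancel_left_pos)
  have cardz: "card {j \<in> {..<n}. z j \<noteq> 0} \<le> 2 * beta * n"
  proof -
    have "{j \<in> {..<n}. z j \<noteq> 0} \<subseteq> S \<union> {j \<in> {..<n} - S. z j \<noteq> 0}" by auto
    then have "card {j \<in> {..<n}. z j \<noteq> 0} \<le> card (S \<union> {j \<in> {..<n} - S. z j \<noteq> 0})"
      by (intro card_mono) (auto simp: S_def)
    also have "\<dots> \<le> card S + card {j \<in> {..<n} - S. z j \<noteq> 0}" by (rule card_Un_le)
    finally have 1: "real (card {j \<in> {..<n}. z j \<noteq> 0}) \<le> card S + real (card {j \<in> {..<n} - S. z j \<noteq> 0})"
      by (simp flip: of_nat_add)
    have "real (card {j \<in> {..<n} - S. z j \<noteq> 0}) = (\<Sum>j\<in>{j \<in> {..<n} - S. z j \<noteq> 0}. 1)" by simp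
    also have "\<dots> \<le> (\<Sum>j\<in>{j \<in> {..<n} - S. z j \<noteq> 0}. \<bar>real_of_int (z j)\<bar>)" by (intro sum_mono) auto
    also have "\<dots> \<le> T" unfolding T_def by (intro sum_mono2) auto
    finally show ?thesis using 1 Tb sp unfolding S_def[symmetric] by linarith
  qed
  have nw: "nsq n w \<le> eta\<^sup>2"
  proof -
    have "nsq n w \<le> (\<Sum>j<n. u\<^sup>2)" unfolding nsq_def
    proof (intro sum_mono)
      fix j assume "j \<in> {..<n}"
      then show "(w j)\<^sup>2 \<le> u\<^sup>2" using wj(1)[of j] u by (metis abs_le_square_iff abs_of_pos lessThan_iff)
    qed
    then show ?thesis using u2 by (simp add: mult.commute)
  qed
  have eta2: "eta\<^sup>2 \<le> (1/64)\<^sup>2" using eta by (intro power_mono) auto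
  let ?x = "\<lambda>j. u * real_of_int (z j)"
  have xw: "?x = (\<lambda>j. x j + w j)" by (simp add: w_def)
  have n_up: "nsq n ?x \<le> 4"
    using nsq_add_le[of n x w] nw x eta2 unfolding xw by (simp add: power2_eq_square)
  have n_lo: "1/4 \<le> nsq n ?x"
  proof -
    have "nsq n (\<lambda>j. ?x j + (- w j)) \<le> 2 * nsq n ?x + 2 * nsq n (\<lambda>j. - w j)" by (rule nsq_add_le)
    moreover have "(\<lambda>j. ?x j + (- w j)) = x" by (simp add: w_def)
    moreover have "nsq n (\<lambda>j. - w j) = nsq n w" by (simp add: nsq_def)
    ultimately show ?thesis using x nw eta2 by (simp add: power2_eq_square)
  qed
  have zsq: "(\<Sum>j<n. (real_of_int (z j))\<^sup>2) \<le> 4 * n / eta\<^sup>2"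
  proof -
    have "u\<^sup>2 * (\<Sum>j<n. (real_of_int (z j))\<^sup>2) \<le> 4" using n_up by (simp add: nsq_def power_mult_distrib sum_distrib_left)
    then have "real n * (u\<^sup>2 * (\<Sum>j<n. (real_of_int (z j))\<^sup>2)) \<le> real n * 4" by (intro mult_left_mono) auto
    moreover have "real n * (u\<^sup>2 * (\<Sum>j<n. (real_of_int (z j))\<^sup>2)) = (u\<^sup>2 * n) * (\<Sum>j<n. (real_of_int (z j))\<^sup>2)"
      by (simp only: mult_ac)
    ultimately have "(\<Sum>j<n. (real_of_int (z j))\<^sup>2) * eta\<^sup>2 \<le> 4 * n" unfolding u2 by (simp only: mult.commute)
    then show ?thesis using eta by (subst pos_le_divide_eq) auto
  qed
  have "z \<in> sparse_net"
    unfolding sparse_net_def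
  proof (intro CollectI conjI cardz zsq PiE_I)
    fix j assume j: "j \<in> {..<n}"
    have "\<bar>z j\<bar> \<le> (z j)\<^sup>2"
    proof (cases "z j = 0")
      case False
      then have "\<bar>z j\<bar> * 1 \<le> \<bar>z j\<bar> * \<bar>z j\<bar>" by (intro mult_left_mono) auto
      then show ?thesis by (simp add: power2_eq_square)
    qed simp
    then have "\<bar>real_of_int (z j)\<bar> \<le> (real_of_int (z j))\<^sup>2" by (metis of_int_abs of_int_le_iff of_int_power)
    also have "\<dots> \<le> (\<Sum>j<n. (real_of_int (z j))\<^sup>2)" using j by (intro member_le_sum) auto
    finally have "\<bar>real_of_int (z j)\<bar> \<le> 4 * n / eta\<^sup>2" using zsq by linarith
    then have "\<bar>z j\<bar> \<le> int (nat \<lceil>4 * n / eta\<^sup>2\<rceil>)" by linarith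
    then show "z j \<in> {- int (nat \<lceil>4 * n / eta\<^sup>2\<rceil>)..int (nat \<lceil>4 * n / eta\<^sup>2\<rceil>)}" by auto
  qed (auto simp: z_def)
  moreover have "(\<Sum>i\<in>J. wt (A i) * (ip n ?x (A i))\<^sup>2) \<le> al / 256 * n"
  proof -
    have "(\<Sum>i\<in>J. wt (A i) * (ip n ?x (A i))\<^sup>2) \<le> (\<Sum>i\<in>J. 2 * (ip n x (A i))\<^sup>2 + 2 * (wt (A i) * (ip n (A i) w)\<^sup>2))"
    proof (intro sum_mono)
      fix i
      have e: "ip n ?x (A i) = ip n x (A i) + ip n (A i) w"
        unfolding xw using ip_add_right[of n "A i" x w] by (simp add: ip_commute)
      have "(ip n ?x (A i))\<^sup>2 \<le> 2 * (ip n x (A i))\<^sup>2 + 2 * (ip n (A i) w)\<^sup>2"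
        unfolding e using zero_le_power2[of "ip n x (A i) - ip n (A i) w"] by (simp add: power2_eq_square algebra_simps)
      then have "wt (A i) * (ip n ?x (A i))\<^sup>2 \<le> wt (A i) * (2 * (ip n x (A i))\<^sup>2 + 2 * (ip n (A i) w)\<^sup>2)"
        using wt_bounds by (intro mult_left_mono) (auto simp: less_imp_le)
      also have "\<dots> = wt (A i) * (2 * (ip n x (A i))\<^sup>2) + 2 * (wt (A i) * (ip n (A i) w)\<^sup>2)" by (simp add: distrib_left)
      also have "wt (A i) * (2 * (ip n x (A i))\<^sup>2) \<le> 1 * (2 * (ip n x (A i))\<^sup>2)"
        using wt_bounds by (intro mult_right_mono) auto
      finally show "wt (A i) * (ip n ?x (A i))\<^sup>2 \<le> 2 * (ip n x (A i))\<^sup>2 + 2 * (wt (A i) * (ip n (A i) w)\<^sup>2)" by simp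
    qed
    also have "\<dots> = 2 * (\<Sum>i\<in>J. (ip n x (A i))\<^sup>2) + 2 * (\<Sum>i\<in>J. wt (A i) * (ip n (A i) w)\<^sup>2)"
      by (simp add: sum.distrib sum_distrib_left)
    also have "\<dots> \<le> 2 * (al / 1024 * n) + 2 * (2 * K)" using s Q' by (intro add_mono mult_left_mono) auto
    finally have fin: "(\<Sum>i\<in>J. wt (A i) * (ip n ?x (A i))\<^sup>2) \<le> 2 * (al / 1024 * n) + 2 * (2 * K)" .
    have "K \<le> al / 4096 * n"
    proof -
      have "K = al\<^sup>2 / 4096 * n" using t by (simp add: K_def eta_def power_divide power_mult_distrib)
      moreover have "al\<^sup>2 \<le> al" using al by (simp add: power2_eq_square mult_left_le)
      ultimately show ?thesis by (simp add: mult_right_mono)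
    qed
    moreover have "0 \<le> al * n" using al by simp
    ultimately have "2 * (al / 1024 * n) + 2 * (2 * K) \<le> al / 256 * n" by simp
    then show ?thesis using fin by linarith
  qed
  ultimately show ?thesis using n_up n_lo unfolding u_def by blast
qed

text \<open>A union bound over \<open>sparse_net\<close>, whose cardinality is beaten by the probability for a single point.\<close>

theorem spread_vectors:
  assumes J: "finite J" "card J \<le> n" "n \<le> 2 * card J"
  shows "\<exists>F\<in>sets (gams J n). measure (gams J n) F \<le> exp (- c1 * n / 32) \<and>
    (\<forall>A\<in>space (gams J n) - F. \<forall>x. nsq n x = 1 \<longrightarrow> (\<Sum>i\<in>J. (ip n x (A i))\<^sup>2) \<le> al / 1024 * n \<longrightarrow>
      beta * n < card {j \<in> {..<n}. rho / sqrt n \<le> \<bar>x j\<bar>})"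
proof -
  let ?x = "\<lambda>z j. eta / sqrt n * real_of_int (z j)"
  let ?Z = "{z \<in> sparse_net. 1/4 \<le> nsq n (?x z) \<and> nsq n (?x z) \<le> 4}"
  let ?E = "\<lambda>z. {A \<in> space (gams J n). (\<Sum>i\<in>J. wt (A i) * (ip n (?x z) (A i))\<^sup>2) \<le> al / 256 * n}"
  have fZ: "finite ?Z" using sparse_net_card(1) by simp
  show ?thesis
  proof (intro bexI conjI ballI allI impI)
    show s: "(\<Union>z\<in>?Z. ?E z) \<in> sets (gams J n)"
      using fZ weighted_product_prob(1)[OF _ _ J(1,3)] by (intro sets.finite_UN) auto
    have "measure (gams J n) (\<Union>z\<in>?Z. ?E z) \<le> (\<Sum>z\<in>?Z. measure (gams J n) (?E z))"
      using weighted_product_prob(1)[OF _ _ J(1,3)]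
      by (intro measure_UNION_le fZ) auto
    also have "\<dots> \<le> (\<Sum>z\<in>?Z. exp (- c1 * n / 16))"
      using weighted_product_prob(2)[OF _ _ J(1,3)] by (intro sum_mono) auto
    also have "\<dots> = card ?Z * exp (- c1 * n / 16)" by simp
    also have "\<dots> \<le> exp (c1 * n / 32) * exp (- c1 * n / 16)"
    proof (intro mult_right_mono)
      have "real (card ?Z) \<le> card sparse_net" using sparse_net_card(1) by (intro of_nat_mono card_mono) auto
      then show "real (card ?Z) \<le> exp (c1 * n / 32)" using sparse_net_card(2) by linarith
    qed simp
    also have "\<dots> = exp (- c1 * n / 32)" by (simp add: mult_exp_exp)
    finally show "measure (gams J n) (\<Union>z\<in>?Z. ?E z) \<le> exp (- c1 * n / 32)" .
    fix A x assume A: "A \<in> space (gams J n) - (\<Union>z\<in>?Z. ?E z)" and x: "nsq n x = 1"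
      and le: "(\<Sum>i\<in>J. (ip n x (A i))\<^sup>2) \<le> al / 1024 * n"
    show "beta * n < card {j \<in> {..<n}. rho / sqrt n \<le> \<bar>x j\<bar>}"
    proof (rule ccontr)
      assume "\<not> beta * n < card {j \<in> {..<n}. rho / sqrt n \<le> \<bar>x j\<bar>}"
      then have "card {j \<in> {..<n}. rho / sqrt n \<le> \<bar>x j\<bar>} \<le> beta * n" by simp
      from sparse_rounding[OF x this J(1,2) le] A show False by auto
    qed
  qed
qed

end

section \<open>Small balls and unstructured directions\<close>

lemma gauss_sum_le: assumes y: "0 < y" shows "(\<Sum>d<L. exp (- (y * real d)\<^sup>2)) \<le> 3 * (1 + 1 / y)"
proof -
  have "(\<Sum>d<L. exp (- (y * real d)\<^sup>2)) \<le> (\<Sum>d<Suc L. exp (- (y * real d)\<^sup>2))" by simp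
  also have "\<dots> = 1 + (\<Sum>d=1..L. exp (- (y * real d)\<^sup>2))"
    unfolding lessThan_Suc_atMost atMost_atLeast0 by (subst sum.atLeast_Suc_atMost) auto
  also have "(\<Sum>d=1..L. exp (- (y * real d)\<^sup>2)) \<le> (\<Sum>d=1..L. exp 1 * exp (- (2 * y) * real d))"
  proof (intro sum_mono)
    fix d
    have "0 \<le> (y * real d - 1)\<^sup>2" by simp
    then have "- (y * real d)\<^sup>2 \<le> 1 + - (2 * y) * real d" by (simp add: power2_eq_square algebra_simps)
    then show "exp (- (y * real d)\<^sup>2) \<le> exp 1 * exp (- (2 * y) * real d)" by (simp add: mult_exp_exp)
  qed
  also have "\<dots> \<le> exp 1 * (1 / (2 * y))"
    unfolding sum_distrib_left[symmetric] using y by (intro mult_left_mono exp_sum_nat_le) auto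
  also have "\<dots> \<le> 3 * (1 / (2 * y))" using e_less_272 y by (intro mult_right_mono) auto
  finally have "(\<Sum>d<L. exp (- (y * real d)\<^sup>2)) \<le> 1 + 3 * (1 / (2 * y))" by simp
  also have "\<dots> \<le> 3 * (1 + 1 / y)" using y by (simp add: field_simps)
  finally show ?thesis .
qed

context entry_law
begin

text \<open>The characteristic function of \<open>ip n x g\<close> at \<open>th\<close> is at most \<open>exp (- psis n x th / 2)\<close>. The function
is subadditive up to a factor of \<open>2\<close> both in \<open>th\<close> and in \<open>x\<close>, so that it is stable under rounding.\<close>

definition psis :: "nat \<Rightarrow> (nat \<Rightarrow> real) \<Rightarrow> real \<Rightarrow> real" where
  "psis n x th = (\<Sum>j<n. defect 0 (th * x j))"

lemma psis_add_arg: "psis n x (a + b) \<le> 2 * psis n x a + 2 * psis n x b"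
  unfolding psis_def sum_distrib_left sum.distrib[symmetric] distrib_right
  by (intro sum_mono defect_add)

lemma psis_add_vec: "psis n (\<lambda>j. x j + y j) th \<le> 2 * psis n x th + 2 * psis n y th"
  unfolding psis_def sum_distrib_left sum.distrib[symmetric] distrib_left
  by (intro sum_mono defect_add)

lemma psis_le: assumes "\<And>j. j < n \<Longrightarrow> defect 0 (th * x j) \<le> c" shows "psis n x th \<le> n * c"
  using sum_mono[of "{..<n}" "\<lambda>j. defect 0 (th * x j)" "\<lambda>_. c"] assms by (simp add: psis_def)

lemma char_psis: "cmod (\<integral>g. cis (th * ip n x g) \<partial>gam n) \<le> exp (- psis n x th / 2)"
  using wchar_product_bound[of 0 n th x] by (simp add: psis_def)

end

text \<open>Here \<open>K\<close> is the scale at which row norms are truncated and \<open>kap ^ n\<close> is the bound for the product of the truncated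
norms.\<close>

locale level0 = flat_entry +
  fixes K kap :: real
  assumes K: "1 \<le> K" and kap: "1 \<le> kap"
begin

definition al1 where "al1 = al * rho\<^sup>2 * beta / 8"
definition th0 where "th0 = ell * beta * sqrt n / 8"
definition ups where "ups = beta * ell * al * al1 / (2 ^ 40 * kap\<^sup>2 * K)"
definition tau where "tau = ups\<^sup>2"
definition s0 where "s0 = tau / (256 * t)"

lemma rho1: "rho \<le> 1" using rho eta by linarith

lemma al1: "0 < al1" "al1 \<le> 1" "al1 \<le> rho"
proof -
  show "0 < al1" using al rho beta by (simp add: al1_def)
  have "al * rho\<^sup>2 * beta \<le> 1 * (rho * 1) * 1" unfolding power2_eq_square
    using al rho rho1 beta by (intro mult_mono) auto
  then show "al1 \<le> rho" using rho by (simp add: al1_def)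
  then show "al1 \<le> 1" using rho1 by linarith
qed

lemma th0: "0 < th0" using ell beta n1 by (simp add: th0_def)

lemma ups: "0 < ups" "ups \<le> beta * ell * al1 / 2 ^ 40" "ups \<le> 1"
proof -
  show "0 < ups" using beta ell al al1 kap K by (simp add: ups_def)
  have kK: "1 \<le> kap\<^sup>2 * K" using mult_mono[of 1 "kap\<^sup>2" 1 K] kap K by (simp add: one_le_power)
  have "beta * ell * al * al1 \<le> beta * ell * 1 * al1"
    using beta ell al al1 by (intro mult_right_mono mult_left_mono) auto
  then have "ups \<le> beta * ell * al1 / (2 ^ 40 * (kap\<^sup>2 * K))"
    unfolding ups_def mult.assoc using kK by (intro divide_right_mono) auto
  also have "\<dots> \<le> beta * ell * al1 / (2 ^ 40 * 1)"
    using kK beta ell al1 by (intro divide_left_mono mult_left_mono) auto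
  finally show u: "ups \<le> beta * ell * al1 / 2 ^ 40" by simp
  have "beta * ell * al1 \<le> 1 * 1 * 1" using beta ell al1 by (intro mult_mono) auto
  then show "ups \<le> 1" using u by simp
qed

lemma tau: "0 < tau" "tau \<le> ups" "tau \<le> 1" "64 * tau \<le> al1 * ell\<^sup>2 * beta\<^sup>2"
proof -
  show "0 < tau" using ups by (simp add: tau_def)
  show t1: "tau \<le> ups" using ups by (simp add: tau_def power2_eq_square mult_left_le)
  show "tau \<le> 1" using t1 ups by linarith
  have "tau \<le> (beta * ell * al1 / 2 ^ 40)\<^sup>2" unfolding tau_def using ups by (intro power_mono) auto
  also have "\<dots> = (al1 * ell\<^sup>2 * beta\<^sup>2) * (al1 / 2 ^ 80)" by (simp add: power_mult_distrib power_divide power2_eq_square)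
  also have "\<dots> \<le> (al1 * ell\<^sup>2 * beta\<^sup>2) * (1 / 64)" using al1 by (intro mult_left_mono) auto
  finally show "64 * tau \<le> al1 * ell\<^sup>2 * beta\<^sup>2" by simp
qed

lemma s0: "0 < s0" "s0 \<le> tau" "16 * s0 \<le> rho * ell * beta" "s0 \<le> ell / 16" "s0 \<le> th0" "s0 \<le> 1"
proof -
  show p: "0 < s0" using tau t by (simp add: s0_def)
  show st: "s0 \<le> tau" unfolding s0_def using tau t by (simp add: divide_le_eq)
  have "16 * s0 \<le> 16 * (beta * ell * al1 / 2 ^ 40)" using st tau ups by linarith
  also have "\<dots> \<le> beta * ell * al1" using beta ell al1 by simp
  also have "\<dots> \<le> beta * ell * rho" using al1 beta ell by (intro mult_left_mono) auto
  finally show a: "16 * s0 \<le> rho * ell * beta" by (simp add: mult_ac)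
  have "rho * ell * beta \<le> 1 * ell * 1" using rho rho1 ell beta by (intro mult_mono) auto
  then show "s0 \<le> ell / 16" using a by simp
  have "rho * ell * beta \<le> 1 * ell * beta" using rho1 ell beta by (intro mult_right_mono) auto
  then have "s0 \<le> ell * beta / 16" using a by simp
  also have "\<dots> \<le> ell * beta * sqrt n / 8"
  proof -
    have "ell * beta * 1 \<le> ell * beta * sqrt n" using n1 ell beta by (intro mult_left_mono) auto
    moreover have "0 \<le> ell * beta" using ell beta by simp
    ultimately show ?thesis by linarith
  qed
  finally show "s0 \<le> th0" by (simp add: th0_def)
  show "s0 \<le> 1" using st tau by linarith
qed

definition spread :: "real \<Rightarrow> (nat \<Rightarrow> real) \<Rightarrow> bool" where
  "spread r x \<longleftrightarrow> nsq n x \<le> 4 \<and> beta * n \<le> card {j \<in> {..<n}. r / sqrt n \<le> \<bar>x j\<bar>}"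

lemma psis_spread:
  assumes x: "spread (rho / 2) x" and th: "0 \<le> th" "th \<le> th0"
  shows "al1 * th\<^sup>2 \<le> psis n x th"
proof -
  define S where "S = {j \<in> {..<n}. rho / 2 / sqrt n \<le> \<bar>x j\<bar>}"
  define b where "b = 8 / (beta * sqrt n)"
  define B where "B = {j \<in> {..<n}. b < \<bar>x j\<bar>}"
  have sn: "0 < sqrt n" "sqrt n * sqrt n = n" using n1 by auto
  have b: "0 < b" using beta sn by (simp add: b_def)
  have b2: "b\<^sup>2 = 64 / (beta\<^sup>2 * n)" by (simp add: b_def power_divide power_mult_distrib)
  have cS: "beta * n \<le> card S" and nx: "nsq n x \<le> 4" using x by (auto simp: spread_def S_def)
  have "card B * b\<^sup>2 = (\<Sum>j\<in>B. b\<^sup>2)" by simp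
  also have "\<dots> \<le> (\<Sum>j\<in>B. (x j)\<^sup>2)"
  proof (intro sum_mono)
    fix j assume "j \<in> B"
    then show "b\<^sup>2 \<le> (x j)\<^sup>2" using b by (auto simp: B_def abs_le_square_iff[symmetric])
  qed
  also have "\<dots> \<le> nsq n x" unfolding nsq_def by (rule sum_mono2) (auto simp: B_def)
  finally have "card B * (64 / (beta\<^sup>2 * n)) \<le> 4" using nx b2 by simp
  then have "real (card B) \<le> beta\<^sup>2 * n / 16" using beta n1 by (simp add: field_simps)
  also have "\<dots> \<le> beta * n / 2"
  proof -
    have "beta * (beta * n) \<le> 1 * (beta * n)" using beta by (intro mult_right_mono) auto
    moreover have "beta\<^sup>2 * n = beta * (beta * n)" by (simp add: power2_eq_square)
    moreover have "0 \<le> beta * n" using beta by simp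
    ultimately show ?thesis by linarith
  qed
  finally have cB: "real (card B) \<le> beta * n / 2" .
  have fin: "finite S" "finite B" by (auto simp: S_def B_def)
  have "real (card S) \<le> card (S - B) + real (card B)"
    using card_mono[of "(S - B) \<union> B" S] card_Un_le[of "S - B" B] fin by (simp flip: of_nat_add)
  then have cSB: "beta * n / 2 \<le> card (S - B)" using cS cB by linarith
  have "al1 * th\<^sup>2 = (beta * n / 2) * (al * th\<^sup>2 * (rho / 2 / sqrt n)\<^sup>2)"
    using n1 by (simp add: al1_def power_divide power_mult_distrib)
  also have "\<dots> \<le> card (S - B) * (al * th\<^sup>2 * (rho / 2 / sqrt n)\<^sup>2)"
    using cSB al by (intro mult_right_mono) auto
  also have "\<dots> = (\<Sum>j\<in>S - B. al * th\<^sup>2 * (rho / 2 / sqrt n)\<^sup>2)" by simp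
  also have "\<dots> \<le> (\<Sum>j\<in>S - B. defect 0 (th * x j))"
  proof (intro sum_mono)
    fix j assume j: "j \<in> S - B"
    have "(rho / 2 / sqrt n)\<^sup>2 \<le> \<bar>x j\<bar>\<^sup>2" using j rho sn by (intro power_mono) (auto simp: S_def)
    then have "al * th\<^sup>2 * (rho / 2 / sqrt n)\<^sup>2 \<le> al * th\<^sup>2 * (x j)\<^sup>2" using al by (intro mult_left_mono) auto
    also have "\<dots> = al * (th * x j)\<^sup>2" by (simp add: power_mult_distrib)
    also have "\<dots> \<le> defect 0 (th * x j)"
    proof (rule low)
      have "\<bar>th * x j\<bar> \<le> th0 * b" unfolding abs_mult using j th by (intro mult_mono) (auto simp: B_def S_def)
      also have "\<dots> = ell" using beta sn by (simp add: th0_def b_def)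
      finally show "\<bar>th * x j\<bar> \<le> ell" .
    qed
    finally show "al * th\<^sup>2 * (rho / 2 / sqrt n)\<^sup>2 \<le> defect 0 (th * x j)" .
  qed
  also have "\<dots> \<le> psis n x th" unfolding psis_def
    by (rule sum_mono2) (auto simp: S_def defect_nonneg)
  finally show ?thesis .
qed

text \<open>On \<open>[0, th0]\<close> the characteristic function is at most Gaussian by \<open>psis_spread\<close>, beyond it is exponentially small
by hypothesis.\<close>

lemma kernel_small_ball:
  fixes s :: real
  assumes x: "spread (rho / 2) x" and s: "exp (- tau * n / 8) \<le> s"
    and large: "\<And>th. th0 \<le> th \<Longrightarrow> th \<le> 1 / s \<Longrightarrow> tau * n / 4 \<le> psis n x th"
  shows "(\<integral>g. 1 / (1 + (ip n x g / s)\<^sup>2) \<partial>gam n) \<le> 160 * s / al1"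
proof -
  interpret g: prob_space "gam n" by (rule prob_gam)
  have sp: "0 < s" using s exp_gt_zero[of "- tau * n / 8"] by linarith
  have "(\<integral>g. 1 / (1 + (ip n x g / s)\<^sup>2) \<partial>gam n) \<le> 20 * (2 * s / (al1 / 2) + exp (- tau * n / 8))"
  proof (rule g.cauchy_kernel_bound[OF meas_ip sp])
    fix th :: real assume th: "0 \<le> th" "th \<le> 1 / s"
    have c: "cmod (\<integral>g. cis (th * ip n x g) \<partial>gam n) \<le> exp (- psis n x th / 2)" by (rule char_psis)
    show "cmod (\<integral>g. cis (th * ip n x g) \<partial>gam n) \<le> 1 / (1 + (al1 / 2 * th)\<^sup>2) + exp (- tau * n / 8)"
    proof (cases "th \<le> th0")
      case True
      then have "al1 * th\<^sup>2 \<le> psis n x th" using psis_spread[OF x th(1)] by simp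
      moreover have "(al1 / 2 * th)\<^sup>2 \<le> al1 * th\<^sup>2 / 2"
      proof -
        have "al1 * (al1 * th\<^sup>2) \<le> 1 * (al1 * th\<^sup>2)" using al1 by (intro mult_right_mono) auto
        moreover have "(al1 / 2 * th)\<^sup>2 = al1 * (al1 * th\<^sup>2) / 4" by (simp add: power2_eq_square)
        moreover have "0 \<le> al1 * th\<^sup>2" using al1 by simp
        ultimately show ?thesis by linarith
      qed
      ultimately have le: "(al1 / 2 * th)\<^sup>2 \<le> psis n x th / 2" by linarith
      have "1 + (al1 / 2 * th)\<^sup>2 \<le> exp (psis n x th / 2)"
        using le exp_ge_add_one_self[of "psis n x th / 2"] by linarith
      then have "inverse (exp (psis n x th / 2)) \<le> inverse (1 + (al1 / 2 * th)\<^sup>2)"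
        by (intro le_imp_inverse_le) (auto simp: add_pos_nonneg)
      then have "exp (- psis n x th / 2) \<le> 1 / (1 + (al1 / 2 * th)\<^sup>2)"
        by (simp add: exp_minus inverse_eq_divide)
      then show ?thesis using c exp_gt_zero[of "- tau * n / 8"] by linarith
    next
      case False
      then have "tau * n / 4 \<le> psis n x th" using large th by simp
      then have "exp (- psis n x th / 2) \<le> exp (- tau * n / 8)" by (simp add: mult.commute)
      moreover have "0 \<le> 1 / (1 + (al1 / 2 * th)\<^sup>2)" by (simp add: add_nonneg_nonneg)
      ultimately show ?thesis using c by linarith
    qed
  qed (use al1 in auto)
  also have "\<dots> \<le> 20 * (2 * s / (al1 / 2) + 4 * s / al1)"
  proof -
    have "s \<le> s / al1" using al1 sp by (simp add: pos_le_divide_eq mult_left_le)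
    moreover have "0 < s / al1" using al1 sp by simp
    ultimately have "exp (- tau * n / 8) \<le> 4 * (s / al1)" using s by linarith
    then show ?thesis by simp
  qed
  also have "\<dots> = 160 * s / al1" by simp
  finally show ?thesis .
qed

text \<open>On the event, the arithmetic-geometric mean inequality bounds the product of \<open>1 + S\<^sup>2/(s\<^sup>2 T\<^sup>2)\<close> by \<open>exp n\<close>, where \<open>S\<close> is
the inner product with a row and \<open>T\<close> its truncated norm. As \<open>T \<ge> 1\<close>, the product of \<open>1/(1 + S\<^sup>2/s\<^sup>2)\<close> is then at least
\<open>exp (- n)\<close> divided by the square of the product of the \<open>T\<close>; Markov's inequality applies.\<close>

lemma weighted_rows_prob:
  fixes s c :: real
  assumes J: "finite J" and s: "0 < s"
    and k: "(\<integral>g. 1 / (1 + (ip n x g / s)\<^sup>2) \<partial>gam n) \<le> c"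
  shows "{A \<in> space (gams J n). (\<Sum>i\<in>J. (ip n x (A i))\<^sup>2 / (trunc_norm K n (A i))\<^sup>2) \<le> s\<^sup>2 * n \<and>
      (\<Prod>i\<in>J. trunc_norm K n (A i)) \<le> kap ^ n} \<in> sets (gams J n)" (is "?E \<in> _")
    "measure (gams J n) {A \<in> space (gams J n). (\<Sum>i\<in>J. (ip n x (A i))\<^sup>2 / (trunc_norm K n (A i))\<^sup>2) \<le> s\<^sup>2 * n \<and>
      (\<Prod>i\<in>J. trunc_norm K n (A i)) \<le> kap ^ n} \<le> exp n * (kap ^ n)\<^sup>2 * c ^ card J"
proof -
  interpret g: prob_space "gam n" by (rule prob_gam)
  have "(\<lambda>A. \<Sum>i\<in>J. (ip n x (A i))\<^sup>2 / (trunc_norm K n (A i))\<^sup>2) \<in> borel_measurable (gams J n)"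
    by (intro borel_measurable_sum borel_measurable_divide borel_measurable_power
        measurable_compose[OF meas_gams_coord meas_trunc] measurable_compose[OF meas_gams_coord meas_ip])
  moreover have "(\<lambda>A. \<Prod>i\<in>J. trunc_norm K n (A i)) \<in> borel_measurable (gams J n)"
    by (intro borel_measurable_prod measurable_compose[OF meas_gams_coord meas_trunc])
  ultimately show E: "?E \<in> sets (gams J n)" by measurable
  let ?f = "\<lambda>g. 1 / ((trunc_norm K n g)\<^sup>2 + (ip n x g / s)\<^sup>2)"
  have r1: "1 \<le> (trunc_norm K n g)\<^sup>2" for g using trunc_norm_ge1[of K n g] by (simp add: one_le_power)
  have fb: "?f g \<le> 1 / (1 + (ip n x g / s)\<^sup>2)" for g
  proof (intro divide_left_mono mult_pos_pos)
    show "0 < (trunc_norm K n g)\<^sup>2 + (ip n x g / s)\<^sup>2" using r1[of g] zero_le_power2[of "ip n x g / s"] by linarith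
    show "0 < 1 + (ip n x g / s)\<^sup>2" using zero_le_power2[of "ip n x g / s"] by linarith
  qed (use r1[of g] in auto)
  have f0: "0 \<le> ?f g" for g using r1[of g] by (simp add: add_nonneg_nonneg)
  have b1: "1 / (1 + (ip n x g / s)\<^sup>2) \<le> 1" for g by (simp add: add_pos_nonneg)
  have fi: "integrable (gam n) ?f"
  proof (rule g.integrable_const_bound[of _ 1])
    show "AE g in gam n. norm (?f g) \<le> 1"
    proof (intro AE_I2)
      fix g show "norm (?f g) \<le> 1" using f0[of g] fb[of g] b1[of g] by (metis abs_of_nonneg order_trans real_norm_def)
    qed
  qed measurable
  have ki: "integrable (gam n) (\<lambda>g. 1 / (1 + (ip n x g / s)\<^sup>2))"
    by (rule g.integrable_const_bound[of _ 1]) (use b1 in \<open>auto simp: abs_of_nonneg add_nonneg_nonneg\<close>)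
  have "(\<integral>g. ?f g \<partial>gam n) \<le> (\<integral>g. 1 / (1 + (ip n x g / s)\<^sup>2) \<partial>gam n)"
    by (intro integral_mono fi ki fb)
  then have fc: "(\<integral>g. ?f g \<partial>gam n) \<le> c" using k by linarith
  have kp: "0 < kap ^ n" using kap by simp
  have "measure (gams J n) ?E \<le> (\<integral>g. ?f g \<partial>gam n) ^ card J / (exp (- real n) / (kap ^ n)\<^sup>2)"
  proof (rule markov_gams[OF J fi E])
    show "0 < exp (- real n) / (kap ^ n)\<^sup>2" using kap by (intro divide_pos_pos zero_less_power) auto
    fix A assume A: "A \<in> ?E"
    define y where "y i = (ip n x (A i))\<^sup>2 / (trunc_norm K n (A i))\<^sup>2 / s\<^sup>2" for i
    define r where "r i = trunc_norm K n (A i)" for i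
    have r: "1 \<le> r i" for i by (simp add: r_def trunc_norm_ge1)
    have y0: "0 \<le> y i" for i by (simp add: y_def)
    have "(\<Sum>i\<in>J. y i) = (\<Sum>i\<in>J. (ip n x (A i))\<^sup>2 / (trunc_norm K n (A i))\<^sup>2) / s\<^sup>2"
      by (simp add: y_def sum_divide_distrib)
    also have "\<dots> \<le> n" using A s by (simp add: pos_divide_le_eq mult.commute)
    finally have sy: "(\<Sum>i\<in>J. y i) \<le> n" .
    have fe: "?f (A i) = inverse ((r i)\<^sup>2) * inverse (1 + y i)" for i
    proof -
      have "(r i)\<^sup>2 + (ip n x (A i) / s)\<^sup>2 = (r i)\<^sup>2 * (1 + y i)"
        using r[of i] by (simp add: y_def r_def[symmetric] power_divide field_simps)
      then show ?thesis by (simp add: r_def divide_inverse)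
    qed
    have "(\<Prod>i\<in>J. 1 + y i) \<le> (\<Prod>i\<in>J. exp (y i))"
      using y0 exp_ge_add_one_self by (intro prod_mono conjI) (auto simp: add_nonneg_nonneg)
    also have "\<dots> \<le> exp n" using sy by (simp add: exp_sum[OF J, symmetric])
    finally have p1: "inverse (exp n) \<le> inverse (\<Prod>i\<in>J. 1 + y i)"
      using y0 by (intro le_imp_inverse_le prod_pos) (auto simp: add_pos_nonneg)
    have "0 < (\<Prod>i\<in>J. r i)" by (intro prod_pos) (use r in \<open>force intro: less_le_trans[of 0 1]\<close>)
    moreover have "(\<Prod>i\<in>J. r i) \<le> kap ^ n" using A by (simp add: r_def)
    ultimately have p2: "inverse ((kap ^ n)\<^sup>2) \<le> inverse ((\<Prod>i\<in>J. r i)\<^sup>2)"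
      by (intro le_imp_inverse_le power_mono) auto
    have "exp (- real n) / (kap ^ n)\<^sup>2 = inverse ((kap ^ n)\<^sup>2) * inverse (exp n)"
      by (simp add: exp_minus divide_inverse)
    also have "\<dots> \<le> inverse ((\<Prod>i\<in>J. r i)\<^sup>2) * inverse (\<Prod>i\<in>J. 1 + y i)"
      by (intro mult_mono p1 p2) auto
    also have "\<dots> = (1 / (\<Prod>i\<in>J. r i)\<^sup>2) * (1 / (\<Prod>i\<in>J. 1 + y i))" by (simp only: inverse_eq_divide)
    also have "\<dots> = (\<Prod>i\<in>J. (1 / (r i)\<^sup>2) * (1 / (1 + y i)))"
      by (simp only: prod.distrib prod_dividef prod_power_distrib prod.neutral_const)
    also have "\<dots> = (\<Prod>i\<in>J. ?f (A i))"
      unfolding fe by (simp only: inverse_eq_divide)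
    finally show "exp (- real n) / (kap ^ n)\<^sup>2 \<le> (\<Prod>i\<in>J. ?f (A i))" .
  qed (rule f0)
  also have "\<dots> = exp n * (kap ^ n)\<^sup>2 * (\<integral>g. ?f g \<partial>gam n) ^ card J"
    by (simp add: exp_minus field_simps)
  also have "\<dots> \<le> exp n * (kap ^ n)\<^sup>2 * c ^ card J"
    by (intro mult_left_mono power_mono fc) (auto intro: integral_nonneg_AE f0)
  finally show "measure (gams J n) ?E \<le> exp n * (kap ^ n)\<^sup>2 * c ^ card J" .
qed

text \<open>By subadditivity of the defect, two multiples of \<open>s0\<close> with small defect that are close to each other have
a difference with small defect, and near the origin the defect is at least quadratic. In a block of length about
\<open>ell/s0\<close> the sum is therefore dominated by a Gaussian sum around the minimum; the Gaussian factor bounds the number of blocks.\<close>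

lemma level_sum:
  assumes e: "0 < e" "e \<le> 8 * s0 / (ell * beta)"
  shows "(\<Sum>k\<in>{- int N..int N}. exp (- (defect 0 (s0 * k) / tau + e\<^sup>2 * (real_of_int k)\<^sup>2)))
     \<le> 2592 * ups / (beta * ell * al * e)"
proof -
  define f where "f k = exp (- (defect 0 (s0 * k) / tau + e\<^sup>2 * (real_of_int k)\<^sup>2))" for k :: int
  define L where "L = nat \<lfloor>ell / s0\<rfloor>"
  have Ls: "1 \<le> ell / s0" using s0 ell by (simp add: field_simps)
  have L: "1 \<le> L" "real L \<le> ell / s0" "ell / (2 * s0) \<le> L"
  proof -
    show l1: "1 \<le> L" using Ls unfolding L_def by linarith
    show "real L \<le> ell / s0" using Ls unfolding L_def by linarith
    have "ell / s0 < real L + 1" using Ls unfolding L_def by linarith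
    then have "ell / s0 \<le> 2 * real L" using l1 by linarith
    then show "ell / (2 * s0) \<le> L" by simp
  qed
  define y where "y = s0 * al / (2 * ups)"
  have y: "0 < y" "y \<le> 1"
  proof -
    show "0 < y" using s0 al ups by (simp add: y_def)
    have "s0 * al \<le> ups * 1" using s0 tau ups al by (intro mult_mono) auto
    then show "y \<le> 1" using ups by (simp add: y_def)
  qed
  \<comment> \<open>within a block, all points but those near one minimiser have a large defect\<close>
  have block: "(\<Sum>r<L. exp (- (defect 0 (s0 * (b * L + r)) / tau))) \<le> 12 / y" for b :: nat
  proof -
    let ?d = "\<lambda>r::nat. defect 0 (s0 * (b * L + r))"
    have "finite (?d ` {..<L})" "?d ` {..<L} \<noteq> {}" using L(1) by (auto simp: lessThan_empty_iff)
    from Min_in[OF this] obtain r0 where r0: "r0 < L" "?d r0 = Min (?d ` {..<L})" by auto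
    have mn: "?d r0 \<le> ?d r" if "r < L" for r using r0 that by simp
    have pt: "exp (- (?d r / tau)) \<le> exp (- (y * (real r - real r0))\<^sup>2)" if r: "r < L" for r
    proof -
      have "defect 0 (s0 * (real r - real r0)) = defect 0 (s0 * (b * L + r) + - (s0 * (b * L + r0)))"
        by (simp add: algebra_simps)
      also have "\<dots> \<le> 2 * ?d r + 2 * defect 0 (- (s0 * (b * L + r0)))" by (rule defect_add)
      also have "\<dots> \<le> 4 * ?d r" using mn[OF r] by (subst defect_minus) auto
      finally have 1: "defect 0 (s0 * (real r - real r0)) \<le> 4 * ?d r" .
      have "al * (s0 * (real r - real r0))\<^sup>2 \<le> defect 0 (s0 * (real r - real r0))"
      proof (rule low)
        have "\<bar>real r - real r0\<bar> \<le> L" using r r0 by linarith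
        then have "s0 * \<bar>real r - real r0\<bar> \<le> s0 * (ell / s0)" using L s0 by (intro mult_left_mono) auto
        then show "\<bar>s0 * (real r - real r0)\<bar> \<le> ell" using s0 by (simp add: abs_mult)
      qed
      then have 2: "al * (s0 * (real r - real r0))\<^sup>2 / (4 * tau) \<le> ?d r / tau"
        using 1 tau by (simp add: field_simps)
      have "(y * (real r - real r0))\<^sup>2 = al * (al * (s0 * (real r - real r0))\<^sup>2 / (4 * tau))"
        using ups by (simp add: y_def tau_def power_mult_distrib power_divide power2_eq_square)
      also have "\<dots> \<le> 1 * (al * (s0 * (real r - real r0))\<^sup>2 / (4 * tau))"
        using al tau by (intro mult_right_mono) auto
      finally show ?thesis using 2 by simp
    qed
    have "(\<Sum>r<L. exp (- (?d r / tau))) \<le> (\<Sum>r<L. exp (- (y * (real r - real r0))\<^sup>2))"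
      by (intro sum_mono pt) auto
    also have "\<dots> \<le> (\<Sum>r\<in>{..<r0}. exp (- (y * (real r - real r0))\<^sup>2)) + (\<Sum>r\<in>{r0..<L}. exp (- (y * (real r - real r0))\<^sup>2))"
      using sum.atLeastLessThan_concat[of 0 r0 L "\<lambda>r. exp (- (y * (real r - real r0))\<^sup>2)"] r0(1)
      unfolding lessThan_atLeast0 by simp
    also have "(\<Sum>r\<in>{..<r0}. exp (- (y * (real r - real r0))\<^sup>2)) \<le> (\<Sum>d<L. exp (- (y * real d)\<^sup>2))"
    proof -
      have "(\<Sum>r\<in>{..<r0}. exp (- (y * (real r - real r0))\<^sup>2)) = (\<Sum>d\<in>{1..r0}. exp (- (y * real d)\<^sup>2))"
        by (rule sum.reindex_bij_witness[of _ "\<lambda>d. r0 - d" "\<lambda>r. r0 - r"])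
           (auto simp: of_nat_diff power_mult_distrib power2_commute)
      also have "\<dots> \<le> (\<Sum>d<L. exp (- (y * real d)\<^sup>2))" using r0 by (intro sum_mono2) auto
      finally show ?thesis .
    qed
    also have "(\<Sum>r\<in>{r0..<L}. exp (- (y * (real r - real r0))\<^sup>2)) \<le> (\<Sum>d<L. exp (- (y * real d)\<^sup>2))"
    proof -
      have "(\<Sum>r\<in>{r0..<L}. exp (- (y * (real r - real r0))\<^sup>2)) = (\<Sum>d\<in>{..<L - r0}. exp (- (y * real d)\<^sup>2))"
        by (rule sum.reindex_bij_witness[of _ "\<lambda>d. r0 + d" "\<lambda>r. r - r0"]) (auto simp: of_nat_diff)
      also have "\<dots> \<le> (\<Sum>d<L. exp (- (y * real d)\<^sup>2))" by (intro sum_mono2) auto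
      finally show ?thesis .
    qed
    finally have "(\<Sum>r<L. exp (- (?d r / tau))) \<le> 2 * (\<Sum>d<L. exp (- (y * real d)\<^sup>2))" by simp
    also have "\<dots> \<le> 2 * (3 * (1 + 1 / y))" by (intro mult_left_mono gauss_sum_le y) auto
    also have "\<dots> \<le> 12 / y" using y by (simp add: field_simps)
    finally show ?thesis .
  qed
  have "(\<Sum>k\<in>{- int N..int N}. f k) = f 0 + 2 * (\<Sum>k=1..N. f (int k))"
    by (rule sum_int_even) (simp add: f_def defect_minus)
  also have "\<dots> \<le> 2 * (\<Sum>k\<le>N. f (int k))"
  proof -
    have "(\<Sum>k\<le>N. f (int k)) = f 0 + (\<Sum>k=1..N. f (int k))"
      unfolding atMost_atLeast0 by (subst sum.atLeast_Suc_atMost) auto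
    moreover have "0 \<le> f 0" by (simp add: f_def)
    ultimately show ?thesis by simp
  qed
  also have "(\<Sum>k\<le>N. f (int k)) \<le> (\<Sum>k<Suc N * L. f (int k))"
  proof (rule sum_mono2)
    show "{..N} \<subseteq> {..<Suc N * L}"
    proof
      fix k assume "k \<in> {..N}"
      then have "k < Suc N * 1" by simp
      also have "\<dots> \<le> Suc N * L" using L(1) by (intro mult_le_mono) auto
      finally show "k \<in> {..<Suc N * L}" by simp
    qed
  qed (auto simp: f_def)
  also have "(\<Sum>k<Suc N * L. f (int k)) = (\<Sum>b<Suc N. \<Sum>k\<in>{b * L..<b * L + L}. f (int k))"
    by (simp only: sum.nat_group)
  also have "\<dots> = (\<Sum>b<Suc N. \<Sum>r<L. f (int (b * L + r)))"
  proof (rule sum.cong[OF refl])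
    fix b
    show "(\<Sum>k\<in>{b * L..<b * L + L}. f (int k)) = (\<Sum>r<L. f (int (b * L + r)))"
      by (rule sum.reindex_bij_witness[of _ "\<lambda>r. b * L + r" "\<lambda>k. k - b * L"]) auto
  qed
  also have "\<dots> \<le> (\<Sum>b<Suc N. exp (- ((e * L) * real b)\<^sup>2) * (12 / y))"
  proof (intro sum_mono)
    fix b
    have "(\<Sum>r<L. f (int (b * L + r))) \<le> (\<Sum>r<L. exp (- ((e * L) * real b)\<^sup>2) * exp (- (defect 0 (s0 * (b * L + r)) / tau)))"
    proof (intro sum_mono)
      fix r
      have "((e * L) * real b)\<^sup>2 \<le> (e * real (b * L + r))\<^sup>2"
        using e by (intro power_mono) (auto simp: mult_ac distrib_left)
      then have "e\<^sup>2 * (real_of_int (int (b * L + r)))\<^sup>2 \<ge> ((e * L) * real b)\<^sup>2" by (simp add: power_mult_distrib)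
      then show "f (int (b * L + r)) \<le> exp (- ((e * L) * real b)\<^sup>2) * exp (- (defect 0 (s0 * (b * L + r)) / tau))"
        unfolding f_def mult_exp_exp by simp
    qed
    also have "\<dots> \<le> exp (- ((e * L) * real b)\<^sup>2) * (12 / y)"
      unfolding sum_distrib_left[symmetric] by (intro mult_left_mono block) auto
    finally show "(\<Sum>r<L. f (int (b * L + r))) \<le> exp (- ((e * L) * real b)\<^sup>2) * (12 / y)" .
  qed
  also have "\<dots> \<le> (3 * (1 + 1 / (e * L))) * (12 / y)"
    unfolding sum_distrib_right[symmetric] using y e L by (intro mult_right_mono gauss_sum_le) auto
  also have "3 * (1 + 1 / (e * L)) \<le> 54 * s0 / (beta * ell * e)"
  proof -
    have "e * L \<le> 8 * s0 / (ell * beta) * (ell / s0)" using e L by (intro mult_mono) auto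
    also have "\<dots> = 8 / beta" using s0 ell by simp
    finally have "beta * (e * L) \<le> 8" using beta by (simp add: pos_le_divide_eq mult.commute)
    moreover have eL: "0 < e * L" using e L by simp
    ultimately have "1 \<le> 8 / (beta * (e * L))" using beta by (intro le_divide_eq_1_pos[THEN iffD2]) auto
    then have "1 \<le> (8 / beta) * (1 / (e * L))" by simp
    moreover have "1 * (1 / (e * L)) \<le> (1 / beta) * (1 / (e * L))"
      using beta eL by (intro mult_right_mono) auto
    moreover have "(9 / beta) * (1 / (e * L)) = (8 / beta) * (1 / (e * L)) + (1 / beta) * (1 / (e * L))"
      by (simp add: add_divide_distrib[symmetric] distrib_right[symmetric])
    moreover have "1 + w \<le> q" if "1 \<le> x" "1 * w \<le> z" "q = x + z" for x w z q :: real using that by linarith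
    ultimately have "1 + 1 / (e * L) \<le> (9 / beta) * (1 / (e * L))" by blast
    also have "1 / (e * L) \<le> 1 / (e * (ell / (2 * s0)))"
      using e L ell s0 by (intro divide_left_mono mult_left_mono mult_pos_pos) auto
    then have "(9 / beta) * (1 / (e * L)) \<le> (9 / beta) * (1 / (e * (ell / (2 * s0))))"
      using beta by (intro mult_left_mono) auto
    also have "\<dots> = 18 * s0 / (beta * ell * e)" using e ell s0 beta by (simp add: field_simps)
    finally show ?thesis by simp
  qed
  then have "(3 * (1 + 1 / (e * L))) * (12 / y) \<le> 54 * s0 / (beta * ell * e) * (12 / y)"
    using y by (intro mult_right_mono) auto
  also have "\<dots> = 1296 * ups / (beta * ell * al * e)"
    using s0 al ups by (simp add: y_def field_simps)
  finally show ?thesis unfolding f_def by simp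
qed

end

section \<open>Normal vectors are unstructured\<close>

locale level = level0 +
  assumes big: "6 / s0\<^sup>2 \<le> n"
begin

text \<open>The arguments at which structure may first show up form an arithmetic progression. At the level \<open>theta g\<close> vectors are
rounded to multiples of \<open>mesh g\<close>, so that \<open>theta g\<close> times a lattice point is a multiple of \<open>s0\<close>.\<close>

definition theta :: "nat \<Rightarrow> real" where "theta g = th0 + g * (s0 / 2)"
definition mesh :: "nat \<Rightarrow> real" where "mesh g = s0 / theta g"
definition width :: "nat \<Rightarrow> real" where "width g = mesh g * sqrt n"
definition top :: real where "top = exp (tau * n / 16)"

lemma theta: "th0 \<le> theta g" "0 < theta g"
  using th0 s0 by (auto simp: theta_def intro: add_pos_nonneg)

lemma mesh_pos: "0 < mesh g" using theta s0 by (simp add: mesh_def)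

lemma mesh_theta: "theta g * mesh g = s0" using theta[of g] by (simp add: mesh_def)

lemma width: "0 < width g" "width g \<le> 8 * s0 / (ell * beta)" "width g \<le> rho / 2" "(mesh g)\<^sup>2 * n = (width g)\<^sup>2"
proof -
  have sn: "0 < sqrt n" using n1 by simp
  show "0 < width g" using mesh_pos sn by (simp add: width_def)
  have "mesh g \<le> s0 / th0" unfolding mesh_def using theta[of g] th0 s0 by (intro divide_left_mono) auto
  then have "width g \<le> s0 / th0 * sqrt n" unfolding width_def using sn by (intro mult_right_mono) auto
  also have "\<dots> = 8 * s0 / (ell * beta)" using sn by (simp add: th0_def)
  finally show a: "width g \<le> 8 * s0 / (ell * beta)" .
  also have "\<dots> \<le> rho / 2"
  proof -
    have "0 < ell * beta" using ell beta by simp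
    moreover have "8 * s0 \<le> rho / 2 * (ell * beta)" using s0(3) by simp
    ultimately show ?thesis by (simp only: pos_divide_le_eq)
  qed
  finally show "width g \<le> rho / 2" .
  show "(mesh g)\<^sup>2 * n = (width g)\<^sup>2" by (simp add: width_def power_mult_distrib)
qed

lemma inverse_s0: "1 / s0 \<le> n" "256 / tau \<le> n" "1 \<le> s0 * sqrt n" "3 / s0\<^sup>2 \<le> n / 2"
proof -
  have i: "1 \<le> 1 / s0" using s0 by simp
  have sq: "1 / s0\<^sup>2 = (1 / s0) * (1 / s0)" by (simp add: power2_eq_square)
  have "(1 / s0) * 1 \<le> (1 / s0) * (1 / s0)" using i s0 by (intro mult_left_mono) auto
  moreover have "6 / s0\<^sup>2 = 6 * (1 / s0\<^sup>2)" by simp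
  moreover have "0 \<le> 1 / s0\<^sup>2" by simp
  ultimately show a: "1 / s0 \<le> n" using big sq by linarith
  have "256 / tau \<le> 256 * t / tau" using t tau by (simp add: divide_right_mono)
  also have "\<dots> = 1 / s0" using t tau by (simp add: s0_def)
  finally show "256 / tau \<le> n" using a by linarith
  have "1 / s0\<^sup>2 \<le> n" using big \<open>6 / s0\<^sup>2 = 6 * (1 / s0\<^sup>2)\<close> \<open>0 \<le> 1 / s0\<^sup>2\<close> by linarith
  then have "1 \<le> s0\<^sup>2 * n" using s0 by (simp add: pos_divide_le_eq mult.commute)
  then have "sqrt 1 \<le> sqrt (s0\<^sup>2 * n)" by (rule real_sqrt_le_mono)
  then show "1 \<le> s0 * sqrt n" using s0 by (simp add: real_sqrt_mult)
  have "3 / s0\<^sup>2 = (6 / s0\<^sup>2) / 2" by simp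
  then show "3 / s0\<^sup>2 \<le> n / 2" using big by linarith
qed

lemma defect_tiny: assumes "\<bar>s\<bar> \<le> 2 * s0" shows "defect 0 s \<le> tau / 8"
proof (rule defect_small[OF mass _ n1])
  show "0 < t" using t by simp
  show "32 / (tau / 8) \<le> n" using inverse_s0(2) by simp
  show "\<bar>s\<bar> \<le> tau / 8 / (16 * t)" using assms by (simp add: s0_def)
qed (use tau in simp)

definition level_net :: "nat \<Rightarrow> (nat \<Rightarrow> int) set" where
  "level_net g = {z \<in> PiE {..<n} (\<lambda>_. {- int (nat \<lceil>4 / (mesh g)\<^sup>2\<rceil>)..int (nat \<lceil>4 / (mesh g)\<^sup>2\<rceil>)}).
     (\<Sum>j<n. (real_of_int (z j))\<^sup>2) \<le> 4 / (mesh g)\<^sup>2 \<and>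
     spread (rho / 2) (\<lambda>j. mesh g * z j) \<and> psis n (\<lambda>j. mesh g * z j) (theta g) \<le> 5 * tau * n \<and>
     (\<forall>th. th0 \<le> th \<longrightarrow> th \<le> theta g \<longrightarrow> tau * n / 4 \<le> psis n (\<lambda>j. mesh g * z j) th)}"

text \<open>The generating function count \<open>weighted_count\<close>, with the sum over one coordinate bounded by \<open>level_sum\<close>: the
condition on \<open>psis\<close> at \<open>theta g\<close> is what makes the net small.\<close>

lemma level_net_card:
  "finite (level_net g)"
  "card (level_net g) \<le> exp (9 * n) * (2592 * ups / (beta * ell * al * width g)) ^ n"
proof -
  define N where "N = nat \<lceil>4 / (mesh g)\<^sup>2\<rceil>"
  define w where "w k = defect 0 (s0 * k) / tau + (width g)\<^sup>2 * (real_of_int k)\<^sup>2" for k :: int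
  have sub: "level_net g \<subseteq> PiE {..<n} (\<lambda>_. {- int N..int N})"
    unfolding level_net_def N_def by (rule Collect_restrict)
  have ww: "(\<Sum>j<n. w (z j)) \<le> 9 * n" if z: "z \<in> level_net g" for z
  proof -
    have m: "theta g * (mesh g * y) = s0 * y" for y
      using mesh_theta[of g] by (metis mult.assoc)
    have "(\<Sum>j<n. w (z j)) = psis n (\<lambda>j. mesh g * z j) (theta g) / tau + (width g)\<^sup>2 * (\<Sum>j<n. (real_of_int (z j))\<^sup>2)"
      by (simp add: w_def psis_def sum.distrib sum_distrib_left sum_divide_distrib m)
    also have "\<dots> \<le> (5 * tau * n) / tau + (width g)\<^sup>2 * (4 / (mesh g)\<^sup>2)"
      using z tau by (intro add_mono divide_right_mono mult_left_mono) (auto simp: level_net_def)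
    also have "(width g)\<^sup>2 * (4 / (mesh g)\<^sup>2) = 4 * n" using mesh_pos[of g] unfolding width(4)[symmetric] by simp
    finally show ?thesis using tau by simp
  qed
  note wc = weighted_count[OF finite_atLeastAtMost_int sub ww]
  show "finite (level_net g)" by (rule wc(1))
  have "card (level_net g) \<le> exp (9 * n) * (\<Sum>k\<in>{- int N..int N}. exp (- w k)) ^ n" by (rule wc(2))
  also have "\<dots> \<le> exp (9 * n) * (2592 * ups / (beta * ell * al * width g)) ^ n"
    unfolding w_def using width by (intro mult_left_mono power_mono level_sum sum_nonneg) auto
  finally show "card (level_net g) \<le> exp (9 * n) * (2592 * ups / (beta * ell * al * width g)) ^ n" .
qed

lemma trunc_norm_controls: "nsq n a \<le> (trunc_norm K n a)\<^sup>2 * (K\<^sup>2 * n)"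
proof -
  have "sqrt (nsq n a) / (K * sqrt n) \<le> trunc_norm K n a" by (simp add: trunc_norm_def)
  moreover have "0 < K * sqrt n" using K n1 by simp
  ultimately have "sqrt (nsq n a) \<le> trunc_norm K n a * (K * sqrt n)" by (simp only: pos_divide_le_eq)
  then have "(sqrt (nsq n a))\<^sup>2 \<le> (trunc_norm K n a * (K * sqrt n))\<^sup>2" by (intro power_mono) auto
  then show ?thesis by (simp add: power_mult_distrib)
qed

text \<open>The weights \<open>1/T\<^sup>2\<close>, for \<open>T\<close> the truncated norm of a row, make the error of \<open>greedy_rounding\<close> independent of the row norms.
The properties of \<open>psis\<close> pass to the lattice point by subadditivity.\<close>

lemma level_rounding:
  assumes v: "nsq n v = 1" and sp: "beta * n \<le> card {j \<in> {..<n}. rho / sqrt n \<le> \<bar>v j\<bar>}"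
    and J: "finite J" "card J \<le> n" and ort: "\<And>i. i \<in> J \<Longrightarrow> ip n v (A i) = 0"
    and good: "\<And>th. th0 \<le> th \<Longrightarrow> th \<le> theta g \<Longrightarrow> tau * n \<le> psis n v th"
    and bad: "theta g \<le> th" "th \<le> theta g + s0 / 2" "psis n v th < tau * n"
  shows "\<exists>z\<in>level_net g. (\<Sum>i\<in>J. (ip n (\<lambda>j. mesh g * z j) (A i))\<^sup>2 / (trunc_norm K n (A i))\<^sup>2) \<le> (K * width g)\<^sup>2 * n"
proof -
  define u where "u = mesh g"
  have u: "0 < u" using mesh_pos by (simp add: u_def)
  have r1: "1 \<le> trunc_norm K n a" for a by (rule trunc_norm_ge1)
  have c0: "0 \<le> 1 / (trunc_norm K n (A i))\<^sup>2" for i by simp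
  from greedy_rounding[where c = "\<lambda>i. 1 / (trunc_norm K n (A i))\<^sup>2" and n = n and x = v and g = A and l = "\<lambda>_. 0", OF J(1) c0 u]
  obtain z0 :: "nat \<Rightarrow> int" where z00: "(\<forall>j<n. z0 j = \<lfloor>v j / u\<rfloor> \<or> z0 j = \<lceil>v j / u\<rceil>) \<and>
    (\<Sum>i\<in>J. 1 / (trunc_norm K n (A i))\<^sup>2 * (ip n (A i) (\<lambda>j. u * z0 j - v j))\<^sup>2) + (\<Sum>j<n. 0 * (u * z0 j - v j))
      \<le> u\<^sup>2 * (\<Sum>i\<in>J. 1 / (trunc_norm K n (A i))\<^sup>2 * nsq n (A i))"
    by (elim exE)
  note z0 = conjunct1[OF z00] and le = conjunct2[OF z00]
  define z where "z = restrict z0 {..<n}"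
  have zz: "z j = \<lfloor>v j / u\<rfloor> \<or> z j = \<lceil>v j / u\<rceil>" if "j < n" for j using z0 that by (simp add: z_def)
  define w where "w j = u * z j - v j" for j
  have wj: "\<bar>w j\<bar> \<le> u" if "j < n" for j
    unfolding w_def using floor_ceiling_close(1)[OF u zz[OF that]] .
  have ipw: "ip n (A i) (\<lambda>j. u * z0 j - v j) = ip n (A i) w" for i
    unfolding ip_def w_def z_def by (intro sum.cong) auto
  let ?x = "\<lambda>j. u * real_of_int (z j)"
  have xw: "?x = (\<lambda>j. v j + w j)" by (simp add: w_def)
  have ipx: "ip n ?x (A i) = ip n (A i) w" if "i \<in> J" for i
    unfolding xw ip_commute[of n _ "A i"] ip_add_right using ort[OF that] by (simp add: ip_commute)
  have sum_le: "(\<Sum>i\<in>J. (ip n ?x (A i))\<^sup>2 / (trunc_norm K n (A i))\<^sup>2) \<le> (K * width g)\<^sup>2 * n"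
  proof -
    have "(\<Sum>i\<in>J. (ip n ?x (A i))\<^sup>2 / (trunc_norm K n (A i))\<^sup>2)
       = (\<Sum>i\<in>J. 1 / (trunc_norm K n (A i))\<^sup>2 * (ip n (A i) (\<lambda>j. u * z0 j - v j))\<^sup>2)"
      using ipx ipw by (intro sum.cong refl) simp
    also have "\<dots> \<le> u\<^sup>2 * (\<Sum>i\<in>J. 1 / (trunc_norm K n (A i))\<^sup>2 * nsq n (A i))" using le by simp
    also have "\<dots> \<le> u\<^sup>2 * (\<Sum>i\<in>J. K\<^sup>2 * n)"
    proof (intro mult_left_mono sum_mono)
      fix i
      have "0 < (trunc_norm K n (A i))\<^sup>2" using r1[of "A i"] by (intro zero_less_power) linarith
      then have "nsq n (A i) / (trunc_norm K n (A i))\<^sup>2 \<le> K\<^sup>2 * n"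
        using trunc_norm_controls[of "A i"] by (subst pos_divide_le_eq) (auto simp: mult.commute)
      then show "1 / (trunc_norm K n (A i))\<^sup>2 * nsq n (A i) \<le> K\<^sup>2 * n" by simp
    qed simp
    also have "\<dots> = u\<^sup>2 * (card J * (K\<^sup>2 * n))" by simp
    also have "\<dots> \<le> u\<^sup>2 * (n * (K\<^sup>2 * n))" using J by (intro mult_left_mono mult_right_mono) auto
    also have "\<dots> = K\<^sup>2 * ((mesh g)\<^sup>2 * n) * n" by (simp add: u_def)
    also have "\<dots> = (K * width g)\<^sup>2 * n" unfolding width(4) by (simp add: power_mult_distrib)
    finally show ?thesis .
  qed
  have nw: "nsq n w \<le> 1/4"
  proof -
    have "nsq n w \<le> (\<Sum>j<n. u\<^sup>2)" unfolding nsq_def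
    proof (intro sum_mono)
      fix j assume "j \<in> {..<n}"
      then show "(w j)\<^sup>2 \<le> u\<^sup>2" using wj[of j] u by (metis abs_le_square_iff abs_of_pos lessThan_iff)
    qed
    also have "\<dots> = (width g)\<^sup>2" using width(4)[of g] by (simp add: u_def mult.commute)
    also have "\<dots> \<le> (1/2)\<^sup>2" using width[of g] rho1 by (intro power_mono) auto
    finally show ?thesis by (simp add: power2_eq_square)
  qed
  have nx: "nsq n ?x \<le> 4"
    using nsq_add_le[of n v w] v nw unfolding xw by linarith
  have spx: "spread (rho / 2) ?x"
    unfolding spread_def
  proof (intro conjI nx)
    have "{j \<in> {..<n}. rho / sqrt n \<le> \<bar>v j\<bar>} \<subseteq> {j \<in> {..<n}. rho / 2 / sqrt n \<le> \<bar>?x j\<bar>}"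
    proof clarsimp
      fix j assume j: "j < n" "rho / sqrt n \<le> \<bar>v j\<bar>"
      have "u * sqrt n \<le> rho / 2" using width(3)[of g] by (simp add: width_def u_def)
      then have "u \<le> rho / 2 / sqrt n" using n1 by (simp add: pos_le_divide_eq)
      moreover have "rho / sqrt n = rho / 2 / sqrt n + rho / 2 / sqrt n" by simp
      moreover have "u * real_of_int (z j) = v j + w j" by (simp add: w_def)
      then have "\<bar>v j\<bar> - \<bar>w j\<bar> \<le> \<bar>u * real_of_int (z j)\<bar>" by linarith
      ultimately have "rho / 2 / sqrt n \<le> \<bar>?x j\<bar>" using j wj[of j] by linarith
      then show "rho / (2 * sqrt n) \<le> \<bar>u * real_of_int (z j)\<bar>" by simp
    qed
    then have "card {j \<in> {..<n}. rho / sqrt n \<le> \<bar>v j\<bar>} \<le> card {j \<in> {..<n}. rho / 2 / sqrt n \<le> \<bar>?x j\<bar>}"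
      by (intro card_mono) auto
    then show "beta * n \<le> card {j \<in> {..<n}. rho / 2 / sqrt n \<le> \<bar>?x j\<bar>}" using sp by linarith
  qed
  have pw: "psis n w a \<le> n * (tau / 8)" if a: "0 \<le> a" "a \<le> theta g + s0 / 2" for a
  proof (intro psis_le defect_tiny)
    fix j assume j: "j < n"
    have "\<bar>a * w j\<bar> \<le> (theta g + s0 / 2) * u" unfolding abs_mult using a wj[OF j] u by (intro mult_mono) auto
    also have "\<dots> \<le> (2 * theta g) * u" using theta[of g] s0 u by (intro mult_right_mono) auto
    also have "\<dots> = 2 * s0" using mesh_theta[of g] by (simp add: u_def)
    finally show "\<bar>a * w j\<bar> \<le> 2 * s0" .
  qed
  have px: "psis n ?x (theta g) \<le> 5 * tau * n"
  proof -
    have 1: "psis n ?x th \<le> 2 * psis n v th + 2 * psis n w th" unfolding xw by (rule psis_add_vec)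
    have 2: "psis n w th \<le> n * (tau / 8)" using bad theta[of g] by (intro pw) auto
    have 3: "psis n ?x (theta g) \<le> 2 * psis n ?x th + 2 * psis n ?x (theta g - th)"
      using psis_add_arg[of n ?x th "theta g - th"] by simp
    have 4: "psis n ?x (theta g - th) \<le> n * (tau / 8)"
    proof (intro psis_le defect_tiny)
      fix j assume j: "j < n"
      have "(?x j)\<^sup>2 \<le> nsq n ?x" unfolding nsq_def using j by (intro member_le_sum) auto
      then have "(?x j)\<^sup>2 \<le> 2\<^sup>2" using nx by simp
      then have "\<bar>?x j\<bar> \<le> 2" using abs_le_square_iff[of "?x j" 2] by simp
      then have "\<bar>theta g - th\<bar> * \<bar>?x j\<bar> \<le> (s0 / 2) * 2" using bad by (intro mult_mono) auto
      then show "\<bar>(theta g - th) * ?x j\<bar> \<le> 2 * s0" using s0 unfolding abs_mult by linarith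
    qed
    have 5: "n * (tau / 8) = tau * n / 8" by simp
    have "0 \<le> tau * n" using tau by simp
    then show ?thesis using 1 2 3 4 bad(3) unfolding 5 by linarith
  qed
  have gx: "tau * n / 4 \<le> psis n ?x a" if a: "th0 \<le> a" "a \<le> theta g" for a
  proof -
    have e1: "(\<lambda>j. ?x j + - w j) = v" by (simp add: w_def)
    have e2: "psis n (\<lambda>j. - w j) a = psis n w a" by (simp add: psis_def defect_minus)
    have "psis n v a \<le> 2 * psis n ?x a + 2 * psis n w a"
      using psis_add_vec[of n ?x "\<lambda>j. - w j" a] unfolding e1 e2 .
    moreover have "psis n w a \<le> n * (tau / 8)" using a th0 s0 by (intro pw) auto
    moreover have "n * (tau / 8) = tau * n / 8" by simp
    moreover have "0 \<le> tau * n" using tau by simp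
    ultimately show ?thesis using good[OF a] by linarith
  qed
  have zsq: "(\<Sum>j<n. (real_of_int (z j))\<^sup>2) \<le> 4 / u\<^sup>2"
  proof -
    have "(\<Sum>j<n. (real_of_int (z j))\<^sup>2) * u\<^sup>2 \<le> 4"
      using nx unfolding nsq_def power_mult_distrib sum_distrib_left[symmetric] by (simp only: mult.commute)
    then show ?thesis using u by (subst pos_le_divide_eq) auto
  qed
  have "z \<in> level_net g"
    unfolding level_net_def u_def[symmetric]
  proof (intro CollectI conjI allI impI zsq spx px gx PiE_I)
    fix j assume j: "j \<in> {..<n}"
    have "\<bar>z j\<bar> \<le> (z j)\<^sup>2"
    proof (cases "z j = 0")
      case False
      then have "\<bar>z j\<bar> * 1 \<le> \<bar>z j\<bar> * \<bar>z j\<bar>" by (intro mult_left_mono) auto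
      then show ?thesis by (simp add: power2_eq_square)
    qed simp
    then have "\<bar>real_of_int (z j)\<bar> \<le> (real_of_int (z j))\<^sup>2" by (metis of_int_abs of_int_le_iff of_int_power)
    also have "\<dots> \<le> (\<Sum>j<n. (real_of_int (z j))\<^sup>2)" using j by (intro member_le_sum) auto
    finally have "\<bar>real_of_int (z j)\<bar> \<le> 4 / u\<^sup>2" using zsq by linarith
    then have "\<bar>z j\<bar> \<le> int (nat \<lceil>4 / u\<^sup>2\<rceil>)" by linarith
    then show "z j \<in> {- int (nat \<lceil>4 / u\<^sup>2\<rceil>)..int (nat \<lceil>4 / u\<^sup>2\<rceil>)}" by auto
  qed (auto simp: z_def)
  then show ?thesis using sum_le unfolding u_def by blast
qed

text \<open>This inequality dictates the choice of \<open>ups\<close>: it says that the probability for a lattice point times the size of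
the net is at most \<open>exp (- 2 n)\<close>, up to the factors that are not of the form \<open>q ^ n\<close>.\<close>

lemma numeric_bound: "exp 10 * kap\<^sup>2 * (2592 * ups / (beta * ell * al)) * (160 * K / al1) \<le> exp (- 2)"
proof -
  have nz: "beta \<noteq> 0" "ell \<noteq> 0" "al \<noteq> 0" "al1 \<noteq> 0" "kap \<noteq> 0" "K \<noteq> 0"
    using beta ell al al1 kap K by auto
  have 1: "kap\<^sup>2 * (2592 * ups / (beta * ell * al)) * (160 * K / al1) = 414720 / 2 ^ 40"
    using nz by (simp add: ups_def)
  have "exp 12 = exp (1::real) ^ 12" by (simp add: exp_of_nat_mult[symmetric])
  also have "\<dots> \<le> 3 ^ 12" using e_less_272 by (intro power_mono) auto
  finally have "exp 12 * q \<le> (3 ^ 12 * q :: real)" if "0 \<le> q" for q using that by (intro mult_right_mono) auto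
  from this[of "414720 / 2 ^ 40"] have e12: "exp 12 * (414720 / 2 ^ 40) \<le> (1::real)" by simp
  have "exp 10 = exp (-2) * (exp 12 :: real)" by (simp add: mult_exp_exp)
  then have "exp 10 * (414720 / 2 ^ 40) = exp (-2) * (exp 12 * (414720 / 2 ^ 40) :: real)" by (simp only: mult.assoc)
  also have "\<dots> \<le> exp (-2) * 1" by (intro mult_left_mono e12) simp
  finally have "exp 10 * (414720 / 2 ^ 40 :: real) \<le> exp (-2)" by simp
  moreover have "exp 10 * kap\<^sup>2 * (2592 * ups / (beta * ell * al)) * (160 * K / al1)
      = exp 10 * (kap\<^sup>2 * (2592 * ups / (beta * ell * al)) * (160 * K / al1))" by (simp only: mult.assoc)
  ultimately show ?thesis unfolding 1 by simp
qed

lemma level_prob: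
  assumes J: "finite J" "Suc (card J) = n" and g: "theta g \<le> top"
  shows "\<exists>F\<in>sets (gams J n). measure (gams J n) F \<le> exp (- 2 * real n) / width g \<and>
    (\<forall>A\<in>space (gams J n) - F. (\<Prod>i\<in>J. trunc_norm K n (A i)) \<le> kap ^ n \<longrightarrow>
      (\<forall>z\<in>level_net g. \<not> (\<Sum>i\<in>J. (ip n (\<lambda>j. mesh g * z j) (A i))\<^sup>2 / (trunc_norm K n (A i))\<^sup>2) \<le> (K * width g)\<^sup>2 * n))"
proof -
  let ?x = "\<lambda>z j. mesh g * real_of_int (z j)"
  let ?s = "K * width g"
  let ?E = "\<lambda>z. {A \<in> space (gams J n). (\<Sum>i\<in>J. (ip n (?x z) (A i))\<^sup>2 / (trunc_norm K n (A i))\<^sup>2) \<le> ?s\<^sup>2 * n \<and>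
      (\<Prod>i\<in>J. trunc_norm K n (A i)) \<le> kap ^ n}"
  let ?c = "160 * ?s / al1"
  have s: "0 < ?s" using K width by simp
  have ws: "width g \<le> ?s" using K width(1)[of g] by simp
  have wth: "width g * theta g = s0 * sqrt n" using mesh_theta[of g] by (simp add: width_def mult_ac)
  have wl: "1 / theta g \<le> width g"
    using wth inverse_s0(3) theta(2)[of g] by (simp add: pos_divide_le_eq)
  have s1: "exp (- tau * n / 8) \<le> ?s"
  proof -
    have "exp (- tau * n / 8) \<le> exp (- (tau * n / 16))" using tau by simp
    also have "\<dots> = 1 / top" by (simp add: top_def exp_minus inverse_eq_divide)
    also have "\<dots> \<le> 1 / theta g" using g theta[of g] by (intro divide_left_mono) (auto simp: top_def)
    finally show ?thesis using wl ws by linarith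
  qed
  have s2: "1 / ?s \<le> theta g"
  proof -
    have "1 / ?s \<le> 1 / width g" using ws s width(1)[of g] by (intro divide_left_mono mult_pos_pos) auto
    also have "\<dots> \<le> theta g" using wl theta(2)[of g] width(1)[of g] by (simp add: field_simps)
    finally show ?thesis .
  qed
  have ker: "(\<integral>a. 1 / (1 + (ip n (?x z) a / ?s)\<^sup>2) \<partial>gam n) \<le> ?c" if z: "z \<in> level_net g" for z
  proof (rule kernel_small_ball[OF _ s1])
    show "spread (rho / 2) (?x z)" using z by (simp add: level_net_def)
    fix th assume "th0 \<le> th" "th \<le> 1 / ?s"
    then show "tau * n / 4 \<le> psis n (?x z) th" using z s2 by (simp add: level_net_def)
  qed
  note wr = weighted_rows_prob[OF J(1) s ker]
  show ?thesis
  proof (intro bexI conjI ballI impI notI)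
    show s: "(\<Union>z\<in>level_net g. ?E z) \<in> sets (gams J n)"
      using level_net_card(1) wr(1) by (intro sets.finite_UN) auto
    have "measure (gams J n) (\<Union>z\<in>level_net g. ?E z) \<le> (\<Sum>z\<in>level_net g. measure (gams J n) (?E z))"
      using wr(1) by (intro measure_UNION_le level_net_card(1)) auto
    also have "\<dots> \<le> (\<Sum>z\<in>level_net g. exp n * (kap ^ n)\<^sup>2 * ?c ^ card J)" by (intro sum_mono wr(2))
    also have "\<dots> = card (level_net g) * (exp n * (kap ^ n)\<^sup>2 * ?c ^ card J)" by simp
    also have "\<dots> \<le> (exp (9 * n) * (2592 * ups / (beta * ell * al * width g)) ^ n) * (exp n * (kap ^ n)\<^sup>2 * ?c ^ card J)"
      using s1 al1 K width(1)[of g] by (intro mult_right_mono level_net_card(2)) auto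
    also have "\<dots> \<le> (exp 10 * kap\<^sup>2 * (2592 * ups / (beta * ell * al)) * (160 * K / al1)) ^ n / width g"
    proof -
      define P where "P = 2592 * ups / (beta * ell * al)"
      define Q where "Q = 160 * K / al1"
      define m where "m = card J"
      have nm: "n = Suc m" using J by (simp add: m_def)
      have w: "0 < width g" by (rule width)
      have P: "0 < P" using ups beta ell al by (simp add: P_def)
      have Q: "1 \<le> Q" unfolding Q_def using al1 K by (simp add: pos_le_divide_eq)
      have e: "exp (real (9 * n)) * exp (real n) = exp 10 ^ n" by (simp add: mult_exp_exp exp_of_nat_mult[symmetric])
      have "(P / width g) ^ n * (Q * width g) ^ m = P ^ n * Q ^ m / width g"
        using w unfolding nm by (simp add: power_divide power_mult_distrib)
      also have "\<dots> \<le> P ^ n * Q ^ n / width g"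
        using P Q w by (intro divide_right_mono mult_left_mono power_increasing) (auto simp: nm)
      finally have "exp 10 ^ n * (kap ^ n)\<^sup>2 * ((P / width g) ^ n * (Q * width g) ^ m) \<le> exp 10 ^ n * (kap ^ n)\<^sup>2 * (P ^ n * Q ^ n / width g)"
        by (intro mult_left_mono) auto
      moreover have "(kap ^ n)\<^sup>2 = (kap\<^sup>2) ^ n" by (simp only: power_mult[symmetric] mult.commute)
      ultimately have fin: "(exp (real (9 * n)) * exp (real n)) * (kap ^ n)\<^sup>2 * ((P / width g) ^ n * (Q * width g) ^ m) \<le> (exp 10 * kap\<^sup>2 * P * Q) ^ n / width g"
        unfolding e by (simp add: power_mult_distrib mult_ac)
      have pe: "2592 * ups / (beta * ell * al * width g) = P / width g" by (simp add: P_def)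
      have qe: "160 * (K * width g) / al1 = Q * width g" by (simp add: Q_def)
      show ?thesis using fin unfolding pe qe P_def[symmetric] Q_def[symmetric] m_def[symmetric] by (simp only: mult_ac of_nat_mult of_nat_numeral)
    qed
    also have "\<dots> \<le> exp (- 2) ^ n / width g"
      using width(1)[of g] numeric_bound ups beta ell al al1 K by (intro divide_right_mono power_mono) auto
    also have "exp (- 2) ^ n = exp (- 2 * real n)" by (simp add: exp_of_nat_mult[symmetric] mult.commute)
    finally show "measure (gams J n) (\<Union>z\<in>level_net g. ?E z) \<le> exp (- 2 * real n) / width g" .
    fix A z assume "A \<in> space (gams J n) - (\<Union>z\<in>level_net g. ?E z)" "(\<Prod>i\<in>J. trunc_norm K n (A i)) \<le> kap ^ n"
      "z \<in> level_net g" "(\<Sum>i\<in>J. (ip n (?x z) (A i))\<^sup>2 / (trunc_norm K n (A i))\<^sup>2) \<le> ?s\<^sup>2 * n"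
    then show False by blast
  qed
qed

text \<open>If \<open>psis\<close> is large up to the argument \<open>top\<close>, then the Cauchy kernel bound holds at every scale down to
\<open>1/top\<close>.\<close>

lemma unstructured_small_ball:
  assumes v: "nsq n v = 1" and sp: "beta * n \<le> card {j \<in> {..<n}. rho / sqrt n \<le> \<bar>v j\<bar>}"
    and good: "\<And>th. th0 \<le> th \<Longrightarrow> th \<le> top \<Longrightarrow> tau * n \<le> psis n v th" and s: "exp (- tau * n / 16) \<le> s"
  shows "measure (gam n) {g \<in> space (gam n). \<bar>ip n v g\<bar> \<le> s} \<le> 320 * s / al1"
proof -
  interpret g: prob_space "gam n" by (rule prob_gam)
  have sp0: "0 < s" using s exp_gt_zero[of "- tau * n / 16"] by linarith
  let ?E = "{g \<in> space (gam n). \<bar>ip n v g\<bar> \<le> s}"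
  have k: "(\<integral>g. 1 / (1 + (ip n v g / s)\<^sup>2) \<partial>gam n) \<le> 160 * s / al1"
  proof (rule kernel_small_ball)
    have "{j \<in> {..<n}. rho / sqrt n \<le> \<bar>v j\<bar>} \<subseteq> {j \<in> {..<n}. rho / 2 / sqrt n \<le> \<bar>v j\<bar>}"
    proof clarsimp
      fix j assume "rho / sqrt n \<le> \<bar>v j\<bar>"
      moreover have "rho / (2 * sqrt n) \<le> rho / sqrt n" using rho n1 by (intro divide_left_mono) auto
      ultimately show "rho / (2 * sqrt n) \<le> \<bar>v j\<bar>" by linarith
    qed
    then have "card {j \<in> {..<n}. rho / sqrt n \<le> \<bar>v j\<bar>} \<le> card {j \<in> {..<n}. rho / 2 / sqrt n \<le> \<bar>v j\<bar>}"
      by (intro card_mono) auto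
    then show "spread (rho / 2) v" unfolding spread_def using v sp by simp
    have "exp (- tau * n / 8) \<le> exp (- tau * n / 16)" using tau by simp
    then show "exp (- tau * n / 8) \<le> s" using s by linarith
    fix th assume th: "th0 \<le> th" "th \<le> 1 / s"
    have "1 / s \<le> 1 / exp (- tau * n / 16)" using s sp0 by (intro divide_left_mono) auto
    also have "\<dots> = top" by (simp add: top_def exp_minus inverse_eq_divide)
    finally have "tau * n \<le> psis n v th" using th by (intro good) auto
    moreover have "0 \<le> tau * n" using tau by simp
    ultimately show "tau * n / 4 \<le> psis n v th" by linarith
  qed
  have "(1/2) * measure (gam n) ?E = (\<integral>g. (1/2::real) * indicator ?E g \<partial>gam n)" by simp
  also have "\<dots> \<le> (\<integral>g. 1 / (1 + (ip n v g / s)\<^sup>2) \<partial>gam n)"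
  proof (intro integral_mono)
    show "integrable (gam n) (\<lambda>g. (1/2::real) * indicator ?E g)"
      by (intro integrable_mult_right g.integrable_const_bound[of _ 1]) auto
    show "integrable (gam n) (\<lambda>g. 1 / (1 + (ip n v g / s)\<^sup>2))"
      by (rule g.integrable_const_bound[of _ 1]) (auto simp: abs_of_nonneg add_nonneg_nonneg add_pos_nonneg)
    fix g
    show "(1/2) * indicator ?E g \<le> 1 / (1 + (ip n v g / s)\<^sup>2)"
    proof (cases "g \<in> ?E")
      case True
      then have "\<bar>ip n v g / s\<bar> \<le> 1" using sp0 by simp
      then have "(ip n v g / s)\<^sup>2 \<le> 1" by (simp add: abs_square_le_1)
      then have "1 / 2 \<le> 1 / (1 + (ip n v g / s)\<^sup>2)"
        by (intro divide_left_mono) (auto simp: add_pos_nonneg)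
      then show ?thesis using True by simp
    next
      case False then show ?thesis by (simp add: add_nonneg_nonneg)
    qed
  qed
  finally show ?thesis using k by simp
qed

text \<open>Either \<open>spread_vectors\<close> fails, or \<open>psis\<close> of a normal vector is small somewhere between \<open>th0\<close> and \<open>top\<close>. In the second case take the
first level at which this happens; the rounded normal vector belongs to the net of this level and is almost orthogonal
to the rows. The number of levels is exponential with a rate less than \<open>2\<close>.\<close>

theorem normal_vectors_unstructured:
  assumes J: "finite J" "Suc (card J) = n" and n2: "2 \<le> n"
  shows "\<exists>F\<in>sets (gams J n). measure (gams J n) F \<le> exp (- c1 * n / 32) + exp (- real n) \<and>
    (\<forall>A\<in>space (gams J n) - F. (\<Prod>i\<in>J. trunc_norm K n (A i)) \<le> kap ^ n \<longrightarrow>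
      (\<forall>v. nsq n v = 1 \<longrightarrow> (\<forall>i\<in>J. ip n v (A i) = 0) \<longrightarrow> (\<forall>s. exp (- tau * n / 16) \<le> s \<longrightarrow>
        measure (gam n) {g \<in> space (gam n). \<bar>ip n v g\<bar> \<le> s} \<le> 320 * s / al1)))"
proof -
  have J2: "card J \<le> n" "n \<le> 2 * card J" using J n2 by auto
  obtain F0 where F0: "F0 \<in> sets (gams J n)" "measure (gams J n) F0 \<le> exp (- c1 * n / 32)"
    "\<And>A x. A \<in> space (gams J n) - F0 \<Longrightarrow> nsq n x = 1 \<Longrightarrow> (\<Sum>i\<in>J. (ip n x (A i))\<^sup>2) \<le> al / 1024 * n \<Longrightarrow>
      beta * n < card {j \<in> {..<n}. rho / sqrt n \<le> \<bar>x j\<bar>}"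
    using spread_vectors[OF J(1) J2] by blast
  define G where "G = {g. theta g \<le> top}"
  have top1: "1 \<le> top" using tau by (simp add: top_def)
  define Gm where "Gm = nat \<lfloor>2 * top / s0\<rfloor>"
  have Gsub: "G \<subseteq> {..Gm}"
  proof
    fix g assume "g \<in> G"
    then have "g * (s0 / 2) \<le> top" using th0 by (simp add: G_def theta_def)
    then have "real g \<le> 2 * top / s0" using s0 by (simp add: pos_le_divide_eq)
    then show "g \<in> {..Gm}" by (simp add: Gm_def le_nat_floor)
  qed
  have fG: "finite G" using Gsub by (rule finite_subset) simp
  have cG: "real (card G) \<le> 3 * top / s0"
  proof -
    have "real (card G) \<le> real (card {..Gm})" using card_mono[OF _ Gsub] by simp
    also have "\<dots> \<le> 2 * top / s0 + 1"
      using s0 top1 by (simp add: Gm_def)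
    also have "1 \<le> top / s0" using s0 top1 by (simp add: pos_le_divide_eq)
    then have "2 * top / s0 + 1 \<le> 3 * top / s0" by simp
    finally show ?thesis .
  qed
  have "\<forall>g\<in>G. \<exists>F. F \<in> sets (gams J n) \<and> measure (gams J n) F \<le> exp (- 2 * real n) / width g \<and>
    (\<forall>A\<in>space (gams J n) - F. (\<Prod>i\<in>J. trunc_norm K n (A i)) \<le> kap ^ n \<longrightarrow>
      (\<forall>z\<in>level_net g. \<not> (\<Sum>i\<in>J. (ip n (\<lambda>j. mesh g * z j) (A i))\<^sup>2 / (trunc_norm K n (A i))\<^sup>2) \<le> (K * width g)\<^sup>2 * n))"
  proof
    fix g assume "g \<in> G"
    then show "\<exists>F. F \<in> sets (gams J n) \<and> measure (gams J n) F \<le> exp (- 2 * real n) / width g \<and>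
    (\<forall>A\<in>space (gams J n) - F. (\<Prod>i\<in>J. trunc_norm K n (A i)) \<le> kap ^ n \<longrightarrow>
      (\<forall>z\<in>level_net g. \<not> (\<Sum>i\<in>J. (ip n (\<lambda>j. mesh g * z j) (A i))\<^sup>2 / (trunc_norm K n (A i))\<^sup>2) \<le> (K * width g)\<^sup>2 * n))"
      using level_prob[OF J, of g] by (simp add: G_def Bex_def)
  qed
  from bchoice[OF this] obtain F where FF: "\<forall>g\<in>G. F g \<in> sets (gams J n) \<and> measure (gams J n) (F g) \<le> exp (- 2 * real n) / width g \<and>
    (\<forall>A\<in>space (gams J n) - F g. (\<Prod>i\<in>J. trunc_norm K n (A i)) \<le> kap ^ n \<longrightarrow>
      (\<forall>z\<in>level_net g. \<not> (\<Sum>i\<in>J. (ip n (\<lambda>j. mesh g * z j) (A i))\<^sup>2 / (trunc_norm K n (A i))\<^sup>2) \<le> (K * width g)\<^sup>2 * n))"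
    by (elim exE)
  have F: "F g \<in> sets (gams J n)" "measure (gams J n) (F g) \<le> exp (- 2 * real n) / width g" if "g \<in> G" for g
    by (rule conjunct1[OF bspec[OF FF that]], rule conjunct1[OF conjunct2[OF bspec[OF FF that]]])
  have F3: "\<not> (\<Sum>i\<in>J. (ip n (\<lambda>j. mesh g * z j) (A i))\<^sup>2 / (trunc_norm K n (A i))\<^sup>2) \<le> (K * width g)\<^sup>2 * n"
    if "g \<in> G" "A \<in> space (gams J n) - F g" "(\<Prod>i\<in>J. trunc_norm K n (A i)) \<le> kap ^ n" "z \<in> level_net g" for g A z
    using conjunct2[OF conjunct2[OF bspec[OF FF that(1)]], THEN bspec, OF that(2), THEN mp, OF that(3), THEN bspec, OF that(4)] .
  have mG: "measure (gams J n) (\<Union>g\<in>G. F g) \<le> exp (- real n)"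
  proof -
    have "measure (gams J n) (\<Union>g\<in>G. F g) \<le> (\<Sum>g\<in>G. measure (gams J n) (F g))"
      using F(1) by (intro measure_UNION_le fG) auto
    also have "\<dots> \<le> (\<Sum>g\<in>G. exp (- 2 * real n) * (top / s0))"
    proof (intro sum_mono)
      fix g assume g: "g \<in> G"
      have "width g * theta g = s0 * sqrt n" using mesh_theta[of g] by (simp add: width_def mult_ac)
      moreover have "s0 * 1 \<le> s0 * sqrt n" using n1 s0 by (intro mult_left_mono) auto
      ultimately have "s0 \<le> width g * top"
        using g width(1)[of g] mult_left_mono[of "theta g" top "width g"] by (simp add: G_def)
      then have "1 / width g \<le> top / s0" using s0 width(1)[of g] by (simp add: divide_simps mult.commute)
      then have "exp (- 2 * real n) * (1 / width g) \<le> exp (- 2 * real n) * (top / s0)" by (intro mult_left_mono) auto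
      then show "measure (gams J n) (F g) \<le> exp (- 2 * real n) * (top / s0)" using F(2)[OF g] by simp
    qed
    also have "\<dots> = card G * (exp (- 2 * real n) * (top / s0))" by simp
    also have "\<dots> \<le> (3 * top / s0) * (exp (- 2 * real n) * (top / s0))"
      using cG s0 top1 by (intro mult_right_mono) auto
    also have "\<dots> = (3 / s0\<^sup>2) * (top\<^sup>2 * exp (- 2 * real n))" by (simp add: power2_eq_square)
    also have "\<dots> \<le> (n / 2) * (top\<^sup>2 * exp (- 2 * real n))" using inverse_s0(4) by (intro mult_right_mono) auto
    also have "\<dots> \<le> exp (n / 2) * (top\<^sup>2 * exp (- 2 * real n))"
    proof (intro mult_right_mono)
      show "n / 2 \<le> exp (n / 2)" using exp_ge_add_one_self[of "n / 2"] by linarith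
    qed auto
    also have "top\<^sup>2 = exp (tau * n / 8)" by (simp add: top_def exp_double[symmetric])
    also have "exp (n / 2) * (exp (tau * n / 8) * exp (- 2 * real n)) = exp (n / 2 + tau * n / 8 - 2 * n)"
      by (simp add: mult_exp_exp)
    also have "\<dots> \<le> exp (- real n)"
    proof -
      have "tau * n \<le> 1 * real n" using tau by (intro mult_right_mono) auto
      then show ?thesis by simp
    qed
    finally show ?thesis .
  qed
  show ?thesis
  proof (intro bexI conjI ballI impI allI)
    show sF: "F0 \<union> (\<Union>g\<in>G. F g) \<in> sets (gams J n)" using F0(1) F(1) fG by (intro sets.Un sets.finite_UN) auto
    have "measure (gams J n) (F0 \<union> (\<Union>g\<in>G. F g)) \<le> measure (gams J n) F0 + measure (gams J n) (\<Union>g\<in>G. F g)"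
      using F0(1) F(1) fG by (intro measure_Un_le sets.finite_UN) auto
    then show "measure (gams J n) (F0 \<union> (\<Union>g\<in>G. F g)) \<le> exp (- c1 * n / 32) + exp (- real n)"
      using F0(2) mG by linarith
    fix A v s
    assume A: "A \<in> space (gams J n) - (F0 \<union> (\<Union>g\<in>G. F g))" and pr: "(\<Prod>i\<in>J. trunc_norm K n (A i)) \<le> kap ^ n"
      and v: "nsq n v = 1" and ort: "\<forall>i\<in>J. ip n v (A i) = 0" and s: "exp (- tau * n / 16) \<le> s"
    have "(\<Sum>i\<in>J. (ip n v (A i))\<^sup>2) \<le> al / 1024 * n" using ort al by simp
    then have "beta * n < card {j \<in> {..<n}. rho / sqrt n \<le> \<bar>v j\<bar>}" using A v by (intro F0(3)) auto
    then have sp: "beta * n \<le> card {j \<in> {..<n}. rho / sqrt n \<le> \<bar>v j\<bar>}" by linarith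
    have good: "tau * n \<le> psis n v th" if "th0 \<le> th" "th \<le> top" for th
    proof (rule ccontr)
      define P where "P g \<longleftrightarrow> (\<exists>th. theta g \<le> th \<and> th \<le> theta g + s0 / 2 \<and> th \<le> top \<and> psis n v th < tau * n)" for g
      have cell: "\<exists>g. theta g \<le> th \<and> th \<le> theta g + s0 / 2 \<and> (\<forall>m. th < theta m \<longrightarrow> g < m)" if "th0 \<le> th" for th
      proof -
        define g where "g = nat \<lfloor>(th - th0) / (s0 / 2)\<rfloor>"
        have nn: "0 \<le> (th - th0) / (s0 / 2)" using that s0 by simp
        then have 1: "real g \<le> (th - th0) / (s0 / 2)" "(th - th0) / (s0 / 2) < real g + 1"
          unfolding g_def by linarith+
        then have 2: "real g * (s0 / 2) \<le> th - th0" "th - th0 \<le> (real g + 1) * (s0 / 2)"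
          using s0 by (simp_all only: pos_le_divide_eq pos_divide_less_eq half_gt_zero_iff less_imp_le)
        have "g < m" if m: "th < theta m" for m
        proof -
          have "real g * (s0 / 2) < real m * (s0 / 2)" using 2 m by (simp add: theta_def)
          then show ?thesis using s0 by simp
        qed
        moreover have "theta g \<le> th" "th \<le> theta g + s0 / 2" using 2 by (simp_all add: theta_def distrib_right add_divide_distrib)
        ultimately show ?thesis by blast
      qed
      assume "\<not> tau * n \<le> psis n v th"
      then have "\<exists>g. P g" using cell[OF \<open>th0 \<le> th\<close>] that unfolding P_def by (metis not_le)
      then have Pg: "P (LEAST g. P g)" by (rule LeastI_ex)
      define g where "g = (LEAST g. P g)"
      have least: "\<not> P m" if "m < g" for m using not_less_Least[of m P] that by (simp add: g_def)
      have Pg': "P g" unfolding g_def by (rule Pg)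
      obtain th' where th': "theta g \<le> th'" "th' \<le> theta g + s0 / 2" "th' \<le> top" "psis n v th' < tau * n"
        using Pg' unfolding P_def by (elim exE conjE)
      have gG: "g \<in> G" using th' by (simp add: G_def)
      have gd: "tau * n \<le> psis n v a" if a: "th0 \<le> a" "a \<le> theta g" for a
      proof (cases "a < theta g")
        case True
        obtain m where m: "theta m \<le> a" "a \<le> theta m + s0 / 2" "m < g" using cell[OF a(1)] True by blast
        have "a \<le> top" using a th' by linarith
        then show ?thesis using least[OF m(3)] m unfolding P_def by (meson not_le)
      next
        case False
        then have ag: "a = theta g" using a by simp
        show ?thesis
        proof (cases g)
          case 0
          then have a0: "a = th0" using ag by (simp add: theta_def)
          have "spread (rho / 2) v"
          proof -
            have "{j \<in> {..<n}. rho / sqrt n \<le> \<bar>v j\<bar>} \<subseteq> {j \<in> {..<n}. rho / 2 / sqrt n \<le> \<bar>v j\<bar>}"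
            proof clarsimp
              fix j assume "rho / sqrt n \<le> \<bar>v j\<bar>"
              moreover have "rho / (2 * sqrt n) \<le> rho / sqrt n" using rho n1 by (intro divide_left_mono) auto
              ultimately show "rho / (2 * sqrt n) \<le> \<bar>v j\<bar>" by linarith
            qed
            then have "card {j \<in> {..<n}. rho / sqrt n \<le> \<bar>v j\<bar>} \<le> card {j \<in> {..<n}. rho / 2 / sqrt n \<le> \<bar>v j\<bar>}"
              by (intro card_mono) auto
            then show ?thesis unfolding spread_def using v sp by simp
          qed
          then have "al1 * th0\<^sup>2 \<le> psis n v th0" using th0 by (intro psis_spread) auto
          moreover have "al1 * th0\<^sup>2 = al1 * ell\<^sup>2 * beta\<^sup>2 / 64 * n" by (simp add: th0_def power_mult_distrib power_divide)
          moreover have "tau * n \<le> al1 * ell\<^sup>2 * beta\<^sup>2 / 64 * n" using tau(4) by (intro mult_right_mono) auto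
          ultimately show ?thesis unfolding a0 by linarith
        next
          case (Suc m)
          have "theta m \<le> a" "a \<le> theta m + s0 / 2" using s0 unfolding ag Suc by (simp_all add: theta_def distrib_right add_divide_distrib)
          moreover have "a \<le> top" using ag th' by linarith
          ultimately show ?thesis using least[of m] Suc unfolding P_def by (meson lessI not_le)
        qed
      qed
      have "card J \<le> n" using J by simp
      from level_rounding[OF v sp J(1) this _ gd th'(1,2,4)] ort
      obtain z where "z \<in> level_net g" "(\<Sum>i\<in>J. (ip n (\<lambda>j. mesh g * z j) (A i))\<^sup>2 / (trunc_norm K n (A i))\<^sup>2) \<le> (K * width g)\<^sup>2 * n"
        by blast
      moreover have "A \<in> space (gams J n) - F g" using A gG by blast
      ultimately show False using F3[OF gG _ pr] by blast
    qed
    show "measure (gam n) {g \<in> space (gam n). \<bar>ip n v g\<bar> \<le> s} \<le> 320 * s / al1"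
      by (rule unstructured_small_ball[OF v sp good s])
  qed
qed

end

section \<open>From distances to the smallest singular value\<close>

lemma ip_scale: "ip n (\<lambda>j. c * x j) y = c * ip n x y"
  by (simp add: ip_def sum_distrib_left mult.assoc)

lemma nsq_scale: "nsq n (\<lambda>j. c * x j) = c\<^sup>2 * nsq n x"
  by (simp add: nsq_def sum_distrib_left power_mult_distrib)

lemma ip_cauchy_schwarz: "(ip n x y)\<^sup>2 \<le> nsq n x * nsq n y"
  unfolding ip_def nsq_def by (rule Cauchy_Schwarz_ineq_sum)

lemma ip_combination:
  "ip n v (\<lambda>i. g i - (\<Sum>j\<in>U. y j * a j i)) = ip n v g - (\<Sum>j\<in>U. y j * ip n v (a j))"
proof -
  have "ip n v (\<lambda>i. g i - (\<Sum>j\<in>U. y j * a j i)) = ip n v g - (\<Sum>i<n. \<Sum>j\<in>U. v i * (y j * a j i))"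
    by (simp add: ip_def right_diff_distrib sum_subtractf sum_distrib_left)
  also have "(\<Sum>i<n. \<Sum>j\<in>U. v i * (y j * a j i)) = (\<Sum>j\<in>U. y j * ip n v (a j))"
    by (subst sum.swap) (simp add: ip_def sum_distrib_left mult_ac)
  finally show ?thesis .
qed

lemma nonzero_orthogonal:
  "finite S \<Longrightarrow> card S < n \<Longrightarrow> \<exists>v. (\<exists>i<n. v i \<noteq> 0) \<and> (\<forall>s\<in>S. ip n v s = 0)"
proof (induction n arbitrary: S)
  case (Suc n)
  have suc: "ip (Suc n) v s = ip n v s + v n * s n" for v s by (simp add: ip_def)
  show ?case
  proof (cases "\<forall>s\<in>S. s n = 0")
    case True
    show ?thesis
    proof (intro exI[of _ "\<lambda>i. if i = n then 1 else 0"] conjI ballI)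
      fix s assume "s \<in> S"
      moreover have "ip n (\<lambda>i. if i = n then 1 else 0) s = 0" by (simp add: ip_def)
      ultimately show "ip (Suc n) (\<lambda>i. if i = n then 1 else 0) s = 0" using True by (simp add: suc)
    qed auto
  next
    case False
    then obtain s0 where s0: "s0 \<in> S" "s0 n \<noteq> 0" by blast
    define f where "f s = (\<lambda>i. s i - (s n / s0 n) * s0 i)" for s :: "nat \<Rightarrow> real"
    have "card (f ` (S - {s0})) \<le> card (S - {s0})" using Suc.prems by (intro card_image_le) auto
    also have "\<dots> < n" using card_Diff1_less[OF Suc.prems(1) s0(1)] Suc.prems(2) by linarith
    finally obtain v where v: "\<exists>i<n. v i \<noteq> 0" "\<And>s. s \<in> S - {s0} \<Longrightarrow> ip n v (f s) = 0"
      using Suc.IH[of "f ` (S - {s0})"] Suc.prems by blast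
    define w where "w = v(n := - ip n v s0 / s0 n)"
    have wip: "ip n w s = ip n v s" for s unfolding ip_def w_def by (intro sum.cong) auto
    show ?thesis
    proof (intro exI[of _ w] conjI ballI)
      show "\<exists>i<Suc n. w i \<noteq> 0" using v(1) by (auto simp: w_def less_Suc_eq)
      fix s assume s: "s \<in> S"
      show "ip (Suc n) w s = 0"
      proof (cases "s = s0")
        case True then show ?thesis using s0 by (simp add: suc wip) (simp add: w_def)
      next
        case False
        have "ip n v (f s) = ip n v s - (s n / s0 n) * ip n v s0"
          by (simp add: f_def ip_def right_diff_distrib sum_subtractf sum_distrib_left mult_ac)
        then have "ip n v s = (s n / s0 n) * ip n v s0" using v(2)[of s] s False by simp
        then show ?thesis using s0 by (simp add: suc wip) (simp add: w_def)
      qed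
    qed
  qed
qed simp

lemma unit_orthogonal:
  assumes "finite S" "card S < n"
  shows "\<exists>v. nsq n v = 1 \<and> (\<forall>s\<in>S. ip n v s = 0)"
proof -
  obtain v i where v: "i < n" "v i \<noteq> 0" "\<And>s. s \<in> S \<Longrightarrow> ip n v s = 0"
    using nonzero_orthogonal[OF assms] by blast
  have "(v i)\<^sup>2 \<le> nsq n v" unfolding nsq_def using v by (intro member_le_sum) auto
  then have p: "0 < nsq n v" using v by (meson less_le_trans zero_less_power2)
  show ?thesis
  proof (intro exI[of _ "\<lambda>j. 1 / sqrt (nsq n v) * v j"] conjI ballI)
    show "nsq n (\<lambda>j. 1 / sqrt (nsq n v) * v j) = 1" unfolding nsq_scale using p by (simp add: power_divide)
    show "ip n (\<lambda>j. 1 / sqrt (nsq n v) * v j) s = 0" if "s \<in> S" for s unfolding ip_scale using v(3)[OF that] by simp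
  qed
qed

lemma rational_approximation:
  fixes F :: "('i \<Rightarrow> real) \<Rightarrow> real"
  assumes "finite V" and c: "\<And>y j. j \<in> V \<Longrightarrow> continuous_on UNIV (\<lambda>x. F (y(j := x)))" and "F y < r"
  shows "\<exists>y'. (\<forall>j\<in>V. y' j \<in> \<rat>) \<and> (\<forall>j. j \<notin> V \<longrightarrow> y' j = y j) \<and> F y' < r"
  using assms(1) c
proof (induction V)
  case empty then show ?case using assms(3) by auto
next
  case (insert k V)
  then obtain y' where y': "\<forall>j\<in>V. y' j \<in> \<rat>" "\<forall>j. j \<notin> V \<longrightarrow> y' j = y j" "F y' < r" by auto
  have "continuous_on UNIV (\<lambda>x. F (y'(k := x)))" using insert.prems by blast
  then have o: "open {x. F (y'(k := x)) < r}" by (rule open_Collect_less) (rule continuous_on_const)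
  moreover have "y' k \<in> {x. F (y'(k := x)) < r}" using y' by simp
  ultimately obtain e where e: "0 < e" "\<And>x. dist x (y' k) < e \<Longrightarrow> F (y'(k := x)) < r"
    unfolding open_dist by blast
  obtain q where q: "q \<in> \<rat>" "y' k < q" "q < y' k + e" using Rats_dense_in_real[of "y' k" "y' k + e"] e by auto
  have "F (y'(k := q)) < r" using e(2)[of q] q by (simp add: dist_real_def)
  moreover have "\<forall>j\<in>insert k V. (y'(k := q)) j \<in> \<rat>" using y' q by auto
  moreover have "\<forall>j. j \<notin> insert k V \<longrightarrow> (y'(k := q)) j = y j" using y' by auto
  ultimately show ?case by blast
qed

context entry_law
begin

text \<open>The squared distance from \<open>g\<close> to the span of the columns indexed by \<open>U\<close> is less than \<open>r\<close>.\<close>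

definition near :: "nat \<Rightarrow> (nat \<Rightarrow> real) \<Rightarrow> 'i set \<Rightarrow> ('i \<Rightarrow> nat \<Rightarrow> real) \<Rightarrow> real \<Rightarrow> bool" where
  "near n g U A r \<longleftrightarrow> (\<exists>y. nsq n (\<lambda>i. g i - (\<Sum>j\<in>U. y j * A j i)) < r)"

lemma near_cong: "(\<And>j. j \<in> U \<Longrightarrow> A j = A' j) \<Longrightarrow> near n g U A r = near n g U A' r"
  unfolding near_def by (simp cong: sum.cong)

text \<open>This makes \<open>near\<close> a countable union of measurable conditions.\<close>

lemma near_rational:
  assumes U: "finite U"
  shows "near n g U A r \<longleftrightarrow> (\<exists>y\<in>PiE U (\<lambda>_. \<rat>). nsq n (\<lambda>i. g i - (\<Sum>j\<in>U. y j * A j i)) < r)"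
proof
  assume "near n g U A r"
  then obtain y where y: "nsq n (\<lambda>i. g i - (\<Sum>j\<in>U. y j * A j i)) < r" unfolding near_def by blast
  have c: "continuous_on UNIV (\<lambda>x. nsq n (\<lambda>i. g i - (\<Sum>j\<in>U. (y(k := x)) j * A j i)))" for y k
  proof -
    have "continuous_on UNIV (\<lambda>x. (y(k := x)) j)" for j by (cases "j = k") auto
    then show ?thesis unfolding nsq_def by (intro continuous_intros)
  qed
  from rational_approximation[of U "\<lambda>y. nsq n (\<lambda>i. g i - (\<Sum>j\<in>U. y j * A j i))", OF U c y]
  obtain y' where y': "\<forall>j\<in>U. y' j \<in> \<rat>" "nsq n (\<lambda>i. g i - (\<Sum>j\<in>U. y' j * A j i)) < r" by blast
  have "nsq n (\<lambda>i. g i - (\<Sum>j\<in>U. restrict y' U j * A j i)) < r" using y'(2) by (simp cong: sum.cong)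
  moreover have "restrict y' U \<in> PiE U (\<lambda>_. \<rat>)" using y'(1) by auto
  ultimately show "\<exists>y\<in>PiE U (\<lambda>_. \<rat>). nsq n (\<lambda>i. g i - (\<Sum>j\<in>U. y j * A j i)) < r" by blast
qed (auto simp: near_def)

lemma near_sets:
  assumes U: "finite U" "U \<subseteq> J" and k: "k \<in> J"
  shows "{A \<in> space (gams J n). near n (A k) U A r} \<in> sets (gams J n)"
proof -
  have m: "(\<lambda>A. A j i) \<in> borel_measurable (gams J n)" if "j \<in> J" "i < n" for j i
    using measurable_compose[OF meas_gams_coord[OF that(1)] meas_coord[OF that(2)]] .
  have "{A \<in> space (gams J n). near n (A k) U A r} =
    (\<Union>y\<in>PiE U (\<lambda>_. \<rat>). {A \<in> space (gams J n). nsq n (\<lambda>i. A k i - (\<Sum>j\<in>U. y j * A j i)) < r})"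
    using near_rational[OF U(1)] by auto
  also have "\<dots> \<in> sets (gams J n)"
  proof (intro sets.countable_UN'')
    show "countable (PiE U (\<lambda>_. \<rat>) :: ('a \<Rightarrow> real) set)" using U by (intro countable_PiE countable_rat) auto
    fix y :: "'a \<Rightarrow> real"
    have "(\<lambda>A. nsq n (\<lambda>i. A k i - (\<Sum>j\<in>U. y j * A j i))) \<in> borel_measurable (gams J n)"
      unfolding nsq_def using U k
      by (intro borel_measurable_sum borel_measurable_power borel_measurable_diff borel_measurable_times
          borel_measurable_const m) auto
    then show "{A \<in> space (gams J n). nsq n (\<lambda>i. A k i - (\<Sum>j\<in>U. y j * A j i)) < r} \<in> sets (gams J n)"
      by measurable
  qed
  finally show ?thesis .
qed

lemma near_section_sets:
  assumes U: "finite U"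
  shows "{g \<in> space (gam n). near n g U A r} \<in> sets (gam n)"
proof -
  have "{g \<in> space (gam n). near n g U A r} =
    (\<Union>y\<in>PiE U (\<lambda>_. \<rat>). {g \<in> space (gam n). nsq n (\<lambda>i. g i - (\<Sum>j\<in>U. y j * A j i)) < r})"
    using near_rational[OF U(1)] by auto
  also have "\<dots> \<in> sets (gam n)"
  proof (intro sets.countable_UN'')
    show "countable (PiE U (\<lambda>_. \<rat>) :: ('a \<Rightarrow> real) set)" using U by (intro countable_PiE countable_rat) auto
    fix y :: "'a \<Rightarrow> real"
    have "(\<lambda>g. nsq n (\<lambda>i. g i - (\<Sum>j\<in>U. y j * A j i))) \<in> borel_measurable (gam n)"
      unfolding nsq_def
      by (intro borel_measurable_sum borel_measurable_power borel_measurable_diff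
          borel_measurable_const meas_coord) auto
    then show "{g \<in> space (gam n). nsq n (\<lambda>i. g i - (\<Sum>j\<in>U. y j * A j i)) < r} \<in> sets (gam n)"
      by measurable
  qed
  finally show ?thesis .
qed

lemma gams_fubini:
  assumes J: "finite J" "k \<notin> J" and E: "E \<in> sets (gams (insert k J) n)"
    and F: "F \<in> sets (gams J n)" and B: "B \<in> sets (gams J n)" and c: "0 \<le> c"
    and le: "\<And>A. A \<in> B \<Longrightarrow> A \<notin> F \<Longrightarrow> measure (gam n) {g \<in> space (gam n). A(k := g) \<in> E} \<le> c"
    and out: "\<And>A g. A \<in> space (gams J n) \<Longrightarrow> g \<in> space (gam n) \<Longrightarrow> A(k := g) \<in> E \<Longrightarrow> A \<in> B"
  shows "measure (gams (insert k J) n) E \<le> measure (gams J n) F + c * measure (gams J n) B"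
proof -
  interpret g: prob_space "gam n" by (rule prob_gam)
  interpret G: prob_space "gams J n" by (rule prob_gams)
  interpret G': prob_space "gams (insert k J) n" by (rule prob_gams)
  interpret product_sigma_finite "\<lambda>_::'a. gam n"
    by (rule product_sigma_finite.intro) (rule prob_space_imp_sigma_finite[OF prob_gam])
  have "emeasure (gams (insert k J) n) E = (\<integral>\<^sup>+A. indicator E A \<partial>gams (insert k J) n)"
    using E by simp
  also have "\<dots> = (\<integral>\<^sup>+A. (\<integral>\<^sup>+g. indicator E (A(k := g)) \<partial>gam n) \<partial>gams J n)"
    using E by (intro product_nn_integral_insert J) simp
  also have "\<dots> \<le> (\<integral>\<^sup>+A. indicator F A + ennreal c * indicator B A \<partial>gams J n)"
  proof (rule nn_integral_mono)
    fix A assume A: "A \<in> space (gams J n)"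
    have sec: "{g \<in> space (gam n). A(k := g) \<in> E} \<in> sets (gam n)"
    proof -
      have "(\<lambda>g. A(k := g)) \<in> gam n \<rightarrow>\<^sub>M gams (insert k J) n"
        by (rule measurable_fun_upd[where J = J]) (use A in auto)
      from measurable_sets[OF this E] show ?thesis by (simp add: vimage_def Int_def conj_commute)
    qed
    have "(\<integral>\<^sup>+g. indicator E (A(k := g)) \<partial>gam n) = (\<integral>\<^sup>+g. indicator {g \<in> space (gam n). A(k := g) \<in> E} g \<partial>gam n)"
      by (intro nn_integral_cong) (auto simp: indicator_def)
    also have "\<dots> = ennreal (measure (gam n) {g \<in> space (gam n). A(k := g) \<in> E})"
      using sec by (simp add: g.emeasure_eq_measure)
    also have "\<dots> \<le> indicator F A + ennreal c * indicator B A"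
    proof (cases "A \<in> F")
      case True
      have "ennreal (measure (gam n) {g \<in> space (gam n). A(k := g) \<in> E}) \<le> 1"
        using g.prob_le_1 by (simp add: ennreal_le_1)
      also have "1 \<le> indicator F A + ennreal c * indicator B A" using True by (simp add: add_increasing2)
      finally show ?thesis .
    next
      case nF: False
      show ?thesis
      proof (cases "A \<in> B")
        case True
        then show ?thesis using le[OF True nF] nF by (simp add: ennreal_leI)
      next
        case False
        then have "{g \<in> space (gam n). A(k := g) \<in> E} = {}" using out[OF A] by blast
        then show ?thesis by (simp only: measure_empty) simp
      qed
    qed
    finally show "(\<integral>\<^sup>+g. indicator E (A(k := g)) \<partial>gam n) \<le> indicator F A + ennreal c * indicator B A" .
  qed
  also have "\<dots> = emeasure (gams J n) F + ennreal c * emeasure (gams J n) B"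
    using F B by (subst nn_integral_add) (auto simp: nn_integral_cmult)
  also have "\<dots> = ennreal (measure (gams J n) F + c * measure (gams J n) B)"
  proof -
    have "ennreal (measure (gams J n) F + c * measure (gams J n) B) = ennreal (measure (gams J n) F) + ennreal (c * measure (gams J n) B)"
      using c by (intro ennreal_plus) auto
    also have "ennreal (c * measure (gams J n) B) = ennreal c * ennreal (measure (gams J n) B)"
      using c by (intro ennreal_mult) auto
    finally show ?thesis by (simp only: G.emeasure_eq_measure)
  qed
  finally show ?thesis unfolding G'.emeasure_eq_measure using c by (subst (asm) ennreal_le_iff) auto
qed

end

lemma near_orthogonal:
  assumes v: "nsq n v = 1" "\<And>j. j \<in> U \<Longrightarrow> ip n v (A j) = 0" and s: "0 \<le> s"
    and near: "nsq n (\<lambda>i. g i - (\<Sum>j\<in>U. y j * A j i)) < s\<^sup>2"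
  shows "\<bar>ip n v g\<bar> < s"
proof -
  have "ip n v (\<lambda>i. g i - (\<Sum>j\<in>U. y j * A j i)) = ip n v g"
    unfolding ip_combination using v by simp
  then have "(ip n v g)\<^sup>2 \<le> 1 * nsq n (\<lambda>i. g i - (\<Sum>j\<in>U. y j * A j i))"
    using ip_cauchy_schwarz[of n v "\<lambda>i. g i - (\<Sum>j\<in>U. y j * A j i)"] v by simp
  then have "(ip n v g)\<^sup>2 < s\<^sup>2" using near by simp
  then show ?thesis using s by (metis abs_of_nonneg power2_abs power_less_imp_less_base abs_ge_zero)
qed

context level
begin

text \<open>The inner product with a unit vector orthogonal to the other columns is at most the distance to their span. The column is independent
of the others, so that Fubini's theorem reduces the claim to \<open>normal_vectors_unstructured\<close>.\<close>

lemma column_near_prob: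
  assumes n2: "2 \<le> n" and k: "k < n" and s: "0 < s"
  defines "J \<equiv> {..<n} - {k}"
  shows "measure (gams {..<n} n) {A \<in> space (gams {..<n} n). near n (A k) J A (s\<^sup>2) \<and> (\<Prod>i\<in>J. trunc_norm K n (A i)) \<le> kap ^ n}
    \<le> exp (- c1 * n / 32) + exp (- real n) + 320 * (s + exp (- tau * n / 16)) / al1"
    "{A \<in> space (gams {..<n} n). near n (A k) J A (s\<^sup>2) \<and> (\<Prod>i\<in>J. trunc_norm K n (A i)) \<le> kap ^ n} \<in> sets (gams {..<n} n)" (is "?E \<in> _")
proof -
  have J: "finite J" "k \<notin> J" "Suc (card J) = n" "insert k J = {..<n}" "J \<subseteq> {..<n}" using k by (auto simp: J_def)
  have pm: "(\<lambda>A. \<Prod>i\<in>J. trunc_norm K n (A i)) \<in> borel_measurable (gams J' n)" if "J \<subseteq> J'" for J'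
    using that by (intro borel_measurable_prod measurable_compose[OF meas_gams_coord meas_trunc]) auto
  show E: "?E \<in> sets (gams {..<n} n)"
  proof -
    have "{A \<in> space (gams {..<n} n). near n (A k) J A (s\<^sup>2)} \<in> sets (gams {..<n} n)"
      using J k by (intro near_sets) auto
    moreover have "{A \<in> space (gams {..<n} n). (\<Prod>i\<in>J. trunc_norm K n (A i)) \<le> kap ^ n} \<in> sets (gams {..<n} n)"
      using pm[of "{..<n}"] J by measurable
    ultimately have "{A \<in> space (gams {..<n} n). near n (A k) J A (s\<^sup>2)} \<inter> {A \<in> space (gams {..<n} n). (\<Prod>i\<in>J. trunc_norm K n (A i)) \<le> kap ^ n} \<in> sets (gams {..<n} n)"
      by (rule sets.Int)
    also have "{A \<in> space (gams {..<n} n). near n (A k) J A (s\<^sup>2)} \<inter> {A \<in> space (gams {..<n} n). (\<Prod>i\<in>J. trunc_norm K n (A i)) \<le> kap ^ n} = ?E" by auto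
    finally show ?thesis .
  qed
  obtain F where F: "F \<in> sets (gams J n)" "measure (gams J n) F \<le> exp (- c1 * n / 32) + exp (- real n)"
    and Fv: "\<And>A v s. A \<in> space (gams J n) - F \<Longrightarrow> (\<Prod>i\<in>J. trunc_norm K n (A i)) \<le> kap ^ n \<Longrightarrow> nsq n v = 1 \<Longrightarrow>
       (\<forall>i\<in>J. ip n v (A i) = 0) \<Longrightarrow> exp (- tau * n / 16) \<le> s \<Longrightarrow>
       measure (gam n) {g \<in> space (gam n). \<bar>ip n v g\<bar> \<le> s} \<le> 320 * s / al1"
    using normal_vectors_unstructured[OF J(1,3) n2] by blast
  let ?B = "{A \<in> space (gams J n). (\<Prod>i\<in>J. trunc_norm K n (A i)) \<le> kap ^ n}"
  have B: "?B \<in> sets (gams J n)" using pm[of J] by measurable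
  define s' where "s' = s + exp (- tau * n / 16)"
  have s': "0 \<le> s'" "exp (- tau * n / 16) \<le> s'" "s \<le> s'" using s by (auto simp: s'_def)
  have "measure (gams (insert k J) n) ?E \<le> measure (gams J n) F + (320 * s' / al1) * measure (gams J n) ?B"
  proof (rule gams_fubini[OF J(1,2) _ F(1) B])
    show "?E \<in> sets (gams (insert k J) n)" using E unfolding J(4) .
    show "0 \<le> 320 * s' / al1" using s' al1 by simp
  next
    fix A assume A: "A \<in> ?B" "A \<notin> F"
    interpret g: prob_space "gam n" by (rule prob_gam)
    have "card (A ` J) < n" using card_image_le[OF J(1), of A] J(3) by simp
    then obtain v where v: "nsq n v = 1" "\<forall>i\<in>J. ip n v (A i) = 0"
      using unit_orthogonal[of "A ` J" n] J(1) by blast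
    have "measure (gam n) {g \<in> space (gam n). A(k := g) \<in> ?E} \<le> measure (gam n) {g \<in> space (gam n). \<bar>ip n v g\<bar> \<le> s'}"
    proof (rule g.finite_measure_mono)
      show "{g \<in> space (gam n). A(k := g) \<in> ?E} \<subseteq> {g \<in> space (gam n). \<bar>ip n v g\<bar> \<le> s'}"
      proof clarsimp
        fix g assume "near n g J (A(k := g)) (s\<^sup>2)"
        then have "near n g J A (s\<^sup>2)" using J(2) by (subst near_cong[of J A "A(k := g)"]) auto
        then obtain y where "nsq n (\<lambda>i. g i - (\<Sum>j\<in>J. y j * A j i)) < s\<^sup>2" unfolding near_def by blast
        then have "\<bar>ip n v g\<bar> < s" using v s by (intro near_orthogonal[of n v J A]) auto
        then show "\<bar>ip n v g\<bar> \<le> s'" using s' by linarith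
      qed
    qed measurable
    also have "\<dots> \<le> 320 * s' / al1" using A v s' by (intro Fv[of A]) auto
    finally show "measure (gam n) {g \<in> space (gam n). A(k := g) \<in> ?E} \<le> 320 * s' / al1" .
  next
    fix A g assume A: "A \<in> space (gams J n)" "g \<in> space (gam n)" "A(k := g) \<in> ?E"
    have "(\<Prod>i\<in>J. trunc_norm K n ((A(k := g)) i)) = (\<Prod>i\<in>J. trunc_norm K n (A i))"
      using J(2) by (intro prod.cong) auto
    then show "A \<in> ?B" using A by simp
  qed
  also have "\<dots> \<le> measure (gams J n) F + (320 * s' / al1) * 1"
  proof -
    interpret G: prob_space "gams J n" by (rule prob_gams)
    show ?thesis using s' al1 by (intro add_left_mono mult_left_mono) auto
  qed
  finally show "measure (gams {..<n} n) ?E \<le> exp (- c1 * n / 32) + exp (- real n) + 320 * (s + exp (- tau * n / 16)) / al1"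
    using F(2) unfolding J(4) s'_def by simp
qed

text \<open>Markov's inequality for the number of columns close to the span of the others.\<close>

lemma many_near_prob:
  assumes n2: "2 \<le> n" and s: "0 < s"
  defines "D \<equiv> \<lambda>k. {A \<in> space (gams {..<n} n). near n (A k) ({..<n} - {k}) A (s\<^sup>2) \<and>
      (\<Prod>i\<in>{..<n} - {k}. trunc_norm K n (A i)) \<le> kap ^ n}"
  shows "{A \<in> space (gams {..<n} n). beta * n \<le> (\<Sum>k<n. indicator (D k) A)} \<in> sets (gams {..<n} n)" (is "?E \<in> _")
    "measure (gams {..<n} n) {A \<in> space (gams {..<n} n). beta * n \<le> (\<Sum>k<n. indicator (D k) A)}
      \<le> (exp (- c1 * n / 32) + exp (- real n) + 320 * (s + exp (- tau * n / 16)) / al1) / beta"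
proof -
  interpret G: prob_space "gams {..<n} n" by (rule prob_gams)
  have D: "D k \<in> sets (gams {..<n} n)" if "k < n" for k
    unfolding D_def using column_near_prob(2)[OF n2 that s] .
  have m: "(\<lambda>A. \<Sum>k<n. indicator (D k) A :: real) \<in> borel_measurable (gams {..<n} n)"
    using D by (intro borel_measurable_sum borel_measurable_indicator) auto
  then show E: "?E \<in> sets (gams {..<n} n)" by measurable
  define c where "c = exp (- c1 * n / 32) + exp (- real n) + 320 * (s + exp (- tau * n / 16)) / al1"
  have i: "integrable (gams {..<n} n) (indicator (D k) :: _ \<Rightarrow> real)" if "k < n" for k
    by (rule G.integrable_const_bound[of _ 1]) (use D that in \<open>auto simp: indicator_def\<close>)
  have "(beta * n) * measure (gams {..<n} n) ?E = (\<integral>A. (beta * n) * indicator ?E A \<partial>gams {..<n} n)" using E by simp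
  also have "\<dots> \<le> (\<integral>A. (\<Sum>k<n. indicator (D k) A) \<partial>gams {..<n} n)"
  proof (intro integral_mono)
    show "integrable (gams {..<n} n) (\<lambda>A. (beta * n) * indicator ?E A)"
      by (intro integrable_mult_right G.integrable_const_bound[of _ 1]) (use E in \<open>auto simp: indicator_def\<close>)
    show "integrable (gams {..<n} n) (\<lambda>A. \<Sum>k<n. indicator (D k) A :: real)" using i by (intro Bochner_Integration.integrable_sum) auto
    fix A
    show "(beta * n) * indicator ?E A \<le> (\<Sum>k<n. indicator (D k) A :: real)"
      by (cases "A \<in> ?E") (auto intro: sum_nonneg)
  qed
  also have "\<dots> = (\<Sum>k<n. measure (gams {..<n} n) (D k))"
    using i D by (subst Bochner_Integration.integral_sum) auto
  also have "\<dots> \<le> (\<Sum>k<n. c)"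
    unfolding D_def c_def by (intro sum_mono column_near_prob(1) n2 s) auto
  also have "\<dots> = n * c" by simp
  finally have "n * (beta * measure (gams {..<n} n) ?E) \<le> n * c" by (simp only: mult_ac)
  then have "beta * measure (gams {..<n} n) ?E \<le> c" using n1 by simp
  then show "measure (gams {..<n} n) ?E \<le> (exp (- c1 * n / 32) + exp (- real n) + 320 * (s + exp (- tau * n / 16)) / al1) / beta"
    unfolding c_def using beta by (simp add: pos_le_divide_eq mult.commute)
qed

text \<open>Rows serve to exclude vectors with few large coordinates, columns to estimate distances, hence the two
random elements \<open>R\<close> and \<open>C\<close> with transposed values. For a spread vector each of its at least \<open>beta * n\<close> large
coordinates yields a column at distance at most \<open>e/rho\<close> from the span of the others.\<close>

theorem invertibility:
  assumes n2: "2 \<le> n" and n3: "1024 \<le> al * n\<^sup>2" and M: "prob_space M"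
    and R: "R \<in> M \<rightarrow>\<^sub>M gams {..<n} n" "distr M (gams {..<n} n) R = gams {..<n} n"
    and C: "C \<in> M \<rightarrow>\<^sub>M gams {..<n} n" "distr M (gams {..<n} n) C = gams {..<n} n"
    and RC: "\<And>\<omega> i j. \<omega> \<in> space M \<Longrightarrow> i < n \<Longrightarrow> j < n \<Longrightarrow> R \<omega> i j = C \<omega> j i"
    and bad: "{A \<in> space (gams {..<n} n). kap ^ n < (\<Prod>i<n. trunc_norm K n (A i))} \<in> sets (gams {..<n} n)"
      "measure (gams {..<n} n) {A \<in> space (gams {..<n} n). kap ^ n < (\<Prod>i<n. trunc_norm K n (A i))} \<le> q"
    and E: "E \<in> sets M" "\<And>\<omega>. \<omega> \<in> E \<Longrightarrow> \<exists>x. nsq n x = 1 \<and> (\<Sum>i<n. (ip n x (R \<omega> i))\<^sup>2) < e\<^sup>2 / n" and e: "0 < e"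
  shows "measure M E \<le> q + exp (- c1 * n / 32) +
    (exp (- c1 * n / 32) + exp (- real n) + 320 * (e / rho + exp (- tau * n / 16)) / al1) / beta"
proof (cases "e\<^sup>2 / n \<le> al / 1024 * n")
  case False
  interpret M: prob_space M by (rule M)
  have "al * n\<^sup>2 / 1024 < e\<^sup>2" using False n1 by (simp add: field_simps power2_eq_square)
  then have "1\<^sup>2 < e\<^sup>2" using n3 by simp
  then have e1: "1 < e" using e by (metis less_imp_le power_less_imp_less_base)
  have "rho * (al1 * beta) \<le> 1 * (1 * 1)" using rho rho1 al1 beta by (intro mult_mono) auto
  then have "1 \<le> 1 / (rho * (al1 * beta))" using rho al1 beta by simp
  also have "\<dots> \<le> 320 * e / (rho * (al1 * beta))" using e1 rho al1 beta by (intro divide_right_mono) auto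
  also have "\<dots> = 320 * (e / rho) / al1 / beta" by simp
  also have "\<dots> \<le> (exp (- c1 * n / 32) + exp (- real n) + 320 * (e / rho + exp (- tau * n / 16)) / al1) / beta"
    using al1 beta by (intro divide_right_mono add_increasing) auto
  finally have "1 \<le> (exp (- c1 * n / 32) + exp (- real n) + 320 * (e / rho + exp (- tau * n / 16)) / al1) / beta" .
  moreover have "0 \<le> q" using bad(2) measure_nonneg order_trans by blast
  moreover have "0 \<le> exp (- c1 * n / 32)" by simp
  ultimately show ?thesis using M.prob_le_1[of E] by linarith
next
  case True
  interpret M: prob_space M by (rule M)
  interpret G: prob_space "gams {..<n} n" by (rule prob_gams)
  let ?Bad = "{A \<in> space (gams {..<n} n). kap ^ n < (\<Prod>i<n. trunc_norm K n (A i))}"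
  define D where "D k = {A \<in> space (gams {..<n} n). near n (A k) ({..<n} - {k}) A ((e / rho)\<^sup>2) \<and>
      (\<Prod>i\<in>{..<n} - {k}. trunc_norm K n (A i)) \<le> kap ^ n}" for k
  let ?Many = "{A \<in> space (gams {..<n} n). beta * n \<le> (\<Sum>k<n. indicator (D k) A)}"
  have er: "0 < e / rho" using e rho by simp
  have mn: "?Many \<in> sets (gams {..<n} n)" "measure (gams {..<n} n) ?Many
      \<le> (exp (- c1 * n / 32) + exp (- real n) + 320 * (e / rho + exp (- tau * n / 16)) / al1) / beta"
    using many_near_prob[OF n2 er] by (simp_all only: D_def)
  obtain F where F: "F \<in> sets (gams {..<n} n)" "measure (gams {..<n} n) F \<le> exp (- c1 * n / 32)"
    and Fx: "\<And>A x. A \<in> space (gams {..<n} n) - F \<Longrightarrow> nsq n x = 1 \<Longrightarrow> (\<Sum>i<n. (ip n x (A i))\<^sup>2) \<le> al / 1024 * n \<Longrightarrow>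
      beta * n < card {j \<in> {..<n}. rho / sqrt n \<le> \<bar>x j\<bar>}"
    using spread_vectors[of "{..<n}"] by auto
  have sub: "E \<subseteq> (R -` F \<inter> space M) \<union> ((C -` ?Bad \<inter> space M) \<union> (C -` ?Many \<inter> space M))"
  proof
    fix \<omega> assume w: "\<omega> \<in> E"
    have ws: "\<omega> \<in> space M" using w E(1) sets.sets_into_space by blast
    have Rs: "R \<omega> \<in> space (gams {..<n} n)" and Cs: "C \<omega> \<in> space (gams {..<n} n)"
      using measurable_space[OF R(1) ws] measurable_space[OF C(1) ws] by auto
    obtain x where x: "nsq n x = 1" "(\<Sum>i<n. (ip n x (R \<omega> i))\<^sup>2) < e\<^sup>2 / n" using E(2)[OF w] by blast
    show "\<omega> \<in> (R -` F \<inter> space M) \<union> ((C -` ?Bad \<inter> space M) \<union> (C -` ?Many \<inter> space M))"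
    proof (rule ccontr)
      assume nin: "\<omega> \<notin> (R -` F \<inter> space M) \<union> ((C -` ?Bad \<inter> space M) \<union> (C -` ?Many \<inter> space M))"
      have nF: "R \<omega> \<in> space (gams {..<n} n) - F" using nin ws Rs by blast
      have nB: "(\<Prod>i<n. trunc_norm K n (C \<omega> i)) \<le> kap ^ n" using nin ws Cs by auto
      have nM: "\<not> beta * n \<le> (\<Sum>k<n. indicator (D k) (C \<omega>))" using nin ws Cs by auto
      define S where "S = {j \<in> {..<n}. rho / sqrt n \<le> \<bar>x j\<bar>}"
      have "(\<Sum>i<n. (ip n x (R \<omega> i))\<^sup>2) \<le> al / 1024 * n" using x True by linarith
      from Fx[OF nF x(1) this] have cS: "beta * n < card S" by (simp add: S_def)
      have inD: "C \<omega> \<in> D k" if k: "k \<in> S" for k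
      proof -
        have kn: "k < n" and xk: "rho / sqrt n \<le> \<bar>x k\<bar>" using k by (auto simp: S_def)
        have "0 < rho / sqrt n" using rho n1 by simp
        then have xk0: "0 < \<bar>x k\<bar>" using xk by linarith
        define y where "y j = - (x j / x k)" for j
        have row: "C \<omega> k i - (\<Sum>j\<in>{..<n} - {k}. y j * C \<omega> j i) = ip n x (R \<omega> i) / x k" if i: "i < n" for i
        proof -
          have "ip n x (R \<omega> i) = (\<Sum>j<n. x j * C \<omega> j i)"
            unfolding ip_def using RC[OF ws i] by (intro sum.cong) auto
          also have "\<dots> = x k * C \<omega> k i + (\<Sum>j\<in>{..<n} - {k}. x j * C \<omega> j i)"
            using kn by (subst sum.remove[of _ k]) auto
          finally have "ip n x (R \<omega> i) / x k = C \<omega> k i + (\<Sum>j\<in>{..<n} - {k}. x j * C \<omega> j i) / x k"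
            using xk0 by (simp add: add_divide_distrib)
          also have "(\<Sum>j\<in>{..<n} - {k}. x j * C \<omega> j i) / x k = - (\<Sum>j\<in>{..<n} - {k}. y j * C \<omega> j i)"
            by (simp add: y_def sum_divide_distrib sum_negf[symmetric])
          finally show ?thesis by simp
        qed
        have "nsq n (\<lambda>i. C \<omega> k i - (\<Sum>j\<in>{..<n} - {k}. y j * C \<omega> j i)) = (\<Sum>i<n. (ip n x (R \<omega> i) / x k)\<^sup>2)"
          unfolding nsq_def using row by (intro sum.cong) auto
        also have "\<dots> = (\<Sum>i<n. (ip n x (R \<omega> i))\<^sup>2) / (x k)\<^sup>2" by (simp add: power_divide sum_divide_distrib)
        also have "\<dots> < (e\<^sup>2 / n) / (x k)\<^sup>2" using x xk0 by (intro divide_strict_right_mono) auto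
        also have "\<dots> \<le> (e\<^sup>2 / n) / (rho / sqrt n)\<^sup>2"
        proof (intro divide_left_mono)
          have "(rho / sqrt n)\<^sup>2 \<le> \<bar>x k\<bar>\<^sup>2" using xk rho by (intro power_mono) auto
          then show "(rho / sqrt n)\<^sup>2 \<le> (x k)\<^sup>2" by simp
          show "0 < (x k)\<^sup>2 * (rho / sqrt n)\<^sup>2" using xk0 rho n1 by simp
        qed simp
        also have "\<dots> = (e / rho)\<^sup>2" using n1 by (simp add: power_divide)
        finally have "near n (C \<omega> k) ({..<n} - {k}) (C \<omega>) ((e / rho)\<^sup>2)" unfolding near_def by blast
        moreover have "(\<Prod>i\<in>{..<n} - {k}. trunc_norm K n (C \<omega> i)) \<le> kap ^ n"
        proof -
          have "1 * (\<Prod>i\<in>{..<n} - {k}. trunc_norm K n (C \<omega> i)) \<le> trunc_norm K n (C \<omega> k) * (\<Prod>i\<in>{..<n} - {k}. trunc_norm K n (C \<omega> i))"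
            by (intro mult_right_mono trunc_norm_ge1 prod_nonneg) (use trunc_norm_ge1 in \<open>force intro: order_trans[of 0 1]\<close>)
          also have "\<dots> = (\<Prod>i<n. trunc_norm K n (C \<omega> i))" using kn by (subst prod.remove[of "{..<n}" k]) auto
          finally show ?thesis using nB by simp
        qed
        ultimately show ?thesis using Cs by (simp add: D_def)
      qed
      have "real (card S) = (\<Sum>k\<in>S. 1)" by simp
      also have "\<dots> = (\<Sum>k\<in>S. indicator (D k) (C \<omega>))" using inD by (intro sum.cong) auto
      also have "\<dots> \<le> (\<Sum>k<n. indicator (D k) (C \<omega>))" by (intro sum_mono2) (auto simp: S_def)
      finally show False using nM cS by linarith
    qed
  qed
  have sF: "R -` F \<inter> space M \<in> sets M" by (rule measurable_sets[OF R(1) F(1)])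
  have sB: "C -` ?Bad \<inter> space M \<in> sets M" by (rule measurable_sets[OF C(1) bad(1)])
  have sM: "C -` ?Many \<inter> space M \<in> sets M" by (rule measurable_sets[OF C(1) mn(1)])
  have "measure M E \<le> measure M ((R -` F \<inter> space M) \<union> ((C -` ?Bad \<inter> space M) \<union> (C -` ?Many \<inter> space M)))"
    by (rule M.finite_measure_mono[OF sub]) (intro sets.Un sF sB sM)
  also have "\<dots> \<le> measure M (R -` F \<inter> space M) + (measure M (C -` ?Bad \<inter> space M) + measure M (C -` ?Many \<inter> space M))"
    using measure_Un_le[OF sF sets.Un[OF sB sM]] measure_Un_le[OF sB sM] by linarith
  also have "measure M (R -` F \<inter> space M) = measure (gams {..<n} n) F"
    using measure_distr[OF R(1) F(1)] R(2) by simp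
  also have "measure M (C -` ?Bad \<inter> space M) = measure (gams {..<n} n) ?Bad"
    using measure_distr[OF C(1) bad(1)] C(2) by simp
  also have "measure M (C -` ?Many \<inter> space M) = measure (gams {..<n} n) ?Many"
    using measure_distr[OF C(1) mn(1)] C(2) by simp
  finally show ?thesis using F(2) bad(2) mn(2) by linarith
qed

end

section \<open>Distance of a random vector to a subspace\<close>

text \<open>Conditioning on all coordinates but the \<open>k\<close>-th. The event \<open>B\<close>, on which nothing depends on that coordinate, lets
the bound be iterated.\<close>

lemma product_coordinate_bound:
  fixes N :: "'m measure" and J :: "'i set" and c :: real
  assumes N: "prob_space N" and J: "finite J" "k \<notin> J"
    and E: "E \<in> sets (PiM (insert k J) (\<lambda>_. N))" and B: "B \<in> sets (PiM (insert k J) (\<lambda>_. N))"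
    and EB: "E \<subseteq> B" and c: "0 \<le> c"
    and inv: "\<And>A g g'. A \<in> space (PiM J (\<lambda>_. N)) \<Longrightarrow> g \<in> space N \<Longrightarrow> g' \<in> space N \<Longrightarrow> A(k := g) \<in> B \<Longrightarrow> A(k := g') \<in> B"
    and le: "\<And>A. A \<in> space (PiM J (\<lambda>_. N)) \<Longrightarrow> measure N {g \<in> space N. A(k := g) \<in> E} \<le> c"
  shows "measure (PiM (insert k J) (\<lambda>_. N)) E \<le> c * measure (PiM (insert k J) (\<lambda>_. N)) B"
proof -
  interpret N: prob_space N by (rule N)
  interpret G: prob_space "PiM (insert k J) (\<lambda>_. N)" by (rule prob_space_PiM) (rule N)
  interpret product_sigma_finite "\<lambda>_::'i. N"
    by (rule product_sigma_finite.intro) (rule prob_space_imp_sigma_finite[OF N])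
  have sec: "{g \<in> space N. A(k := g) \<in> X} \<in> sets N"
    if "A \<in> space (PiM J (\<lambda>_. N))" "X \<in> sets (PiM (insert k J) (\<lambda>_. N))" for A X
  proof -
    have "(\<lambda>g. A(k := g)) \<in> N \<rightarrow>\<^sub>M PiM (insert k J) (\<lambda>_. N)"
      by (rule measurable_fun_upd[where J = J]) (use that in auto)
    from measurable_sets[OF this that(2)] show ?thesis by (simp add: vimage_def Int_def conj_commute)
  qed
  have sval: "(\<integral>\<^sup>+g. indicator X (A(k := g)) \<partial>N) = ennreal (measure N {g \<in> space N. A(k := g) \<in> X})"
    if "A \<in> space (PiM J (\<lambda>_. N))" "X \<in> sets (PiM (insert k J) (\<lambda>_. N))" for A X
  proof -
    have "(\<integral>\<^sup>+g. indicator X (A(k := g)) \<partial>N) = (\<integral>\<^sup>+g. indicator {g \<in> space N. A(k := g) \<in> X} g \<partial>N)"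
      by (intro nn_integral_cong) (auto simp: indicator_def)
    then show ?thesis using sec[OF that] by (simp add: N.emeasure_eq_measure)
  qed
  have "emeasure (PiM (insert k J) (\<lambda>_. N)) E = (\<integral>\<^sup>+A. indicator E A \<partial>PiM (insert k J) (\<lambda>_. N))"
    using E by simp
  also have "\<dots> = (\<integral>\<^sup>+A. (\<integral>\<^sup>+g. indicator E (A(k := g)) \<partial>N) \<partial>PiM J (\<lambda>_. N))"
    using E by (intro product_nn_integral_insert[OF J, of "indicator E"]) simp
  also have "\<dots> \<le> (\<integral>\<^sup>+A. ennreal c * (\<integral>\<^sup>+g. indicator B (A(k := g)) \<partial>N) \<partial>PiM J (\<lambda>_. N))"
  proof (rule nn_integral_mono)
    fix A assume A: "A \<in> space (PiM J (\<lambda>_. N))"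
    show "(\<integral>\<^sup>+g. indicator E (A(k := g)) \<partial>N) \<le> ennreal c * (\<integral>\<^sup>+g. indicator B (A(k := g)) \<partial>N)"
    proof (cases "\<exists>g\<in>space N. A(k := g) \<in> B")
      case True
      then have "{g \<in> space N. A(k := g) \<in> B} = space N" using inv[OF A] by blast
      then show ?thesis using le[OF A] by (simp add: sval[OF A E] sval[OF A B] N.prob_space ennreal_leI)
    next
      case False
      then have "{g \<in> space N. A(k := g) \<in> E} = {}" using EB by blast
      then show ?thesis by (simp only: sval[OF A E] measure_empty) simp
    qed
  qed
  also have "\<dots> = ennreal c * (\<integral>\<^sup>+A. indicator B A \<partial>PiM (insert k J) (\<lambda>_. N))"
  proof -
    have "(\<lambda>(A, g). indicator B (A(k := g)) :: ennreal) = indicator B \<circ> (\<lambda>(A, g). A(k := g))" by auto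
    then have "(\<lambda>(A, g). indicator B (A(k := g)) :: ennreal) \<in> borel_measurable (PiM J (\<lambda>_. N) \<Otimes>\<^sub>M N)"
      using measurable_comp[OF measurable_add_dim[of k J "\<lambda>_. N"] borel_measurable_indicator[OF B]] by simp
    then have m: "(\<lambda>A. \<integral>\<^sup>+g. indicator B (A(k := g)) \<partial>N) \<in> borel_measurable (PiM J (\<lambda>_. N))"
      by (rule N.borel_measurable_nn_integral)
    have "(\<integral>\<^sup>+A. indicator B A \<partial>PiM (insert k J) (\<lambda>_. N)) = (\<integral>\<^sup>+A. (\<integral>\<^sup>+g. indicator B (A(k := g)) \<partial>N) \<partial>PiM J (\<lambda>_. N))"
      using B by (intro product_nn_integral_insert[OF J, of "indicator B"]) simp
    then show ?thesis using m by (simp add: nn_integral_cmult)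
  qed
  also have "\<dots> = ennreal c * emeasure (PiM (insert k J) (\<lambda>_. N)) B" using B by simp
  also have "\<dots> = ennreal (c * measure (PiM (insert k J) (\<lambda>_. N)) B)"
    using c by (simp add: G.emeasure_eq_measure ennreal_mult)
  finally show ?thesis unfolding G.emeasure_eq_measure using c by (subst (asm) ennreal_le_iff) auto
qed

lemma large_coordinate:
  assumes "nsq n v = 1" shows "\<exists>i<n. 1 / sqrt n \<le> \<bar>v i\<bar>"
proof (rule ccontr)
  assume "\<not> ?thesis"
  then have h: "\<And>i. i < n \<Longrightarrow> \<bar>v i\<bar> < 1 / sqrt n" by (auto simp: not_le)
  have n0: "n \<noteq> 0"
  proof
    assume "n = 0" then show False using assms by (simp add: nsq_def)
  qed
  have "nsq n v < (\<Sum>i<n. 1 / real n)" unfolding nsq_def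
  proof (rule sum_strict_mono)
    fix i assume "i \<in> {..<n}"
    then have "\<bar>v i\<bar>\<^sup>2 < (1 / sqrt n)\<^sup>2" using h by (intro power_strict_mono) auto
    then show "(v i)\<^sup>2 < 1 / real n" by (simp add: power_divide)
  qed (use n0 in auto)
  then show False using assms n0 by simp
qed

text \<open>Vectors orthogonal to \<open>W\<close> in echelon form: each one vanishes at the pivots of its predecessors. Impose these extra equations one
after the other; a homogeneous system with fewer equations than unknowns has a nonzero solution.\<close>

lemma staircase_normals:
  fixes W :: "(nat \<Rightarrow> real) set"
  assumes W: "finite W" "card W + m \<le> n"
  shows "\<exists>v \<iota>. \<forall>r<m. nsq n (v r) = 1 \<and> (\<forall>w\<in>W. ip n (v r) w = 0) \<and> \<iota> r < n \<and>
     1 / sqrt n \<le> \<bar>v r (\<iota> r)\<bar> \<and> (\<forall>s<r. v r (\<iota> s) = (0::real))"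
  using W(2)
proof (induction m)
  case (Suc m)
  then obtain v \<iota> where IH: "\<And>r. r < m \<Longrightarrow> nsq n (v r) = 1 \<and> (\<forall>w\<in>W. ip n (v r) w = 0) \<and> \<iota> r < n \<and>
     1 / sqrt n \<le> \<bar>v r (\<iota> r)\<bar> \<and> (\<forall>s<r. v r (\<iota> s) = (0::real))" by auto
  define e where "e i = (\<lambda>j. if j = i then 1 else 0 :: real)" for i :: nat
  have "card (W \<union> (\<lambda>s. e (\<iota> s)) ` {..<m}) \<le> card W + card ((\<lambda>s. e (\<iota> s)) ` {..<m})" by (rule card_Un_le)
  also have "\<dots> \<le> card W + m" using card_image_le[of "{..<m}" "\<lambda>s. e (\<iota> s)"] by simp
  also have "\<dots> < n" using Suc.prems by simp
  finally obtain x where x: "nsq n x = 1" "\<forall>s\<in>W \<union> (\<lambda>s. e (\<iota> s)) ` {..<m}. ip n x s = 0"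
    using unit_orthogonal[of "W \<union> (\<lambda>s. e (\<iota> s)) ` {..<m}" n] W(1) by auto
  obtain i where i: "i < n" "1 / sqrt n \<le> \<bar>x i\<bar>" using large_coordinate[OF x(1)] by blast
  have z: "x (\<iota> s) = 0" if "s < m" for s
  proof -
    have "ip n x (e (\<iota> s)) = 0" using x that by auto
    moreover have "ip n x (e (\<iota> s)) = x (\<iota> s)"
    proof -
      have "ip n x (e (\<iota> s)) = (\<Sum>j<n. if j = \<iota> s then x j else 0)" unfolding ip_def e_def by (intro sum.cong) auto
      then show ?thesis using IH[OF that] by simp
    qed
    ultimately show ?thesis by simp
  qed
  show ?case
  proof (intro exI[of _ "v(m := x)"] exI[of _ "\<iota>(m := i)"] allI impI)
    fix r assume "r < Suc m"
    then consider "r < m" | "r = m" by linarith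
    then show "nsq n ((v(m := x)) r) = 1 \<and> (\<forall>w\<in>W. ip n ((v(m := x)) r) w = 0) \<and> (\<iota>(m := i)) r < n \<and>
     1 / sqrt n \<le> \<bar>(v(m := x)) r ((\<iota>(m := i)) r)\<bar> \<and> (\<forall>s<r. (v(m := x)) r ((\<iota>(m := i)) s) = 0)"
    proof cases
      case 1
      then show ?thesis using IH[OF 1] by auto
    next
      case 2
      then show ?thesis using x i z by auto
    qed
  qed
qed simp

lemma near_image:
  assumes "inj_on p S"
  shows "(\<exists>y. nsq n (\<lambda>i. g i - (\<Sum>j\<in>p ` S. y j * A j i)) < r) \<longleftrightarrow> (\<exists>y. nsq n (\<lambda>i. g i - (\<Sum>j\<in>S. y j * A (p j) i)) < r)"
proof
  assume "\<exists>y. nsq n (\<lambda>i. g i - (\<Sum>j\<in>p ` S. y j * A j i)) < r"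
  then obtain y where "nsq n (\<lambda>i. g i - (\<Sum>j\<in>p ` S. y j * A j i)) < r" by blast
  then have "nsq n (\<lambda>i. g i - (\<Sum>j\<in>S. y (p j) * A (p j) i)) < r" using assms by (simp add: sum.reindex)
  then show "\<exists>y. nsq n (\<lambda>i. g i - (\<Sum>j\<in>S. y j * A (p j) i)) < r" by (intro exI[of _ "\<lambda>j. y (p j)"])
next
  assume "\<exists>y. nsq n (\<lambda>i. g i - (\<Sum>j\<in>S. y j * A (p j) i)) < r"
  then obtain y where y: "nsq n (\<lambda>i. g i - (\<Sum>j\<in>S. y j * A (p j) i)) < r" by blast
  have "(\<Sum>j\<in>p ` S. y (the_inv_into S p j) * A j i) = (\<Sum>j\<in>S. y j * A (p j) i)" for i
    using assms by (simp add: sum.reindex the_inv_into_f_f)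
  then have "nsq n (\<lambda>i. g i - (\<Sum>j\<in>p ` S. y (the_inv_into S p j) * A j i)) < r" using y by simp
  then show "\<exists>y. nsq n (\<lambda>i. g i - (\<Sum>j\<in>p ` S. y j * A j i)) < r" by (intro exI[of _ "\<lambda>j. y (the_inv_into S p j)"])
qed

context entry_law
begin

lemma near_reindex: "inj_on p S \<Longrightarrow> near n g (p ` S) A r = near n g S (\<lambda>j. A (p j)) r"
  unfolding near_def by (rule near_image)

lemma near_mono:
  assumes "finite U" "U' \<subseteq> U" "near n g U' A r" shows "near n g U A r"
proof -
  obtain y where y: "nsq n (\<lambda>i. g i - (\<Sum>j\<in>U'. y j * A j i)) < r" using assms unfolding near_def by blast
  have "(\<Sum>j\<in>U. (if j \<in> U' then y j else 0) * A j i) = (\<Sum>j\<in>U'. y j * A j i)" for i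
    using assms by (intro sum.mono_neutral_cong_right) auto
  then show ?thesis unfolding near_def using y by (intro exI[of _ "\<lambda>j. if j \<in> U' then y j else 0"]) simp
qed

text \<open>Odlyzko's argument. Being close to the subspace, \<open>g\<close> is almost orthogonal to the staircase of normal vectors; given the
other coordinates, each normal vector confines the coordinate of \<open>g\<close> at its pivot to an interval of radius \<open>a\<close>. The echelon form
makes these \<open>m\<close> constraints successive.\<close>

lemma near_subspace_prob:
  assumes a: "0 < a" and conc: "\<And>z. prob {x. \<bar>x - z\<bar> < a} \<le> b" and b: "0 \<le> b" and U: "finite U" "card U + m \<le> n"
  shows "measure (gam n) {g \<in> space (gam n). near n g U A ((a / sqrt n)\<^sup>2)} \<le> b ^ m"
proof -
  interpret g: prob_space "gam n" by (rule prob_gam)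
  have "card (A ` U) + m \<le> n" using card_image_le[OF U(1), of A] U by linarith
  from staircase_normals[OF finite_imageI[OF U(1)] this]
  obtain v \<iota> where vv: "\<forall>r<m. nsq n (v r) = 1 \<and> (\<forall>w\<in>A ` U. ip n (v r) w = 0) \<and> \<iota> r < n \<and>
     1 / sqrt n \<le> \<bar>v r (\<iota> r)\<bar> \<and> (\<forall>s<r. v r (\<iota> s) = (0::real))"
    by (elim exE)
  have v: "nsq n (v r) = 1" "\<forall>w\<in>A ` U. ip n (v r) w = 0" "\<iota> r < n" "1 / sqrt n \<le> \<bar>v r (\<iota> r)\<bar>" "\<forall>s<r. v r (\<iota> s) = 0"
    if "r < m" for r using vv that by simp_all
  define d where "d = a / sqrt n"
  define Q where "Q l = {g \<in> space (gam n). \<forall>r\<in>{l..<m}. \<bar>ip n (v r) g\<bar> < d}" for l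
  have Qs: "Q l \<in> sets (gam n)" for l unfolding Q_def by measurable
  have step: "measure (gam n) (Q l) \<le> b * measure (gam n) (Q (Suc l))" if l: "l < m" for l
  proof -
    define J where "J = {..<n} - {\<iota> l}"
    have J: "insert (\<iota> l) J = {..<n}" "finite J" "\<iota> l \<notin> J" using v(3)[OF l] by (auto simp: J_def)
    have n0: "0 < n" using v(3)[OF l] by simp
    have ipu: "ip n w (g(\<iota> l := x)) = w (\<iota> l) * x + (\<Sum>j\<in>J. w j * g j)" for w g x
    proof -
      have "ip n w (g(\<iota> l := x)) = (\<Sum>j\<in>insert (\<iota> l) J. w j * (g(\<iota> l := x)) j)" unfolding ip_def J(1) ..
      also have "\<dots> = w (\<iota> l) * x + (\<Sum>j\<in>J. w j * (g(\<iota> l := x)) j)" unfolding sum.insert[OF J(2,3)] by simp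
      also have "(\<Sum>j\<in>J. w j * (g(\<iota> l := x)) j) = (\<Sum>j\<in>J. w j * g j)" using J(3) by (intro sum.cong) auto
      finally show ?thesis .
    qed
    have "measure (PiM (insert (\<iota> l) J) (\<lambda>_. \<mu>)) (Q l) \<le> b * measure (PiM (insert (\<iota> l) J) (\<lambda>_. \<mu>)) (Q (Suc l))"
    proof (rule product_coordinate_bound[OF prob_space_axioms J(2,3)])
      show "Q l \<in> sets (PiM (insert (\<iota> l) J) (\<lambda>_. \<mu>))" "Q (Suc l) \<in> sets (PiM (insert (\<iota> l) J) (\<lambda>_. \<mu>))"
        using Qs unfolding J(1) gam_def by auto
      show "Q l \<subseteq> Q (Suc l)" by (auto simp: Q_def)
      show "0 \<le> b" by (rule b)
    next
      fix g x x' assume g: "g \<in> space (PiM J (\<lambda>_. \<mu>))" and q: "g(\<iota> l := x) \<in> Q (Suc l)"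
      have sp: "g(\<iota> l := x') \<in> space (gam n)"
        using g unfolding gam_def J(1)[symmetric] by (auto simp: space_PiM PiE_def extensional_def)
      have "ip n (v r) (g(\<iota> l := x')) = ip n (v r) (g(\<iota> l := x))" if "r \<in> {Suc l..<m}" for r
        using v(5)[of r] that by (simp add: ipu)
      then show "g(\<iota> l := x') \<in> Q (Suc l)" using q sp by (simp add: Q_def)
    next
      fix g assume g: "g \<in> space (PiM J (\<lambda>_. \<mu>))"
      define w where "w = v l (\<iota> l)"
      define s where "s = (\<Sum>j\<in>J. v l j * g j)"
      have w: "1 / sqrt n \<le> \<bar>w\<bar>" using v(4)[OF l] by (simp add: w_def)
      have "0 < 1 / sqrt n" using n0 by simp
      then have w0: "0 < \<bar>w\<bar>" using w by linarith
      have "{x \<in> space \<mu>. g(\<iota> l := x) \<in> Q l} \<subseteq> {x. \<bar>x - (- s / w)\<bar> < a}"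
      proof clarsimp
        fix x assume "g(\<iota> l := x) \<in> Q l"
        then have "\<bar>ip n (v l) (g(\<iota> l := x))\<bar> < d" using l by (simp add: Q_def)
        then have 1: "\<bar>w * x + s\<bar> < d" by (simp add: ipu w_def s_def)
        have "w * x + s = w * (x + s / w)" using w0 by (simp add: distrib_left)
        then have 2: "\<bar>w\<bar> * \<bar>x + s / w\<bar> < a / sqrt n" using 1 by (simp add: abs_mult d_def)
        have "1 / sqrt n * \<bar>x + s / w\<bar> \<le> \<bar>w\<bar> * \<bar>x + s / w\<bar>" using w by (intro mult_right_mono) auto
        then have "\<bar>x + s / w\<bar> / sqrt n < a / sqrt n" using 2 by simp
        then show "\<bar>x + s / w\<bar> < a" using n0 by (simp add: divide_less_cancel)
      qed
      then have "prob {x \<in> space \<mu>. g(\<iota> l := x) \<in> Q l} \<le> prob {x. \<bar>x - (- s / w)\<bar> < a}"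
        by (rule finite_measure_mono) simp
      then show "prob {x \<in> space \<mu>. g(\<iota> l := x) \<in> Q l} \<le> b" using conc[of "- s / w"] by linarith
    qed
    then show ?thesis unfolding J(1) gam_def .
  qed
  have "measure (gam n) (Q (m - k)) \<le> b ^ k" if "k \<le> m" for k
    using that
  proof (induction k)
    case 0 then show ?case by simp
  next
    case (Suc k)
    then have "measure (gam n) (Q (m - Suc k)) \<le> b * measure (gam n) (Q (Suc (m - Suc k)))" by (intro step) auto
    also have "Suc (m - Suc k) = m - k" using Suc.prems by simp
    also have "b * measure (gam n) (Q (m - k)) \<le> b * b ^ k" using Suc b by (intro mult_left_mono) auto
    finally show ?case by simp
  qed
  from this[of m] have Q0: "measure (gam n) (Q 0) \<le> b ^ m" by simp
  have "{g \<in> space (gam n). near n g U A ((a / sqrt n)\<^sup>2)} \<subseteq> Q 0"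
  proof clarsimp
    fix g assume g: "g \<in> space (gam n)" and "near n g U A ((a / sqrt n)\<^sup>2)"
    then obtain y where y: "nsq n (\<lambda>i. g i - (\<Sum>j\<in>U. y j * A j i)) < d\<^sup>2" unfolding near_def d_def by blast
    have "\<bar>ip n (v r) g\<bar> < d" if "r < m" for r
      using a v that by (intro near_orthogonal[OF _ _ _ y]) (auto simp: d_def)
    then show "g \<in> Q 0" using g by (simp add: Q_def)
  qed
  then have "measure (gam n) {g \<in> space (gam n). near n g U A ((a / sqrt n)\<^sup>2)} \<le> measure (gam n) (Q 0)"
    by (intro g.finite_measure_mono Qs)
  then show ?thesis using Q0 by linarith
qed

end

section \<open>Well separated columns\<close>

definition colmat :: "nat \<Rightarrow> (nat \<Rightarrow> nat \<Rightarrow> real) \<Rightarrow> real mat" where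
  "colmat n a = mat n n (\<lambda>(i, k). a k i)"

lemma colmat_carrier [simp]: "colmat n a \<in> carrier_mat n n" by (simp add: colmat_def)

lemma colmat_mult_vec: "i < n \<Longrightarrow> (colmat n a *\<^sub>v vec n x) $ i = (\<Sum>k<n. x k * a k i)"
  by (auto simp: colmat_def scalar_prod_def lessThan_atLeast0 intro!: sum.cong)

lemma colmat_simps [simp]: "dim_row (colmat n a) = n" "dim_col (colmat n a) = n"
  "i < n \<Longrightarrow> k < n \<Longrightarrow> colmat n a $$ (i, k) = a k i"
  by (simp_all add: colmat_def)

lemma colmat_det_0_iff:
  "det (colmat n a) = 0 \<longleftrightarrow> (\<exists>x. (\<exists>k<n. x k \<noteq> 0) \<and> (\<forall>i<n. (\<Sum>k<n. x k * a k i) = 0))"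
proof -
  have "det (colmat n a) = 0 \<longleftrightarrow> (\<exists>v. v \<in> carrier_vec n \<and> v \<noteq> 0\<^sub>v n \<and> colmat n a *\<^sub>v v = 0\<^sub>v n)"
    by (rule det_0_iff_vec_prod_zero_field) simp
  also have "\<dots> \<longleftrightarrow> (\<exists>x. (\<exists>k<n. x k \<noteq> 0) \<and> (\<forall>i<n. (\<Sum>k<n. x k * a k i) = 0))"
  proof
    assume "\<exists>v. v \<in> carrier_vec n \<and> v \<noteq> 0\<^sub>v n \<and> colmat n a *\<^sub>v v = 0\<^sub>v n"
    then obtain v where v: "v \<in> carrier_vec n" "v \<noteq> 0\<^sub>v n" "colmat n a *\<^sub>v v = 0\<^sub>v n" by blast
    have vv: "vec n (\<lambda>k. v $ k) = v" using v(1) by auto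
    have "\<exists>k<n. v $ k \<noteq> 0" using v by (metis carrier_vecD eq_vecI index_zero_vec(1) index_zero_vec(2))
    moreover have "\<forall>i<n. (\<Sum>k<n. v $ k * a k i) = 0"
      using colmat_mult_vec[of _ n a "\<lambda>k. v $ k"] v(3) unfolding vv by auto
    ultimately show "\<exists>x. (\<exists>k<n. x k \<noteq> 0) \<and> (\<forall>i<n. (\<Sum>k<n. x k * a k i) = 0)" by blast
  next
    assume "\<exists>x. (\<exists>k<n. x k \<noteq> 0) \<and> (\<forall>i<n. (\<Sum>k<n. x k * a k i) = 0)"
    then obtain x k where x: "k < n" "x k \<noteq> 0" "\<forall>i<n. (\<Sum>k<n. x k * a k i) = 0" by blast
    have "vec n x \<noteq> 0\<^sub>v n" using x(1,2) by (metis index_vec index_zero_vec(1))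
    moreover have "colmat n a *\<^sub>v vec n x = 0\<^sub>v n"
      using x(3) colmat_mult_vec[of _ n a x] by (intro eq_vecI) (auto simp: colmat_def)
    ultimately show "\<exists>v. v \<in> carrier_vec n \<and> v \<noteq> 0\<^sub>v n \<and> colmat n a *\<^sub>v v = 0\<^sub>v n" by (intro exI[of _ "vec n x"]) auto
  qed
  finally show ?thesis .
qed

lemma colmat_cramer:
  assumes d: "det (colmat n a) \<noteq> 0"
  shows "\<exists>x. (\<forall>i<n. g i = (\<Sum>k<n. x k * a k i)) \<and> (\<forall>k<n. det (colmat n (a(k := g))) = x k * det (colmat n a))"
proof -
  define row where "row i = (\<lambda>k. if k < n then a k i else g i)" for i :: nat
  have "card (row ` {..<n}) < Suc n" using card_image_le[of "{..<n}" row] by simp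
  then obtain y where y: "\<exists>k<Suc n. y k \<noteq> 0" "\<forall>s\<in>row ` {..<n}. ip (Suc n) y s = 0"
    using nonzero_orthogonal[of "row ` {..<n}" "Suc n"] by blast
  have e: "(\<Sum>k<n. y k * a k i) + y n * g i = 0" if "i < n" for i
  proof -
    have "ip (Suc n) y (row i) = (\<Sum>k<n. y k * a k i) + y n * g i" unfolding ip_def by (simp add: row_def)
    then show ?thesis using y(2) that by simp
  qed
  have yn: "y n \<noteq> 0"
  proof
    assume "y n = 0"
    then have "\<forall>i<n. (\<Sum>k<n. y k * a k i) = 0" "\<exists>k<n. y k \<noteq> 0" using e y(1) by (auto simp: less_Suc_eq)
    then show False using d colmat_det_0_iff by blast
  qed
  define x where "x k = - y k / y n" for k
  have g: "g i = (\<Sum>k<n. x k * a k i)" if "i < n" for i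
  proof -
    have "(\<Sum>k<n. x k * a k i) = - (\<Sum>k<n. y k * a k i) / y n"
      by (simp add: x_def sum_divide_distrib sum_negf[symmetric])
    also have "\<dots> = g i" using e[OF that] yn by (simp add: field_simps)
    finally show ?thesis by simp
  qed
  have "det (colmat n (a(k := g))) = x k * det (colmat n a)" if k: "k < n" for k
  proof -
    have "colmat n (a(k := g)) = replace_col (colmat n a) (colmat n a *\<^sub>v vec n x) k"
      unfolding replace_col_def
      by (rule eq_matI) (auto simp: g colmat_mult_vec simp del: index_mult_mat_vec)
    then show ?thesis using cramer_lemma_mat[OF colmat_carrier _ k, of "vec n x" a] k by simp
  qed
  then show ?thesis using g by blast
qed

abbreviation enorm :: "nat \<Rightarrow> (nat \<Rightarrow> real) \<Rightarrow> real" where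
  "enorm n x \<equiv> sqrt (nsq n x)"

lemma enorm_add: "enorm n (\<lambda>i. x i + y i) \<le> enorm n x + enorm n y"
  using L2_set_triangle_ineq[of x y "{..<n}"] by (simp add: L2_set_def nsq_def)

lemma enorm_scale: "enorm n (\<lambda>i. c * x i) = \<bar>c\<bar> * enorm n x"
  by (simp add: nsq_scale real_sqrt_mult)

lemma enorm_sum: "finite V \<Longrightarrow> enorm n (\<lambda>i. \<Sum>k\<in>V. f k i) \<le> (\<Sum>k\<in>V. enorm n (f k))"
proof (induction V rule: finite_induct)
  case empty then show ?case by (simp add: nsq_def)
next
  case (insert k V)
  then show ?case using enorm_add[of n "f k" "\<lambda>i. \<Sum>k\<in>V. f k i"] by simp
qed

context entry_law
begin

lemma not_near_coefficient:
  assumes U: "finite U" "k \<in> U" and nn: "\<not> near n (A k) (U - {k}) A (d\<^sup>2)" and d: "0 < d"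
    and le: "enorm n (\<lambda>i. \<Sum>j\<in>U. x j * A j i) \<le> r"
  shows "\<bar>x k\<bar> \<le> r / d"
proof (cases "x k = 0")
  case True
  have "0 \<le> enorm n (\<lambda>i. \<Sum>j\<in>U. x j * A j i)" by simp
  then have "0 \<le> r" using le by linarith
  then show ?thesis using True d by simp
next
  case False
  have e: "(\<Sum>j\<in>U. x j * A j i) = x k * (A k i - (\<Sum>j\<in>U - {k}. (- (x j / x k)) * A j i))" for i
  proof -
    have "(\<Sum>j\<in>U. x j * A j i) = x k * A k i + (\<Sum>j\<in>U - {k}. x j * A j i)" using U by (simp add: sum.remove)
    also have "(\<Sum>j\<in>U - {k}. x j * A j i) = - x k * (\<Sum>j\<in>U - {k}. (- (x j / x k)) * A j i)"
      unfolding sum_distrib_left using False by (intro sum.cong) auto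
    finally show ?thesis by (simp add: algebra_simps)
  qed
  have "d\<^sup>2 \<le> nsq n (\<lambda>i. A k i - (\<Sum>j\<in>U - {k}. (- (x j / x k)) * A j i))"
    using nn unfolding near_def by (meson not_le)
  then have "d \<le> enorm n (\<lambda>i. A k i - (\<Sum>j\<in>U - {k}. (- (x j / x k)) * A j i))"
    using d by (simp add: real_le_rsqrt)
  then have "\<bar>x k\<bar> * d \<le> \<bar>x k\<bar> * enorm n (\<lambda>i. A k i - (\<Sum>j\<in>U - {k}. (- (x j / x k)) * A j i))"
    by (intro mult_left_mono) auto
  also have "\<dots> = enorm n (\<lambda>i. \<Sum>j\<in>U. x j * A j i)" unfolding e by (simp only: enorm_scale)
  finally have "\<bar>x k\<bar> * d \<le> r" using le by linarith
  then show ?thesis using d by (simp add: pos_le_divide_eq)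
qed

lemma peel_group:
  assumes U: "finite U" "V \<subseteq> U" "card V \<le> n" and d: "0 < d" "d \<le> L" and n1: "1 \<le> n"
    and nn: "\<And>k. k \<in> V \<Longrightarrow> \<not> near n (A k) (U - {k}) A (d\<^sup>2)"
    and L: "\<And>k. k \<in> V \<Longrightarrow> enorm n (A k) \<le> L"
    and le: "enorm n (\<lambda>i. \<Sum>j\<in>U. x j * A j i) \<le> r"
  shows "enorm n (\<lambda>i. \<Sum>j\<in>U - V. x j * A j i) \<le> (2 * real n * L / d) * r"
proof -
  have r0: "0 \<le> r" using le real_sqrt_ge_zero[OF nsq_nonneg, of n "\<lambda>i. \<Sum>j\<in>U. x j * A j i"] by linarith
  have fV: "finite V" using U finite_subset by blast
  have e: "(\<lambda>i. \<Sum>j\<in>U - V. x j * A j i) = (\<lambda>i. (\<Sum>j\<in>U. x j * A j i) + (\<Sum>j\<in>V. (- x j) * A j i))"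
    using U by (auto simp: sum_diff sum_negf)
  have "enorm n (\<lambda>i. \<Sum>j\<in>U - V. x j * A j i) \<le> enorm n (\<lambda>i. \<Sum>j\<in>U. x j * A j i) + enorm n (\<lambda>i. \<Sum>j\<in>V. (- x j) * A j i)"
    unfolding e by (rule enorm_add)
  also have "enorm n (\<lambda>i. \<Sum>j\<in>V. (- x j) * A j i) \<le> (\<Sum>j\<in>V. enorm n (\<lambda>i. (- x j) * A j i))" by (rule enorm_sum[OF fV])
  also have "\<dots> \<le> (\<Sum>j\<in>V. (r / d) * L)"
  proof (intro sum_mono)
    fix j assume j: "j \<in> V"
    have "\<bar>x j\<bar> \<le> r / d" using U j nn[OF j] d le by (intro not_near_coefficient[of U j]) auto
    then have "\<bar>x j\<bar> * enorm n (A j) \<le> (r / d) * L" using L[OF j] r0 d by (intro mult_mono) auto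
    then show "enorm n (\<lambda>i. (- x j) * A j i) \<le> (r / d) * L"
      unfolding enorm_scale[of n "- x j" "A j"] by simp
  qed
  also have "\<dots> = card V * ((r / d) * L)" by simp
  also have "\<dots> \<le> n * ((r / d) * L)" using U r0 d by (intro mult_right_mono) auto
  also have "enorm n (\<lambda>i. \<Sum>j\<in>U. x j * A j i) \<le> n * ((r / d) * L)"
  proof -
    have "1 \<le> L / d" using d by simp
    then have "r * 1 \<le> r * (L / d)" using r0 by (intro mult_left_mono) auto
    also have "\<dots> = 1 * ((r / d) * L)" by simp
    also have "\<dots> \<le> n * ((r / d) * L)" using n1 r0 d by (intro mult_right_mono) auto
    finally show ?thesis using le by linarith
  qed
  finally show ?thesis by (simp add: mult_ac)
qed

text \<open>A short combination of the columns has small coefficients in the last group, since these columns are far from the span of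
all the others. After this group, whose columns have norm at most \<open>L\<close>, has been subtracted, the same applies to the middle
group and then to the first group, where no bound for the norms is necessary. Every step costs a factor of \<open>2 n L/d\<close>.\<close>

lemma well_separated_columns:
  fixes A :: "nat \<Rightarrow> nat \<Rightarrow> real"
  assumes N: "h1 \<le> h2" "h2 \<le> n" "1 \<le> n" and d: "0 < d" "d \<le> L"
    and G1: "\<And>k. k < h1 \<Longrightarrow> \<not> near n (A k) ({..<h1} - {k}) A (d\<^sup>2)"
    and G2: "\<And>k. h1 \<le> k \<Longrightarrow> k < h2 \<Longrightarrow> \<not> near n (A k) ({..<h2} - {k}) A (d\<^sup>2) \<and> enorm n (A k) \<le> L"
    and G3: "\<And>k. h2 \<le> k \<Longrightarrow> k < n \<Longrightarrow> \<not> near n (A k) ({..<n} - {k}) A (d\<^sup>2) \<and> enorm n (A k) \<le> L"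
    and x: "nsq n x = 1"
  shows "d / (2 * sqrt n * (2 * real n * L / d)\<^sup>2) \<le> enorm n (\<lambda>i. \<Sum>k<n. x k * A k i)"
proof (rule ccontr)
  define q where "q = 2 * real n * L / d"
  define r where "r = enorm n (\<lambda>i. \<Sum>k<n. x k * A k i)"
  assume "\<not> ?thesis"
  then have rl: "r < d / (2 * sqrt n * q\<^sup>2)" by (simp add: q_def r_def)
  have "1 \<le> L / d" using d by simp
  moreover have "1 \<le> 2 * real n" using N by simp
  ultimately have "1 * 1 \<le> (2 * real n) * (L / d)" by (intro mult_mono) auto
  then have q1: "1 \<le> q" by (simp add: q_def)
  have r0: "0 \<le> r" by (simp add: r_def)
  have n0: "0 < sqrt n" using N by simp
  have s0: "enorm n (\<lambda>i. \<Sum>k\<in>{..<n}. x k * A k i) \<le> r" by (simp add: r_def)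
  have s1: "enorm n (\<lambda>i. \<Sum>k\<in>{..<n} - {h2..<n}. x k * A k i) \<le> q * r"
    unfolding q_def using N G3 by (intro peel_group[OF _ _ _ d _ _ _ s0]) auto
  also have "{..<n} - {h2..<n} = {..<h2}" using N by auto
  finally have s1: "enorm n (\<lambda>i. \<Sum>k\<in>{..<h2}. x k * A k i) \<le> q * r" .
  have "enorm n (\<lambda>i. \<Sum>k\<in>{..<h2} - {h1..<h2}. x k * A k i) \<le> q * (q * r)"
    unfolding q_def[symmetric] using N G2 by (intro peel_group[OF _ _ _ d _ _ _ s1, folded q_def]) auto
  also have "{..<h2} - {h1..<h2} = {..<h1}" using N by auto
  finally have s2: "enorm n (\<lambda>i. \<Sum>k\<in>{..<h1}. x k * A k i) \<le> q * (q * r)" .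
  have mono: "r / d \<le> q * (q * r) / d" "q * r / d \<le> q * (q * r) / d"
  proof -
    have 1: "1 * (q * r) \<le> q * (q * r)" using q1 r0 by (intro mult_right_mono) auto
    have 2: "1 * r \<le> q * r" using q1 r0 by (intro mult_right_mono) auto
    show "r / d \<le> q * (q * r) / d" "q * r / d \<le> q * (q * r) / d" using 1 2 d by (auto intro!: divide_right_mono)
  qed
  have xk: "\<bar>x k\<bar> \<le> q * (q * r) / d" if k: "k < n" for k
  proof -
    consider "k < h1" | "h1 \<le> k" "k < h2" | "h2 \<le> k" by linarith
    then show ?thesis
    proof cases
      case 1 then show ?thesis using G1[OF 1] d s2 by (intro not_near_coefficient[of "{..<h1}"]) auto
    next
      case 2
      have "\<bar>x k\<bar> \<le> q * r / d" using 2 G2[OF 2] d s1 by (intro not_near_coefficient[of "{..<h2}"]) auto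
      then show ?thesis using mono by linarith
    next
      case 3
      have "\<bar>x k\<bar> \<le> r / d" using 3 k G3[OF 3 k] d s0 by (intro not_near_coefficient[of "{..<n}"]) auto
      then show ?thesis using mono by linarith
    qed
  qed
  have "q * (q * r) / d < 1 / (2 * sqrt n)"
  proof -
    have "q\<^sup>2 * r < q\<^sup>2 * (d / (2 * sqrt n * q\<^sup>2))" using rl q1 by (intro mult_strict_left_mono) auto
    also have "\<dots> = d / (2 * sqrt n)" using q1 by simp
    finally have "q\<^sup>2 * r / d < d / (2 * sqrt n) / d" using d by (intro divide_strict_right_mono) auto
    then show ?thesis using d by (simp add: power2_eq_square mult.assoc)
  qed
  then have xk': "\<bar>x k\<bar> \<le> 1 / (2 * sqrt n)" if "k < n" for k using xk[OF that] by linarith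
  have "nsq n x \<le> (\<Sum>k<n. 1 / (4 * n))" unfolding nsq_def
  proof (intro sum_mono)
    fix k assume "k \<in> {..<n}"
    then have "\<bar>x k\<bar>\<^sup>2 \<le> (1 / (2 * sqrt n))\<^sup>2" using xk' by (intro power_mono) auto
    then show "(x k)\<^sup>2 \<le> 1 / (4 * n)" by (simp add: power_divide power_mult_distrib)
  qed
  also have "\<dots> = 1/4" using N by simp
  finally show False using x by simp
qed

text \<open>Indices below \<open>h\<close> are kept. Behind them lie blocks of \<open>T\<close> copies, and from the \<open>j\<close>-th block the copy \<open>c j\<close> is picked.\<close>

definition pick :: "nat \<Rightarrow> nat \<Rightarrow> (nat \<Rightarrow> nat) \<Rightarrow> nat \<Rightarrow> nat" where
  "pick h T c k = (if k < h then k else h + (k - h) * T + c (k - h))"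

lemma pick_inj:
  assumes c: "\<And>j. j < N \<Longrightarrow> c j < T" and n: "n = h + N"
  shows "inj_on (pick h T c) {..<n}" "pick h T c ` {..<n} \<subseteq> {..<h + N * T}"
proof -
  have dv: "(k * T + c k) div T = k" if "k < N" for k
    using c[OF that] by (metis add.commute div_mult_self3 div_less le_less_trans le0 less_nat_zero_code mult.commute neq0_conv plus_nat.add_0)
  show "inj_on (pick h T c) {..<n}"
  proof (rule inj_onI)
    fix k l assume k: "k \<in> {..<n}" and l: "l \<in> {..<n}" and e: "pick h T c k = pick h T c l"
    show "k = l"
    proof (cases "k < h \<or> l < h")
      case True then show ?thesis using e by (auto simp: pick_def split: if_splits)
    next
      case False
      then have "(k - h) * T + c (k - h) = (l - h) * T + c (l - h)" using e by (simp add: pick_def)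
      then have "k - h = l - h" using dv[of "k - h"] dv[of "l - h"] k l n False by (metis add_diff_inverse_nat lessThan_iff nat_add_left_cancel_less)
      then show ?thesis using False by linarith
    qed
  qed
  show "pick h T c ` {..<n} \<subseteq> {..<h + N * T}"
  proof (rule image_subsetI)
    fix k assume k: "k \<in> {..<n}"
    show "pick h T c k \<in> {..<h + N * T}"
    proof (cases "k < h")
      case False
      then have j: "k - h < N" using k n by auto
      have "(k - h) * T + c (k - h) < (k - h) * T + T" using c[OF j] by simp
      also have "\<dots> = Suc (k - h) * T" by simp
      also have "\<dots> \<le> N * T" using j by (intro mult_le_mono) auto
      finally show ?thesis using False by (simp add: pick_def)
    qed (auto simp: pick_def)
  qed
qed

text \<open>Among the admissible choices of copies take one that maximises the absolute value of the determinant. Should a chosen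
column be close to the span of the others, then exchanging it for a copy that is farther away would increase the
determinant, by Cramer's rule.\<close>

lemma good_configuration:
  fixes A :: "nat \<Rightarrow> nat \<Rightarrow> real"
  assumes n: "n = h + N" and T: "1 \<le> T" and d: "0 < d"
    and indep: "\<And>x. (\<forall>i<n. (\<Sum>k<h. x k * A k i) = 0) \<Longrightarrow> \<forall>k<h. x k = (0::real)"
    and copies: "\<And>c j. c \<in> PiE {..<N} (\<lambda>_. {..<T}) \<Longrightarrow> j < N \<Longrightarrow>
      \<exists>t<T. B (A (h + j * T + t)) \<and> \<not> near n (A (h + j * T + t)) ({..<n} - {h + j}) (\<lambda>k. A (pick h T c k)) d"
  shows "\<exists>c\<in>PiE {..<N} (\<lambda>_. {..<T}). \<forall>j<N. B (A (h + j * T + c j)) \<and>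
    \<not> near n (A (pick h T c (h + j))) ({..<n} - {h + j}) (\<lambda>k. A (pick h T c k)) d"
proof -
  define P where "P c = (\<lambda>k. A (pick h T c k))" for c
  define Cfg where "Cfg = {c \<in> PiE {..<N} (\<lambda>_. {..<T}). \<forall>j<N. B (A (h + j * T + c j))}"
  have fC: "finite Cfg" unfolding Cfg_def by (rule finite_subset[of _ "PiE {..<N} (\<lambda>_. {..<T})"]) (auto intro: finite_PiE)
  have Pj: "P c (h + j) = A (h + j * T + c j)" for c j by (simp add: P_def pick_def)
  have Plow: "P c k = A k" if "k < h" for c k using that by (simp add: P_def pick_def)
  have Pupd: "P (c(j := t)) k = P c k" if "k \<noteq> h + j" for c j t k
    using that by (auto simp: P_def pick_def)
  have Cupd: "c(j := t) \<in> PiE {..<N} (\<lambda>_. {..<T})" if "c \<in> PiE {..<N} (\<lambda>_. {..<T})" "j < N" "t < T" for c j t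
    using that by (auto simp: PiE_def extensional_def Pi_def)
  have seq: "\<exists>c\<in>Cfg. \<forall>j<m. \<not> near n (P c (h + j)) {..<h + j} (P c) d" if "m \<le> N" for m
    using that
  proof (induction m)
    case 0
    have c0: "restrict (\<lambda>_. 0) {..<N} \<in> PiE {..<N} (\<lambda>_. {..<T})" using T by auto
    define c where "c = restrict (\<lambda>j. SOME t. t < T \<and> B (A (h + j * T + t))) {..<N}"
    have cj: "c j < T \<and> B (A (h + j * T + c j))" if "j < N" for j
    proof -
      have "\<exists>t. t < T \<and> B (A (h + j * T + t))" using copies[OF c0 that] by blast
      from someI_ex[OF this] show ?thesis using that by (simp add: c_def)
    qed
    then have "c \<in> Cfg" unfolding Cfg_def by (auto simp: c_def)
    then show ?case by blast
  next
    case (Suc m)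
    then obtain c where c: "c \<in> Cfg" "\<And>j. j < m \<Longrightarrow> \<not> near n (P c (h + j)) {..<h + j} (P c) d" by auto
    have cP: "c \<in> PiE {..<N} (\<lambda>_. {..<T})" using c(1) by (simp add: Cfg_def)
    have mN: "m < N" using Suc.prems by simp
    obtain t where t: "t < T" "B (A (h + m * T + t))" "\<not> near n (A (h + m * T + t)) ({..<n} - {h + m}) (P c) d"
      using copies[OF cP mN] unfolding P_def by blast
    have c': "c(m := t) \<in> Cfg" using c(1) t Cupd[OF cP mN t(1)] by (auto simp: Cfg_def)
    moreover have "\<not> near n (P (c(m := t)) (h + j)) {..<h + j} (P (c(m := t))) d" if "j < Suc m" for j
    proof -
      have cg: "near n g {..<h + j} (P (c(m := t))) d = near n g {..<h + j} (P c) d" for g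
        using that by (intro near_cong) (auto intro!: Pupd)
      show ?thesis
      proof (cases "j = m")
        case True
        have "{..<h + m} \<subseteq> {..<n} - {h + m}" using mN n by auto
        then have "\<not> near n (A (h + m * T + t)) {..<h + m} (P c) d"
          using t(3) near_mono[of "{..<n} - {h + m}" "{..<h + m}" n _ "P c" d] by blast
        then show ?thesis using cg True by (simp add: Pj)
      next
        case False
        then show ?thesis using cg c(2)[of j] that Pupd[of "h + j" m c t] by auto
      qed
    qed
    ultimately show ?case by blast
  qed
  obtain c0 where c0: "c0 \<in> Cfg" "\<And>j. j < N \<Longrightarrow> \<not> near n (P c0 (h + j)) {..<h + j} (P c0) d" using seq[of N] by auto
  have d0: "det (colmat n (P c0)) \<noteq> 0"
  proof
    assume "det (colmat n (P c0)) = 0"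
    then obtain x where x: "\<exists>k<n. x k \<noteq> 0" "\<And>i. i < n \<Longrightarrow> (\<Sum>k<n. x k * P c0 k i) = 0"
      using colmat_det_0_iff by blast
    have hi: "x k = 0" if "h \<le> k" "k < n" for k
    proof (rule ccontr)
      assume "x k \<noteq> 0"
      define m where "m = Max {k. k < n \<and> x k \<noteq> 0}"
      have fin: "finite {k. k < n \<and> x k \<noteq> 0}" by simp
      have ne: "{k. k < n \<and> x k \<noteq> 0} \<noteq> {}" using \<open>x k \<noteq> 0\<close> that by auto
      have m: "m < n" "x m \<noteq> 0" using Max_in[OF fin ne] by (auto simp: m_def)
      have mk: "k \<le> m" using Max_ge[OF fin, of k] \<open>x k \<noteq> 0\<close> that by (simp add: m_def)
      have above: "x l = 0" if "m < l" "l < n" for l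
      proof (rule ccontr)
        assume "x l \<noteq> 0"
        then have "l \<le> m" using Max_ge[OF fin, of l] that by (simp add: m_def)
        then show False using that by simp
      qed
      have row: "P c0 m i - (\<Sum>l<m. (- (x l / x m)) * P c0 l i) = 0" if i: "i < n" for i
      proof -
        have "(\<Sum>k<n. x k * P c0 k i) = (\<Sum>k<Suc m. x k * P c0 k i)"
          using m above by (intro sum.mono_neutral_right) (auto simp: not_less_eq)
        then have "P c0 m i * x m = - (\<Sum>l<m. x l * P c0 l i)"
          using x(2)[OF i] by (simp add: eq_neg_iff_add_eq_0 add.commute mult.commute)
        then have "P c0 m i = - (\<Sum>l<m. x l * P c0 l i) / x m" by (simp only: nonzero_eq_divide_eq[OF m(2)])
        moreover have "(\<Sum>l<m. (- (x l / x m)) * P c0 l i) = - (\<Sum>l<m. x l * P c0 l i) / x m"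
          by (simp add: sum_divide_distrib sum_negf[symmetric])
        ultimately show ?thesis by linarith
      qed
      have "nsq n (\<lambda>i. P c0 m i - (\<Sum>l<m. (- (x l / x m)) * P c0 l i)) = 0"
        unfolding nsq_def using row by simp
      then have "near n (P c0 m) {..<m} (P c0) d" unfolding near_def using d by (intro exI[of _ "\<lambda>l. - (x l / x m)"]) simp
      moreover have mh: "m - h < N" "h + (m - h) = m" using m(1) mk that n by linarith+
      ultimately show False using c0(2)[OF mh(1)] unfolding mh(2) by blast
    qed
    have "(\<Sum>k<h. x k * A k i) = 0" if "i < n" for i
    proof -
      have "(\<Sum>k<n. x k * P c0 k i) = (\<Sum>k<h. x k * A k i)"
        using hi n by (intro sum.mono_neutral_cong_right) (auto simp: Plow)
      then show ?thesis using x(2)[OF that] by simp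
    qed
    then have "\<forall>k<h. x k = 0" using indep by blast
    then show False using x(1) hi by (metis not_le)
  qed
  define M where "M = Max ((\<lambda>c. \<bar>det (colmat n (P c))\<bar>) ` Cfg)"
  have fi: "finite ((\<lambda>c. \<bar>det (colmat n (P c))\<bar>) ` Cfg)" using fC by simp
  have "M \<in> (\<lambda>c. \<bar>det (colmat n (P c))\<bar>) ` Cfg" unfolding M_def using fi c0(1) by (intro Max_in) auto
  then obtain c where c: "c \<in> Cfg" "\<bar>det (colmat n (P c))\<bar> = M" by auto
  have mx: "\<bar>det (colmat n (P c'))\<bar> \<le> \<bar>det (colmat n (P c))\<bar>" if "c' \<in> Cfg" for c'
    unfolding c(2) M_def using fi that by (intro Max_ge) auto
  have dc: "det (colmat n (P c)) \<noteq> 0" using mx[OF c0(1)] d0 by auto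
  have cP: "c \<in> PiE {..<N} (\<lambda>_. {..<T})" using c(1) by (simp add: Cfg_def)
  show ?thesis
  proof (intro bexI[OF _ cP] allI impI conjI)
    fix j assume j: "j < N"
    show "B (A (h + j * T + c j))" using c(1) j by (simp add: Cfg_def)
    obtain t where t: "t < T" "B (A (h + j * T + t))" "\<not> near n (A (h + j * T + t)) ({..<n} - {h + j}) (P c) d"
      using copies[OF cP j] unfolding P_def by blast
    define g where "g = A (h + j * T + t)"
    define k where "k = h + j"
    have k: "k < n" using j n by (simp add: k_def)
    obtain x where x: "\<And>i. i < n \<Longrightarrow> g i = (\<Sum>l<n. x l * P c l i)"
      "\<And>k. k < n \<Longrightarrow> det (colmat n ((P c)(k := g))) = x k * det (colmat n (P c))"
      using colmat_cramer[OF dc, of g] by blast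
    have "P (c(j := t)) = (P c)(k := g)"
    proof
      fix l show "P (c(j := t)) l = ((P c)(k := g)) l"
        by (cases "l = k") (auto simp: k_def g_def Pj Pupd)
    qed
    moreover have "c(j := t) \<in> Cfg" using c(1) t Cupd[OF cP j t(1)] by (auto simp: Cfg_def)
    ultimately have "\<bar>x k * det (colmat n (P c))\<bar> \<le> \<bar>det (colmat n (P c))\<bar>"
      using mx[of "c(j := t)"] x(2)[OF k] by simp
    then have xk: "\<bar>x k\<bar> \<le> 1" using dc by (simp add: abs_mult)
    have "\<not> near n (P c k) ({..<n} - {k}) (P c) d"
    proof
      assume "near n (P c k) ({..<n} - {k}) (P c) d"
      then obtain y where y: "nsq n (\<lambda>i. P c k i - (\<Sum>l\<in>{..<n} - {k}. y l * P c l i)) < d" unfolding near_def by blast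
      have row: "g i - (\<Sum>l\<in>{..<n} - {k}. (x l + x k * y l) * P c l i) = x k * (P c k i - (\<Sum>l\<in>{..<n} - {k}. y l * P c l i))" if "i < n" for i
      proof -
        have "g i = x k * P c k i + (\<Sum>l\<in>{..<n} - {k}. x l * P c l i)" unfolding x(1)[OF that] using k by (simp add: sum.remove)
        then show ?thesis by (simp add: distrib_right sum.distrib right_diff_distrib sum_distrib_left mult.assoc)
      qed
      have "nsq n (\<lambda>i. g i - (\<Sum>l\<in>{..<n} - {k}. (x l + x k * y l) * P c l i))
         = nsq n (\<lambda>i. x k * (P c k i - (\<Sum>l\<in>{..<n} - {k}. y l * P c l i)))"
        unfolding nsq_def using row by (intro sum.cong) auto
      also have "\<dots> = (x k)\<^sup>2 * nsq n (\<lambda>i. P c k i - (\<Sum>l\<in>{..<n} - {k}. y l * P c l i))" by (rule nsq_scale)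
      also have "\<dots> \<le> 1 * nsq n (\<lambda>i. P c k i - (\<Sum>l\<in>{..<n} - {k}. y l * P c l i))"
        using xk by (intro mult_right_mono) (auto simp: abs_square_le_1)
      also have "\<dots> < d" using y by simp
      finally have "near n g ({..<n} - {k}) (P c) d"
        unfolding near_def by (intro exI[of _ "\<lambda>l. x l + x k * y l"])
      then show False using t(3) by (simp add: g_def k_def)
    qed
    then show "\<not> near n (A (pick h T c (h + j))) ({..<n} - {h + j}) (\<lambda>k. A (pick h T c k)) d"
      by (simp add: P_def k_def)
  qed
qed

end

section \<open>An estimate for small dimensions\<close>

context entry_law
begin

lemma near_prob:
  assumes a: "0 < a" and conc: "\<And>z. prob {x. \<bar>x - z\<bar> < a} \<le> b" and b: "0 \<le> b"
    and J: "finite J" "k \<in> J" and U: "U \<subseteq> J - {k}" "card U + m \<le> n"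
  shows "measure (gams J n) {A \<in> space (gams J n). near n (A k) U A ((a / sqrt n)\<^sup>2)} \<le> b ^ m"
proof -
  interpret G: prob_space "gams J n" by (rule prob_gams)
  let ?E = "{A \<in> space (gams J n). near n (A k) U A ((a / sqrt n)\<^sup>2)}"
  define J' where "J' = J - {k}"
  have J': "finite J'" "k \<notin> J'" "insert k J' = J" using J by (auto simp: J'_def)
  have fU: "finite U" using U J by (meson finite_Diff finite_subset)
  have kU: "k \<notin> U" using U by auto
  have E: "?E \<in> sets (gams J n)" using fU U J by (intro near_sets) auto
  have "measure (gams (insert k J') n) ?E \<le> b ^ m * measure (gams (insert k J') n) (space (gams (insert k J') n))"
  proof (rule product_coordinate_bound[OF prob_gam J'(1,2)])
    show "?E \<in> sets (gams (insert k J') n)" using E unfolding J'(3) .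
    show "?E \<subseteq> space (gams (insert k J') n)" unfolding J'(3) by auto
    show "0 \<le> b ^ m" using b by simp
    fix A g g' assume "A \<in> space (gams J' n)" "g' \<in> space (gam n)"
    then show "A(k := g') \<in> space (gams (insert k J') n)" by (auto simp: space_PiM PiE_def extensional_def)
  next
    fix A assume "A \<in> space (gams J' n)"
    interpret g: prob_space "gam n" by (rule prob_gam)
    have nc: "near n g U (A(k := g)) r = near n g U A r" for g r using kU by (intro near_cong) auto
    have "measure (gam n) {g \<in> space (gam n). A(k := g) \<in> ?E} \<le> measure (gam n) {g \<in> space (gam n). near n g U A ((a / sqrt n)\<^sup>2)}"
      using near_section_sets[OF fU] by (intro g.finite_measure_mono) (auto simp: nc)
    also have "\<dots> \<le> b ^ m" by (rule near_subspace_prob[OF a conc b fU U(2)])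
    finally show "measure (gam n) {g \<in> space (gam n). A(k := g) \<in> ?E} \<le> b ^ m" .
  qed auto
  then show ?thesis unfolding J'(3) using G.prob_space by simp
qed

text \<open>The copies are independent of each other and of the columns that span the subspace, so that their failures multiply.\<close>

lemma copies_prob:
  assumes a: "0 < a" and conc: "\<And>z. prob {x. \<bar>x - z\<bar> < a} \<le> b" and b: "0 \<le> b"
    and tail: "measure (gam n) {g \<in> space (gam n). L < enorm n g} \<le> pe" and J: "finite J"
    and q: "inj_on q {..<T}" "q ` {..<T} \<subseteq> J" and U: "U \<subseteq> J - q ` {..<T}" "card U < n"
  shows "{A \<in> space (gams J n). \<forall>t<T. L < enorm n (A (q t)) \<or> near n (A (q t)) U A ((a / sqrt n)\<^sup>2)} \<in> sets (gams J n)"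
    "measure (gams J n) {A \<in> space (gams J n). \<forall>t<T. L < enorm n (A (q t)) \<or> near n (A (q t)) U A ((a / sqrt n)\<^sup>2)} \<le> (b + pe) ^ T"
proof -
  interpret G: prob_space "gams J n" by (rule prob_gams)
  interpret g: prob_space "gam n" by (rule prob_gam)
  define d where "d = (a / sqrt n)\<^sup>2"
  define H where "H s = {A \<in> space (gams J n). \<forall>t<s. L < enorm n (A (q t)) \<or> near n (A (q t)) U A d}" for s
  have fU: "finite U" using U J by (meson finite_Diff finite_subset)
  have pe: "0 \<le> pe" using tail measure_nonneg order_trans by blast
  have ms: "{A \<in> space (gams J n). L < enorm n (A k)} \<in> sets (gams J n)" if "k \<in> J" for k
  proof -
    have "(\<lambda>A. nsq n (A k)) \<in> borel_measurable (gams J n)"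
      using measurable_compose[OF meas_gams_coord[OF that] meas_nsq] .
    then show ?thesis by measurable
  qed
  have Hs: "H s \<in> sets (gams J n)" if "s \<le> T" for s
  proof -
    have "H s = space (gams J n) - (\<Union>t<s. space (gams J n) - ({A \<in> space (gams J n). L < enorm n (A (q t))} \<union> {A \<in> space (gams J n). near n (A (q t)) U A d}))"
      by (auto simp: H_def)
    also have "\<dots> \<in> sets (gams J n)"
    proof (intro sets.Diff sets.top sets.finite_UN sets.Un ms near_sets fU)
      fix t assume "t \<in> {..<s}"
      then show "q t \<in> J" using q that by auto
      then show "q t \<in> J" .
    qed (use U in auto)
    finally show ?thesis .
  qed
  have step: "measure (gams J n) (H (Suc s)) \<le> (b + pe) * measure (gams J n) (H s)" if s: "s < T" for s
  proof -
    define J' where "J' = J - {q s}"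
    have qs: "q s \<in> J" using q s by auto
    have J': "finite J'" "q s \<notin> J'" "insert (q s) J' = J" using J qs by (auto simp: J'_def)
    have qU: "q s \<notin> U" using U s by auto
    have qt: "q t \<noteq> q s" if "t < s" for t using q(1) s that by (auto dest: inj_onD)
    have nc: "near n w U (A(q s := g)) r = near n w U A r" for w A g r using qU by (intro near_cong) auto
    have "measure (gams (insert (q s) J') n) (H (Suc s)) \<le> (b + pe) * measure (gams (insert (q s) J') n) (H s)"
    proof (rule product_coordinate_bound[OF prob_gam J'(1,2)])
      show "H (Suc s) \<in> sets (gams (insert (q s) J') n)" "H s \<in> sets (gams (insert (q s) J') n)"
        using Hs[of s] Hs[of "Suc s"] s unfolding J'(3) by auto
      show "H (Suc s) \<subseteq> H s"
      proof
        fix A assume "A \<in> H (Suc s)"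
        then show "A \<in> H s" unfolding H_def by (simp add: less_Suc_eq)
      qed
      show "0 \<le> b + pe" using b pe by simp
    next
      fix A g g' assume A: "A \<in> space (gams J' n)" "g' \<in> space (gam n)" "A(q s := g) \<in> H s"
      have "A(q s := g') \<in> space (gams J n)"
        using A unfolding J'(3)[symmetric] by (auto simp: space_PiM PiE_def extensional_def)
      moreover have "\<forall>t<s. L < enorm n ((A(q s := g')) (q t)) \<or> near n ((A(q s := g')) (q t)) U (A(q s := g')) d"
      proof (intro allI impI)
        fix t assume t: "t < s"
        have "L < enorm n ((A(q s := g)) (q t)) \<or> near n ((A(q s := g)) (q t)) U (A(q s := g)) d"
          using A(3) t unfolding H_def by blast
        then show "L < enorm n ((A(q s := g')) (q t)) \<or> near n ((A(q s := g')) (q t)) U (A(q s := g')) d"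
          unfolding nc using qt[OF t] by simp
      qed
      ultimately show "A(q s := g') \<in> H s" unfolding H_def by blast
    next
      fix A assume "A \<in> space (gams J' n)"
      let ?N = "{g \<in> space (gam n). near n g U A d}" and ?L = "{g \<in> space (gam n). L < enorm n g}"
      have sN: "?N \<in> sets (gam n)" by (rule near_section_sets[OF fU])
      have sL: "?L \<in> sets (gam n)" by measurable
      have "measure (gam n) {g \<in> space (gam n). A(q s := g) \<in> H (Suc s)} \<le> measure (gam n) (?N \<union> ?L)"
      proof (rule g.finite_measure_mono)
        show "{g \<in> space (gam n). A(q s := g) \<in> H (Suc s)} \<subseteq> ?N \<union> ?L"
        proof
          fix g assume g: "g \<in> {g \<in> space (gam n). A(q s := g) \<in> H (Suc s)}"
          then have "L < enorm n ((A(q s := g)) (q s)) \<or> near n ((A(q s := g)) (q s)) U (A(q s := g)) d"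
            unfolding H_def by blast
          then show "g \<in> ?N \<union> ?L" using g unfolding nc by auto
        qed
      qed (use sN sL in auto)
      also have "\<dots> \<le> measure (gam n) ?N + measure (gam n) ?L" by (rule measure_Un_le[OF sN sL])
      also have "\<dots> \<le> b ^ 1 + pe"
        unfolding d_def using U(2) by (intro add_mono tail near_subspace_prob[OF a conc b fU]) auto
      finally show "measure (gam n) {g \<in> space (gam n). A(q s := g) \<in> H (Suc s)} \<le> b + pe" by simp
    qed
    then show ?thesis unfolding J'(3) .
  qed
  have "measure (gams J n) (H s) \<le> (b + pe) ^ s" if "s \<le> T" for s
    using that
  proof (induction s)
    case 0 show ?case by simp
  next
    case (Suc s)
    then have "measure (gams J n) (H (Suc s)) \<le> (b + pe) * measure (gams J n) (H s)" by (intro step) auto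
    also have "\<dots> \<le> (b + pe) * (b + pe) ^ s" using Suc b pe by (intro mult_left_mono) auto
    finally show ?case by simp
  qed
  from this[OF order_refl] show "measure (gams J n) {A \<in> space (gams J n). \<forall>t<T. L < enorm n (A (q t)) \<or> near n (A (q t)) U A ((a / sqrt n)\<^sup>2)} \<le> (b + pe) ^ T"
    unfolding H_def d_def .
  show "{A \<in> space (gams J n). \<forall>t<T. L < enorm n (A (q t)) \<or> near n (A (q t)) U A ((a / sqrt n)\<^sup>2)} \<in> sets (gams J n)"
    using Hs[OF order_refl] unfolding H_def d_def .
qed

text \<open>The columns come in three groups: the last \<open>N2\<close> are picked from \<open>T\<close> copies, the \<open>N1 - N2\<close> before them
need only be far from the span of the columns outside the last group, and the others from the span of the columns of their own
group. A larger codimension makes a failure less likely, so that each group can afford the union bound over its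
members. The good event for a suitable choice of copies is pulled back from the good event for the matrix by one of
\<open>T ^ N2\<close> measure preserving maps.\<close>

theorem small_dimension_estimate:
  fixes L :: real
  assumes a: "0 < a" and conc: "\<And>z. prob {x. \<bar>x - z\<bar> < a} \<le> b" and b: "0 \<le> b" and n1: "1 \<le> n"
    and N: "N2 \<le> N1" "N1 \<le> n" and T: "1 \<le> T"
    and tail: "measure (gam n) {g \<in> space (gam n). L < enorm n g} \<le> pe"
    and e1: "N1 = n \<or> n * b ^ Suc N1 \<le> 1/8" and e2: "N2 = N1 \<or> N1 * b ^ Suc N2 \<le> 1/8"
    and e3: "N1 * pe \<le> 1/8" and e4: "real N2 * real T ^ N2 * (b + pe) ^ T \<le> 1/8" and dL: "a / sqrt n \<le> L"
  shows "\<exists>G\<in>sets (gams {..<n} n). 1 / (2 * real T ^ N2) \<le> measure (gams {..<n} n) G \<and>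
    (\<forall>A\<in>G. \<forall>x. nsq n x = 1 \<longrightarrow>
      a / sqrt n / (2 * sqrt n * (2 * real n * L / (a / sqrt n))\<^sup>2) \<le> enorm n (\<lambda>i. \<Sum>k<n. x k * A k i))"
proof -
  define d where "d = a / sqrt n"
  define h where "h = n - N2"
  define h1 where "h1 = n - N1"
  define I where "I = {..<h + N2 * T}"
  have d: "0 < d" using a n1 by (simp add: d_def)
  have h: "n = h + N2" "h1 \<le> h" "h \<le> n" using N by (auto simp: h_def h1_def)
  have hI: "{..<h} \<subseteq> I" "finite I" by (auto simp: I_def)
  have h1I: "{..<h1} \<subseteq> I" using h(2) hI(1) by (meson lessThan_subset_iff subset_trans)
  interpret G: prob_space "gams {..<n} n" by (rule prob_gams)
  interpret I: prob_space "gams I n" by (rule prob_gams)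
  interpret g: prob_space "gam n" by (rule prob_gam)
  have pe0: "0 \<le> pe" using tail measure_nonneg order_trans by blast
  let ?nr = "\<lambda>J k U. {A \<in> space (gams J n). near n (A k) U A (d\<^sup>2)}"
  let ?lg = "\<lambda>J k. {A \<in> space (gams J n). L < enorm n (A k)}"
  have lg_sets: "?lg J k \<in> sets (gams J n)" if "k \<in> J" for J :: "nat set" and k
  proof -
    have "(\<lambda>A. nsq n (A k)) \<in> borel_measurable (gams J n)"
      using measurable_compose[OF meas_gams_coord[OF that] meas_nsq] .
    then show ?thesis by measurable
  qed
  have lg_prob: "measure (gams I n) (?lg I k) \<le> pe" if k: "k \<in> I" for k
  proof -
    have "distr (gams I n) (gam n) (\<lambda>A. A k) = gam n"
      using k by (intro distr_PiM_component prob_gam)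
    moreover have sL: "{g \<in> space (gam n). L < enorm n g} \<in> sets (gam n)" by measurable
    ultimately have "measure (gam n) {g \<in> space (gam n). L < enorm n g} = measure (gams I n) ((\<lambda>A. A k) -` {g \<in> space (gam n). L < enorm n g} \<inter> space (gams I n))"
      using measure_distr[OF meas_gams_coord[OF k] sL] by simp
    also have "(\<lambda>A. A k) -` {g \<in> space (gam n). L < enorm n g} \<inter> space (gams I n) = ?lg I k"
      using measurable_space[OF meas_gams_coord[OF k]] by auto
    finally show ?thesis using tail by simp
  qed
  define Bad1 where "Bad1 = (\<Union>k<h1. ?nr I k ({..<h1} - {k}))"
  define Bad2 where "Bad2 = (\<Union>k\<in>{h1..<h}. ?nr I k ({..<h} - {k}))"
  define Bad2' where "Bad2' = (\<Union>k\<in>{h1..<h}. ?lg I k)"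
  define Cfg where "Cfg = PiE {..<N2} (\<lambda>_. {..<T})"
  define S where "S c j = {A \<in> space (gams I n). \<forall>t<T. L < enorm n (A (h + j * T + t)) \<or>
      near n (A (h + j * T + t)) (pick h T c ` ({..<n} - {h + j})) A (d\<^sup>2)}" for c j
  define Bad3 where "Bad3 = (\<Union>c\<in>Cfg. \<Union>j<N2. S c j)"
  have fC: "finite Cfg" unfolding Cfg_def by (intro finite_PiE) auto
  have cC: "card Cfg = T ^ N2" unfolding Cfg_def by (simp add: card_PiE)
  have nr1: "?nr I k ({..<h1} - {k}) \<in> sets (gams I n)" "measure (gams I n) (?nr I k ({..<h1} - {k})) \<le> b ^ Suc N1" if "k < h1" for k
  proof -
    have kI: "k \<in> I" using that h hI by auto
    show "?nr I k ({..<h1} - {k}) \<in> sets (gams I n)" using hI(2) h1I kI by (intro near_sets) auto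
    show "measure (gams I n) (?nr I k ({..<h1} - {k})) \<le> b ^ Suc N1"
      unfolding d_def using that hI(2) h1I kI N by (intro near_prob[OF a conc b]) (auto simp: h1_def)
  qed
  have nr2: "?nr I k ({..<h} - {k}) \<in> sets (gams I n)" "measure (gams I n) (?nr I k ({..<h} - {k})) \<le> b ^ Suc N2" if "k < h" for k
  proof -
    have kI: "k \<in> I" using that hI by auto
    show "?nr I k ({..<h} - {k}) \<in> sets (gams I n)" using hI(1) kI by (intro near_sets) blast+
    have "card ({..<h} - {k}) + Suc N2 \<le> n" using that h(1) by simp
    moreover have "{..<h} - {k} \<subseteq> I - {k}" using hI(1) by blast
    ultimately show "measure (gams I n) (?nr I k ({..<h} - {k})) \<le> b ^ Suc N2"
      unfolding d_def by (intro near_prob[OF a conc b hI(2) kI])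
  qed
  have S: "S c j \<in> sets (gams I n)" "measure (gams I n) (S c j) \<le> (b + pe) ^ T" if c: "c \<in> Cfg" and j: "j < N2" for c j
  proof -
    have cT: "\<And>j. j < N2 \<Longrightarrow> c j < T" using c by (auto simp: Cfg_def PiE_def Pi_def)
    have pk: "inj_on (pick h T c) {..<n}" "pick h T c ` {..<n} \<subseteq> {..<h + N2 * T}"
      by (rule pick_inj[OF _ h(1)], erule cT)+
    have q1: "inj_on (\<lambda>t. h + j * T + t) {..<T}" by (simp add: inj_on_def)
    have q2: "(\<lambda>t. h + j * T + t) ` {..<T} \<subseteq> I"
    proof (rule image_subsetI)
      fix t assume "t \<in> {..<T}"
      then have "j * T + t < Suc j * T" by simp
      also have "\<dots> \<le> N2 * T" using j by (intro mult_le_mono) auto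
      finally show "h + j * T + t \<in> I" by (simp add: I_def)
    qed
    have q3: "pick h T c ` ({..<n} - {h + j}) \<subseteq> I - (\<lambda>t. h + j * T + t) ` {..<T}"
    proof (rule image_subsetI)
      fix k assume k: "k \<in> {..<n} - {h + j}"
      have "pick h T c k \<in> I" using pk(2) k unfolding I_def by auto
      moreover have "pick h T c k \<noteq> h + j * T + t" if t: "t < T" for t
      proof (cases "k < h")
        case True then show ?thesis by (simp add: pick_def)
      next
        case False
        have kh: "k - h < N2" "k - h \<noteq> j" using k False h(1) by auto
        have "((k - h) * T + c (k - h)) div T = k - h" "(j * T + t) div T = j" using cT[OF kh(1)] t by simp_all
        then have "(k - h) * T + c (k - h) \<noteq> j * T + t" using kh by auto
        then show ?thesis using False by (simp add: pick_def)
      qed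
      ultimately show "pick h T c k \<in> I - (\<lambda>t. h + j * T + t) ` {..<T}" by auto
    qed
    have q4: "card (pick h T c ` ({..<n} - {h + j})) < n"
    proof -
      have "card (pick h T c ` ({..<n} - {h + j})) \<le> card ({..<n} - {h + j})" by (rule card_image_le) simp
      also have "\<dots> < n" using j h(1) by simp
      finally show ?thesis .
    qed
    show "S c j \<in> sets (gams I n)" "measure (gams I n) (S c j) \<le> (b + pe) ^ T"
      unfolding S_def d_def
      by (rule copies_prob[OF a conc b tail hI(2) q1 q2 q3 q4])+
  qed
  have sB: "Bad1 \<in> sets (gams I n)" "Bad2 \<in> sets (gams I n)" "Bad2' \<in> sets (gams I n)" "Bad3 \<in> sets (gams I n)"
    unfolding Bad1_def Bad2_def Bad2'_def Bad3_def
    using nr1(1) nr2(1) S(1) fC lg_sets hI(1) by (auto intro!: sets.finite_UN)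
  have p1: "measure (gams I n) Bad1 \<le> 1/8"
  proof (cases "N1 = n")
    case True then show ?thesis by (simp add: Bad1_def h1_def)
  next
    case False
    have "measure (gams I n) Bad1 \<le> (\<Sum>k<h1. measure (gams I n) (?nr I k ({..<h1} - {k})))"
      unfolding Bad1_def using nr1(1) by (intro measure_UNION_le) auto
    also have "\<dots> \<le> (\<Sum>k<h1. b ^ Suc N1)" using nr1(2) by (intro sum_mono) auto
    also have "\<dots> = h1 * b ^ Suc N1" by simp
    also have "\<dots> \<le> n * b ^ Suc N1" using b by (intro mult_right_mono) (auto simp: h1_def)
    finally show ?thesis using e1 False by simp
  qed
  have p2: "measure (gams I n) Bad2 \<le> 1/8"
  proof (cases "N2 = N1")
    case True then show ?thesis by (simp add: Bad2_def h1_def h_def)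
  next
    case False
    have "measure (gams I n) Bad2 \<le> (\<Sum>k\<in>{h1..<h}. measure (gams I n) (?nr I k ({..<h} - {k})))"
      unfolding Bad2_def using nr2(1) by (intro measure_UNION_le) auto
    also have "\<dots> \<le> (\<Sum>k\<in>{h1..<h}. b ^ Suc N2)" using nr2(2) by (intro sum_mono) auto
    also have "\<dots> = (h - h1) * b ^ Suc N2" by simp
    also have "\<dots> \<le> N1 * b ^ Suc N2" using b by (intro mult_right_mono) (auto simp: h_def h1_def)
    finally show ?thesis using e2 False by simp
  qed
  have p2': "measure (gams I n) Bad2' \<le> 1/8"
  proof -
    have "measure (gams I n) Bad2' \<le> (\<Sum>k\<in>{h1..<h}. measure (gams I n) (?lg I k))"
      unfolding Bad2'_def using lg_sets hI(1) by (intro measure_UNION_le) auto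
    also have "\<dots> \<le> (\<Sum>k\<in>{h1..<h}. pe)" using hI(1) by (intro sum_mono lg_prob) auto
    also have "\<dots> = (h - h1) * pe" by simp
    also have "\<dots> \<le> N1 * pe" using pe0 by (intro mult_right_mono) (auto simp: h_def h1_def)
    finally show ?thesis using e3 by simp
  qed
  have p3: "measure (gams I n) Bad3 \<le> 1/8"
  proof -
    have "measure (gams I n) Bad3 \<le> (\<Sum>c\<in>Cfg. measure (gams I n) (\<Union>j<N2. S c j))"
      unfolding Bad3_def using fC S(1) by (intro measure_UNION_le sets.finite_UN) auto
    also have "\<dots> \<le> (\<Sum>c\<in>Cfg. N2 * (b + pe) ^ T)"
    proof (intro sum_mono)
      fix c assume c: "c \<in> Cfg"
      have "measure (gams I n) (\<Union>j<N2. S c j) \<le> (\<Sum>j<N2. measure (gams I n) (S c j))"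
        using S(1)[OF c] by (intro measure_UNION_le) auto
      also have "\<dots> \<le> (\<Sum>j<N2. (b + pe) ^ T)" using S(2)[OF c] by (intro sum_mono) auto
      finally show "measure (gams I n) (\<Union>j<N2. S c j) \<le> N2 * (b + pe) ^ T" by simp
    qed
    also have "\<dots> = real N2 * real T ^ N2 * (b + pe) ^ T" by (simp add: cC)
    finally show ?thesis using e4 by simp
  qed
  define Bad where "Bad = (Bad1 \<union> Bad2) \<union> (Bad2' \<union> Bad3)"
  have sBad: "Bad \<in> sets (gams I n)" unfolding Bad_def using sB by auto
  have pBad: "measure (gams I n) Bad \<le> 1/2"
    using measure_Un_le[OF sets.Un[OF sB(1,2)] sets.Un[OF sB(3,4)]] measure_Un_le[OF sB(1,2)] measure_Un_le[OF sB(3,4)] p1 p2 p2' p3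
    unfolding Bad_def by linarith
  define Gd where "Gd = {A \<in> space (gams {..<n} n).
     (\<forall>k<h1. \<not> near n (A k) ({..<h1} - {k}) A (d\<^sup>2)) \<and>
     (\<forall>k\<in>{h1..<h}. \<not> near n (A k) ({..<h} - {k}) A (d\<^sup>2) \<and> enorm n (A k) \<le> L) \<and>
     (\<forall>k\<in>{h..<n}. \<not> near n (A k) ({..<n} - {k}) A (d\<^sup>2) \<and> enorm n (A k) \<le> L)}"
  have sG: "Gd \<in> sets (gams {..<n} n)"
  proof -
    have "Gd = space (gams {..<n} n) - ((\<Union>k<h1. ?nr {..<n} k ({..<h1} - {k})) \<union>
       ((\<Union>k\<in>{h1..<h}. ?nr {..<n} k ({..<h} - {k}) \<union> ?lg {..<n} k) \<union>
        (\<Union>k\<in>{h..<n}. ?nr {..<n} k ({..<n} - {k}) \<union> ?lg {..<n} k)))"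
      by (auto simp: Gd_def not_less)
    also have "\<dots> \<in> sets (gams {..<n} n)"
      using h by (intro sets.Diff sets.top sets.Un sets.finite_UN near_sets lg_sets) auto
    finally show ?thesis .
  qed
  let ?p = "\<lambda>c A. (\<lambda>k\<in>{..<n}. A (pick h T c k))"
  have law: "?p c \<in> gams I n \<rightarrow>\<^sub>M gams {..<n} n" "distr (gams I n) (gams {..<n} n) (?p c) = gams {..<n} n" if c: "c \<in> Cfg" for c
  proof -
    have cT: "\<And>j. j < N2 \<Longrightarrow> c j < T" using c by (auto simp: Cfg_def PiE_def Pi_def)
    have pk: "inj_on (pick h T c) {..<n}" "pick h T c ` {..<n} \<subseteq> {..<h + N2 * T}"
      by (rule pick_inj[OF _ h(1)], erule cT)+
    show "?p c \<in> gams I n \<rightarrow>\<^sub>M gams {..<n} n"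
      using pk(2) by (intro measurable_restrict meas_gams_coord) (auto simp: I_def)
    show "distr (gams I n) (gams {..<n} n) (?p c) = gams {..<n} n"
      using distr_PiM_reindex[of I "\<lambda>_. gam n" "pick h T c" "{..<n}"] pk prob_gam unfolding I_def by (auto simp: Pi_def)
  qed
  have sub: "space (gams I n) - Bad \<subseteq> (\<Union>c\<in>Cfg. ?p c -` Gd \<inter> space (gams I n))"
  proof
    fix A assume A: "A \<in> space (gams I n) - Bad"
    have g1: "\<not> near n (A k) ({..<h1} - {k}) A (d\<^sup>2)" if "k < h1" for k
      using A that unfolding Bad_def Bad1_def by auto
    have g2: "\<not> near n (A k) ({..<h} - {k}) A (d\<^sup>2)" "enorm n (A k) \<le> L" if "h1 \<le> k" "k < h" for k
      using A that unfolding Bad_def Bad2_def Bad2'_def by (fastforce simp: not_less[symmetric])+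
    have indep: "\<forall>k<h. x k = 0" if x: "\<forall>i<n. (\<Sum>k<h. x k * A k i) = 0" for x :: "nat \<Rightarrow> real"
    proof -
      have z0: "enorm n (\<lambda>i. \<Sum>k\<in>{..<h}. x k * A k i) \<le> 0" using x by (simp add: nsq_def)
      have hi: "x k = 0" if "h1 \<le> k" "k < h" for k
        using not_near_coefficient[OF _ _ g2(1)[OF that] d z0] that by auto
      have "enorm n (\<lambda>i. \<Sum>k\<in>{..<h1}. x k * A k i) \<le> 0"
      proof -
        have "(\<Sum>k\<in>{..<h}. x k * A k i) = (\<Sum>k\<in>{..<h1}. x k * A k i)" for i
          using h hi by (intro sum.mono_neutral_right) auto
        then show ?thesis using z0 by simp
      qed
      then have lo: "x k = 0" if "k < h1" for k
        using not_near_coefficient[OF _ _ g1[OF that] d, of x 0] that by auto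
      show ?thesis using hi lo by (meson not_le)
    qed
    have "\<exists>c\<in>PiE {..<N2} (\<lambda>_. {..<T}). \<forall>j<N2. enorm n (A (h + j * T + c j)) \<le> L \<and>
      \<not> near n (A (pick h T c (h + j))) ({..<n} - {h + j}) (\<lambda>k. A (pick h T c k)) (d\<^sup>2)"
    proof (rule good_configuration[OF h(1) T _ indep])
      show "0 < d\<^sup>2" using d by simp
      fix c j assume c: "c \<in> PiE {..<N2} (\<lambda>_. {..<T})" and j: "j < N2"
      have cT: "\<And>j. j < N2 \<Longrightarrow> c j < T" using c by (auto simp: PiE_def Pi_def)
      have pk: "inj_on (pick h T c) {..<n}" "pick h T c ` {..<n} \<subseteq> {..<h + N2 * T}"
      by (rule pick_inj[OF _ h(1)], erule cT)+
      have "A \<notin> S c j" using A c j unfolding Bad_def Bad3_def Cfg_def by auto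
      then obtain t where t: "t < T" "enorm n (A (h + j * T + t)) \<le> L"
        "\<not> near n (A (h + j * T + t)) (pick h T c ` ({..<n} - {h + j})) A (d\<^sup>2)"
        using A unfolding S_def by (auto simp: not_less)
      moreover have "inj_on (pick h T c) ({..<n} - {h + j})" using pk(1) by (rule inj_on_subset) auto
      ultimately show "\<exists>t<T. enorm n (A (h + j * T + t)) \<le> L \<and>
        \<not> near n (A (h + j * T + t)) ({..<n} - {h + j}) (\<lambda>k. A (pick h T c k)) (d\<^sup>2)"
        by (auto simp: near_reindex)
    qed
    then obtain c where c: "c \<in> Cfg" and cj: "\<And>j. j < N2 \<Longrightarrow> enorm n (A (h + j * T + c j)) \<le> L \<and>
      \<not> near n (A (pick h T c (h + j))) ({..<n} - {h + j}) (\<lambda>k. A (pick h T c k)) (d\<^sup>2)"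
      unfolding Cfg_def by blast
    have low: "?p c A k = A k" if "k < h" for k using that h by (simp add: pick_def)
    have nl: "near n w U (?p c A) r = near n w U A r" if "U \<subseteq> {..<h}" for w U r
    proof (rule near_cong)
      fix j assume "j \<in> U"
      then have "j < h" using that by blast
      then show "?p c A j = A j" by (rule low)
    qed
    have nh: "near n w ({..<n} - {k}) (?p c A) r = near n w ({..<n} - {k}) (\<lambda>k. A (pick h T c k)) r" for w k r
      by (intro near_cong) auto
    have "?p c A \<in> Gd"
      unfolding Gd_def
    proof (intro CollectI conjI allI impI ballI)
      show "?p c A \<in> space (gams {..<n} n)" using measurable_space[OF law(1)[OF c]] A by auto
      fix k assume k: "k < h1"
      have "near n (A k) ({..<h1} - {k}) (?p c A) (d\<^sup>2) = near n (A k) ({..<h1} - {k}) A (d\<^sup>2)" using h by (intro nl) auto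
      then show "\<not> near n (?p c A k) ({..<h1} - {k}) (?p c A) (d\<^sup>2)" using g1[OF k] low[of k] k h by simp
    next
      fix k assume k: "k \<in> {h1..<h}"
      have "near n (A k) ({..<h} - {k}) (?p c A) (d\<^sup>2) = near n (A k) ({..<h} - {k}) A (d\<^sup>2)" by (intro nl) auto
      then show "\<not> near n (?p c A k) ({..<h} - {k}) (?p c A) (d\<^sup>2)" using g2(1)[of k] low[of k] k by simp
      show "enorm n (?p c A k) \<le> L" using g2(2)[of k] low[of k] k by simp
    next
      fix k assume k: "k \<in> {h..<n}"
      define j where "j = k - h"
      have j: "j < N2" "k = h + j" using k h(1) by (auto simp: j_def)
      have e: "?p c A k = A (pick h T c k)" "pick h T c k = h + j * T + c j" using k j by (auto simp: pick_def)
      show "\<not> near n (?p c A k) ({..<n} - {k}) (?p c A) (d\<^sup>2)" unfolding nh e(1) using cj[OF j(1)] unfolding j(2) by blast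
      show "enorm n (?p c A k) \<le> L" unfolding e using cj[OF j(1)] by blast
    qed
    then show "A \<in> (\<Union>c\<in>Cfg. ?p c -` Gd \<inter> space (gams I n))" using c A by blast
  qed
  have "1/2 \<le> measure (gams I n) (space (gams I n) - Bad)" using pBad I.prob_compl[OF sBad] by linarith
  also have "\<dots> \<le> measure (gams I n) (\<Union>c\<in>Cfg. ?p c -` Gd \<inter> space (gams I n))"
    using measurable_sets[OF law(1) sG] fC by (intro I.finite_measure_mono[OF sub] sets.finite_UN) auto
  also have "\<dots> \<le> (\<Sum>c\<in>Cfg. measure (gams I n) (?p c -` Gd \<inter> space (gams I n)))"
    using measurable_sets[OF law(1) sG] fC by (intro measure_UNION_le) auto
  also have "\<dots> = (\<Sum>c\<in>Cfg. measure (gams {..<n} n) Gd)"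
    using measure_distr[OF law(1) sG] law(2) by (intro sum.cong) auto
  also have "\<dots> = T ^ N2 * measure (gams {..<n} n) Gd" by (simp add: cC)
  finally have pr: "1/2 \<le> T ^ N2 * measure (gams {..<n} n) Gd" .
  have "0 < real T ^ N2" using T by simp
  then have m: "1 / (2 * real T ^ N2) \<le> measure (gams {..<n} n) Gd" using pr by (simp add: field_simps)
  show ?thesis
  proof (rule bexI[OF _ sG], rule conjI, rule m, intro ballI allI impI)
    fix A x assume A: "A \<in> Gd" and x: "nsq n x = (1::real)"
    show "a / sqrt n / (2 * sqrt n * (2 * real n * L / (a / sqrt n))\<^sup>2) \<le> enorm n (\<lambda>i. \<Sum>k<n. x k * A k i)"
      unfolding d_def[symmetric]
      by (rule well_separated_columns[of h1 h n d L A x]) (use A h n1 d dL x in \<open>auto simp: Gd_def d_def\<close>)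
  qed
qed

end

text \<open>Taking logarithms, a multiple \<open>M\<close> of \<open>N\<^sup>2\<close> beats \<open>N ln (M N\<^sup>2)\<close>.\<close>

lemma copies_number:
  fixes b :: real assumes b: "0 < b" "b < 1"
  shows "\<exists>M\<ge>1. \<forall>N\<ge>1. real N * (real (M * N\<^sup>2)) ^ N * b ^ (M * N\<^sup>2) \<le> 1/8"
proof -
  define l where "l = - ln b"
  have l: "0 < l" using b by (simp add: l_def)
  have "eventually (\<lambda>M::real. 10 + ln M \<le> l * M) at_top" using l by real_asymp
  then have "eventually (\<lambda>M::nat. 10 + ln (real M) \<le> l * real M) sequentially"
    by (rule eventually_compose_filterlim) (rule filterlim_real_sequentially)
  then obtain M0 where M0: "\<And>M::nat. M0 \<le> M \<Longrightarrow> 10 + ln (real M) \<le> l * real M" unfolding eventually_sequentially by blast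
  define M where "M = max M0 1"
  have M: "1 \<le> M" "10 + ln (real M) \<le> l * real M" using M0[of M] by (auto simp: M_def)
  show ?thesis
  proof (intro exI[of _ M] conjI allI impI M)
    fix N :: nat assume N: "1 \<le> N"
    have N2: "real N \<le> (real N)\<^sup>2" using N by (simp add: power2_eq_square)
    have lN: "ln (real N) \<le> N" using N ln_le_minus_one[of "real N"] by simp
    have lM: "0 \<le> ln (real M)" using M by simp
    have "ln (8 * real N) + real N * ln (real (M * N\<^sup>2)) \<le> (real N)\<^sup>2 * (10 + ln (real M))"
    proof -
      have "ln (8 * real N) \<le> 8 * real N - 1" using N by (intro ln_le_minus_one) simp
      then have 1: "ln (8 * real N) \<le> 8 * (real N)\<^sup>2" using N2 by linarith
      have "ln (real (M * N\<^sup>2)) = ln (real M) + 2 * ln (real N)" using M N by (simp add: ln_mult ln_realpow)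
      then have "real N * ln (real (M * N\<^sup>2)) = real N * ln (real M) + 2 * (real N * ln (real N))" by (simp add: distrib_left)
      also have "\<dots> \<le> (real N)\<^sup>2 * ln (real M) + 2 * (real N)\<^sup>2"
      proof (intro add_mono mult_left_mono)
        show "real N * ln (real M) \<le> (real N)\<^sup>2 * ln (real M)" using N2 lM by (intro mult_right_mono)
        show "real N * ln (real N) \<le> (real N)\<^sup>2" unfolding power2_eq_square using lN by (intro mult_left_mono) auto
      qed auto
      finally show ?thesis using 1 by (simp add: distrib_left)
    qed
    also have "\<dots> \<le> (real N)\<^sup>2 * (l * real M)" using M by (intro mult_left_mono) auto
    finally have le: "ln (8 * real N) + real N * ln (real (M * N\<^sup>2)) \<le> l * real (M * N\<^sup>2)" by (simp add: mult_ac)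
    have "8 * (real N * (real (M * N\<^sup>2)) ^ N * b ^ (M * N\<^sup>2)) = exp (ln (8 * real N) + real N * ln (real (M * N\<^sup>2)) - l * real (M * N\<^sup>2))"
    proof -
      have p: "0 < real (M * N\<^sup>2)" using M N by simp
      have "exp (real N * ln (real (M * N\<^sup>2))) = (real (M * N\<^sup>2)) ^ N" using p by (simp add: exp_of_nat_mult del: of_nat_mult)
      moreover have "exp (- (l * real (M * N\<^sup>2))) = b ^ (M * N\<^sup>2)"
      proof -
        have "- (l * real (M * N\<^sup>2)) = real (M * N\<^sup>2) * ln b" by (simp add: l_def)
        then show ?thesis using b by (simp add: exp_of_nat_mult del: of_nat_mult)
      qed
      moreover have "exp (ln (8 * real N)) = 8 * real N" using N by simp
      ultimately show ?thesis by (simp add: exp_add exp_diff exp_minus divide_inverse del: of_nat_mult)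
    qed
    also have "\<dots> \<le> exp 0" using le by (subst exp_le_cancel_iff) linarith
    finally show "real N * (real (M * N\<^sup>2)) ^ N * b ^ (M * N\<^sup>2) \<le> 1/8" by simp
  qed
qed

lemma log_square_bound:
  fixes k l :: real assumes "0 < l"
  shows "\<exists>C. \<forall>N\<ge>1. k * (1 + (1 + ln (8 * real N)) / l)\<^sup>2 \<le> C + l * real N / 2"
proof -
  have "eventually (\<lambda>x::real. k * (1 + (1 + ln (8 * x)) / l)\<^sup>2 \<le> l * x / 2) at_top" using assms by real_asymp
  then have "eventually (\<lambda>N::nat. k * (1 + (1 + ln (8 * real N)) / l)\<^sup>2 \<le> l * real N / 2) sequentially"
    by (rule eventually_compose_filterlim) (rule filterlim_real_sequentially)
  then obtain N0 where N0: "\<And>N::nat. N0 \<le> N \<Longrightarrow> k * (1 + (1 + ln (8 * real N)) / l)\<^sup>2 \<le> l * real N / 2"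
    unfolding eventually_sequentially by blast
  define f where "f N = \<bar>k * (1 + (1 + ln (8 * real N)) / l)\<^sup>2\<bar>" for N :: nat
  show ?thesis
  proof (intro exI[of _ "\<Sum>N<N0. f N"] allI impI)
    fix N :: nat assume "1 \<le> N"
    have s0: "0 \<le> (\<Sum>N<N0. f N)" unfolding f_def by (intro sum_nonneg) auto
    show "k * (1 + (1 + ln (8 * real N)) / l)\<^sup>2 \<le> (\<Sum>N<N0. f N) + l * real N / 2"
    proof (cases "N0 \<le> N")
      case True then show ?thesis using N0[OF True] s0 by linarith
    next
      case False
      then have "f N \<le> (\<Sum>N<N0. f N)" by (intro member_le_sum) (auto simp: f_def)
      moreover have "0 \<le> l * real N / 2" using assms by simp
      ultimately show ?thesis unfolding f_def by linarith
    qed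
  qed
qed

lemma group_size:
  fixes b :: real assumes b: "0 < b" "b < 1" and n: "1 \<le> n"
  shows "\<exists>N\<ge>1. N \<le> n \<and> (N = n \<or> n * b ^ Suc N \<le> 1/8) \<and> real N \<le> 1 + (1 + ln (8 * real n)) / (- ln b)"
proof -
  define l where "l = - ln b"
  have l: "0 < l" using b by (simp add: l_def)
  have ln8: "0 < ln (8 * real n)" using n by simp
  define N where "N = min n (nat \<lceil>ln (8 * real n) / l\<rceil>)"
  have pos: "0 < ln (8 * real n) / l" using ln8 l by simp
  show ?thesis
  proof (intro exI[of _ N] conjI)
    show "1 \<le> N" using n pos unfolding N_def by (auto simp: Suc_le_eq)
    show "N \<le> n" by (simp add: N_def)
    have "ln (8 * real n) / l \<le> (1 + ln (8 * real n)) / l" using l by (intro divide_right_mono) auto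
    moreover have "real N \<le> ln (8 * real n) / l + 1" using pos unfolding N_def by linarith
    ultimately show "real N \<le> 1 + (1 + ln (8 * real n)) / (- ln b)" unfolding l_def[symmetric] by linarith
    show "N = n \<or> n * b ^ Suc N \<le> 1/8"
    proof (cases "N = n")
      case False
      then have "ln (8 * real n) / l \<le> real N" using pos unfolding N_def by linarith
      then have "ln (8 * real n) \<le> l * real N" using l by (simp add: pos_divide_le_eq mult.commute)
      also have "\<dots> \<le> l * real (Suc N)" using l by simp
      finally have le: "ln (8 * real n) - l * real (Suc N) \<le> 0" by simp
      have "8 * (n * b ^ Suc N) = exp (ln (8 * real n) - l * real (Suc N))"
      proof -
        have "- (l * real (Suc N)) = real (Suc N) * ln b" by (simp add: l_def)
        then have "exp (- (l * real (Suc N))) = b ^ Suc N" using b by (simp add: exp_of_nat_mult del: of_nat_Suc power_Suc)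
        then show ?thesis using n by (simp add: exp_diff exp_minus divide_inverse del: of_nat_Suc power_Suc)
      qed
      also have "\<dots> \<le> exp 0" using le by (subst exp_le_cancel_iff)
      finally show ?thesis by simp
    qed simp
  qed
qed

text \<open>The first size is logarithmic in \<open>n\<close> and the second is logarithmic in the first, so that \<open>T ^ N2\<close> is at most
the exponential of a power of \<open>ln ln n\<close>. This is much less than \<open>n\<close>.\<close>

lemma group_sizes:
  fixes b :: real assumes b: "0 < b" "b < 1"
  shows "\<exists>cb>0. \<forall>n\<ge>1::nat. \<exists>N1 N2 T. N2 \<le> N1 \<and> N1 \<le> n \<and> 1 \<le> T \<and>
    (N1 = n \<or> n * b ^ Suc N1 \<le> 1/8) \<and> (N2 = N1 \<or> N1 * b ^ Suc N2 \<le> 1/8) \<and>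
    real N2 * real T ^ N2 * ((1 + b) / 2) ^ T \<le> 1/8 \<and> cb / n \<le> 1 / (2 * real T ^ N2)"
proof -
  define l where "l = - ln b"
  have l: "0 < l" using b by (simp add: l_def)
  have b': "0 < (1 + b) / 2" "(1 + b) / 2 < 1" using b by auto
  obtain M where M: "1 \<le> M" "\<And>N. 1 \<le> N \<Longrightarrow> real N * (real (M * N\<^sup>2)) ^ N * ((1 + b) / 2) ^ (M * N\<^sup>2) \<le> 1/8"
    using copies_number[OF b'] by blast
  define k where "k = ln (real M) + 2"
  have k: "0 < k" using M by (simp add: k_def add_nonneg_pos)
  obtain C where C: "\<And>N::nat. 1 \<le> N \<Longrightarrow> k * (1 + (1 + ln (8 * real N)) / l)\<^sup>2 \<le> C + l * real N / 2"
    using log_square_bound[OF l, of k] by blast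
  define cb where "cb = exp (- (C + l + 1 + ln 8)) / 2"
  show ?thesis
  proof (intro exI[of _ cb] conjI allI impI)
    show "0 < cb" by (simp add: cb_def)
    fix n :: nat assume n: "1 \<le> n"
    obtain N1 where N1: "1 \<le> N1" "N1 \<le> n" "N1 = n \<or> n * b ^ Suc N1 \<le> 1/8" "real N1 \<le> 1 + (1 + ln (8 * real n)) / l"
      using group_size[OF b n] unfolding l_def by blast
    obtain N2 where N2: "1 \<le> N2" "N2 \<le> N1" "N2 = N1 \<or> N1 * b ^ Suc N2 \<le> 1/8" "real N2 \<le> 1 + (1 + ln (8 * real N1)) / l"
      using group_size[OF b N1(1)] unfolding l_def by blast
    define T where "T = M * N2\<^sup>2"
    have T: "1 \<le> T" using M N2 by (simp add: T_def Suc_le_eq)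
    have e4: "real N2 * real T ^ N2 * ((1 + b) / 2) ^ T \<le> 1/8" using M(2)[OF N2(1)] unfolding T_def by simp
    have "ln (real T ^ N2) = real N2 * (ln (real M) + 2 * ln (real N2))"
      using M N2 by (simp add: T_def ln_mult ln_realpow)
    also have "\<dots> \<le> real N2 * (real N2 * k)"
    proof (intro mult_left_mono)
      have "ln (real N2) \<le> real N2" using N2 ln_le_minus_one[of "real N2"] by simp
      moreover have "1 * ln (real M) \<le> real N2 * ln (real M)" using N2 M by (intro mult_right_mono) auto
      ultimately show "ln (real M) + 2 * ln (real N2) \<le> real N2 * k" by (simp add: k_def distrib_left)
    qed simp
    also have "\<dots> = k * (real N2)\<^sup>2" by (simp add: power2_eq_square)
    also have "\<dots> \<le> k * (1 + (1 + ln (8 * real N1)) / l)\<^sup>2" using k N2 by (intro mult_left_mono power_mono) auto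
    also have "\<dots> \<le> C + l * real N1 / 2" by (rule C[OF N1(1)])
    also have "\<dots> \<le> C + (l + 1 + ln (8 * real n))"
    proof -
      have "l * real N1 \<le> l * (1 + (1 + ln (8 * real n)) / l)" using l N1 by (intro mult_left_mono) auto
      also have "\<dots> = l * 1 + l * ((1 + ln (8 * real n)) / l)" by (rule distrib_left)
      also have "\<dots> = l + 1 + ln (8 * real n)" using l by simp
      finally have "l * real N1 \<le> l + 1 + ln (8 * real n)" .
      moreover have "0 \<le> l * real N1" using l by simp
      ultimately show ?thesis by linarith
    qed
    finally have "ln (real T ^ N2) \<le> (C + l + 1 + ln 8) + ln (real n)" using n by (simp add: ln_mult)
    then have "exp (ln (real T ^ N2)) \<le> exp ((C + l + 1 + ln 8) + ln (real n))" by (subst exp_le_cancel_iff)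
    moreover have "exp (ln (real T ^ N2)) = real T ^ N2" using T by simp
    moreover
    have "exp (E + ln (real n)) = n / (2 * (exp (- E) / 2))" for E :: real
    proof -
      have "exp (ln (real n)) = real n" using n by simp
      then show ?thesis unfolding exp_add exp_minus by (simp add: inverse_eq_divide mult.commute)
    qed
    then have "exp ((C + l + 1 + ln 8) + ln (real n)) = n / (2 * cb)" unfolding cb_def .
    ultimately have Tn: "real T ^ N2 \<le> n / (2 * cb)" by simp
    have cbp: "0 < cb" by (simp add: cb_def)
    have "cb / n \<le> 1 / (2 * real T ^ N2)"
    proof -
      have "0 < real T ^ N2" using T by simp
      then have "1 / (2 * (n / (2 * cb))) \<le> 1 / (2 * real T ^ N2)" using Tn n cbp by (intro divide_left_mono) auto
      then show ?thesis using cbp by simp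
    qed
    then show "\<exists>N1 N2 T. N2 \<le> N1 \<and> N1 \<le> n \<and> 1 \<le> T \<and>
      (N1 = n \<or> n * b ^ Suc N1 \<le> 1/8) \<and> (N2 = N1 \<or> N1 * b ^ Suc N2 \<le> 1/8) \<and>
      real N2 * real T ^ N2 * ((1 + b) / 2) ^ T \<le> 1/8 \<and> cb / n \<le> 1 / (2 * real T ^ N2)"
      using N1 N2 T e4 by (intro exI[of _ N1] exI[of _ N2] exI[of _ T]) auto
  qed
qed

section \<open>Laws of the rows and columns; large dimensions\<close>

context entry_law
begin

lemma independent_array_law:
  fixes M :: "'w measure" and Y :: "nat \<times> nat \<Rightarrow> 'w \<Rightarrow> real"
  assumes M: "prob_space M" and iv: "prob_space.indep_vars M (\<lambda>_. borel) Y ({..<n} \<times> {..<n})"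
    and law: "\<And>k i. k < n \<Longrightarrow> i < n \<Longrightarrow> distr M borel (Y (k, i)) = \<mu>" and n: "1 \<le> n"
  defines "X \<equiv> \<lambda>k \<omega>. \<lambda>i\<in>{..<n}. Y (k, i) \<omega>"
  shows "X 0 \<in> M \<rightarrow>\<^sub>M gam n" "distr M (gam n) (X 0) = gam n"
    "(\<lambda>\<omega>. \<lambda>k\<in>{..<n}. X k \<omega>) \<in> M \<rightarrow>\<^sub>M gams {..<n} n"
    "distr M (gams {..<n} n) (\<lambda>\<omega>. \<lambda>k\<in>{..<n}. X k \<omega>) = gams {..<n} n"
proof -
  interpret M: prob_space M by (rule M)
  have rv: "Y (k, i) \<in> borel_measurable M" if "k < n" "i < n" for k i
    using iv that unfolding M.indep_vars_def by (elim conjE) (drule bspec[of _ _ "(k, i)"], auto)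
  have ne: "{..<n} \<noteq> {}" using n by (auto simp: lessThan_empty_iff)
  have sg: "sets (PiM {..<n} (\<lambda>_. borel)) = sets (gam n)"
    unfolding gam_def by (intro sets_PiM_cong) auto
  have mX: "X k \<in> M \<rightarrow>\<^sub>M gam n" if "k < n" for k
    unfolding X_def gam_def
  proof (rule measurable_restrict)
    fix i assume "i \<in> {..<n}"
    then show "Y (k, i) \<in> M \<rightarrow>\<^sub>M \<mu>"
      using rv[of k i] that by (subst measurable_cong_sets[OF refl sets_mu]) auto
  qed
  have dX: "distr M (gam n) (X k) = gam n" if k: "k < n" for k
  proof -
    have "M.indep_vars (\<lambda>i. PiM {(k, i)} (\<lambda>_. borel)) (\<lambda>i \<omega>. restrict (\<lambda>z. Y z \<omega>) {(k, i)}) {..<n}"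
      using k by (intro M.indep_vars_restrict[OF iv]) (auto simp: disjoint_family_on_def)
    then have "M.indep_vars (\<lambda>_. borel) (\<lambda>i \<omega>. (\<lambda>i v. v (k, i)) i (restrict (\<lambda>z. Y z \<omega>) {(k, i)})) {..<n}"
      by (rule M.indep_vars_compose2) (intro measurable_component_singleton, auto)
    then have "M.indep_vars (\<lambda>_. borel) (\<lambda>i. Y (k, i)) {..<n}" by simp
    then have "distr M (PiM {..<n} (\<lambda>_. borel)) (\<lambda>\<omega>. \<lambda>i\<in>{..<n}. Y (k, i) \<omega>) = PiM {..<n} (\<lambda>i. distr M borel (Y (k, i)))"
      using rv k by (subst (asm) M.indep_vars_iff_distr_eq_PiM'[OF ne]) auto
    also have "\<dots> = gam n" unfolding gam_def using law k by (intro PiM_cong) auto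
    finally show ?thesis unfolding X_def by (subst distr_cong[OF refl sg[symmetric] refl])
  qed
  have "M.indep_vars (\<lambda>k. PiM ({k} \<times> {..<n}) (\<lambda>_. borel)) (\<lambda>k \<omega>. restrict (\<lambda>z. Y z \<omega>) ({k} \<times> {..<n})) {..<n}"
    by (intro M.indep_vars_restrict[OF iv]) (auto simp: disjoint_family_on_def)
  then have "M.indep_vars (\<lambda>_. gam n) (\<lambda>k \<omega>. (\<lambda>k v. \<lambda>i\<in>{..<n}. v (k, i)) k (restrict (\<lambda>z. Y z \<omega>) ({k} \<times> {..<n}))) {..<n}"
  proof (rule M.indep_vars_compose2)
    fix k
    have "(\<lambda>v. \<lambda>i\<in>{..<n}. v (k, i)) \<in> PiM ({k} \<times> {..<n}) (\<lambda>_. borel) \<rightarrow>\<^sub>M PiM {..<n} (\<lambda>_. borel)"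
      by (intro measurable_restrict measurable_component_singleton) auto
    then show "(\<lambda>v. \<lambda>i\<in>{..<n}. v (k, i)) \<in> PiM ({k} \<times> {..<n}) (\<lambda>_. borel) \<rightarrow>\<^sub>M gam n"
      by (subst measurable_cong_sets[OF refl sg[symmetric]])
  qed
  moreover have "(\<lambda>k v. \<lambda>i\<in>{..<n}. v (k, i)) k (restrict (\<lambda>z. Y z \<omega>) ({k} \<times> {..<n})) = X k \<omega>" for k \<omega>
    by (auto simp: X_def)
  ultimately have iX: "M.indep_vars (\<lambda>_. gam n) X {..<n}" by simp
  show "X 0 \<in> M \<rightarrow>\<^sub>M gam n" "distr M (gam n) (X 0) = gam n" using mX dX n by auto
  show "(\<lambda>\<omega>. \<lambda>k\<in>{..<n}. X k \<omega>) \<in> M \<rightarrow>\<^sub>M gams {..<n} n" using mX by (intro measurable_restrict) auto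
  have "distr M (gams {..<n} n) (\<lambda>\<omega>. \<lambda>k\<in>{..<n}. X k \<omega>) = PiM {..<n} (\<lambda>k. distr M (gam n) (X k))"
    using iX mX by (subst (asm) M.indep_vars_iff_distr_eq_PiM'[OF ne]) auto
  also have "\<dots> = gams {..<n} n" using dX by (intro PiM_cong) auto
  finally show "distr M (gams {..<n} n) (\<lambda>\<omega>. \<lambda>k\<in>{..<n}. X k \<omega>) = gams {..<n} n" .
qed

end

text \<open>The sphere is nonempty since \<open>n \<ge> 1\<close>, and an infimum below \<open>r\<close> is undercut by some unit vector.\<close>

lemma small_singular_value_witness:
  assumes A: "A \<in> carrier_mat n n" and n: "1 \<le> n" and s: "smallest_singular_value A < r"
  shows "\<exists>x. nsq n x = 1 \<and> (\<Sum>i<n. (ip n x (\<lambda>k\<in>{..<n}. A $$ (i, k)))\<^sup>2) < r\<^sup>2"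
proof -
  let ?S = "{x \<in> carrier_vec n. eucl_norm x = 1}"
  have "eucl_norm (unit_vec n 0) = sqrt (\<Sum>i<n. if i = 0 then 1 else 0)"
    unfolding eucl_norm_def by (intro arg_cong[where f=sqrt] sum.cong) auto
  also have "\<dots> = 1" using n by simp
  finally have "?S \<noteq> {}" by (intro ex_in_conv[THEN iffD1] exI[of _ "unit_vec n 0"]) simp
  moreover have "(INF x\<in>?S. eucl_norm (A *\<^sub>v x)) < r" using s A by (simp add: smallest_singular_value_def)
  ultimately obtain x where x: "x \<in> ?S" "eucl_norm (A *\<^sub>v x) < r"
    using cInf_lessD[of "(\<lambda>x. eucl_norm (A *\<^sub>v x)) ` ?S" r] by blast
  define y where "y i = x $ i" for i
  have dx: "dim_vec x = n" using x by auto
  have "nsq n y = 1" using x(1) dx by (simp add: eucl_norm_def nsq_def y_def)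
  moreover have "eucl_norm (A *\<^sub>v x) = sqrt (\<Sum>i<n. (ip n y (\<lambda>k\<in>{..<n}. A $$ (i, k)))\<^sup>2)"
  proof -
    have "(A *\<^sub>v x) $ i = ip n y (\<lambda>k\<in>{..<n}. A $$ (i, k))" if "i < n" for i
    proof -
      have "(A *\<^sub>v x) $ i = (\<Sum>k\<in>{0..<n}. row A i $ k * x $ k)"
        using A that dx by (simp add: scalar_prod_def)
      also have "\<dots> = ip n y (\<lambda>k\<in>{..<n}. A $$ (i, k))"
        using A that unfolding ip_def y_def by (intro sum.cong) (auto simp: mult.commute)
      finally show ?thesis .
    qed
    then show ?thesis unfolding eucl_norm_def using A by (intro arg_cong[where f=sqrt] sum.cong) auto
  qed
  moreover have "s < r\<^sup>2" if "sqrt s < r" "0 \<le> s" for s :: real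
  proof -
    have "(sqrt s)\<^sup>2 < r\<^sup>2" using that by (intro power_strict_mono) auto
    then show ?thesis using that by simp
  qed
  ultimately show ?thesis using x(2) by (intro exI[of _ y]) (simp add: sum_nonneg)
qed

text \<open>Young's inequality, that is, convexity of the exponential function.\<close>

lemma powr_le_chord:
  fixes s z :: real assumes "0 < s" "s \<le> 1" "0 \<le> z"
  shows "z powr s \<le> s * z + (1 - s)"
proof (cases "z = 0")
  case False
  then have z: "0 < z" using assms by simp
  have "exp ((1 - s) *\<^sub>R 0 + s *\<^sub>R ln z) \<le> (1 - s) * exp 0 + s * exp (ln z)"
    using assms by (intro convex_onD[OF exp_convex]) auto
  then show ?thesis using z by (simp add: powr_def)
qed (use assms in auto)

context entry_law
begin

text \<open>With \<open>X\<close> at least \<open>2\<close>, numerical factors are absorbed by powers of \<open>X\<close>; the exponents are what this bookkeeping yields.\<close>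

lemma main_regime:
  fixes M :: "'w measure" and X :: real
  assumes X: "2 \<le> X" and conc: "\<And>z. prob {x. \<bar>x - z\<bar> < 1 / X} \<le> 1 - 1 / X"
    and p: "0 < p" "p \<le> 1" and q: "exp (- real n / (4 * X)) \<le> p" and nX: "X ^ 3829 \<le> n"
    and i: "integrable (gam n) (\<lambda>g. (sqrt (nsq n g) / (X * sqrt n)) powr p)"
    and m: "(\<integral>g. (sqrt (nsq n g) / (X * sqrt n)) powr p \<partial>gam n) \<le> 1"
    and M: "prob_space M"
    and R: "R \<in> M \<rightarrow>\<^sub>M gams {..<n} n" "distr M (gams {..<n} n) R = gams {..<n} n"
    and C: "C \<in> M \<rightarrow>\<^sub>M gams {..<n} n" "distr M (gams {..<n} n) C = gams {..<n} n"
    and RC: "\<And>\<omega> i j. \<omega> \<in> space M \<Longrightarrow> i < n \<Longrightarrow> j < n \<Longrightarrow> R \<omega> i j = C \<omega> j i"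
    and E: "E \<in> sets M" "\<And>\<omega>. \<omega> \<in> E \<Longrightarrow> \<exists>x. nsq n x = 1 \<and> (\<Sum>i<n. (ip n x (R \<omega> i))\<^sup>2) < e\<^sup>2 / n" and e: "0 < e"
  shows "measure M E \<le> exp (- p * n) + X ^ 1090 * e + X ^ 863 * exp (- real n / X ^ 1886)"
proof -
  define Z where "Z = 1 / X"
  have Z: "0 < Z" "Z \<le> 1/2" using X by (auto simp: Z_def field_simps)
  have XZ: "X ^ k * Z ^ k = 1" for k using X by (simp add: Z_def power_mult_distrib[symmetric])
  have Zk: "1 / X ^ k = Z ^ k" for k by (simp add: Z_def power_one_over)
  have two: "(2::real) ^ k \<le> X ^ k" for k using X by (intro power_mono) auto
  have half: "Z ^ k \<le> 1 / 2 ^ k" for k using Z power_mono[of Z "1/2" k] by (simp add: power_one_over)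
  have X1: "1 \<le> X ^ k" for k using X by (intro one_le_power) simp
  have Xmono: "X ^ k \<le> X ^ l" if "k \<le> l" for k l using X that by (intro power_increasing) auto
  have n1: "1 \<le> n" using nX X1[of 3829] by (simp add: order_trans)
  have Xn: "X ^ k \<le> n" if "k \<le> 3829" for k using Xmono[OF that] nX by linarith
  have q': "exp (real_of_int (- int n) / (4 * X)) \<le> p" using q by simp
  have c0: "prob {x. \<bar>x\<bar> < 1 / X} \<le> 1 - 1 / X" using conc[of 0] by simp
  have tail: "measure (gam n) {g \<in> space (gam n). X ^ 23 * sqrt n < sqrt (nsq n g)} \<le> 1/4"
    by (rule norm_tail[OF X c0 n1 p q' i m])
  have t0: "0 < X ^ 23" using X by simp
  have mass: "1/4 \<le> wmass (1 / ((X ^ 23)\<^sup>2 * n)) ^ n" by (rule wmass_from_tail[OF t0 n1 tail])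
  have "64 * X\<^sup>2 \<le> X ^ 6 * X\<^sup>2" using two[of 6] X by (intro mult_right_mono) auto
  also have "\<dots> = X ^ 8" by (simp flip: power_add)
  also have "\<dots> \<le> n" by (rule Xn) simp
  finally have n64: "64 * X\<^sup>2 \<le> n" .
  have smalls: "\<bar>s\<bar> \<le> 1 / (8 * X ^ 23 * X)" if "\<bar>s\<bar> \<le> Z ^ 27" for s
  proof -
    have "8 * X ^ 23 * X \<le> X ^ 3 * X ^ 23 * X" using two[of 3] X by (intro mult_right_mono) auto
    also have "\<dots> = X ^ 27" by (simp flip: power_add power_Suc2)
    finally have "1 / X ^ 27 \<le> 1 / (8 * X ^ 23 * X)" using X by (intro divide_left_mono) auto
    then show ?thesis using that unfolding Zk by linarith
  qed
  have low: "Z ^ 7 * s\<^sup>2 \<le> defect l s" if "\<bar>s\<bar> \<le> Z ^ 27" "0 \<le> l" "l \<le> 1 / ((X ^ 23)\<^sup>2 * n)" for l s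
    using defect_large[OF mass t0 X n64 conc that(2,3) smalls[OF that(1)]]
    unfolding Zk[symmetric] by (simp add: mult.commute)
  \<comment> \<open>The exponents 7, 27 and 23 come from defect_large and norm_tail.\<close>
  interpret V: level0 \<mu> n "Z ^ 7" "Z ^ 27" "X ^ 23" X "X ^ 7"
  proof unfold_locales
    show "Z ^ 7 * s\<^sup>2 \<le> defect 0 s" if "\<bar>s\<bar> \<le> Z ^ 27" for s using low[OF that, of 0] by simp
    show "Z ^ 7 * s\<^sup>2 \<le> defect (1 / ((X ^ 23)\<^sup>2 * n)) s" if "\<bar>s\<bar> \<le> Z ^ 27" for s by (rule low[OF that]) auto
  qed (use n1 Z X X1 mass in \<open>auto intro!: power_le_one\<close>)
  have Zp: "0 < Z ^ k" "0 \<le> Z ^ k" for k using Z by simp_all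
  have b1: "Z ^ 69 \<le> V.c1"
  proof -
    have "Z ^ 69 = Z ^ 7 * (Z ^ 27)\<^sup>2 * Z ^ 8" by (simp flip: power_add power_mult)
    also have "\<dots> \<le> Z ^ 7 * (Z ^ 27)\<^sup>2 * (1 / 2 ^ 8)" using half[of 8] Z by (intro mult_left_mono) auto
    finally show ?thesis by (simp add: V.c1_def)
  qed
  have b2: "Z ^ 36 \<le> V.eta"
  proof -
    have "Z ^ 36 = Z ^ 7 * Z ^ 23 * Z ^ 6" by (simp flip: power_add)
    also have "\<dots> \<le> Z ^ 7 * Z ^ 23 * (1 / 2 ^ 6)" using half[of 6] Z by (intro mult_left_mono) auto
    also have "\<dots> = V.eta" unfolding V.eta_def unfolding Zk[symmetric] by simp
    finally show ?thesis .
  qed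
  have b3: "Z ^ 192 \<le> V.beta"
  proof -
    have "Z ^ 69 * Z ^ 9 \<le> V.c1 * (1 / 2 ^ 9)" using b1 half[of 9] V.c1 Z by (intro mult_mono) auto
    then have "(Z ^ 69 * Z ^ 9)\<^sup>2 \<le> (V.c1 / 512)\<^sup>2" using Zp by (intro power_mono) auto
    then have "Z ^ 36 * (Z ^ 69 * Z ^ 9)\<^sup>2 \<le> V.beta" unfolding V.beta_def using b2 V.eta Zp by (intro mult_mono) auto
    then show ?thesis by (simp flip: power_add power_mult)
  qed
  have b4: "Z ^ 229 \<le> V.rho"
  proof -
    have "Z ^ 192 * Z ^ 36 * Z ^ 1 \<le> V.beta * V.eta * (1 / 2 ^ 1)"
      using b3 b2 V.eta V.beta half[of 1] Zp Z by (intro mult_mono mult_nonneg_nonneg) auto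
    then show ?thesis by (simp add: V.rho_def flip: power_add power_Suc2)
  qed
  have b5: "Z ^ 660 \<le> V.al1"
  proof -
    have "Z ^ 7 * (Z ^ 229)\<^sup>2 * Z ^ 192 * Z ^ 3 \<le> Z ^ 7 * V.rho\<^sup>2 * V.beta * (1 / 2 ^ 3)"
      using b3 b4 V.rho V.beta half[of 3] Zp Z by (intro mult_mono mult_nonneg_nonneg power_mono) auto
    then show ?thesis by (simp add: V.al1_def flip: power_add power_mult)
  qed
  have b6: "Z ^ 941 \<le> V.ups"
  proof -
    have "Z ^ 192 * Z ^ 27 * Z ^ 7 * Z ^ 660 * Z ^ 40 * Z ^ 15 \<le> V.beta * Z ^ 27 * Z ^ 7 * V.al1 * (1 / 2 ^ 40) * (1 / X ^ 15)"
      unfolding Zk using b3 b5 V.beta V.al1 half[of 40] Zp Z by (intro mult_mono mult_nonneg_nonneg) auto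
    also have "\<dots> = V.ups"
    proof -
      have "X ^ 15 = (X ^ 7)\<^sup>2 * X" by (simp flip: power_mult power_Suc2)
      then show ?thesis unfolding V.ups_def by simp
    qed
    finally show ?thesis by (simp flip: power_add)
  qed
  have b7: "Z ^ 1882 \<le> V.tau"
    unfolding V.tau_def using power_mono[OF b6 Zp(2), of 2] by (simp flip: power_mult)
  have b8: "Z ^ 1913 \<le> V.s0"
  proof -
    have "Z ^ 1882 * Z ^ 8 * Z ^ 23 \<le> V.tau * (1 / 2 ^ 8) * Z ^ 23"
      using b7 V.ups half[of 8] Zp Z by (intro mult_mono mult_nonneg_nonneg) (auto simp: V.tau_def)
    also have "\<dots> = V.s0" unfolding V.s0_def unfolding Zk[symmetric] by simp
    finally show ?thesis by (simp flip: power_add)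
  qed
  have s0p: "0 < V.s0" using b8 Zp(1)[of 1913] by linarith
  have big: "6 / V.s0\<^sup>2 \<le> n"
  proof -
    have "6 / V.s0\<^sup>2 \<le> 6 / (Z ^ 1913)\<^sup>2" using b8 s0p Z by (intro divide_left_mono power_mono mult_pos_pos zero_less_power) auto
    also have "\<dots> = 6 * X ^ 3826" using XZ[of 3826] Zp[of 3826] by (simp add: field_simps flip: power_mult)
    also have "\<dots> \<le> X ^ 3 * X ^ 3826" using two[of 3] X by (intro mult_right_mono) auto
    also have "\<dots> = X ^ 3829" by (simp flip: power_add)
    finally show ?thesis using nX by linarith
  qed
  interpret V: level \<mu> n "Z ^ 7" "Z ^ 27" "X ^ 23" X "X ^ 7" by unfold_locales (rule big)
  have n2: "2 \<le> n" using Xn[of 1] X by simp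
  have n3: "1024 \<le> Z ^ 7 * n\<^sup>2"
  proof -
    have "1024 \<le> X ^ 10" using two[of 10] by simp
    also have "\<dots> = (X ^ 7 * Z ^ 7) * X ^ 10" unfolding XZ by simp
    also have "\<dots> = Z ^ 7 * (X ^ 7 * X ^ 10)" by (simp only: mult_ac)
    also have "X ^ 7 * X ^ 10 = X ^ 17" by (simp flip: power_add)
    also have "Z ^ 7 * X ^ 17 \<le> Z ^ 7 * n\<^sup>2"
    proof (rule mult_left_mono)
      have "X ^ 17 * 1 \<le> real n * real n" using Xn[of 17] n1 by (intro mult_mono) auto
      then show "X ^ 17 \<le> real (n\<^sup>2)" by (simp add: power2_eq_square)
    qed (use Z in simp)
    finally show ?thesis by simp
  qed
  note tp = trunc_norm_product_tail[OF X c0 n1 p q' i m, of "{..<n}"]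
  have "measure M E \<le> exp (- p * n) + exp (- V.c1 * n / 32) +
    (exp (- V.c1 * n / 32) + exp (- real n) + 320 * (e / V.rho + exp (- V.tau * n / 16)) / V.al1) / V.beta"
    by (rule V.invertibility[OF n2 n3 M R C RC tp(1) tp(2) E e]) auto
  also have "\<dots> \<le> exp (- p * n) + X ^ 1090 * e + X ^ 863 * exp (- real n / X ^ 1886)"
  proof -
    define y where "y = exp (- real n / X ^ 1886)"
    have y: "0 < y" by (simp add: y_def)
    have ex: "exp (- u * n) \<le> y" if "Z ^ 1886 \<le> u" for u
    proof -
      have "n / X ^ 1886 = Z ^ 1886 * n" using Zk[of 1886] by (metis mult.commute mult_1 times_divide_eq_left times_divide_eq_right)
      also have "\<dots> \<le> u * n" using that by (intro mult_right_mono) auto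
      finally show ?thesis unfolding y_def by simp
    qed
    have e1: "exp (- V.c1 * n / 32) \<le> y"
    proof -
      have "Z ^ 1886 \<le> Z ^ (69 + 5)" using Z by (intro power_decreasing) auto
      also have "\<dots> \<le> V.c1 * (1 / 2 ^ 5)" unfolding power_add using b1 half[of 5] V.c1 Z by (intro mult_mono) auto
      finally show ?thesis using ex[of "V.c1 / 32"] by simp
    qed
    have e2: "exp (- real n) \<le> y" using ex[of 1] Z by (simp add: power_le_one)
    have e3: "exp (- V.tau * n / 16) \<le> y"
    proof -
      have "Z ^ 1886 = Z ^ 1882 * Z ^ 4" by (simp flip: power_add)
      also have "\<dots> \<le> V.tau * (1 / 2 ^ 4)" using b7 half[of 4] Z by (intro mult_mono) (auto simp: V.tau_def)
      finally show ?thesis using ex[of "V.tau / 16"] by simp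
    qed
    have inv: "1 / u \<le> X ^ k" if "Z ^ k \<le> u" for u k
    proof -
      have "1 / u \<le> 1 / Z ^ k" using that Zp[of k] by (intro divide_left_mono) (auto intro: mult_pos_pos less_le_trans)
      also have "\<dots> = X ^ k" by (metis XZ nonzero_eq_divide_eq Zp(1) less_irrefl)
      finally show ?thesis .
    qed
    have r: "e / V.rho \<le> X ^ 229 * e" using mult_right_mono[OF inv[OF b4], of e] e by simp
    have "320 * (e / V.rho + exp (- V.tau * n / 16)) / V.al1 \<le> 320 * (X ^ 229 * e + y) * X ^ 660"
    proof -
      have "320 * (e / V.rho + exp (- V.tau * n / 16)) * (1 / V.al1) \<le> 320 * (X ^ 229 * e + y) * X ^ 660"
        using r e3 e y X V.al1 V.rho inv[OF b5] by (intro mult_mono) auto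
      then show ?thesis by simp
    qed
    then have s: "exp (- V.c1 * n / 32) + exp (- real n) + 320 * (e / V.rho + exp (- V.tau * n / 16)) / V.al1
       \<le> 2 * y + 320 * (X ^ 229 * e + y) * X ^ 660" (is "?s \<le> ?s'") using e1 e2 by linarith
    have s0: "0 \<le> ?s'" using y e X by simp
    have "?s / V.beta \<le> ?s' / V.beta" using s V.beta by (intro divide_right_mono) auto
    also have "\<dots> = ?s' * (1 / V.beta)" by simp
    also have "\<dots> \<le> ?s' * X ^ 192" using s0 inv[OF b3] by (intro mult_left_mono) auto
    also have "\<dots> = 2 * X ^ 192 * y + 320 * X ^ 852 * y + 320 * X ^ 1081 * e"
      by (simp add: algebra_simps flip: power_add)
    finally have "?s / V.beta \<le> 2 * X ^ 192 * y + 320 * X ^ 852 * y + 320 * X ^ 1081 * e" .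
    moreover have "2 * X ^ 192 * y \<le> 2 * X ^ 852 * y" using Xmono[of 192 852] y by simp
    moreover have "1 * y \<le> X ^ 852 * y" using X1[of 852] y by (intro mult_right_mono) auto
    moreover have "323 * (X ^ 852 * y) \<le> X ^ 11 * (X ^ 852 * y)" using two[of 11] y X by (intro mult_right_mono) auto
    moreover have "X ^ 11 * (X ^ 852 * y) = X ^ 863 * y" by (simp add: mult.assoc[symmetric] flip: power_add)
    moreover have "320 * (X ^ 1081 * e) \<le> X ^ 9 * (X ^ 1081 * e)" using two[of 9] e X by (intro mult_right_mono) auto
    moreover have "X ^ 9 * (X ^ 1081 * e) = X ^ 1090 * e" by (simp add: mult.assoc[symmetric] flip: power_add)
    ultimately show ?thesis using e1 unfolding y_def[symmetric] by linarith
  qed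
  finally show ?thesis .
qed

end

section \<open>Small dimensions\<close>

context entry_law
begin

text \<open>The norm of a column is less than \<open>L = X sqrt n (8 n X)^(1/p)\<close> up to the probability \<open>1/(8 n X)\<close> by Markov's inequality; this is why
the threshold for \<open>r\<close> depends on \<open>p\<close> in this way.\<close>

lemma small_regime:
  fixes M :: "'w measure" and X :: real
  assumes X: "2 \<le> X" and b: "0 < b" "b < 1" "1 / (1 - b) \<le> X" and conc: "\<And>z. prob {x. \<bar>x - z\<bar> < 1 / X} \<le> b"
    and p: "0 < p" and n1: "1 \<le> n"
    and i: "integrable (gam n) (\<lambda>g. (sqrt (nsq n g) / (X * sqrt n)) powr p)"
    and m: "(\<integral>g. (sqrt (nsq n g) / (X * sqrt n)) powr p \<partial>gam n) \<le> 1"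
    and sizes: "\<exists>N1 N2 T. N2 \<le> N1 \<and> N1 \<le> n \<and> 1 \<le> T \<and>
      (N1 = n \<or> n * b ^ Suc N1 \<le> 1/8) \<and> (N2 = N1 \<or> N1 * b ^ Suc N2 \<le> 1/8) \<and>
      real N2 * real T ^ N2 * ((1 + b) / 2) ^ T \<le> 1/8 \<and> cb / n \<le> 1 / (2 * real T ^ N2)"
    and M: "prob_space M"
    and C: "C \<in> M \<rightarrow>\<^sub>M gams {..<n} n" "distr M (gams {..<n} n) C = gams {..<n} n"
    and E: "E \<in> sets M" "\<And>\<omega>. \<omega> \<in> E \<Longrightarrow> \<exists>x. nsq n x = 1 \<and> nsq n (\<lambda>i. \<Sum>k<n. x k * C \<omega> k i) < r\<^sup>2"
    and r: "0 < r" "r * (8 * real n ^ 5 * X ^ 5 * (8 * real n * X) powr (2 / p)) \<le> 1"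
  shows "measure M E \<le> 1 - cb / n"
proof -
  interpret M: prob_space M by (rule M)
  interpret g: prob_space "gam n" by (rule prob_gam)
  define w where "w = 8 * real n * X"
  have n1': "1 \<le> real n" using n1 by simp
  have "1 * 2 \<le> real n * X" using n1' X by (intro mult_mono) auto
  then have w: "16 \<le> w" unfolding w_def by linarith
  define v where "v = w powr (1 / p)"
  have v: "1 \<le> v" using w p by (simp add: v_def ge_one_powr_ge_zero)
  define L where "L = X * sqrt n * v"
  have sn: "0 < sqrt n" "1 \<le> sqrt n" "sqrt n * sqrt n = n" using n1 by auto
  have tail: "measure (gam n) {g \<in> space (gam n). L < enorm n g} \<le> 1 / w"
  proof -
    let ?Y = "\<lambda>g. (sqrt (nsq n g) / (X * sqrt n)) powr p"
    have my: "?Y \<in> borel_measurable (gam n)" using i by simp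
    have "measure (gam n) {g \<in> space (gam n). L < enorm n g} \<le> measure (gam n) {g \<in> space (gam n). w \<le> ?Y g}"
    proof (rule g.finite_measure_mono)
      show "{g \<in> space (gam n). L < enorm n g} \<subseteq> {g \<in> space (gam n). w \<le> ?Y g}"
      proof safe
        fix g assume "L < enorm n g"
        then have "v \<le> enorm n g / (X * sqrt n)" using X sn unfolding L_def by (simp add: pos_le_divide_eq mult_ac)
        then have "v powr p \<le> ?Y g" using v p by (intro powr_mono2) auto
        then show "w \<le> ?Y g" using w p by (simp add: v_def powr_powr)
      qed
      show "{g \<in> space (gam n). w \<le> ?Y g} \<in> sets (gam n)" using my by measurable
    qed
    also have "\<dots> \<le> (\<integral>g. ?Y g \<partial>gam n) / w"
      using w by (intro integral_Markov_inequality_measure[OF i, of "{}"]) auto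
    also have "\<dots> \<le> 1 / w" using m w by (intro divide_right_mono) auto
    finally show ?thesis .
  qed
  have pe: "1 / w \<le> 1 / 8 * (1 - b)"
  proof -
    have "1 \<le> X * (1 - b)" using b by (simp add: pos_divide_le_eq)
    also have "\<dots> \<le> (real n * X) * (1 - b)" using n1' X b by (intro mult_right_mono) auto
    finally have "1 \<le> real n * X * (1 - b)" .
    moreover have "w * (1 - b) = 8 * (real n * X * (1 - b))" by (simp only: w_def mult.assoc)
    ultimately have "8 \<le> w * (1 - b)" by linarith
    then show ?thesis using w by (simp add: pos_divide_le_eq mult_ac)
  qed
  have bpe: "b + 1 / w \<le> (1 + b) / 2" "0 \<le> b + 1 / w" using pe b w by (auto simp: field_simps)
  from sizes show ?thesis
  proof (elim exE conjE)
    fix N1 N2 T :: nat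
    assume N: "N2 \<le> N1" "N1 \<le> n" "1 \<le> T" and e1: "N1 = n \<or> n * b ^ Suc N1 \<le> 1/8" and e2: "N2 = N1 \<or> N1 * b ^ Suc N2 \<le> 1/8"
      and e4: "real N2 * real T ^ N2 * ((1 + b) / 2) ^ T \<le> 1/8" and cb: "cb / n \<le> 1 / (2 * real T ^ N2)"
    have e3: "N1 * (1 / w) \<le> 1/8"
    proof -
      have "real N1 * 8 \<le> real n * 8 * 1" using N by simp
      also have "\<dots> \<le> real n * 8 * X" using X by (intro mult_left_mono) auto
      finally have "real N1 * 8 \<le> w" by (simp add: w_def mult_ac)
      then show ?thesis using w by (simp add: pos_divide_le_eq)
    qed
    have e4': "real N2 * real T ^ N2 * (b + 1 / w) ^ T \<le> 1/8"
    proof -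
      have "real N2 * real T ^ N2 * (b + 1 / w) ^ T \<le> real N2 * real T ^ N2 * ((1 + b) / 2) ^ T"
        using bpe by (intro mult_left_mono power_mono) auto
      then show ?thesis using e4 by linarith
    qed
    have dL: "1 / X / sqrt n \<le> L"
    proof -
      have "1 / X / sqrt n \<le> 1 / 1 / 1" using X sn by (intro frac_le) auto
      also have "\<dots> \<le> X * sqrt n * v"
        using X sn v mult_mono[of 1 X 1 "sqrt n"] mult_mono[of 1 "X * sqrt n" 1 v] by simp
      finally show ?thesis by (simp add: L_def)
    qed
    have aX: "0 < 1 / X" using X by simp
    have b0: "0 \<le> b" using b by simp
    obtain G where G: "G \<in> sets (gams {..<n} n)" "1 / (2 * real T ^ N2) \<le> measure (gams {..<n} n) G"
      and Gx: "\<And>A x. A \<in> G \<Longrightarrow> nsq n x = 1 \<Longrightarrow>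
        1 / X / sqrt n / (2 * sqrt n * (2 * real n * L / (1 / X / sqrt n))\<^sup>2) \<le> enorm n (\<lambda>i. \<Sum>k<n. x k * A k i)"
      using small_dimension_estimate[OF aX conc b0 n1 N(1) N(2) N(3) tail e1 e2 e3 e4' dL] by blast
    have r0: "r \<le> 1 / X / sqrt n / (2 * sqrt n * (2 * real n * L / (1 / X / sqrt n))\<^sup>2)" (is "_ \<le> ?r0")
    proof -
      have "2 * real n * L / (1 / X / sqrt n) = 2 * real n * X\<^sup>2 * (sqrt n * sqrt n) * v"
        by (simp add: L_def power2_eq_square)
      also have "\<dots> = 2 * (real n)\<^sup>2 * X\<^sup>2 * v" unfolding sn(3) by (simp add: power2_eq_square)
      finally have q: "2 * real n * L / (1 / X / sqrt n) = 2 * (real n)\<^sup>2 * X\<^sup>2 * v" .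
      have "?r0 = 1 / (X * (sqrt n * sqrt n) * 2 * (2 * (real n)\<^sup>2 * X\<^sup>2 * v)\<^sup>2)" unfolding q by (simp add: mult_ac)
      also have "\<dots> = 1 / (8 * real n ^ 5 * X ^ 5 * v\<^sup>2)"
        unfolding sn(3) by (simp add: power_mult_distrib eval_nat_numeral mult_ac)
      also have "v\<^sup>2 = w powr (2 / p)" unfolding v_def power2_eq_square powr_add[symmetric] by simp
      finally have "?r0 = 1 / (8 * real n ^ 5 * X ^ 5 * w powr (2 / p))" .
      moreover have "0 < 8 * real n ^ 5 * X ^ 5 * w powr (2 / p)" using n1 X w by simp
      ultimately show ?thesis using r(2) unfolding w_def[symmetric] by (simp only: pos_le_divide_eq)
    qed
    have "E \<subseteq> space M - (C -` G \<inter> space M)"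
    proof
      fix \<omega> assume \<omega>: "\<omega> \<in> E"
      then obtain x where x: "nsq n x = 1" "nsq n (\<lambda>i. \<Sum>k<n. x k * C \<omega> k i) < r\<^sup>2" using E(2) by blast
      then have "enorm n (\<lambda>i. \<Sum>k<n. x k * C \<omega> k i) < r" using r(1) real_sqrt_less_mono[OF x(2)] by simp
      then have "C \<omega> \<notin> G" using Gx[OF _ x(1), of "C \<omega>"] r0 by linarith
      then show "\<omega> \<in> space M - (C -` G \<inter> space M)" using \<omega> sets.sets_into_space[OF E(1)] by blast
    qed
    then have "measure M E \<le> measure M (space M - (C -` G \<inter> space M))"
      using measurable_sets[OF C(1) G(1)] by (intro M.finite_measure_mono) auto
    also have "\<dots> = 1 - measure M (C -` G \<inter> space M)" by (rule M.prob_compl[OF measurable_sets[OF C(1) G(1)]])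
    also have "measure M (C -` G \<inter> space M) = measure (gams {..<n} n) G" using measure_distr[OF C(1) G(1)] C(2) by simp
    finally show ?thesis using G(2) cb by linarith
  qed
qed

end

text \<open>If \<open>p n \<le> 1\<close>, then \<open>exp (- p n) \<le> 1 - p n/2\<close> leaves room for a second term of size \<open>p/4\<close>; otherwise both terms are at most one half
of the right hand side.\<close>

lemma two_exponentials:
  fixes p n c v :: real
  assumes p: "0 < p" "p \<le> 1" and n: "1 \<le> n" and c: "0 \<le> c" "c \<le> 1/4" "c * n \<le> v / 2" and v: "exp (- v) \<le> p / 4"
  shows "exp (- p * n) + exp (- v) \<le> exp (- (c * p * n))"
proof (cases "p * n \<le> 1")
  case True
  have "exp (- (p * n)) \<le> 1 - p * n / 2" using p n True by (intro exp_minus_le_chord) auto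
  moreover have "p * 1 \<le> p * n" using p n by (intro mult_left_mono) auto
  moreover have "c * (p * n) \<le> 1/4 * (p * n)" using c p n by (intro mult_right_mono) auto
  moreover have "1 + (- (c * p * n)) \<le> exp (- (c * p * n))" by (rule exp_ge_add_one_self)
  ultimately show ?thesis using v by (simp add: mult.assoc)
next
  case False
  define y where "y = exp (- (c * p * n))"
  have y: "0 < y" by (simp add: y_def)
  have "exp (- (p * n)) \<le> 1/2 * y"
  proof -
    have "c * (p * n) \<le> 1/4 * (p * n)" using c p n by (intro mult_right_mono) auto
    then have "- (p * n) \<le> - (3/4) + - (c * p * n)" using False by (simp add: mult.assoc)
    then have "exp (- (p * n)) \<le> exp (- (3/4) + - (c * p * n))" by (subst exp_le_cancel_iff)
    then have "exp (- (p * n)) \<le> exp (- (3/4)) * y" unfolding y_def exp_add .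
    moreover have "exp (- (3/4::real)) \<le> 1/2"
    proof -
      have "1 + 3/4 + (3/4)\<^sup>2 / 2 \<le> exp (3/4::real)" by (rule exp_lower_Taylor_quadratic) simp
      then have "2 \<le> exp (3/4::real)" by (simp add: power2_eq_square)
      then show ?thesis by (simp add: exp_minus field_simps)
    qed
    then have "exp (- (3/4)) * y \<le> 1/2 * y" using y by (intro mult_right_mono) auto
    ultimately show ?thesis by linarith
  qed
  moreover have "exp (- v) \<le> 1/2 * y"
  proof -
    have "c * p * n \<le> c * 1 * n" using c p n by (intro mult_right_mono mult_left_mono) auto
    then have "exp (- (v / 2)) \<le> y" using c unfolding y_def by simp
    moreover have "exp (- (v / 2)) \<le> 1/2"
    proof -
      have "(exp (- (v / 2)))\<^sup>2 = exp (- v)" by (simp add: power2_eq_square flip: exp_add)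
      then have "(exp (- (v / 2)))\<^sup>2 \<le> (1/2)\<^sup>2" using v p by (simp add: power_divide)
      then show ?thesis by (rule power2_le_imp_le) simp
    qed
    ultimately have "exp (- (v / 2)) * exp (- (v / 2)) \<le> 1/2 * y" by (intro mult_mono) auto
    then show ?thesis by (simp flip: exp_add)
  qed
  ultimately show ?thesis unfolding y_def by simp
qed

section \<open>Choice of the constants\<close>

definition bound_rate :: "real \<Rightarrow> real \<Rightarrow> real" where
  "bound_rate cb X = min cb 1 / 4 / X ^ 8000"

definition bound_factor :: "real \<Rightarrow> real \<Rightarrow> real" where
  "bound_factor p X = 8 ^ (nat \<lceil>2 / p\<rceil> + 1) * (1 + ln (1 / p)) ^ (nat \<lceil>2 / p\<rceil> + 5) * X ^ (30000 + 4001 * nat \<lceil>2 / p\<rceil>)"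

context entry_law
begin

text \<open>For \<open>n\<close> below the threshold, \<open>small_regime\<close> is used if its bound for \<open>r\<close> is fulfilled, and otherwise \<open>e\<close> is so large that
the first term of the claim exceeds \<open>1\<close>. The rate suits both cases because \<open>p * n\<^sup>2\<close> is at most \<open>4 * X ^ 8000\<close>.\<close>

lemma singular_value_bound:
  fixes M :: "'w measure" and X :: real
  assumes X: "2 \<le> X" and b: "0 < b" "b < 1" "1 / (1 - b) \<le> X" and conc: "\<And>z. prob {x. \<bar>x - z\<bar> < 1 / X} \<le> b"
    and p: "0 < p" "p \<le> 1" and n1: "1 \<le> n"
    and i: "integrable (gam n) (\<lambda>g. (sqrt (nsq n g) / (X * sqrt n)) powr p)"
    and m: "(\<integral>g. (sqrt (nsq n g) / (X * sqrt n)) powr p \<partial>gam n) \<le> 1"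
    and cb: "0 < cb" and sizes: "\<exists>N1 N2 T. N2 \<le> N1 \<and> N1 \<le> n \<and> 1 \<le> T \<and>
      (N1 = n \<or> n * b ^ Suc N1 \<le> 1/8) \<and> (N2 = N1 \<or> N1 * b ^ Suc N2 \<le> 1/8) \<and>
      real N2 * real T ^ N2 * ((1 + b) / 2) ^ T \<le> 1/8 \<and> cb / n \<le> 1 / (2 * real T ^ N2)"
    and M: "prob_space M"
    and R: "R \<in> M \<rightarrow>\<^sub>M gams {..<n} n" "distr M (gams {..<n} n) R = gams {..<n} n"
    and C: "C \<in> M \<rightarrow>\<^sub>M gams {..<n} n" "distr M (gams {..<n} n) C = gams {..<n} n"
    and RC: "\<And>\<omega> i j. \<omega> \<in> space M \<Longrightarrow> i < n \<Longrightarrow> j < n \<Longrightarrow> R \<omega> i j = C \<omega> j i"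
    and E: "E \<in> sets M" "\<And>\<omega>. \<omega> \<in> E \<Longrightarrow> \<exists>x. nsq n x = 1 \<and> (\<Sum>i<n. (ip n x (R \<omega> i))\<^sup>2) < (e / sqrt n)\<^sup>2" and e: "0 < e"
  shows "measure M E \<le> bound_factor p X * e + exp (- (bound_rate cb X * p * n))"
proof -
  interpret M: prob_space M by (rule M)
  define W where "W = 1 + ln (1 / p)"
  define Q where "Q = nat \<lceil>2 / p\<rceil>"
  define F where "F = bound_factor p X"
  define c where "c = bound_rate cb X"
  have F: "F = 8 ^ (Q + 1) * W ^ (Q + 5) * X ^ (30000 + 4001 * Q)" by (simp add: F_def bound_factor_def W_def Q_def)
  have W: "1 \<le> W" using p by (simp add: W_def)
  have X1: "1 \<le> X ^ k" for k using X by (intro one_le_power) simp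
  have Xmono: "X ^ k \<le> X ^ l" if "k \<le> l" for k l using X that by (intro power_increasing) auto
  have two: "(2::real) ^ k \<le> X ^ k" for k using X by (intro power_mono) auto
  have n1': "1 \<le> real n" using n1 by simp
  have c: "0 < c" "c \<le> 1/4" "c * X ^ 8000 * 4 \<le> cb"
  proof -
    show "0 < c" using cb X by (simp add: c_def bound_rate_def)
    have "c \<le> 1 / 4 / 1" unfolding c_def bound_rate_def using cb X1[of 8000] by (intro frac_le) auto
    then show "c \<le> 1/4" by simp
    have "X ^ 8000 \<noteq> 0" using X by simp
    then have "c * X ^ 8000 = min cb 1 / 4" unfolding c_def bound_rate_def by simp
    then show "c * X ^ 8000 * 4 \<le> cb" by simp
  qed
  have F1: "1 \<le> 8 ^ (Q + 1) * W ^ (Q + 5)"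
    using mult_mono[of 1 "8 ^ (Q + 1)" 1 "W ^ (Q + 5)"] one_le_power[OF W] one_le_power[of "8::real" "Q + 1"] by simp
  show ?thesis
  \<comment> \<open>From this threshold on, the error term of main_regime is less than p/4.\<close>
  proof (cases "X ^ 4000 * W \<le> n")
    case True
    define v where "v = n / X ^ 1886 / 2"
    have v2: "X ^ 2114 * W / 2 \<le> v"
    proof -
      have "X ^ 4000 = X ^ 2114 * X ^ 1886" by (simp flip: power_add)
      then have "X ^ 2114 * W * X ^ 1886 \<le> n" using True by (simp add: mult_ac)
      then have "X ^ 2114 * W \<le> n / X ^ 1886" using X by (simp add: pos_le_divide_eq)
      then show ?thesis by (simp add: v_def)
    qed
    have big: "2048 * X \<le> X ^ 2114"
    proof -
      have "2048 * X \<le> X ^ 11 * X" using two[of 11] X by (intro mult_right_mono) auto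
      also have "\<dots> = X ^ 12" by (simp flip: power_Suc2)
      also have "\<dots> \<le> X ^ 2114" by (rule Xmono) simp
      finally show ?thesis .
    qed
    have "X ^ 2114 * 1 \<le> X ^ 2114 * W" using W X by (intro mult_left_mono) auto
    then have XW: "2048 * X \<le> X ^ 2114 * W" using big by linarith
    have v3: "863 * X \<le> v" using v2 XW X by linarith
    have v4: "W + 1 \<le> v"
    proof -
      have "4 * W \<le> X ^ 2114 * W" using big X W by (intro mult_right_mono) auto
      then show ?thesis using v2 W by linarith
    qed
    have lp: "exp (- ln (1 / p)) = p" using p by (simp add: ln_div)
    have q: "exp (- real n / (4 * X)) \<le> p"
    proof -
      have "4 * X * W \<le> X ^ 4000 * W"
      proof (rule mult_right_mono)
        have "4 * X \<le> X ^ 2 * X" using two[of 2] X by (intro mult_right_mono) auto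
        also have "\<dots> = X ^ 3" by (simp flip: power_Suc2)
        also have "\<dots> \<le> X ^ 4000" by (rule Xmono) simp
        finally show "4 * X \<le> X ^ 4000" .
      qed (use W in simp)
      then have "W \<le> n / (4 * X)" using True X by (simp add: pos_le_divide_eq mult_ac)
      then have "- real n / (4 * X) \<le> - ln (1 / p)" unfolding W_def by simp
      then have "exp (- real n / (4 * X)) \<le> exp (- ln (1 / p))" by (subst exp_le_cancel_iff)
      then show ?thesis unfolding lp .
    qed
    have nX: "X ^ 3829 \<le> n"
    proof -
      have "X ^ 3829 \<le> X ^ 4000" by (rule Xmono) simp
      also have "X ^ 4000 * 1 \<le> X ^ 4000 * W" using W X by (intro mult_left_mono) auto
      then have "X ^ 4000 \<le> X ^ 4000 * W" unfolding mult_1_right .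
      finally show ?thesis using True by linarith
    qed
    have E': "\<exists>x. nsq n x = 1 \<and> (\<Sum>i<n. (ip n x (R \<omega> i))\<^sup>2) < e\<^sup>2 / n" if "\<omega> \<in> E" for \<omega>
      using E(2)[OF that] by (simp add: power_divide)
    have conc': "prob {x. \<bar>x - z\<bar> < 1 / X} \<le> 1 - 1 / X" for z
    proof -
      have "b \<le> 1 - 1 / X" using b X by (simp add: field_simps)
      then show ?thesis using conc[of z] by linarith
    qed
    have "measure M E \<le> exp (- p * n) + X ^ 1090 * e + X ^ 863 * exp (- real n / X ^ 1886)"
      by (rule main_regime[OF X conc' p q nX i m M R C RC E(1) E' e])
    moreover have "X ^ 863 * exp (- real n / X ^ 1886) \<le> exp (- v)"
    proof -
      have "X \<le> exp X" using exp_ge_add_one_self[of X] by linarith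
      then have "X ^ 863 \<le> exp X ^ 863" using X by (intro power_mono) auto
      also have "\<dots> = exp (863 * X)" using exp_of_nat_mult[of 863 X] by simp
      also have "\<dots> \<le> exp v" using v3 by simp
      finally have "X ^ 863 * exp (- real n / X ^ 1886) \<le> exp v * exp (- real n / X ^ 1886)" by (intro mult_right_mono) auto
      also have "\<dots> = exp (v + - real n / X ^ 1886)" by (rule exp_add[symmetric])
      also have "v + - real n / X ^ 1886 = - v" by (simp add: v_def)
      finally show ?thesis .
    qed
    moreover have "exp (- p * n) + exp (- v) \<le> exp (- (c * p * n))"
    proof (rule two_exponentials[OF p n1'])
      show "0 \<le> c" "c \<le> 1/4" using c by auto
      have "c \<le> 1 / 4 / X ^ 1886" unfolding c_def bound_rate_def using cb X Xmono[of 1886 8000] by (intro frac_le) auto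
      then have "c * n \<le> 1 / 4 / X ^ 1886 * n" by (intro mult_right_mono) auto
      then show "c * n \<le> v / 2" by (simp add: v_def)
      have "exp (- v) \<le> exp (- 2 + - ln (1 / p))" using v4 by (simp add: W_def)
      also have "\<dots> = exp (- 2) * p" unfolding exp_add lp ..
      also have "\<dots> \<le> 1 / 4 * p"
      proof (rule mult_right_mono)
        have "2 * 2 \<le> exp 1 * exp (1::real)" using exp_ge_add_one_self[of "1::real"] by (intro mult_mono) auto
        then have "4 \<le> exp (2::real)" by (simp flip: exp_add)
        then show "exp (- 2) \<le> 1 / (4::real)" by (simp add: exp_minus field_simps)
      qed (use p in simp)
      finally show "exp (- v) \<le> p / 4" by simp
    qed
    moreover have "X ^ 1090 * e \<le> F * e"
    proof (rule mult_right_mono)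
      have "1 * X ^ 1090 \<le> 8 ^ (Q + 1) * W ^ (Q + 5) * X ^ (30000 + 4001 * Q)"
        using F1 X Xmono by (intro mult_mono) auto
      then show "X ^ 1090 \<le> F" by (simp add: F)
    qed (use e in simp)
    ultimately show ?thesis unfolding F_def[symmetric] c_def[symmetric] by linarith
  next
    case False
    then have nW: "real n \<le> X ^ 4000 * W" by simp
    define r where "r = e / sqrt n"
    have r: "0 < r" "r \<le> e"
    proof -
      show "0 < r" using e n1 by (simp add: r_def)
      have "e / sqrt n \<le> e / 1" using e n1 by (intro divide_left_mono) auto
      then show "r \<le> e" by (simp add: r_def)
    qed
    let ?D = "8 * real n ^ 5 * X ^ 5 * (8 * real n * X) powr (2 / p)"
    have D0: "0 \<le> ?D" using X by simp
    show ?thesis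
    proof (cases "r * ?D \<le> 1")
      case True
      have E': "\<exists>x. nsq n x = 1 \<and> nsq n (\<lambda>i. \<Sum>k<n. x k * C \<omega> k i) < r\<^sup>2" if \<omega>: "\<omega> \<in> E" for \<omega>
      proof -
        have "ip n x (R \<omega> i) = (\<Sum>k<n. x k * C \<omega> k i)" if "i < n" for x i
          unfolding ip_def using RC[of \<omega> i] that \<omega> sets.sets_into_space[OF E(1)] by (intro sum.cong) auto
        then have "nsq n (\<lambda>i. \<Sum>k<n. x k * C \<omega> k i) = (\<Sum>i<n. (ip n x (R \<omega> i))\<^sup>2)" for x
          unfolding nsq_def by (intro sum.cong) auto
        then show ?thesis using E(2)[OF \<omega>] unfolding r_def by simp
      qed
      have "measure M E \<le> 1 - cb / n"
        by (rule small_regime[OF X b conc p(1) n1 i m sizes M C E(1) E' r(1) True])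
      also have "\<dots> \<le> exp (- (cb / n))" using exp_ge_add_one_self[of "- (cb / n)"] by simp
      also have "\<dots> \<le> exp (- (c * p * n))"
      proof -
        \<comment> \<open>The logarithm in W is compensated by p.\<close>
    have pW: "p * W\<^sup>2 \<le> 4"
        proof -
          define s where "s = ln (1 / p)"
          have s: "0 \<le> s" using p by (simp add: s_def)
          have "W \<le> 2 * (1 + s / 2)" by (simp add: W_def s_def)
          also have "\<dots> \<le> 2 * exp (s / 2)" by (intro mult_left_mono exp_ge_add_one_self) simp
          finally have "W\<^sup>2 \<le> (2 * exp (s / 2))\<^sup>2" using W by (intro power_mono) auto
          also have "\<dots> = 4 * exp (s / 2 + s / 2)" unfolding exp_add by (simp add: power2_eq_square)
          also have "s / 2 + s / 2 = s" by simp
          also have "exp s = 1 / p" using p by (simp add: s_def)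
          finally show ?thesis using p by (simp add: field_simps)
        qed
        have "c * p * (real n)\<^sup>2 \<le> c * p * (X ^ 4000 * W)\<^sup>2"
          using nW c p by (intro mult_left_mono power_mono) auto
        also have "\<dots> = c * X ^ 8000 * (p * W\<^sup>2)" by (simp add: power_mult_distrib mult_ac flip: power_mult)
        also have "\<dots> \<le> c * X ^ 8000 * 4" using pW c X by (intro mult_left_mono) auto
        also have "\<dots> \<le> cb" by (rule c(3))
        finally have "c * p * n * n \<le> cb" by (simp add: power2_eq_square mult.assoc)
        then have "c * p * n \<le> cb / n" using n1 by (simp add: pos_le_divide_eq)
        then show ?thesis by simp
      qed
      finally have "measure M E \<le> exp (- (c * p * n))" .
      moreover have "0 \<le> F * e" using F1 X e by (simp add: F)
      ultimately show ?thesis unfolding F_def[symmetric] c_def[symmetric] by linarith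
    next
      case False
      have "?D \<le> F"
      proof -
        define w where "w = 8 * real n * X"
        have w1: "1 \<le> w" using n1' X mult_mono[of 1 "real n" 2 X] by (simp add: w_def)
        have "2 / p \<le> real Q" unfolding Q_def using real_nat_ceiling_ge by blast
        then have "w powr (2 / p) \<le> w powr real Q" using w1 by (intro powr_mono) auto
        also have "\<dots> = w ^ Q" using w1 by (simp add: powr_realpow)
        also have "\<dots> \<le> (8 * (X ^ 4000 * W) * X) ^ Q"
          unfolding w_def using nW X by (intro power_mono mult_right_mono mult_left_mono) auto
        also have "\<dots> = 8 ^ Q * W ^ Q * X ^ (4001 * Q)"
        proof -
          have "X ^ 4001 = X ^ 4000 * X" using power_Suc2[of X 4000] by simp
          then have "8 * (X ^ 4000 * W) * X = 8 * W * X ^ 4001" by (simp only: mult_ac)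
          then show ?thesis by (simp only: power_mult_distrib power_mult)
        qed
        finally have wQ: "w powr (2 / p) \<le> 8 ^ Q * W ^ Q * X ^ (4001 * Q)" .
        have "real n ^ 5 \<le> (X ^ 4000 * W) ^ 5" using nW by (intro power_mono) auto
        then have "?D \<le> 8 * (X ^ 4000 * W) ^ 5 * X ^ 5 * (8 ^ Q * W ^ Q * X ^ (4001 * Q))"
          unfolding w_def[symmetric] using wQ X W by (intro mult_mono mult_nonneg_nonneg zero_le_power) auto
        also have "\<dots> = 8 ^ (Q + 1) * W ^ (Q + 5) * X ^ (20005 + 4001 * Q)"
        proof -
          have "(X ^ 4000) ^ 5 = X ^ 20000" by (simp flip: power_mult)
          moreover have "X ^ (20005 + 4001 * Q) = X ^ 20000 * X ^ 5 * X ^ (4001 * Q)" by (simp flip: power_add)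
          moreover have "W ^ (Q + 5) = W ^ Q * W ^ 5" "(8::real) ^ (Q + 1) = 8 ^ Q * 8" by (simp_all only: power_add power_one_right)
          ultimately show ?thesis by (simp only: power_mult_distrib mult_ac)
        qed
        also have "\<dots> \<le> 8 ^ (Q + 1) * W ^ (Q + 5) * X ^ (30000 + 4001 * Q)"
          using Xmono[of "20005 + 4001 * Q" "30000 + 4001 * Q"] F1 by (intro mult_left_mono) auto
        finally show ?thesis by (simp add: F)
      qed
      then have "r * ?D \<le> e * F" using r e D0 by (intro mult_mono) auto
      then have "1 \<le> F * e" using False by (simp add: mult.commute)
      moreover have "measure M E \<le> 1" by simp
      moreover have "0 \<le> exp (- (c * p * n))" by simp
      ultimately show ?thesis unfolding F_def[symmetric] c_def[symmetric] by linarith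
    qed
  qed
qed

end

lemma bound_rate_pos: "0 < cb \<Longrightarrow> 0 < X \<Longrightarrow> 0 < bound_rate cb X"
  by (simp add: bound_rate_def)

lemma bound_factor_pos: "0 < p \<Longrightarrow> p \<le> 1 \<Longrightarrow> 0 < X \<Longrightarrow> 0 < bound_factor p X"
  by (simp add: bound_factor_def add_pos_nonneg)

definition scale :: "real \<Rightarrow> real \<Rightarrow> real \<Rightarrow> real" where
  "scale K a b = 2 + K + 1 / a + 1 / (1 - b)"

text \<open>Reduction to \<open>singular_value_bound\<close>: the law of an entry is read off from the corner of the matrix, and \<open>powr_le_chord\<close> replaces the
order \<open>p\<close> by the minimum of \<open>1\<close> and \<open>p\<close>. As to measurability of the event, a set that is not measurable has
\<open>measure\<close> zero.\<close>

lemma iid_matrix_singular_value_bound: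
  fixes M :: "'w measure" and A :: "'w \<Rightarrow> real mat"
  assumes p: "0 < p" and K: "0 < K" and a: "0 < a" and b: "0 < b" "b < 1" and n1: "1 \<le> n"
    and M: "prob_space M" and iid: "prob_space.iid_matrix M n A"
    and conc: "\<forall>i<n. \<forall>j<n. prob_space.concentration_function M (\<lambda>\<omega>. A \<omega> $$ (i, j)) a < b"
    and int: "integrable M (\<lambda>\<omega>. eucl_norm (col (A \<omega>) 0) powr p)"
    and mom: "(\<integral>\<omega>. eucl_norm (col (A \<omega>) 0) powr p \<partial>M) powr (1 / p) \<le> K * sqrt (real n)"
    and cb: "0 < cb" and sizes: "\<exists>N1 N2 T. N2 \<le> N1 \<and> N1 \<le> n \<and> 1 \<le> T \<and>
      (N1 = n \<or> n * b ^ Suc N1 \<le> 1/8) \<and> (N2 = N1 \<or> N1 * b ^ Suc N2 \<le> 1/8) \<and>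
      real N2 * real T ^ N2 * ((1 + b) / 2) ^ T \<le> 1/8 \<and> cb / n \<le> 1 / (2 * real T ^ N2)"
    and e: "0 < e"
  shows "measure M {\<omega> \<in> space M. smallest_singular_value (A \<omega>) < e / sqrt (real n)}
    \<le> bound_factor (min 1 p) (scale K a b) * e + exp (- (bound_rate cb (scale K a b) * min 1 p * real n))"
proof -
  interpret M: prob_space M by (rule M)
  define X where "X = scale K a b"
  have X: "2 \<le> X" "K \<le> X" "1 / (1 - b) \<le> X" "1 / a \<le> X"
    using K a b by (simp_all add: X_def scale_def)
  have n0: "0 < n" using n1 by simp
  define Y where "Y z \<omega> = A \<omega> $$ z" for z \<omega>
  define \<mu> where "\<mu> = distr M borel (Y (0, 0))"
  have car: "A \<omega> \<in> carrier_mat n n" if "\<omega> \<in> space M" for \<omega> using iid that by (simp add: M.iid_matrix_def)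
  have "(\<lambda>(i, j) \<omega>. A \<omega> $$ (i, j)) = Y" by (auto simp: Y_def fun_eq_iff)
  then have iv: "M.indep_vars (\<lambda>_. borel) Y ({..<n} \<times> {..<n})" using iid by (simp add: M.iid_matrix_def)
  have rv: "Y (i, j) \<in> borel_measurable M" if "i < n" "j < n" for i j
    using iv that unfolding M.indep_vars_def by (elim conjE) (drule bspec[of _ _ "(i, j)"], auto)
  have law: "distr M borel (Y (i, j)) = \<mu>" if "i < n" "j < n" for i j
  proof -
    have "\<forall>i<n. \<forall>j<n. \<forall>k<n. \<forall>l<n. distr M borel (\<lambda>\<omega>. A \<omega> $$ (i, j)) = distr M borel (\<lambda>\<omega>. A \<omega> $$ (k, l))"
      using iid unfolding M.iid_matrix_def by (elim conjE)
    from this[rule_format, OF that n0 n0] show ?thesis unfolding \<mu>_def Y_def .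
  qed
  have r0: "Y (0, 0) \<in> borel_measurable M" using rv n0 by blast
  interpret L: entry_law \<mu>
    using M.prob_space_distr[OF r0] by (simp add: entry_law_def entry_law_axioms_def \<mu>_def)
  let ?R = "\<lambda>\<omega>. \<lambda>i\<in>{..<n}. \<lambda>k\<in>{..<n}. Y (i, k) \<omega>"
  let ?C = "\<lambda>\<omega>. \<lambda>k\<in>{..<n}. \<lambda>i\<in>{..<n}. Y (i, k) \<omega>"
  let ?c = "\<lambda>\<omega>. \<lambda>i\<in>{..<n}. Y (i, 0) \<omega>"
  note rows = L.independent_array_law(3,4)[OF M iv law n1]
  have iv': "M.indep_vars (\<lambda>_. borel) (\<lambda>z. Y (prod.swap z)) ({..<n} \<times> {..<n})"
  proof -
    have "M.indep_vars (\<lambda>z. PiM {prod.swap z} (\<lambda>_. borel)) (\<lambda>z \<omega>. restrict (\<lambda>z. Y z \<omega>) {prod.swap z}) ({..<n} \<times> {..<n})"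
      by (intro M.indep_vars_restrict[OF iv]) (auto simp: disjoint_family_on_def)
    then have "M.indep_vars (\<lambda>_. borel) (\<lambda>z \<omega>. (\<lambda>z v. v (prod.swap z)) z (restrict (\<lambda>z. Y z \<omega>) {prod.swap z})) ({..<n} \<times> {..<n})"
      by (rule M.indep_vars_compose2) (intro measurable_component_singleton, auto)
    then show ?thesis by simp
  qed
  have law': "distr M borel (Y (prod.swap (k, i))) = \<mu>" if "k < n" "i < n" for k i using law that by simp
  note columns = L.independent_array_law[OF M iv' law' n1, unfolded prod.swap_def fst_conv snd_conv]
  have c1: "?c \<in> M \<rightarrow>\<^sub>M L.gam n" and c2: "distr M (L.gam n) ?c = L.gam n"
    and C: "?C \<in> M \<rightarrow>\<^sub>M L.gams {..<n} n" "distr M (L.gams {..<n} n) ?C = L.gams {..<n} n"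
    using columns by simp_all
  have nc: "eucl_norm (col (A \<omega>) 0) = sqrt (nsq n (?c \<omega>))" if "\<omega> \<in> space M" for \<omega>
    unfolding eucl_norm_def nsq_def using car[OF that] n1 by (intro arg_cong[where f=sqrt] sum.cong) (auto simp: Y_def)
  define S where "S = X * sqrt n"
  have S: "0 < S" using X n1 by (simp add: S_def)
  define h where "h \<omega> = sqrt (nsq n (?c \<omega>)) / S" for \<omega>
  have hp: "h \<omega> powr p = eucl_norm (col (A \<omega>) 0) powr p / S powr p" if "\<omega> \<in> space M" for \<omega>
    unfolding h_def nc[OF that] by (rule powr_divide)
  have ihp: "integrable M (\<lambda>\<omega>. h \<omega> powr p)"
  proof (rule iffD2[OF Bochner_Integration.integrable_cong[OF refl hp]])
    show "integrable M (\<lambda>\<omega>. eucl_norm (col (A \<omega>) 0) powr p / S powr p)"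
      by (rule integrable_divide_zero) (rule int)
  qed
  have mhp: "(\<integral>\<omega>. h \<omega> powr p \<partial>M) \<le> 1"
  proof -
    define I where "I = (\<integral>\<omega>. eucl_norm (col (A \<omega>) 0) powr p \<partial>M)"
    have I0: "0 \<le> I" unfolding I_def by (intro integral_nonneg_AE) auto
    have "I = (I powr (1 / p)) powr p" using I0 p by (simp add: powr_powr)
    also have "\<dots> \<le> (K * sqrt n) powr p" using mom p unfolding I_def by (intro powr_mono2) auto
    also have "\<dots> \<le> S powr p" unfolding S_def using X K p by (intro powr_mono2 mult_right_mono) auto
    finally have "I / S powr p \<le> 1" using S by simp
    moreover have "(\<integral>\<omega>. h \<omega> powr p \<partial>M) = I / S powr p"
      unfolding I_def using Bochner_Integration.integral_cong[OF refl hp] by simp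
    ultimately show ?thesis by simp
  qed
  define p' where "p' = min 1 p"
  have p': "0 < p'" "p' \<le> 1" "p' \<le> p" using p by (auto simp: p'_def)
  define s where "s = p' / p"
  have s: "0 < s" "s \<le> 1" using p p' by (auto simp: s_def)
  have young: "h \<omega> powr p' \<le> s * h \<omega> powr p + (1 - s)" for \<omega>
  proof -
    have "h \<omega> powr p' = (h \<omega> powr p) powr s" using p by (simp add: powr_powr s_def)
    then show ?thesis using powr_le_chord[OF s, of "h \<omega> powr p"] by simp
  qed
  have mf: "(\<lambda>g. (sqrt (nsq n g) / (X * sqrt n)) powr p') \<in> borel_measurable (L.gam n)"
    using L.meas_nsq by measurable
  have mh: "(\<lambda>\<omega>. h \<omega> powr p') \<in> borel_measurable M"
    using measurable_compose[OF c1 mf] by (simp add: h_def S_def)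
  have ib: "integrable M (\<lambda>\<omega>. s * h \<omega> powr p + (1 - s))" using ihp by simp
  have ih: "integrable M (\<lambda>\<omega>. h \<omega> powr p')"
  proof (rule Bochner_Integration.integrable_bound[OF ib mh AE_I2])
    fix \<omega> show "norm (h \<omega> powr p') \<le> norm (s * h \<omega> powr p + (1 - s))" using young[of \<omega>] s by simp
  qed
  have mh1: "(\<integral>\<omega>. h \<omega> powr p' \<partial>M) \<le> 1"
  proof -
    have "(\<integral>\<omega>. h \<omega> powr p' \<partial>M) \<le> (\<integral>\<omega>. s * h \<omega> powr p + (1 - s) \<partial>M)" by (rule integral_mono[OF ih ib young])
    also have "\<dots> = s * (\<integral>\<omega>. h \<omega> powr p \<partial>M) + (1 - s)" using ihp M.prob_space by simp
    also have "\<dots> \<le> s * 1 + (1 - s)" using mhp s by (intro add_mono mult_left_mono) auto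
    finally show ?thesis by simp
  qed
  have i: "integrable (L.gam n) (\<lambda>g. (sqrt (nsq n g) / (X * sqrt n)) powr p')"
  proof -
    have "integrable (distr M (L.gam n) ?c) (\<lambda>g. (sqrt (nsq n g) / (X * sqrt n)) powr p')"
      using ih by (subst integrable_distr_eq[OF c1 mf]) (simp add: h_def S_def)
    then show ?thesis unfolding c2 .
  qed
  have m: "(\<integral>g. (sqrt (nsq n g) / (X * sqrt n)) powr p' \<partial>L.gam n) \<le> 1"
  proof -
    have "(\<integral>g. (sqrt (nsq n g) / (X * sqrt n)) powr p' \<partial>distr M (L.gam n) ?c) \<le> 1"
      using mh1 by (subst integral_distr[OF c1 mf]) (simp add: h_def S_def)
    then show ?thesis unfolding c2 .
  qed
  have conc': "L.prob {x. \<bar>x - z\<bar> < 1 / X} \<le> b" for z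
  proof -
    have "{x. \<bar>x - z\<bar> < 1 / X} \<in> sets (borel :: real measure)" by measurable
    then have "L.prob {x. \<bar>x - z\<bar> < 1 / X} = M.prob (Y (0, 0) -` {x. \<bar>x - z\<bar> < 1 / X} \<inter> space M)"
      unfolding \<mu>_def using r0 by (intro measure_distr) auto
    also have "\<dots> \<le> M.prob {\<omega> \<in> space M. \<bar>A \<omega> $$ (0, 0) - z\<bar> < a}"
    proof (rule M.finite_measure_mono)
      have "1 / X \<le> a" using X a by (simp add: field_simps)
      then show "Y (0, 0) -` {x. \<bar>x - z\<bar> < 1 / X} \<inter> space M \<subseteq> {\<omega> \<in> space M. \<bar>A \<omega> $$ (0, 0) - z\<bar> < a}"
        by (auto simp: Y_def)
      show "{\<omega> \<in> space M. \<bar>A \<omega> $$ (0, 0) - z\<bar> < a} \<in> sets M" using r0 unfolding Y_def by measurable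
    qed
    also have "\<dots> \<le> M.concentration_function (\<lambda>\<omega>. A \<omega> $$ (0, 0)) a"
      unfolding M.concentration_function_def by (rule cSUP_upper) (auto intro!: bdd_aboveI[of _ 1])
    also have "\<dots> < b" using conc n1 by (auto simp: Suc_le_eq)
    finally show ?thesis by simp
  qed
  let ?E = "{\<omega> \<in> space M. smallest_singular_value (A \<omega>) < e / sqrt (real n)}"
  show ?thesis
  proof (cases "?E \<in> sets M")
    case True
    have "measure M ?E \<le> bound_factor p' X * e + exp (- (bound_rate cb X * p' * n))"
    proof (rule L.singular_value_bound[OF X(1) b X(3) conc' p'(1,2) n1 i m cb sizes M rows C _ True _ e])
      show "?R \<omega> i j = ?C \<omega> j i" if "i < n" "j < n" for \<omega> i j using that by simp
      fix \<omega> assume "\<omega> \<in> ?E"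
      then obtain x where x: "nsq n x = 1" "(\<Sum>i<n. (ip n x (\<lambda>k\<in>{..<n}. A \<omega> $$ (i, k)))\<^sup>2) < (e / sqrt n)\<^sup>2"
        using small_singular_value_witness[OF car n1, of \<omega> "e / sqrt n"] by blast
      moreover have "(\<Sum>i<n. (ip n x (?R \<omega> i))\<^sup>2) = (\<Sum>i<n. (ip n x (\<lambda>k\<in>{..<n}. A \<omega> $$ (i, k)))\<^sup>2)"
        by (intro sum.cong) (auto simp: Y_def)
      ultimately show "\<exists>x. nsq n x = 1 \<and> (\<Sum>i<n. (ip n x (?R \<omega> i))\<^sup>2) < (e / sqrt n)\<^sup>2" by (intro exI[of _ x]) simp
    qed
    then show ?thesis unfolding X_def p'_def .
  next
    case False
    have "0 < bound_factor p' X * e" using bound_factor_pos[OF p'(1,2)] X(1) e by simp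
    then show ?thesis using measure_notin_sets[OF False] unfolding X_def p'_def by (simp add: add_nonneg_nonneg)
  qed
qed

theorem corollary2:
  shows "\<exists>(c :: real \<Rightarrow> real \<Rightarrow> real \<Rightarrow> real) (C :: real \<Rightarrow> real \<Rightarrow> real \<Rightarrow> real \<Rightarrow> real).
    (\<forall>K>0. \<forall>a>0. \<forall>b\<in>{0<..<1}. c K a b > 0) \<and>
    (\<forall>p>0. \<forall>K>0. \<forall>a>0. \<forall>b\<in>{0<..<1}. C p K a b > 0) \<and>
    rate_depends_polynomially c \<and>
    (\<forall>p>0. factor_depends_polynomially (C p)) \<and>
    (\<forall>p>0. \<forall>K>0. \<forall>a>0. \<forall>b\<in>{0<..<1}. \<forall>n\<ge>1.
      \<forall>(M :: 'w measure) (A :: 'w \<Rightarrow> real mat).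
        prob_space M \<longrightarrow>
        prob_space.iid_matrix M n A \<longrightarrow>
        (\<forall>i<n. \<forall>j<n. prob_space.concentration_function M (\<lambda>\<omega>. A \<omega> $$ (i, j)) a < b) \<longrightarrow>
        integrable M (\<lambda>\<omega>. eucl_norm (col (A \<omega>) 0) powr p) \<longrightarrow>
        (\<integral>\<omega>. eucl_norm (col (A \<omega>) 0) powr p \<partial>M) powr (1 / p) \<le> K * sqrt (real n) \<longrightarrow>
        (\<forall>\<epsilon>>0. measure M {\<omega> \<in> space M. smallest_singular_value (A \<omega>) < \<epsilon> / sqrt (real n)}
          \<le> C p K a b * \<epsilon> + exp (- (c K a b * min 1 p * real n))))"
proof -
  define sizes where "sizes b cb n \<longleftrightarrow> (\<exists>N1 N2 T. N2 \<le> N1 \<and> N1 \<le> n \<and> 1 \<le> T \<and>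
      (N1 = n \<or> n * b ^ Suc N1 \<le> 1/8) \<and> (N2 = N1 \<or> N1 * b ^ Suc N2 \<le> 1/8) \<and>
      real N2 * real T ^ N2 * ((1 + b) / 2) ^ T \<le> 1/8 \<and> cb / n \<le> 1 / (2 * real T ^ N2))"
    for b cb :: real and n :: nat
  have "\<exists>cb>0. \<forall>n\<ge>1. sizes b cb n" if "b \<in> {0<..<1}" for b
    unfolding sizes_def using that by (intro group_sizes) auto
  then obtain cb where cb: "\<And>b. b \<in> {0<..<1} \<Longrightarrow> 0 < cb b" "\<And>b n. b \<in> {0<..<1} \<Longrightarrow> 1 \<le> n \<Longrightarrow> sizes b (cb b) n"
    by metis
  have Xp: "0 < scale K a b" if "0 < K" "0 < a" "b \<in> {0<..<1}" for K a b
    using that by (simp add: scale_def add_pos_pos)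
  show ?thesis
  proof (intro exI[of _ "\<lambda>K a b. bound_rate (cb b) (scale K a b)"]
      exI[of _ "\<lambda>p K a b. bound_factor (min 1 p) (scale K a b)"] conjI)
    show "\<forall>K>0. \<forall>a>0. \<forall>b\<in>{0<..<1}. 0 < bound_rate (cb b) (scale K a b)"
      using cb(1) Xp bound_rate_pos by simp
    show "\<forall>p>0. \<forall>K>0. \<forall>a>0. \<forall>b\<in>{0<..<1}. 0 < bound_factor (min 1 p) (scale K a b)"
      using Xp bound_factor_pos by simp
    show "rate_depends_polynomially (\<lambda>K a b. bound_rate (cb b) (scale K a b))"
      unfolding rate_depends_polynomially_def
    proof
      fix b :: real assume b: "b \<in> {0<..<1}"
      define q where "q = 2 + 1 / (1 - b)"
      have q: "1 \<le> q" using b by (simp add: q_def add_increasing2)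
      have m: "0 < min (cb b) 1" using cb(1)[OF b] by simp
      show "\<exists>D m. \<forall>K>0. \<forall>a>0. 1 / bound_rate (cb b) (scale K a b) \<le> D * (1 + K + 1 / a) ^ m"
      proof (intro exI[of _ "4 / min (cb b) 1 * q ^ 8000"] exI[of _ 8000] allI impI)
        fix K a :: real assume K: "0 < K" and a: "0 < a"
        have "scale K a b = q * 1 + (K + 1 / a)" by (simp add: scale_def q_def)
        also have "\<dots> \<le> q * 1 + q * (K + 1 / a)" using q K a mult_right_mono[of 1 q "K + 1 / a"] by simp
        also have "\<dots> = q * (1 + K + 1 / a)" by (simp add: algebra_simps)
        finally have le: "scale K a b \<le> q * (1 + K + 1 / a)" .
        have "1 / bound_rate (cb b) (scale K a b) = 4 / min (cb b) 1 * scale K a b ^ 8000"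
          by (simp add: bound_rate_def)
        also have "\<dots> \<le> 4 / min (cb b) 1 * (q * (1 + K + 1 / a)) ^ 8000"
          using le Xp[OF K a b] m by (intro mult_left_mono power_mono) auto
        also have "\<dots> = 4 / min (cb b) 1 * q ^ 8000 * (1 + K + 1 / a) ^ 8000"
          by (simp add: power_mult_distrib)
        finally show "1 / bound_rate (cb b) (scale K a b) \<le> 4 / min (cb b) 1 * q ^ 8000 * (1 + K + 1 / a) ^ 8000" .
      qed
    qed
    show "\<forall>p>0. factor_depends_polynomially (\<lambda>K a b. bound_factor (min 1 p) (scale K a b))"
      unfolding factor_depends_polynomially_def
    proof (intro allI impI)
      fix p :: real assume p: "0 < p"
      define p' where "p' = min 1 p"
      have p': "0 < p'" "p' \<le> 1" using p by (auto simp: p'_def)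
      define k where "k = 30000 + 4001 * nat \<lceil>2 / p'\<rceil>"
      define D where "D = bound_factor p' 1"
      have fD: "bound_factor p' Y = D * Y ^ k" for Y by (simp add: bound_factor_def D_def k_def)
      have D: "0 < D" unfolding D_def using p' by (intro bound_factor_pos) auto
      show "\<exists>D m. \<forall>K>0. \<forall>a>0. \<forall>b\<in>{0<..<1}. bound_factor (min 1 p) (scale K a b) \<le> D * (1 + K + 1 / a + 1 / (1 - b)) ^ m"
      proof (intro exI[of _ "D * 2 ^ k"] exI[of _ k] allI impI ballI)
        fix K a b :: real assume K: "0 < K" and a: "0 < a" and b: "b \<in> {0<..<1}"
        have "0 < 1 / a" "0 < 1 / (1 - b)" using a b by auto
        moreover have "2 * (1 + K + 1 / a + 1 / (1 - b)) = 2 + 2 * K + 2 * (1 / a) + 2 * (1 / (1 - b))"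
          by (simp only: distrib_left mult_1_right)
        ultimately have "scale K a b \<le> 2 * (1 + K + 1 / a + 1 / (1 - b))" using K unfolding scale_def by linarith
        then have "D * scale K a b ^ k \<le> D * (2 * (1 + K + 1 / a + 1 / (1 - b))) ^ k"
          using D Xp[OF K a b] by (intro mult_left_mono power_mono) auto
        also have "\<dots> = D * 2 ^ k * (1 + K + 1 / a + 1 / (1 - b)) ^ k" by (simp only: power_mult_distrib mult.assoc)
        finally show "bound_factor (min 1 p) (scale K a b) \<le> D * 2 ^ k * (1 + K + 1 / a + 1 / (1 - b)) ^ k"
          unfolding p'_def[symmetric] fD .
      qed
    qed
    show "\<forall>p>0. \<forall>K>0. \<forall>a>0. \<forall>b\<in>{0<..<1}. \<forall>n\<ge>1.
      \<forall>(M :: 'w measure) (A :: 'w \<Rightarrow> real mat).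
        prob_space M \<longrightarrow>
        prob_space.iid_matrix M n A \<longrightarrow>
        (\<forall>i<n. \<forall>j<n. prob_space.concentration_function M (\<lambda>\<omega>. A \<omega> $$ (i, j)) a < b) \<longrightarrow>
        integrable M (\<lambda>\<omega>. eucl_norm (col (A \<omega>) 0) powr p) \<longrightarrow>
        (\<integral>\<omega>. eucl_norm (col (A \<omega>) 0) powr p \<partial>M) powr (1 / p) \<le> K * sqrt (real n) \<longrightarrow>
        (\<forall>\<epsilon>>0. measure M {\<omega> \<in> space M. smallest_singular_value (A \<omega>) < \<epsilon> / sqrt (real n)}
          \<le> bound_factor (min 1 p) (scale K a b) * \<epsilon> + exp (- (bound_rate (cb b) (scale K a b) * min 1 p * real n)))"
    proof (intro allI impI ballI)
      fix p K a b :: real and n :: nat and M :: "'w measure" and A :: "'w \<Rightarrow> real mat" and \<epsilon> :: real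
      assume p: "0 < p" and K: "0 < K" and a: "0 < a" and b: "b \<in> {0<..<1}" and n: "1 \<le> n"
        and h: "prob_space M" "prob_space.iid_matrix M n A"
          "\<forall>i<n. \<forall>j<n. prob_space.concentration_function M (\<lambda>\<omega>. A \<omega> $$ (i, j)) a < b"
          "integrable M (\<lambda>\<omega>. eucl_norm (col (A \<omega>) 0) powr p)"
          "(\<integral>\<omega>. eucl_norm (col (A \<omega>) 0) powr p \<partial>M) powr (1 / p) \<le> K * sqrt (real n)"
        and e: "0 < \<epsilon>"
      have b': "0 < b" "b < 1" using b by auto
      show "measure M {\<omega> \<in> space M. smallest_singular_value (A \<omega>) < \<epsilon> / sqrt (real n)}
          \<le> bound_factor (min 1 p) (scale K a b) * \<epsilon> + exp (- (bound_rate (cb b) (scale K a b) * min 1 p * real n))"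
        by (rule iid_matrix_singular_value_bound[OF p K a b' n h cb(1)[OF b] cb(2)[OF b n, unfolded sizes_def] e])
    qed
  qed
qed

end
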